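(* Let $A\subset\mathbb R^q$ be Borel with $p_A:=\mathbb P(\mathbf Z\in A)>0$, assume Condition (C) below holds, let $\psi:[0,1]^p\to\mathbb R$ be continuous, let $K,K'\subset I:=\{1,\dots,p\}$, and assume the map $\mathbf u_{K'}\mapsto\int\psi(\mathbf u)C_K(\mathbf u_K|A)\,d\mathbf u_{I\setminus K'}$ is of bounded variation on $[0,1]^{|K'|}$. Then $$\sqrt n\big(\hat\rho_{K,K'}(A)-\rho_{K,K'}(A)\big)\xrightarrow{w}\mathcal N\big(0,\sigma^2_{K,K'}(A)\big),$$ where $$\sigma^2_{K,K'}(A):=\mathrm{Var}\Big(\int\psi(\mathbf u)\,\mathbb C_{\infty,K}(\mathbf u_K|A)\,C_{K'}(d\mathbf u_{K'}|A)\,d\mathbf u_{I\setminus K'}+\int\psi(\mathbf u)\,C_K(\mathbf u_K|A)\,\mathbb C_{\infty,K'}(d\mathbf u_{K'}|A)\,d\mathbf u_{I\setminus K'}\Big).$$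
   Context: Let $(\mathbf X,\mathbf Z)$ be a random vector in $\mathbb R^p\times\mathbb R^q$ with i.i.d. copies $(\mathbf X_i,\mathbf Z_i)_{i\le n}$. Vector inequalities and $\wedge$ componentwise. Conditional margins $F_k(t|A):=\mathbb P(X_k\le t\mid\mathbf Z\in A)$ are continuous (standing assumption); $C(\cdot|A)$ is the conditional copula of $\mathbf X$ given $\mathbf Z\in A$. $\mathbf U^A:=(F_1(X_1|A),\dots,F_p(X_p|A))$, $D(\mathbf u,A):=\mathbb P(\mathbf U^A\le\mathbf u,\mathbf Z\in A)$. Condition (C): for each $k$, the partial derivative $\partial_kD(\mathbf u,A)$ w.r.t. $u_k$ exists and is continuous on $\{\mathbf u\in[0,1]^p:0<u_k<1\}$. For a function $G$ on $[0,1]^p$ and $K\subset I$, $G_K(\mathbf u_K)$ is $G$ evaluated at the point with coordinates $\mathbf u_K=(u_j)_{j\in K}$ in $K$ and $1$ elsewhere. Conventions: when $K'=\emptyset$ there is no integration w.r.t. $C_{K'}(d\mathbf u_{K'})$, when $K'=I$ no integration w.r.t. $d\mathbf u_{I\setminus K'}$. Define $\rho_{K,K'}(A):=\int\psi(\mathbf u)C_K(\mathbf u_K|A)C_{K'}(d\mathbf u_{K'}|A)\,d\mathbf u_{I\setminus K'}$. Empirical: $\hat p_A:=n^{-1}\sum_i\mathbf 1(\mathbf Z_i\in A)$, $F_{n,k}(t|A):=\frac1{n\hat p_A}\sum_i\mathbf 1(X_{i,k}\le t,\mathbf Z_i\in A)$, $\hat C_{n,K}(\mathbf u_K|A):=\frac1{n\hat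 p_A}\sum_i\mathbf 1(F_{n,j}(X_{i,j}|A)\le u_j\ \forall j\in K,\ \mathbf Z_i\in A)$, and $\hat\rho_{K,K'}(A):=\int\psi(\mathbf u)\hat C_{n,K}(\mathbf u_K|A)\hat C_{n,K'}(d\mathbf u_{K'}|A)\,d\mathbf u_{I\setminus K'}$. The limit process: $\mathbb C_\infty(\mathbf u|A):=\frac{\mathbb B(\mathbf u,A)}{p_A}-\sum_{k=1}^p\frac{\partial_kD(\mathbf u,A)}{p_A^2}\big(\mathbb B((u_k,\mathbf 1_{-k}),A)-u_k\mathbb B(\mathbf 1,A)\big)-\frac{D(\mathbf u,A)}{p_A^2}\mathbb B(\mathbf 1,A)$, where $(u_k,\mathbf 1_{-k})$ has $k$-th coordinate $u_k$, others $1$, and $\mathbb B(\cdot,A)$ is a centered Gaussian process with covariance $p_AC(\mathbf u\wedge\mathbf u'|A)-p_A^2C(\mathbf u|A)C(\mathbf u'|A)$; $\mathbb C_{\infty,K}(\mathbf u_K|A)$ is $\mathbb C_\infty(\cdot|A)$ evaluated with coordinates outside $K$ set to $1$ (integrals against $\mathbb C_{\infty,K'}(d\mathbf u_{K'}|A)$ being defined by integration by parts when needed). *)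

theory Defs
  imports "HOL-Probability.Probability"
begin

section \<open>Vector helpers on real^'p  (index type 'p plays the role of I = {1..p})\<close>

definition vmix :: "'p::finite set \<Rightarrow> real^'p \<Rightarrow> real^'p \<Rightarrow> real^'p" where
  "vmix K u w = (\<chi> j. if j \<in> K then u$j else w$j)"

definition vupd :: "real^'p::finite \<Rightarrow> 'p \<Rightarrow> real \<Rightarrow> real^'p" where
  "vupd u k t = (\<chi> j. if j = k then t else u$j)"

definition vmeet :: "real^'p::finite \<Rightarrow> real^'p \<Rightarrow> real^'p" where
  "vmeet u v = (\<chi> j. min (u$j) (v$j))"

abbreviation unitcube :: "(real^'p::finite) set" where
  "unitcube \<equiv> cbox 0 (vec 1)"

text \<open>G_K(u_K) := G evaluated at the point with coordinates u_K in K and 1 elsewhere\<close>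
abbreviation onK :: "'p::finite set \<Rightarrow> real^'p \<Rightarrow> real^'p" where
  "onK K u \<equiv> vmix K u (vec 1)"

definition pA :: "'a measure \<Rightarrow> ('a \<Rightarrow> real^'q::finite) \<Rightarrow> (real^'q) set \<Rightarrow> real" where
  "pA M Z A = measure M {\<omega> \<in> space M. Z \<omega> \<in> A}"

definition condF :: "'a measure \<Rightarrow> ('a \<Rightarrow> real^'p::finite) \<Rightarrow> ('a \<Rightarrow> real^'q::finite) \<Rightarrow> (real^'q) set
    \<Rightarrow> 'p \<Rightarrow> real \<Rightarrow> real" where
  "condF M X Z A k t = measure M {\<omega> \<in> space M. X \<omega> $ k \<le> t \<and> Z \<omega> \<in> A} / pA M Z A"

definition UA :: "'a measure \<Rightarrow> ('a \<Rightarrow> real^'p::finite) \<Rightarrow> ('a \<Rightarrow> real^'q::finite) \<Rightarrow> (real^'q) set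
    \<Rightarrow> 'a \<Rightarrow> real^'p" where
  "UA M X Z A \<omega> = (\<chi> k. condF M X Z A k (X \<omega> $ k))"

definition DA :: "'a measure \<Rightarrow> ('a \<Rightarrow> real^'p::finite) \<Rightarrow> ('a \<Rightarrow> real^'q::finite) \<Rightarrow> (real^'q) set
    \<Rightarrow> real^'p \<Rightarrow> real" where
  "DA M X Z A u = measure M {\<omega> \<in> space M. (\<forall>k. UA M X Z A \<omega> $ k \<le> u $ k) \<and> Z \<omega> \<in> A}"

text \<open>conditional copula C(u|A) = P(U^A \<le> u | Z \<in> A) (margins are continuous)\<close>
definition condCop :: "'a measure \<Rightarrow> ('a \<Rightarrow> real^'p::finite) \<Rightarrow> ('a \<Rightarrow> real^'q::finite) \<Rightarrow> (real^'q) set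
    \<Rightarrow> real^'p \<Rightarrow> real" where
  "condCop M X Z A u = DA M X Z A u / pA M Z A"

definition pdD :: "'a measure \<Rightarrow> ('a \<Rightarrow> real^'p::finite) \<Rightarrow> ('a \<Rightarrow> real^'q::finite) \<Rightarrow> (real^'q) set
    \<Rightarrow> 'p \<Rightarrow> real^'p \<Rightarrow> real" where
  "pdD M X Z A k u = deriv (\<lambda>t. DA M X Z A (vupd u k t)) (u $ k)"

definition condition_C :: "'a measure \<Rightarrow> ('a \<Rightarrow> real^'p::finite) \<Rightarrow> ('a \<Rightarrow> real^'q::finite) \<Rightarrow> (real^'q) set \<Rightarrow> bool" where
  "condition_C M X Z A \<longleftrightarrow>
     (\<forall>k. (\<forall>u \<in> {u \<in> unitcube. 0 < u$k \<and> u$k < 1}.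
             (\<lambda>t. DA M X Z A (vupd u k t)) differentiable (at (u $ k))) \<and>
          continuous_on {u \<in> unitcube. 0 < u$k \<and> u$k < 1} (pdD M X Z A k))"

text \<open>rho_{K,K'}(A) = \<integral> psi(u) C_K(u_K|A) C_{K'}(du_{K'}|A) du_{I\K'}.
  The integration against C_{K'}(du_{K'}|A) is an integral over the conditional law of U^A
  given Z \<in> A; the Lebesgue integration over the coordinates in I\K' is written as an
  integral over the whole unit cube (the extra coordinates in K' are integrated against a
  probability measure and do not matter).\<close>
definition rhoKK :: "'a measure \<Rightarrow> ('a \<Rightarrow> real^'p::finite) \<Rightarrow> ('a \<Rightarrow> real^'q::finite) \<Rightarrow> (real^'q) set
    \<Rightarrow> (real^'p \<Rightarrow> real) \<Rightarrow> 'p set \<Rightarrow> 'p set \<Rightarrow> real" where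
  "rhoKK M X Z A \<psi> K K' =
     (\<integral>\<omega>. indicator {\<omega>. Z \<omega> \<in> A} \<omega> *
        (LINT w : unitcube | lborel.
           \<psi> (vmix K' (UA M X Z A \<omega>) w) *
           condCop M X Z A (onK K (vmix K' (UA M X Z A \<omega>) w))) \<partial>M) / pA M Z A"

definition phiKK :: "'a measure \<Rightarrow> ('a \<Rightarrow> real^'p::finite) \<Rightarrow> ('a \<Rightarrow> real^'q::finite) \<Rightarrow> (real^'q) set
    \<Rightarrow> (real^'p \<Rightarrow> real) \<Rightarrow> 'p set \<Rightarrow> 'p set \<Rightarrow> real^'p \<Rightarrow> real" where
  "phiKK M X Z A \<psi> K K' v =
     (LINT w : unitcube | lborel. \<psi> (vmix K' v w) * condCop M X Z A (onK K (vmix K' v w)))"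

definition phatA :: "(nat \<Rightarrow> 'a \<Rightarrow> real^'q::finite) \<Rightarrow> (real^'q) set \<Rightarrow> nat \<Rightarrow> 'a \<Rightarrow> real" where
  "phatA Zs A n \<omega> = (\<Sum>i<n. indicator A (Zs i \<omega>)) / real n"

definition empF :: "(nat \<Rightarrow> 'a \<Rightarrow> real^'p::finite) \<Rightarrow> (nat \<Rightarrow> 'a \<Rightarrow> real^'q::finite) \<Rightarrow> (real^'q) set
    \<Rightarrow> nat \<Rightarrow> 'a \<Rightarrow> 'p \<Rightarrow> real \<Rightarrow> real" where
  "empF Xs Zs A n \<omega> k t =
     (\<Sum>i<n. if Xs i \<omega> $ k \<le> t \<and> Zs i \<omega> \<in> A then 1 else 0) / (real n * phatA Zs A n \<omega>)"

definition pseudoU :: "(nat \<Rightarrow> 'a \<Rightarrow> real^'p::finite) \<Rightarrow> (nat \<Rightarrow> 'a \<Rightarrow> real^'q::finite) \<Rightarrow> (real^'q) set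
    \<Rightarrow> nat \<Rightarrow> 'a \<Rightarrow> nat \<Rightarrow> real^'p" where
  "pseudoU Xs Zs A n \<omega> i = (\<chi> j. empF Xs Zs A n \<omega> j (Xs i \<omega> $ j))"

definition empCop :: "(nat \<Rightarrow> 'a \<Rightarrow> real^'p::finite) \<Rightarrow> (nat \<Rightarrow> 'a \<Rightarrow> real^'q::finite) \<Rightarrow> (real^'q) set
    \<Rightarrow> nat \<Rightarrow> 'a \<Rightarrow> 'p set \<Rightarrow> real^'p \<Rightarrow> real" where
  "empCop Xs Zs A n \<omega> K u =
     (\<Sum>i<n. if (\<forall>j\<in>K. pseudoU Xs Zs A n \<omega> i $ j \<le> u $ j) \<and> Zs i \<omega> \<in> A then 1 else 0)
       / (real n * phatA Zs A n \<omega>)"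

text \<open>hat rho_{K,K'}(A): hat C_{n,K'}(du_{K'}|A) puts mass 1/(n hat p_A) at the K'-coordinates
  of each pseudo-observation with Z_i \<in> A.\<close>
definition rhohat :: "(nat \<Rightarrow> 'a \<Rightarrow> real^'p::finite) \<Rightarrow> (nat \<Rightarrow> 'a \<Rightarrow> real^'q::finite) \<Rightarrow> (real^'q) set
    \<Rightarrow> (real^'p \<Rightarrow> real) \<Rightarrow> 'p set \<Rightarrow> 'p set \<Rightarrow> nat \<Rightarrow> 'a \<Rightarrow> real" where
  "rhohat Xs Zs A \<psi> K K' n \<omega> =
     (\<Sum>i<n. if Zs i \<omega> \<in> A then
        (LINT w : unitcube | lborel.
           \<psi> (vmix K' (pseudoU Xs Zs A n \<omega> i) w) *
           empCop Xs Zs A n \<omega> K (vmix K' (pseudoU Xs Zs A n \<omega> i) w)) else 0)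
       / (real n * phatA Zs A n \<omega>)"

text \<open>A grid on the face [0,1]^J (coordinates outside J are fixed to 1).\<close>
definition is_grid :: "'p::finite set \<Rightarrow> ('p \<Rightarrow> real set) \<Rightarrow> bool" where
  "is_grid J g \<longleftrightarrow> (\<forall>j\<in>J. finite (g j) \<and> {0,1} \<subseteq> g j \<and> g j \<subseteq> {0..1})"

definition grid_cells :: "'p::finite set \<Rightarrow> ('p \<Rightarrow> real set) \<Rightarrow> ((real^'p) \<times> (real^'p)) set" where
  "grid_cells J g = {(a,b). (\<forall>j\<in>J. a$j \<in> g j \<and> b$j \<in> g j \<and> a$j < b$j \<and> {a$j<..<b$j} \<inter> g j = {})
                          \<and> (\<forall>j. j \<notin> J \<longrightarrow> a$j = 1 \<and> b$j = 1)}"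

definition grid_mesh :: "'p::finite set \<Rightarrow> ('p \<Rightarrow> real set) \<Rightarrow> real" where
  "grid_mesh J g = Max ({0} \<union> {b$j - a$j | a b j. (a,b) \<in> grid_cells J g \<and> j \<in> J})"

definition qvol :: "'p::finite set \<Rightarrow> (real^'p \<Rightarrow> real) \<Rightarrow> real^'p \<Rightarrow> real^'p \<Rightarrow> real" where
  "qvol J f a b = (\<Sum>S\<in>Pow J. (-1) ^ card S * f (vmix S a b))"

definition vitali_bv :: "'p::finite set \<Rightarrow> (real^'p \<Rightarrow> real) \<Rightarrow> bool" where
  "vitali_bv J f \<longleftrightarrow> bdd_above {(\<Sum>c\<in>grid_cells J g. \<bar>qvol J f (fst c) (snd c)\<bar>) | g. is_grid J g}"

text \<open>bounded (Hardy--Krause) variation of u_{K'} |-> f(u) on [0,1]^{|K'|}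
  (f only depends on the coordinates in K'; faces anchored at 1)\<close>
definition hk_bv :: "'p::finite set \<Rightarrow> (real^'p \<Rightarrow> real) \<Rightarrow> bool" where
  "hk_bv K' f \<longleftrightarrow> (\<forall>J. J \<subseteq> K' \<and> J \<noteq> {} \<longrightarrow> vitali_bv J (\<lambda>x. f (onK J x)))"

definition has_RS :: "'p::finite set \<Rightarrow> (real^'p \<Rightarrow> real) \<Rightarrow> (real^'p \<Rightarrow> real) \<Rightarrow> real \<Rightarrow> bool" where
  "has_RS J g f I \<longleftrightarrow>
     (\<forall>\<epsilon>>0. \<exists>\<delta>>0. \<forall>gr tag. is_grid J gr \<and> grid_mesh J gr < \<delta> \<and>
        (\<forall>c\<in>grid_cells J gr. \<forall>j. fst c $ j \<le> tag c $ j \<and> tag c $ j \<le> snd c $ j) \<longrightarrow>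
        \<bar>(\<Sum>c\<in>grid_cells J gr. g (tag c) * qvol J f (fst c) (snd c)) - I\<bar> < \<epsilon>)"

definition RS_int :: "'p::finite set \<Rightarrow> (real^'p \<Rightarrow> real) \<Rightarrow> (real^'p \<Rightarrow> real) \<Rightarrow> real" where
  "RS_int J g f = (THE I. has_RS J g f I)"

text \<open>\<integral> f(u) G_{K'}(du_{K'}) defined by integration by parts (G grounded):
  sum over faces J \<subseteq> K' of (-1)^|J| \<integral> G(u_J;1) df(u_J;1)\<close>
definition ibp_int :: "'p::finite set \<Rightarrow> (real^'p \<Rightarrow> real) \<Rightarrow> (real^'p \<Rightarrow> real) \<Rightarrow> real" where
  "ibp_int K' f G = (\<Sum>J\<in>Pow K'. (-1) ^ card J * RS_int J (\<lambda>x. G (onK J x)) (\<lambda>x. f (onK J x)))"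

text \<open>N(0,v), allowing the degenerate case v = 0\<close>
definition normal_meas :: "real \<Rightarrow> real measure" where
  "normal_meas v = distr (density lborel std_normal_density) borel (\<lambda>x. sqrt v * x)"

definition gaussian_process :: "'b measure \<Rightarrow> (real^'p::finite \<Rightarrow> 'b \<Rightarrow> real)
    \<Rightarrow> (real^'p \<Rightarrow> real^'p \<Rightarrow> real) \<Rightarrow> bool" where
  "gaussian_process N B cov \<longleftrightarrow> prob_space N \<and>
     (\<forall>u. B u \<in> borel_measurable N) \<and>
     (\<forall>\<omega>\<in>space N. continuous_on unitcube (\<lambda>u. B u \<omega>)) \<and>
     (\<forall>(n::nat) (us::nat \<Rightarrow> real^'p) (c::nat \<Rightarrow> real). (\<forall>i<n. us i \<in> unitcube) \<longrightarrow>
        distr N borel (\<lambda>\<omega>. \<Sum>i<n. c i * B (us i) \<omega>)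
          = normal_meas (\<Sum>i<n. \<Sum>j<n. c i * c j * cov (us i) (us j)))"

definition covB :: "'a measure \<Rightarrow> ('a \<Rightarrow> real^'p::finite) \<Rightarrow> ('a \<Rightarrow> real^'q::finite) \<Rightarrow> (real^'q) set
    \<Rightarrow> real^'p \<Rightarrow> real^'p \<Rightarrow> real" where
  "covB M X Z A u u' = pA M Z A * condCop M X Z A (vmeet u u')
                      - (pA M Z A)^2 * condCop M X Z A u * condCop M X Z A u'"

definition Cinf :: "'a measure \<Rightarrow> ('a \<Rightarrow> real^'p::finite) \<Rightarrow> ('a \<Rightarrow> real^'q::finite) \<Rightarrow> (real^'q) set
    \<Rightarrow> (real^'p \<Rightarrow> 'b \<Rightarrow> real) \<Rightarrow> real^'p \<Rightarrow> 'b \<Rightarrow> real" where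
  "Cinf M X Z A B u \<omega> =
     B u \<omega> / pA M Z A
     - (\<Sum>k\<in>UNIV. pdD M X Z A k u / (pA M Z A)^2 *
                   (B (vupd (vec 1) k (u$k)) \<omega> - u$k * B (vec 1) \<omega>))
     - DA M X Z A u / (pA M Z A)^2 * B (vec 1) \<omega>"

definition limitRV :: "'a measure \<Rightarrow> ('a \<Rightarrow> real^'p::finite) \<Rightarrow> ('a \<Rightarrow> real^'q::finite) \<Rightarrow> (real^'q) set
    \<Rightarrow> (real^'p \<Rightarrow> real) \<Rightarrow> 'p set \<Rightarrow> 'p set \<Rightarrow> (real^'p \<Rightarrow> 'b \<Rightarrow> real) \<Rightarrow> 'b \<Rightarrow> real" where
  "limitRV M X Z A \<psi> K K' B \<eta> =
     (\<integral>\<omega>. indicator {\<omega>. Z \<omega> \<in> A} \<omega> *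
        (LINT w : unitcube | lborel.
           \<psi> (vmix K' (UA M X Z A \<omega>) w) *
           Cinf M X Z A B (onK K (vmix K' (UA M X Z A \<omega>) w)) \<eta>) \<partial>M) / pA M Z A
   + ibp_int K' (phiKK M X Z A \<psi> K K') (\<lambda>u. Cinf M X Z A B (onK K' u) \<eta>)"

definition sigma2 :: "'a measure \<Rightarrow> ('a \<Rightarrow> real^'p::finite) \<Rightarrow> ('a \<Rightarrow> real^'q::finite) \<Rightarrow> (real^'q) set
    \<Rightarrow> (real^'p \<Rightarrow> real) \<Rightarrow> 'p set \<Rightarrow> 'p set \<Rightarrow> 'b measure \<Rightarrow> (real^'p \<Rightarrow> 'b \<Rightarrow> real) \<Rightarrow> real" where
  "sigma2 M X Z A \<psi> K K' N B = prob_space.variance N (limitRV M X Z A \<psi> K K' B)"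

end

theory Submission
  imports Defs
begin

text \<open>
  The statistic is split as \<open>S\<^sub>1 + S\<^sub>2\<close>, where \<open>S\<^sub>1\<close>
  carries the error of the empirical copula in the integrand and \<open>S\<^sub>2\<close> that of
  the empirical measure. A pointwise linearisation, valid under Condition (C), replaces \<open>sqrt
  n (C\<^sub>n - C)\<close> by the operator \<open>Cop\<close> (the map taking \<open>B\<close> to
  \<open>C\<^sub>\<infinity>\<close>) applied to the empirical process \<open>alpha n\<close> of the
  transformed data; since the partial derivatives may be discontinuous at the boundary, the error is
  controlled in mean over the sampling distribution rather than uniformly. In
  \<open>S\<^sub>2\<close> summation by parts over the faces moves the increments onto the function
  of bounded variation. Rounding to a grid of mesh \<open>1/m\<close> then approximates the
  statistic in \<open>L\<^sup>1\<close>, uniformly in large \<open>n\<close>, by a finite linear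
  combination \<open>T\<^sub>m(alpha n)\<close> of values of the empirical process. No tightness is
  needed: \<open>T\<^sub>m(alpha n)\<close> and \<open>T\<^sub>m(B)\<close> have the same variance,
  so all the \<open>L\<^sup>2\<close> errors can be read off the Gaussian process \<open>B\<close>,
  where they tend to \<open>0\<close> by path continuity because almost sure limits of Gaussian
  variables converge in \<open>L\<^sup>2\<close>. The one-dimensional central limit theorem for
  fixed \<open>m\<close> and \<open>T\<^sub>m(B) \<rightarrow> limitRV\<close> finish the proof.
\<close>

section \<open>Pointwise linearisation of the empirical copula of a finite sample\<close>

text \<open>The statistic reads the empirical process at points that are themselves observations,
  and no supremum over points is under control. So the linearisation error is bounded by quadratic
  functionals of the path at one point, and \<open>second_moment_at_sample\<close> bounds their
  means at an observation by splitting off the one summand that depends on it. Events with too few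
  observations have probability of order 1/n and are kept apart by \<open>approx\<close>. In the
  second part of the statistic the mesh has to depend on n at first: \<phi> is merely uniformly
  continuous, and its rounding error is multiplied by sqrt n. The fixed mesh of the central limit
  theorem is reached afterwards, because the variance of the difference of two \<open>T2\<close>
  sums under \<open>alpha n\<close> does not depend on n. A separate difficulty sits in the limit
  variable. At \<open>u $ k = 0\<close> the two-sided derivative may be undefined, and the Gaussian
  path vanishes there only almost surely, whereas \<open>limitRV\<close> is defined on every path
  and must be measurable. This is the reason for \<open>CopC\<close>, \<open>qk\<close> and the
  subspace argument in \<open>RS_int_measurable\<close>.\<close>

declare vec_1 [simp del]

lemma vupd_nth [simp]: "vupd u k t $ j = (if j = k then t else u $ j)"
  by (simp add: vupd_def)

lemma vmix_nth [simp]: "vmix K u w $ j = (if j \<in> K then u $ j else w $ j)"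
  by (simp add: vmix_def)

lemma vupd_self [simp]: "vupd u k (u $ k) = u"
  by (simp add: vec_eq_iff)

lemma vupd_vec1 [simp]: "vupd (vec 1) k 1 = vec 1"
  by (simp add: vec_eq_iff)

lemma unitcube_iff: "u \<in> unitcube \<longleftrightarrow> (\<forall>k. 0 \<le> u $ k \<and> u $ k \<le> 1)"
  by (auto simp: mem_box_cart)

section \<open>Size and oscillation of a path at a point\<close>

definition w0f :: "(real^'p::finite \<Rightarrow> real) \<Rightarrow> real^'p \<Rightarrow> real" where
  "w0f b u = \<bar>b u\<bar> + (\<Sum>k\<in>UNIV. \<bar>b (vupd (vec 1) k (u $ k))\<bar>) + \<bar>b (vec 1)\<bar>"

text \<open>Only finitely many offsets enter, so second moments suffice to bound the mean; points
  between the offsets are reached by monotonicity of the empirical distribution, in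
  \<open>sandwich\<close>. The factor \<open>1 / s\<close> is the scale 1/sqrt n on which data and
  ranks differ.\<close>

definition oscf :: "real \<Rightarrow> (real^'p::finite) set \<Rightarrow> (real^'p \<Rightarrow> real) \<Rightarrow> real^'p \<Rightarrow> real" where
  "oscf s Gr b u = (\<Sum>v\<in>Gr. \<bar>b (u + (1 / s) *\<^sub>R v) - b u\<bar>)"

definition w1f :: "real \<Rightarrow> (real^'p::finite) set \<Rightarrow> (real^'p \<Rightarrow> real) \<Rightarrow> real^'p \<Rightarrow> real" where
  "w1f s Gr b u = oscf s Gr b u + (\<Sum>k\<in>UNIV. oscf s Gr b (vupd (vec 1) k (u $ k)))"

text \<open>For the empirical process this is the fluctuation of the k-th empirical margin, up to
  division by the sample share (\<open>Fn_minus\<close>). Its variance is proportional to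
  \<open>u $ k * (1 - u $ k)\<close>, and this decay at both ends stands in for continuity of the
  partial derivatives there.\<close>

definition bridge :: "(real^'p::finite \<Rightarrow> real) \<Rightarrow> 'p \<Rightarrow> real^'p \<Rightarrow> real" where
  "bridge b k u = b (vupd (vec 1) k (u $ k)) - u $ k * b (vec 1)"

lemma oscf_nonneg: "0 \<le> oscf s Gr b u"
  by (simp add: oscf_def sum_nonneg)

lemma w1f_nonneg: "0 \<le> w1f s Gr b u"
  by (simp add: w1f_def oscf_nonneg sum_nonneg)

lemma w1f_ge: "oscf s Gr b u \<le> w1f s Gr b u"
  "oscf s Gr b (vupd (vec 1) k (u $ k)) \<le> w1f s Gr b u"
proof -
  show "oscf s Gr b u \<le> w1f s Gr b u" by (simp add: w1f_def oscf_nonneg sum_nonneg)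
  have "oscf s Gr b (vupd (vec 1) k (u $ k)) \<le> (\<Sum>k\<in>UNIV. oscf s Gr b (vupd (vec 1) k (u $ k)))"
    by (rule member_le_sum) (auto simp: oscf_nonneg)
  then show "oscf s Gr b (vupd (vec 1) k (u $ k)) \<le> w1f s Gr b u"
    using oscf_nonneg[of s Gr b u] by (simp add: w1f_def)
qed

lemma w0f_nonneg: "0 \<le> w0f b u"
  by (simp add: w0f_def sum_nonneg)

lemma w0f_ge: "\<bar>b u\<bar> \<le> w0f b u" "\<bar>b (vupd (vec 1) k (u $ k))\<bar> + \<bar>b (vec 1)\<bar> \<le> w0f b u"
  "\<bar>b (vec 1)\<bar> \<le> w0f b u" "\<bar>b (vupd (vec 1) k (u $ k))\<bar> \<le> w0f b u"
proof -
  have *: "\<bar>b (vupd (vec 1) k (u $ k))\<bar> \<le> (\<Sum>k\<in>UNIV. \<bar>b (vupd (vec 1) k (u $ k))\<bar>)"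
    by (rule member_le_sum) auto
  have **: "0 \<le> (\<Sum>k\<in>UNIV. \<bar>b (vupd (vec 1) k (u $ k))\<bar>)" by (simp add: sum_nonneg)
  show "\<bar>b u\<bar> \<le> w0f b u" "\<bar>b (vupd (vec 1) k (u $ k))\<bar> + \<bar>b (vec 1)\<bar> \<le> w0f b u"
    "\<bar>b (vec 1)\<bar> \<le> w0f b u" "\<bar>b (vupd (vec 1) k (u $ k))\<bar> \<le> w0f b u"
    using * ** by (auto simp: w0f_def)
qed

lemma bridge_le: assumes "u \<in> unitcube" shows "\<bar>bridge b k u\<bar> \<le> w0f b u"
proof -
  have "\<bar>u $ k * b (vec 1)\<bar> \<le> 1 * \<bar>b (vec 1)\<bar>"
    unfolding abs_mult using assms by (intro mult_right_mono) (auto simp: unitcube_iff)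
  then show ?thesis using w0f_ge(2)[of b k u] by (simp add: bridge_def)
qed

section \<open>The limiting linear operator of a distribution function with uniform margins\<close>

locale copula_fun =
  fixes D :: "real^'p::finite \<Rightarrow> real" and p :: real and g :: "'p \<Rightarrow> real^'p \<Rightarrow> real"
  assumes p_pos: "0 < p"
    and D_lip: "\<And>u v. \<bar>D u - D v\<bar> \<le> p * (\<Sum>k\<in>UNIV. \<bar>u $ k - v $ k\<bar>)"
    and D_marg: "\<And>k t. 0 \<le> t \<Longrightarrow> t \<le> 1 \<Longrightarrow> D (vupd (vec 1) k t) = p * t"
    and D_nonneg: "\<And>u. 0 \<le> D u" and D_le: "\<And>u. D u \<le> p"
    and g_deriv: "\<And>k u. u \<in> unitcube \<Longrightarrow> 0 < u $ k \<Longrightarrow> u $ k < 1 \<Longrightarrow>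
        ((\<lambda>t. D (vupd u k t)) has_real_derivative g k u) (at (u $ k))"
    and g_cont: "\<And>k. continuous_on {u \<in> unitcube. 0 < u $ k \<and> u $ k < 1} (g k)"
    and g_zero: "\<And>k u. \<not> (0 < u $ k \<and> u $ k < 1) \<Longrightarrow> g k u = 0"
begin

text \<open>The formula of the limit process with \<open>g\<close> in place of the partial
  derivative. The two agree on paths whose bridges vanish at both ends of the unit interval.\<close>

definition Cop :: "(real^'p \<Rightarrow> real) \<Rightarrow> real^'p \<Rightarrow> real" where
  "Cop b u = b u / p - (\<Sum>k\<in>UNIV. g k u / p\<^sup>2 * bridge b k u) - D u / p\<^sup>2 * b (vec 1)"

lemma D_one: "D (vec 1) = p"
  using D_marg[of 1] by simp

text \<open>In a single coordinate \<open>D\<close> has Lipschitz constant \<open>p\<close>, which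
  bounds every difference quotient and hence its limit.\<close>

lemma g_bound:
  assumes "u \<in> unitcube"
  shows "\<bar>g k u\<bar> \<le> p"
proof (cases "0 < u $ k \<and> u $ k < 1")
  case True
  have lim: "((\<lambda>t. (D (vupd u k t) - D u) / (t - u $ k)) \<longlongrightarrow> g k u) (at (u $ k))"
    using g_deriv[OF assms] True by (simp add: has_field_derivative_iff)
  have "\<bar>(D (vupd u k t) - D u) / (t - u $ k)\<bar> \<le> p" for t
  proof -
    have "(\<Sum>j\<in>UNIV. \<bar>vupd u k t $ j - u $ j\<bar>) = (\<Sum>j\<in>UNIV. if j = k then \<bar>t - u $ k\<bar> else 0)"
      by (intro sum.cong) auto
    then have "\<bar>D (vupd u k t) - D u\<bar> \<le> p * \<bar>t - u $ k\<bar>"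
      using D_lip[of "vupd u k t" u] by simp
    then show ?thesis
      using p_pos by (cases "t = u $ k") (auto simp: abs_divide divide_simps)
  qed
  then show ?thesis
    by (intro tendsto_upperbound[OF tendsto_rabs[OF lim]]) auto
qed (use g_zero p_pos in auto)

lemma Cop_bound:
  assumes "u \<in> unitcube"
  shows "\<bar>Cop b u\<bar> \<le> (2 + real CARD('p)) * w0f b u / p"
proof -
  have "\<bar>\<Sum>k\<in>UNIV. g k u / p\<^sup>2 * bridge b k u\<bar> \<le> (\<Sum>k\<in>(UNIV::'p set). w0f b u / p)"
  proof (rule order_trans[OF sum_abs], rule sum_mono)
    fix k
    have "\<bar>g k u * bridge b k u\<bar> \<le> p * w0f b u"
      unfolding abs_mult using g_bound[OF assms] bridge_le[OF assms] p_pos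
      by (intro mult_mono) auto
    then show "\<bar>g k u / p\<^sup>2 * bridge b k u\<bar> \<le> w0f b u / p"
      using p_pos by (simp add: abs_mult abs_divide field_simps power2_eq_square)
  qed
  moreover have "\<bar>D u / p\<^sup>2 * b (vec 1)\<bar> \<le> w0f b u / p"
  proof -
    have "\<bar>D u * b (vec 1)\<bar> \<le> p * w0f b u"
      unfolding abs_mult using D_nonneg D_le w0f_ge p_pos by (intro mult_mono) auto
    then show ?thesis
      using p_pos by (simp add: abs_mult abs_divide field_simps power2_eq_square)
  qed
  moreover have "\<bar>b u / p\<bar> \<le> w0f b u / p"
    using w0f_ge(1)[of b u] p_pos by (simp add: abs_divide divide_right_mono)
  ultimately have "\<bar>Cop b u\<bar> \<le> w0f b u / p + (\<Sum>k\<in>(UNIV::'p set). w0f b u / p) + w0f b u / p"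
    unfolding Cop_def by linarith
  then show ?thesis by (simp add: algebra_simps add_divide_distrib)
qed

text \<open>Replacing the coordinates of \<open>y\<close> by those of \<open>x\<close> one at a time.\<close>
lemma telescope:
  assumes "\<And>k S. k \<notin> S \<Longrightarrow>
     \<bar>s * (D (vupd (vmix S x y) k (x $ k)) - D (vupd (vmix S x y) k (y $ k))) - c k\<bar> \<le> e k"
  shows "\<bar>s * (D x - D y) - (\<Sum>k\<in>UNIV. c k)\<bar> \<le> (\<Sum>k\<in>UNIV. e k)"
proof -
  have "\<bar>s * (D (vmix S x y) - D y) - (\<Sum>k\<in>S. c k)\<bar> \<le> (\<Sum>k\<in>S. e k)" if "finite S" for S
    using that
  proof (induction S rule: finite_induct)
    case empty
    have "vmix {} x y = y" by (simp add: vec_eq_iff)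
    then show ?case by simp
  next
    case (insert k S)
    have "vmix (insert k S) x y = vupd (vmix S x y) k (x $ k)"
      "vupd (vmix S x y) k (y $ k) = vmix S x y"
      using insert by (auto simp: vec_eq_iff)
    then have "\<bar>s * (D (vmix (insert k S) x y) - D (vmix S x y)) - c k\<bar> \<le> e k"
      using assms[OF insert(2)] by simp
    then show ?case using insert by (simp add: algebra_simps)
  qed
  from this[of UNIV] show ?thesis
    by (simp add: vec_eq_iff[THEN iffD2, of "vmix UNIV x y" x])
qed

end

section \<open>Empirical distribution and ranks of a fixed sample\<close>

locale sample = copula_fun D p g for D :: "real^'p::finite \<Rightarrow> real" and p g +
  fixes n :: nat and a :: "nat set" and U :: "nat \<Rightarrow> real^'p"
  assumes n_pos: "0 < n" and a_fin: "finite a"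
    and U_pos: "\<And>j k. j \<in> a \<Longrightarrow> 0 < U j $ k" and U_le: "\<And>j k. j \<in> a \<Longrightarrow> U j $ k \<le> 1"
    and U_inj: "\<And>i j k. i \<in> a \<Longrightarrow> j \<in> a \<Longrightarrow> U i $ k = U j $ k \<Longrightarrow> i = j"
    \<comment> \<open>Keeps the share of the sample away from 0: dividing by it instead of
      \<open>p\<close> costs at most a factor 2 (\<open>div_P_le\<close>).\<close>
    and many: "p / 2 \<le> real (card a) / real n"
begin

definition En :: "real^'p \<Rightarrow> real" where
  "En u = real (card {j \<in> a. \<forall>k. U j $ k \<le> u $ k}) / real n"

definition Fn :: "'p \<Rightarrow> real \<Rightarrow> real" where
  "Fn k t = real (card {j \<in> a. U j $ k \<le> t}) / real (card a)"

definition Chat :: "real^'p \<Rightarrow> real" where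
  "Chat y = real (card {j \<in> a. \<forall>k. Fn k (U j $ k) \<le> y $ k}) / real (card a)"

definition al :: "real^'p \<Rightarrow> real" where
  "al u = sqrt (real n) * (En u - D u)"

abbreviation "s \<equiv> sqrt (real n)"

definition P :: real where "P = real (card a) / real n"

lemma many': "p / 2 \<le> P"
  using many by (simp add: P_def)

lemma s_pos: "0 < s" and s_ge1: "1 \<le> s" and ss: "s * s = real n"
  using n_pos by auto

lemma P_pos: "0 < P"
  using many' p_pos by linarith

lemma card_a_pos: "0 < card a"
proof (rule ccontr)
  assume "\<not> 0 < card a" then show False using P_pos by (simp add: P_def)
qed

lemma En_marg: "En (vupd (vec 1) k t) = real (card {j \<in> a. U j $ k \<le> t}) / real n"
proof -
  have "{j \<in> a. \<forall>i. U j $ i \<le> vupd (vec 1) k t $ i} = {j \<in> a. U j $ k \<le> t}"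
    using U_le by (auto dest: spec[of _ k])
  then show ?thesis by (simp add: En_def)
qed

lemma En_one: "En (vec 1) = P"
  using U_le by (auto simp: En_def P_def intro!: arg_cong[where f = card])

lemma En_mono: "(\<And>k. u $ k \<le> v $ k) \<Longrightarrow> En u \<le> En v"
  unfolding En_def using a_fin
  by (intro divide_right_mono of_nat_mono card_mono) (auto intro: order_trans)

lemma Fn_En: "Fn k t = En (vupd (vec 1) k t) / P"
  using n_pos by (simp add: Fn_def En_marg P_def)

lemma P_al: "P = p + al (vec 1) / s"
  using s_pos by (simp add: al_def En_one D_one field_simps)

lemma En_al: "En u = D u + al u / s"
  using s_pos by (simp add: al_def field_simps)

lemma En_sum: "En u = (\<Sum>j\<in>a. if \<forall>k. U j $ k \<le> u $ k then 1 else 0) / real n"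
  unfolding En_def using a_fin by (simp add: sum.If_cases Int_def)

text \<open>The indicator of a lower orthant changes only if one of its coordinate indicators does.
  Along one coordinate all observations change in the same direction, so the absolute value may be
  taken after summation (\<open>sgn\<close> below).\<close>

lemma En_diff:
  "\<bar>En x - En u\<bar> \<le> (\<Sum>k\<in>UNIV. \<bar>En (vupd (vec 1) k (x $ k)) - En (vupd (vec 1) k (u $ k))\<bar>)"
proof -
  define I where "I j k t = (if U j $ k \<le> t then 1 else 0 :: real)" for j k t
  have marg: "En (vupd (vec 1) k t) = (\<Sum>j\<in>a. I j k t) / real n" for k t
    unfolding En_marg I_def using a_fin by (simp add: sum.If_cases Int_def)
  have one: "\<bar>(if \<forall>k. U j $ k \<le> x $ k then 1 else 0) - (if \<forall>k. U j $ k \<le> u $ k then 1 else 0 :: real)\<bar>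
      \<le> (\<Sum>k\<in>UNIV. \<bar>I j k (x $ k) - I j k (u $ k)\<bar>)" for j
  proof (cases "(\<forall>k. U j $ k \<le> x $ k) \<longleftrightarrow> (\<forall>k. U j $ k \<le> u $ k)")
    case True then show ?thesis by (simp add: sum_nonneg)
  next
    case False
    then obtain k where "(U j $ k \<le> x $ k) \<noteq> (U j $ k \<le> u $ k)" by metis
    then have "1 \<le> \<bar>I j k (x $ k) - I j k (u $ k)\<bar>" by (auto simp: I_def)
    also have "\<dots> \<le> (\<Sum>k\<in>UNIV. \<bar>I j k (x $ k) - I j k (u $ k)\<bar>)"
      by (rule member_le_sum) auto
    finally show ?thesis by auto
  qed
  have sgn: "(\<Sum>j\<in>a. \<bar>I j k t - I j k t'\<bar>) = \<bar>(\<Sum>j\<in>a. I j k t) - (\<Sum>j\<in>a. I j k t')\<bar>" for k t t'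
  proof (cases "t \<le> t'")
    case True
    then have "I j k t \<le> I j k t'" for j by (auto simp: I_def)
    then show ?thesis by (simp add: sum_subtractf[symmetric] abs_of_nonpos sum_nonpos sum_negf[symmetric])
  next
    case False
    then have "I j k t' \<le> I j k t" for j by (auto simp: I_def)
    then show ?thesis by (simp add: sum_subtractf[symmetric] abs_of_nonneg sum_nonneg)
  qed
  have "\<bar>En x - En u\<bar> * real n \<le> (\<Sum>j\<in>a. \<Sum>k\<in>UNIV. \<bar>I j k (x $ k) - I j k (u $ k)\<bar>)"
    unfolding En_sum diff_divide_distrib[symmetric] sum_subtractf[symmetric] abs_divide
    using n_pos by (auto intro!: order_trans[OF sum_abs] sum_mono one)
  also have "\<dots> = (\<Sum>k\<in>UNIV. \<bar>(\<Sum>j\<in>a. I j k (x $ k)) - (\<Sum>j\<in>a. I j k (u $ k))\<bar>)"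
    by (subst sum.swap) (simp add: sgn)
  also have "\<dots> = (\<Sum>k\<in>UNIV. \<bar>En (vupd (vec 1) k (x $ k)) - En (vupd (vec 1) k (u $ k))\<bar>) * real n"
    unfolding marg diff_divide_distrib[symmetric] abs_divide sum_divide_distrib[symmetric]
    using n_pos by simp
  finally show ?thesis using n_pos by simp
qed

lemma Fn_mono: "t \<le> t' \<Longrightarrow> Fn k t \<le> Fn k t'"
  unfolding Fn_def using a_fin
  by (intro divide_right_mono of_nat_mono card_mono) auto

text \<open>An empirical quantile. Without ties, passing to the next order statistic raises
  \<open>Fn\<close> by exactly \<open>1 / card a\<close>, which gives the last inequality.\<close>

lemma quantile:
  assumes t: "0 \<le> t" "t \<le> 1"
  obtains x where "0 \<le> x" "x \<le> 1" "\<And>j. j \<in> a \<Longrightarrow> Fn k (U j $ k) \<le> t \<longleftrightarrow> U j $ k \<le> x"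
    "Fn k x \<le> t" "t - 1 / real (card a) \<le> Fn k x"
proof
  define S where "S = {U j $ k |j. j \<in> a \<and> Fn k (U j $ k) \<le> t}"
  \<comment> \<open>The value 0 covers the case that no rank is at most \<open>t\<close>; since all
    data are positive it then has no observation below it.\<close>
  define x where "x = Max (insert 0 S)"
  have finS: "finite S" using a_fin by (simp add: S_def)
  have Sx: "z \<le> x" if "z \<in> S" for z using that finS by (simp add: x_def)
  show "0 \<le> x" using finS by (simp add: x_def)
  show "x \<le> 1" using finS U_le by (auto simp: x_def S_def)
  have x_cases: "(x = 0 \<and> S = {}) \<or> x \<in> S"
  proof (cases "S = {}")
    case False
    then obtain z where z: "z \<in> S" by auto
    then have "0 < z" using U_pos by (auto simp: S_def)
    then have "0 < x" using Sx[OF z] by simp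
    moreover have "x \<in> insert 0 S" unfolding x_def using finS by (intro Max_in) auto
    ultimately show ?thesis by auto
  qed (simp add: x_def)
  show Fx: "Fn k x \<le> t"
    using x_cases
  proof
    assume "x = 0 \<and> S = {}"
    moreover have "{j \<in> a. U j $ k \<le> 0} = {}" using U_pos by (auto simp: not_le)
    then have "Fn k 0 = 0" unfolding Fn_def by (metis card.empty div_0 of_nat_0)
    ultimately show ?thesis using t by simp
  qed (auto simp: S_def)
  show "Fn k (U j $ k) \<le> t \<longleftrightarrow> U j $ k \<le> x" if "j \<in> a" for j
    using that Sx[of "U j $ k"] Fn_mono[of "U j $ k" x k] Fx by (auto simp: S_def)
  show "t - 1 / real (card a) \<le> Fn k x"
  proof (cases "{j \<in> a. x < U j $ k} = {}")
    case True
    then have "{j \<in> a. U j $ k \<le> x} = a" by (auto simp: not_less)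
    then have "Fn k x = 1" using card_a_pos by (simp add: Fn_def)
    then show ?thesis using t by (simp add: algebra_simps add_increasing2)
  next
    case False
    \<comment> \<open>\<open>B\<close> holds the data beyond \<open>x\<close>. The rank of its
      smallest member \<open>j0\<close> exceeds \<open>t\<close>, as \<open>j0\<close> would
      otherwise contribute to \<open>S\<close>.\<close>
    define B where "B = {j \<in> a. x < U j $ k}"
    have "finite B" "B \<noteq> {}" using a_fin False by (auto simp: B_def)
    then obtain j0 where j0: "j0 \<in> B" "\<And>j. j \<in> B \<Longrightarrow> U j0 $ k \<le> U j $ k"
      using ex_min_if_finite[of "(\<lambda>j. U j $ k) ` B"] by (metis (no_types, lifting) arg_min_if_finite(1) arg_min_least)
    have "{j \<in> a. U j $ k \<le> U j0 $ k} = insert j0 {j \<in> a. U j $ k \<le> x}"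
    proof (intro set_eqI iffI)
      fix j assume j: "j \<in> {j \<in> a. U j $ k \<le> U j0 $ k}"
      show "j \<in> insert j0 {j \<in> a. U j $ k \<le> x}"
      proof (cases "U j $ k \<le> x")
        case False
        then have "j \<in> B" using j by (auto simp: B_def)
        then have "U j $ k = U j0 $ k" using j0(2)[of j] j by auto
        then have "j = j0" using U_inj j j0(1) by (auto simp: B_def)
        then show ?thesis by simp
      qed (use j in auto)
    qed (use j0(1) in \<open>auto simp: B_def\<close>)
    moreover have "j0 \<notin> {j \<in> a. U j $ k \<le> x}" using j0(1) by (auto simp: B_def)
    ultimately have "Fn k (U j0 $ k) = Fn k x + 1 / real (card a)"
      using a_fin by (simp add: Fn_def add_divide_distrib)
    moreover have "t < Fn k (U j0 $ k)"
    proof (rule ccontr)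
      assume "\<not> t < Fn k (U j0 $ k)"
      then have "U j0 $ k \<in> S" using j0(1) by (auto simp: S_def B_def)
      then show False using Sx j0(1) by (force simp: B_def)
    qed
    ultimately show ?thesis by simp
  qed
qed

text \<open>Reading the empirical copula at \<open>y\<close> amounts to reading the empirical distribution at a
  point \<open>x\<close>; the coordinates in \<open>L\<close> are given on the scale of the data, the others on the scale
  of the ranks.\<close>
lemma obtain_x:
  assumes u: "u \<in> unitcube" and y: "y = vmix L (\<chi> k. Fn k (u $ k)) u"
  obtains x where "x \<in> unitcube" "Chat y = En x / P" "\<And>k. k \<in> L \<Longrightarrow> x $ k = u $ k"
    "\<And>k. k \<notin> L \<Longrightarrow> En (vupd (vec 1) k (x $ k)) \<le> P * u $ k"
    "\<And>k. k \<notin> L \<Longrightarrow> P * u $ k - 1 / real n \<le> En (vupd (vec 1) k (x $ k))"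
proof -
  have "\<forall>k. \<exists>q. 0 \<le> q \<and> q \<le> 1 \<and> (\<forall>j\<in>a. Fn k (U j $ k) \<le> u $ k \<longleftrightarrow> U j $ k \<le> q) \<and>
      Fn k q \<le> u $ k \<and> u $ k - 1 / real (card a) \<le> Fn k q"
  proof
    fix k
    show "\<exists>q. 0 \<le> q \<and> q \<le> 1 \<and> (\<forall>j\<in>a. Fn k (U j $ k) \<le> u $ k \<longleftrightarrow> U j $ k \<le> q) \<and>
      Fn k q \<le> u $ k \<and> u $ k - 1 / real (card a) \<le> Fn k q"
      using u quantile[of "u $ k" k] by (metis unitcube_iff)
  qed
  then obtain q where q: "\<And>k. 0 \<le> q k" "\<And>k. q k \<le> 1"
    "\<And>k j. j \<in> a \<Longrightarrow> Fn k (U j $ k) \<le> u $ k \<longleftrightarrow> U j $ k \<le> q k"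
    "\<And>k. Fn k (q k) \<le> u $ k" "\<And>k. u $ k - 1 / real (card a) \<le> Fn k (q k)"
    by metis
  define x where "x = (\<chi> k. if k \<in> L then u $ k else q k)"
  \<comment> \<open>\<open>Fn\<close> is not injective, but it separates an observation from any
    smaller argument, since the count rises by at least one.\<close>
  have L: "Fn k (U j $ k) \<le> Fn k (u $ k) \<longleftrightarrow> U j $ k \<le> u $ k" if "j \<in> a" for j k
  proof
    assume le: "Fn k (U j $ k) \<le> Fn k (u $ k)"
    show "U j $ k \<le> u $ k"
    proof (rule ccontr)
      assume neg: "\<not> U j $ k \<le> u $ k"
      then have "{i \<in> a. U i $ k \<le> u $ k} \<subset> {i \<in> a. U i $ k \<le> U j $ k}"
        using that by auto
      then have "card {i \<in> a. U i $ k \<le> u $ k} < card {i \<in> a. U i $ k \<le> U j $ k}"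
        using a_fin by (intro psubset_card_mono) auto
      then have "Fn k (u $ k) < Fn k (U j $ k)"
        using card_a_pos by (simp add: Fn_def divide_strict_right_mono)
      then show False using le by simp
    qed
  qed (rule Fn_mono)
  show thesis
  proof
    show "x \<in> unitcube" using u q(1,2) by (simp add: x_def unitcube_iff)
    have "Fn k (U j $ k) \<le> y $ k \<longleftrightarrow> U j $ k \<le> x $ k" if "j \<in> a" for j k
      using that L[OF that] q(3)[OF that] by (simp add: y x_def)
    then have "{j \<in> a. \<forall>k. Fn k (U j $ k) \<le> y $ k} = {j \<in> a. \<forall>k. U j $ k \<le> x $ k}" by auto
    then show "Chat y = En x / P" using n_pos by (simp add: Chat_def En_def P_def)
    fix k
    show "k \<in> L \<Longrightarrow> x $ k = u $ k" by (simp add: x_def)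
    assume k: "k \<notin> L"
    show "En (vupd (vec 1) k (x $ k)) \<le> P * u $ k"
      using q(4)[of k] k P_pos by (simp add: x_def) (simp only: Fn_En pos_divide_le_eq mult.commute times_divide_eq_right)
    have "P * (u $ k - 1 / real (card a)) \<le> En (vupd (vec 1) k (q k))"
      using q(5)[of k] P_pos by (simp only: Fn_En pos_le_divide_eq mult.commute)
    \<comment> \<open>One observation weighs \<open>1 / card a\<close> on the scale of ranks and
      \<open>1 / n\<close> under \<open>En\<close>.\<close>
    moreover have "P * (u $ k - 1 / real (card a)) = P * u $ k - 1 / real n"
      using card_a_pos n_pos by (simp add: right_diff_distrib P_def)
    ultimately show "P * u $ k - 1 / real n \<le> En (vupd (vec 1) k (x $ k))"
      using k by (simp add: x_def)
  qed
qed

end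

text \<open>The offsets are divided by sqrt n when used, so the grid covers a cube of side of order
  1/sqrt n with a number of points that does not grow with n.\<close>

definition offset_grid :: "int \<Rightarrow> real \<Rightarrow> (real^'p::finite) set" where
  "offset_grid J \<epsilon> = (\<lambda>f. \<chi> k. \<epsilon> * of_int (f k)) ` (UNIV \<rightarrow>\<^sub>E {-J..J})"

lemma finite_offset_grid: "finite (offset_grid J \<epsilon>)"
  unfolding offset_grid_def by (intro finite_imageI finite_PiE) auto

lemma offset_gridI:
  assumes "\<And>k. -J \<le> f k \<and> f k \<le> J"
  shows "(\<chi> k. \<epsilon> * of_int (f k)) \<in> offset_grid J \<epsilon>"
  unfolding offset_grid_def using assms by (intro imageI) auto

lemma oscf_ge:
  assumes "finite Gr" "v \<in> Gr"
  shows "\<bar>b (u + (1 / s) *\<^sub>R v) - b u\<bar> \<le> oscf s Gr b u"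
  unfolding oscf_def by (rule member_le_sum[OF assms(2)]) (use assms in auto)

lemma abs_minus_minus_le: "\<bar>a\<bar> \<le> A \<Longrightarrow> \<bar>b\<bar> \<le> B \<Longrightarrow> \<bar>a - - b\<bar> \<le> A + (B::real)"
  by linarith

lemma abs_add3_le: "\<bar>a\<bar> \<le> A \<Longrightarrow> \<bar>b\<bar> \<le> B \<Longrightarrow> \<bar>c\<bar> \<le> C \<Longrightarrow> \<bar>a + b + c\<bar> \<le> A + B + (C::real)"
  by linarith

lemma abs_add2_le: "\<bar>a\<bar> \<le> A \<Longrightarrow> \<bar>b\<bar> \<le> B \<Longrightarrow> \<bar>a + b\<bar> \<le> A + (B::real)"
  by linarith

context copula_fun
begin

text \<open>The intermediate point is located in \<open>lo\<close> to \<open>hi\<close> rather than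
  between \<open>t\<close> and \<open>t'\<close>, so that the order of the two, and the case
  \<open>t = t'\<close>, need no attention in \<open>good\<close>.\<close>

lemma mvt_coord:
  assumes z: "z \<in> unitcube" and lo: "0 < lo" "hi < 1"
    and t: "lo \<le> t" "t \<le> hi" "lo \<le> t'" "t' \<le> hi"
  obtains c where "lo \<le> c" "c \<le> hi"
    "D (vupd z k t) - D (vupd z k t') = g k (vupd z k c) * (t - t')"
proof -
  have der: "((\<lambda>t. D (vupd z k t)) has_real_derivative g k (vupd z k c)) (at c)"
    if "lo \<le> c" "c \<le> hi" for c
  proof -
    have "vupd z k c \<in> unitcube" using z lo that by (auto simp: unitcube_iff)
    moreover have "vupd (vupd z k c) k t = vupd z k t" for t by (simp add: vec_eq_iff)
    ultimately show ?thesis using g_deriv[of "vupd z k c" k] lo that by simp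
  qed
  consider "t < t'" | "t = t'" | "t' < t" by linarith
  then show thesis
  proof cases
    case 1
    obtain c where "t < c" "c < t'" "D (vupd z k t') - D (vupd z k t) = (t' - t) * g k (vupd z k c)"
      using MVT2[OF 1, of "\<lambda>t. D (vupd z k t)" "\<lambda>c. g k (vupd z k c)"] der t by auto
    then show thesis using t by (intro that[of c]) (auto simp: algebra_simps)
  next
    case 2
    then show thesis using t by (intro that[of lo]) auto
  next
    case 3
    obtain c where "t' < c" "c < t" "D (vupd z k t) - D (vupd z k t') = (t - t') * g k (vupd z k c)"
      using MVT2[OF 3, of "\<lambda>t. D (vupd z k t)" "\<lambda>c. g k (vupd z k c)"] der t by auto
    then show thesis using t by (intro that[of c]) (auto simp: algebra_simps)
  qed
qed

lemma D_lip1: "\<bar>D (vupd z k t) - D (vupd z k t')\<bar> \<le> p * \<bar>t - t'\<bar>"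
proof -
  have "(\<Sum>j\<in>UNIV. \<bar>vupd z k t $ j - vupd z k t' $ j\<bar>) = (\<Sum>j\<in>UNIV. if j = k then \<bar>t - t'\<bar> else 0)"
    by (intro sum.cong) auto
  then show ?thesis using D_lip[of "vupd z k t" "vupd z k t'"] by simp
qed

end

context sample
begin

text \<open>Exact, without remainder: \<open>P\<close> equals \<open>p + al (vec 1) / s\<close>, and
  the deterministic parts \<open>p * u $ k\<close> cancel.\<close>

lemma Fn_minus:
  assumes "u \<in> unitcube"
  shows "Fn k (u $ k) - u $ k = bridge al k u / (P * s)"
proof -
  have E: "En (vupd (vec 1) k (u $ k)) = p * u $ k + al (vupd (vec 1) k (u $ k)) / s"
    using En_al[of "vupd (vec 1) k (u $ k)"] assms by (simp add: D_marg unitcube_iff)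
  have "En (vupd (vec 1) k (u $ k)) - u $ k * P = bridge al k u / s"
    unfolding E P_al bridge_def by (simp add: algebra_simps diff_divide_distrib)
  moreover have "Fn k (u $ k) - u $ k = (En (vupd (vec 1) k (u $ k)) - u $ k * P) / P"
    unfolding Fn_En diff_divide_distrib using P_pos by simp
  ultimately show ?thesis by (simp add: mult.commute)
qed

lemma div_P_le: "0 \<le> c \<Longrightarrow> c / P \<le> 2 * c / p"
proof -
  assume c: "0 \<le> c"
  have "c / P \<le> c / (p / 2)" using c many' P_pos p_pos by (intro divide_left_mono) auto
  then show ?thesis by (simp add: mult.commute)
qed

lemma Fn_minus_le:
  assumes "u \<in> unitcube"
  shows "s * \<bar>Fn k (u $ k) - u $ k\<bar> \<le> 2 * \<bar>bridge al k u\<bar> / p"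
proof -
  have "s * \<bar>Fn k (u $ k) - u $ k\<bar> = \<bar>bridge al k u\<bar> / P"
    unfolding Fn_minus[OF assms] using s_pos P_pos by (simp add: abs_mult abs_divide)
  then show ?thesis using div_P_le[of "\<bar>bridge al k u\<bar>"] by simp
qed

lemma inverse_P_diff: "s * (1 / P - 1 / p) = - al (vec 1) / (p * P)"
proof -
  have "1 / P - 1 / p = (p - P) / (p * P)" using P_pos p_pos by (simp add: diff_divide_distrib)
  also have "p - P = - (al (vec 1) / s)" using P_al by linarith
  finally have "1 / P - 1 / p = - (al (vec 1) / s) / (p * P)" .
  then show ?thesis using s_pos by (simp only:) simp
qed

lemma s_div_n: "s * (1 / real n) = 1 / s"
  using s_pos ss by (simp add: field_simps)

text \<open>A bound without any smallness assumption, linear in the size of the path at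
  \<open>u\<close>; it serves in \<open>linearisation\<close> for the paths that \<open>good\<close>
  does not cover.\<close>

lemma crude:
  assumes u: "u \<in> unitcube" and y: "y = vmix L (\<chi> k. Fn k (u $ k)) u"
  shows "\<bar>s * (Chat y - D y / p)\<bar> \<le> (4 * real CARD('p) + 4) * (1 + w0f al u) / p"
proof -
  define w where "w = w0f al u"
  have w: "0 \<le> w" by (simp add: w_def w0f_nonneg)
  obtain x where x: "x \<in> unitcube" "Chat y = En x / P" "\<And>k. k \<in> L \<Longrightarrow> x $ k = u $ k"
    "\<And>k. k \<notin> L \<Longrightarrow> En (vupd (vec 1) k (x $ k)) \<le> P * u $ k"
    "\<And>k. k \<notin> L \<Longrightarrow> P * u $ k - 1 / real n \<le> En (vupd (vec 1) k (x $ k))"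
    using obtain_x[OF u y] by blast
  \<comment> \<open>For \<open>k\<close> in \<open>L\<close> both points have the same coordinate.
    Otherwise both marginal values are compared with \<open>P * u $ k\<close>, one up to
    \<open>1 / n\<close> and the other up to a bridge.\<close>
  have each: "s * \<bar>En (vupd (vec 1) k (x $ k)) - En (vupd (vec 1) k (u $ k))\<bar> \<le> 1 + w" for k
  proof (cases "k \<in> L")
    case True then show ?thesis using x(3) w by simp
  next
    case False
    have e: "En (vupd (vec 1) k (u $ k)) - P * u $ k = bridge al k u / s"
    proof -
      have "Fn k (u $ k) * P = En (vupd (vec 1) k (u $ k))" using P_pos by (simp only: Fn_En) simp
      moreover have "(Fn k (u $ k) - u $ k) * P = bridge al k u / s"
        unfolding Fn_minus[OF u] using P_pos by simp
      ultimately show ?thesis by (simp only: left_diff_distrib) (simp add: mult.commute)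
    qed
    have "\<bar>En (vupd (vec 1) k (x $ k)) - En (vupd (vec 1) k (u $ k))\<bar> \<le> 1 / real n + \<bar>bridge al k u / s\<bar>"
      using x(4)[OF False] x(5)[OF False] e by linarith
    then have "s * \<bar>En (vupd (vec 1) k (x $ k)) - En (vupd (vec 1) k (u $ k))\<bar>
        \<le> s * (1 / real n + \<bar>bridge al k u / s\<bar>)"
      using s_pos by (intro mult_left_mono) auto
    also have "\<dots> = 1 / s + \<bar>bridge al k u\<bar>"
      using s_pos by (simp only: distrib_left s_div_n) (simp add: abs_divide)
    also have "\<dots> \<le> 1 + w"
      using s_ge1 bridge_le[OF u, of al k] by (intro add_mono) (auto simp: w_def)
    finally show ?thesis .
  qed
  have "s * \<bar>En x - En u\<bar> \<le> (\<Sum>k\<in>UNIV. s * \<bar>En (vupd (vec 1) k (x $ k)) - En (vupd (vec 1) k (u $ k))\<bar>)"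
    using mult_left_mono[OF En_diff[of x u], of s] s_pos by (simp add: sum_distrib_left)
  also have "\<dots> \<le> (\<Sum>k\<in>(UNIV::'p set). 1 + w)" by (rule sum_mono) (rule each)
  finally have 1: "s * \<bar>En x - En u\<bar> \<le> real CARD('p) * (1 + w)" by simp
  have 1: "\<bar>s * (En x - En u) / P\<bar> \<le> 2 * (real CARD('p) * (1 + w)) / p"
  proof -
    have "\<bar>s * (En x - En u) / P\<bar> = s * \<bar>En x - En u\<bar> / P"
      using s_pos P_pos by (simp add: abs_mult abs_divide)
    also have "\<dots> \<le> real CARD('p) * (1 + w) / P" using 1 P_pos by (intro divide_right_mono) auto
    also have "\<dots> \<le> 2 * (real CARD('p) * (1 + w)) / p" using w by (intro div_P_le) auto
    finally show ?thesis .
  qed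
  have 2: "\<bar>s * (En u / P - D u / p)\<bar> \<le> 4 * w / p"
  proof -
    have "s * (En u / P - D u / p) = s * (En u - D u) / P + D u * (s * (1 / P - 1 / p))"
      by (simp add: algebra_simps diff_divide_distrib)
    also have "\<dots> = al u / P - D u * al (vec 1) / p / P"
      unfolding inverse_P_diff by (simp add: al_def)
    finally have "\<bar>s * (En u / P - D u / p)\<bar> \<le> \<bar>al u\<bar> / P + \<bar>D u * al (vec 1) / p\<bar> / P"
      using abs_triangle_ineq4[of "al u / P" "D u * al (vec 1) / p / P"] P_pos
      by (simp only: abs_divide[of _ P] abs_of_pos)
    also have "\<dots> \<le> w / P + w / P"
    proof (intro add_mono divide_right_mono)
      have "\<bar>D u * al (vec 1)\<bar> \<le> p * w"
        unfolding abs_mult using D_nonneg D_le w0f_ge p_pos by (intro mult_mono) (auto simp: w_def)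
      then show "\<bar>D u * al (vec 1) / p\<bar> \<le> w" using p_pos by (simp add: abs_divide field_simps)
    qed (use w0f_ge P_pos in \<open>auto simp: w_def\<close>)
    also have "\<dots> \<le> 4 * w / p" using div_P_le[OF w] by simp
    finally show ?thesis .
  qed
  have 3: "\<bar>s * (D u - D y) / p\<bar> \<le> real CARD('p) * (2 * w / p)"
  proof -
    have "s * \<bar>D u - D y\<bar> / p \<le> s * (p * (\<Sum>k\<in>UNIV. \<bar>u $ k - y $ k\<bar>)) / p"
      using s_pos p_pos D_lip by (intro divide_right_mono mult_left_mono) auto
    also have "\<dots> = (\<Sum>k\<in>UNIV. s * \<bar>u $ k - y $ k\<bar>)" using p_pos by (simp add: sum_distrib_left[symmetric])
    also have "\<dots> \<le> (\<Sum>k\<in>(UNIV::'p set). 2 * w / p)"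
    proof (rule sum_mono)
      fix k
      show "s * \<bar>u $ k - y $ k\<bar> \<le> 2 * w / p"
      proof (cases "k \<in> L")
        case True
        have "s * \<bar>u $ k - y $ k\<bar> = s * \<bar>Fn k (u $ k) - u $ k\<bar>" using True by (simp add: y abs_minus_commute)
        also have "\<dots> \<le> 2 * \<bar>bridge al k u\<bar> / p" by (rule Fn_minus_le[OF u])
        also have "\<dots> \<le> 2 * w / p"
          using bridge_le[OF u] p_pos by (intro divide_right_mono) (auto simp: w_def)
        finally show ?thesis .
      qed (use w p_pos in \<open>simp add: y\<close>)
    qed
    finally show ?thesis using s_pos p_pos by (simp add: abs_mult abs_divide)
  qed
  \<comment> \<open>Three errors: moving the argument of \<open>En\<close> from \<open>x\<close> to
    \<open>u\<close>, the fluctuation at \<open>u\<close> together with the random mass, and moving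
    the argument of \<open>D\<close> from \<open>u\<close> to \<open>y\<close>.\<close>
  have "s * (Chat y - D y / p) = s * (En x - En u) / P + s * (En u / P - D u / p) + s * (D u - D y) / p"
    unfolding x(2) by (simp add: algebra_simps diff_divide_distrib)
  then have "\<bar>s * (Chat y - D y / p)\<bar> \<le> 2 * (real CARD('p) * (1 + w)) / p + 4 * w / p + real CARD('p) * (2 * w / p)"
    using 1 2 3 by linarith
  also have "\<dots> = (2 * (real CARD('p) * (1 + w)) + 4 * w + real CARD('p) * (2 * w)) / p"
    by (simp add: add_divide_distrib)
  also have "\<dots> \<le> (4 * real CARD('p) + 4) * (1 + w) / p"
    using p_pos w by (intro divide_right_mono) (auto simp: algebra_simps)
  finally show ?thesis by (simp add: w_def)
qed

text \<open>By monotonicity \<open>En\<close> at \<open>x\<close> lies between its values at the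
  lattice points just above and just below. Exchanging \<open>En\<close> for \<open>al\<close> costs
  the scaled increment of \<open>D\<close> over one lattice cell, which is the last term.\<close>

lemma sandwich:
  assumes eps: "0 < \<epsilon>" and near: "\<And>k. \<bar>x $ k - b $ k\<bar> \<le> of_int J * \<epsilon> / s"
  shows "\<bar>al x - al b\<bar> \<le> oscf s (offset_grid J \<epsilon>) al b + p * real CARD('p) * \<epsilon>"
proof -
  \<comment> \<open>Position of \<open>x\<close> relative to \<open>b\<close> in lattice units; its
    floor and ceiling stay within \<open>J\<close> steps.\<close>
  define t where "t k = s * (x $ k - b $ k) / \<epsilon>" for k
  have tJ: "\<bar>t k\<bar> \<le> of_int J" for k
  proof -
    have "\<bar>t k\<bar> = s * \<bar>x $ k - b $ k\<bar> / \<epsilon>" using s_pos eps by (simp add: t_def abs_mult abs_divide)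
    also have "\<dots> \<le> s * (of_int J * \<epsilon> / s) / \<epsilon>"
      using near[of k] s_pos eps by (intro divide_right_mono mult_left_mono) auto
    finally show ?thesis using s_pos eps by simp
  qed
  define up where "up = (\<chi> k. \<epsilon> * of_int \<lceil>t k\<rceil> :: real^'p)"
  define dn where "dn = (\<chi> k. \<epsilon> * of_int \<lfloor>t k\<rfloor> :: real^'p)"
  have tk: "t k \<le> of_int J" "of_int (-J) \<le> t k" for k using tJ[of k] by auto
  have up: "up \<in> offset_grid J \<epsilon>"
    unfolding up_def
  proof (rule offset_gridI)
    fix k
    show "-J \<le> \<lceil>t k\<rceil> \<and> \<lceil>t k\<rceil> \<le> J"
      using tk[of k] by (metis ceiling_le_iff ceiling_mono ceiling_of_int)
  qed
  have dn: "dn \<in> offset_grid J \<epsilon>"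
    unfolding dn_def
  proof (rule offset_gridI)
    fix k
    show "-J \<le> \<lfloor>t k\<rfloor> \<and> \<lfloor>t k\<rfloor> \<le> J"
      using tk[of k] by (metis le_floor_iff floor_mono floor_of_int)
  qed
  have xk: "x $ k = b $ k + (1 / s) * (\<epsilon> * t k)" for k
    using s_pos eps by (simp add: t_def)
  have hi: "x $ k \<le> (b + (1 / s) *\<^sub>R up) $ k" "(b + (1 / s) *\<^sub>R up) $ k - x $ k \<le> \<epsilon> / s" for k
  proof -
    have "t k \<le> of_int \<lceil>t k\<rceil>" "of_int \<lceil>t k\<rceil> \<le> t k + 1" by linarith+
    then have "(1 / s) * (\<epsilon> * t k) \<le> (1 / s) * (\<epsilon> * of_int \<lceil>t k\<rceil>)"
      "(1 / s) * (\<epsilon> * of_int \<lceil>t k\<rceil>) \<le> (1 / s) * (\<epsilon> * (t k + 1))"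
      using s_pos eps by (auto intro!: mult_left_mono divide_right_mono)
    then show "x $ k \<le> (b + (1 / s) *\<^sub>R up) $ k" "(b + (1 / s) *\<^sub>R up) $ k - x $ k \<le> \<epsilon> / s"
      by (simp_all add: xk up_def algebra_simps add_divide_distrib)
  qed
  have lo: "(b + (1 / s) *\<^sub>R dn) $ k \<le> x $ k" "x $ k - (b + (1 / s) *\<^sub>R dn) $ k \<le> \<epsilon> / s" for k
  proof -
    have "of_int \<lfloor>t k\<rfloor> \<le> t k" "t k \<le> of_int \<lfloor>t k\<rfloor> + 1" by linarith+
    then have "(1 / s) * (\<epsilon> * of_int \<lfloor>t k\<rfloor>) \<le> (1 / s) * (\<epsilon> * t k)"
      "(1 / s) * (\<epsilon> * t k) \<le> (1 / s) * (\<epsilon> * (of_int \<lfloor>t k\<rfloor> + 1))"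
      using s_pos eps by (auto intro!: mult_left_mono divide_right_mono)
    then show "(b + (1 / s) *\<^sub>R dn) $ k \<le> x $ k" "x $ k - (b + (1 / s) *\<^sub>R dn) $ k \<le> \<epsilon> / s"
      by (simp_all add: xk dn_def algebra_simps add_divide_distrib)
  qed
  have lip: "s * \<bar>D v - D x\<bar> \<le> p * real CARD('p) * \<epsilon>" if "\<And>k. \<bar>v $ k - x $ k\<bar> \<le> \<epsilon> / s" for v
  proof -
    have "s * \<bar>D v - D x\<bar> \<le> s * (p * (\<Sum>k\<in>(UNIV::'p set). \<epsilon> / s))"
      using s_pos p_pos that
      by (intro mult_left_mono order_trans[OF D_lip] sum_mono) auto
    then show ?thesis using s_pos by (simp add: mult_ac)
  qed
  have "al x \<le> al (b + (1 / s) *\<^sub>R up) + s * (D (b + (1 / s) *\<^sub>R up) - D x)"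
    using mult_left_mono[OF En_mono[of x "b + (1 / s) *\<^sub>R up"], of s] hi(1) s_pos
    by (simp add: al_def algebra_simps)
  moreover have "s * (D (b + (1 / s) *\<^sub>R up) - D x) \<le> p * real CARD('p) * \<epsilon>"
  proof (rule order_trans[OF _ lip])
    show "s * (D (b + (1 / s) *\<^sub>R up) - D x) \<le> s * \<bar>D (b + (1 / s) *\<^sub>R up) - D x\<bar>"
      using s_pos by (intro mult_left_mono) auto
    show "\<bar>(b + (1 / s) *\<^sub>R up) $ k - x $ k\<bar> \<le> \<epsilon> / s" for k using hi[of k] by linarith
  qed
  moreover have "al (b + (1 / s) *\<^sub>R dn) + s * (D (b + (1 / s) *\<^sub>R dn) - D x) \<le> al x"
    using mult_left_mono[OF En_mono[of "b + (1 / s) *\<^sub>R dn" x], of s] lo(1) s_pos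
    by (simp add: al_def algebra_simps)
  moreover have "- (s * (D (b + (1 / s) *\<^sub>R dn) - D x)) \<le> p * real CARD('p) * \<epsilon>"
  proof (rule order_trans[OF _ lip])
    have "s * - (D (b + (1 / s) *\<^sub>R dn) - D x) \<le> s * \<bar>D (b + (1 / s) *\<^sub>R dn) - D x\<bar>"
      using s_pos by (intro mult_left_mono) auto
    then show "- (s * (D (b + (1 / s) *\<^sub>R dn) - D x)) \<le> s * \<bar>D (b + (1 / s) *\<^sub>R dn) - D x\<bar>"
      by (simp only: mult_minus_right)
    show "\<bar>(b + (1 / s) *\<^sub>R dn) $ k - x $ k\<bar> \<le> \<epsilon> / s" for k using lo[of k] by linarith
  qed
  ultimately show ?thesis
    using oscf_ge[OF finite_offset_grid up, of al b s] oscf_ge[OF finite_offset_grid dn, of al b s]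
    by linarith
qed

text \<open>If \<open>t\<close> were further than \<open>M / s\<close> from \<open>u $ k\<close>,
  monotonicity of the margin would carry the bound on \<open>En\<close> over to the point at
  distance exactly \<open>M / s\<close>, which is a lattice offset. There the drift
  \<open>p * M\<close> would have to be compensated by at most \<open>2 * m + 2\<close>:
  \<open>m\<close> from the margin, \<open>m\<close> from the mass, 1 from the oscillation and 1
  from the granularity of ranks.\<close>

lemma localise:
  assumes u: "u \<in> unitcube" and w0: "w0f al u \<le> m" and eps: "0 < \<epsilon>"
    and w1: "w1f s (offset_grid J \<epsilon>) al u \<le> 1" and M: "M = of_int J * \<epsilon>" "(2 * m + 4) / p \<le> M"
    and xk: "0 \<le> t" "t \<le> 1"
    and q: "En (vupd (vec 1) k t) \<le> P * u $ k" "P * u $ k - 1 / real n \<le> En (vupd (vec 1) k t)"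
  shows "\<bar>t - u $ k\<bar> \<le> M / s"
proof -
  have m0: "0 \<le> m" using w0 w0f_nonneg order_trans by blast
  have pM: "2 * m + 4 \<le> p * M" using M(2) p_pos by (simp add: pos_divide_le_eq mult.commute)
  have J: "0 \<le> J"
  proof -
    have "0 < p * M" using pM m0 by linarith
    then have "0 < of_int J * \<epsilon>" using p_pos M(1) by (simp add: zero_less_mult_iff)
    then show ?thesis using eps by (simp add: zero_less_mult_iff)
  qed
  have uk: "0 \<le> u $ k" "u $ k \<le> 1" using u by (auto simp: unitcube_iff)
  have shift: "vupd (vec 1) k (u $ k) + (1 / s) *\<^sub>R (\<chi> i. \<epsilon> * of_int (if i = k then j else 0))
      = vupd (vec 1) k (u $ k + \<epsilon> * of_int j / s)" for j
    by (simp add: vec_eq_iff)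
  have osc: "\<bar>al (vupd (vec 1) k (u $ k + \<epsilon> * of_int j / s)) - al (vupd (vec 1) k (u $ k))\<bar> \<le> 1"
    if "j = J \<or> j = -J" for j
  proof -
    have "(\<chi> i. \<epsilon> * of_int (if i = k then j else 0)) \<in> (offset_grid J \<epsilon> :: (real^'p) set)"
      using that J by (intro offset_gridI) auto
    from oscf_ge[OF finite_offset_grid this, of al "vupd (vec 1) k (u $ k)" s]
    show ?thesis unfolding shift using w1f_ge(2)[of s "offset_grid J \<epsilon>" al k u] w1 by linarith
  qed
  have uk1: "u $ k * al (vec 1) \<le> m" "- m \<le> u $ k * al (vec 1)"
  proof -
    have "\<bar>u $ k * al (vec 1)\<bar> \<le> 1 * m"
      unfolding abs_mult using uk w0f_ge(3)[of al u] w0 by (intro mult_mono) auto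
    then show "u $ k * al (vec 1) \<le> m" "- m \<le> u $ k * al (vec 1)" by auto
  qed
  have ak: "\<bar>al (vupd (vec 1) k (u $ k))\<bar> \<le> m" using w0f_ge(4)[of al k u] w0 by linarith
  have sP: "s * P * u $ k = s * p * u $ k + u $ k * al (vec 1)"
    unfolding P_al using s_pos by (simp add: algebra_simps)
  have sEn: "s * En (vupd (vec 1) k r) = s * p * r + al (vupd (vec 1) k r)" if "0 \<le> r" "r \<le> 1" for r
    using that by (simp add: al_def D_marg algebra_simps)
  have "t \<le> u $ k + M / s"
  proof (rule ccontr)
    assume neg: "\<not> t \<le> u $ k + M / s"
    define r where "r = u $ k + M / s"
    have M0: "0 \<le> M" using J eps M(1) by simp
    have r: "0 \<le> r" "r \<le> 1" "r \<le> t" using neg uk xk M0 s_pos by (auto simp: r_def)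
    have "En (vupd (vec 1) k r) \<le> En (vupd (vec 1) k t)" using r by (intro En_mono) auto
    then have "s * En (vupd (vec 1) k r) \<le> s * (P * u $ k)"
      using q(1) s_pos by (intro mult_left_mono) auto
    then have "s * p * r + al (vupd (vec 1) k r) \<le> s * p * u $ k + m"
      using sEn[OF r(1,2)] sP uk1 by (simp add: mult.assoc)
    moreover have "s * p * r = s * p * u $ k + p * M" using s_pos by (simp add: r_def algebra_simps)
    moreover have "r = u $ k + \<epsilon> * of_int J / s" by (simp add: r_def M(1) mult.commute)
    then have "\<bar>al (vupd (vec 1) k r) - al (vupd (vec 1) k (u $ k))\<bar> \<le> 1" using osc[of J] by simp
    ultimately show False using ak pM by linarith
  qed
  moreover have "u $ k - M / s \<le> t"
  proof (rule ccontr)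
    assume neg: "\<not> u $ k - M / s \<le> t"
    define r where "r = u $ k - M / s"
    have M0: "0 \<le> M" using J eps M(1) by simp
    then have "0 \<le> M / s" using s_pos by simp
    then have r: "0 \<le> r" "r \<le> 1" "t \<le> r" using neg uk xk by (auto simp: r_def)
    have "En (vupd (vec 1) k t) \<le> En (vupd (vec 1) k r)" using r by (intro En_mono) auto
    then have "s * (P * u $ k - 1 / real n) \<le> s * En (vupd (vec 1) k r)"
      using q(2) s_pos by (intro mult_left_mono) auto
    then have "s * p * u $ k - m - 1 / s \<le> s * p * r + al (vupd (vec 1) k r)"
      using sEn[OF r(1,2)] sP uk1 by (simp only: right_diff_distrib s_div_n mult.assoc)
    moreover have "s * p * r = s * p * u $ k - p * M" using s_pos by (simp add: r_def algebra_simps)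
    moreover have "r = u $ k + \<epsilon> * of_int (-J) / s" by (simp add: r_def M(1) mult.commute)
    then have "\<bar>al (vupd (vec 1) k r) - al (vupd (vec 1) k (u $ k))\<bar> \<le> 1" using osc[of "-J"] by simp
    moreover have "1 / s \<le> 1" using s_ge1 by simp
    ultimately show False using ak pM by linarith
  qed
  ultimately show ?thesis by linarith
qed

text \<open>On a path of moderate size and small oscillation the displacement between the scale of
  the data and that of the ranks is \<open>- bridge / p\<close> to first order in each coordinate,
  on whichever scale the coordinate is given. Hence \<open>Cop\<close> does not depend on
  \<open>L\<close>. Away from the ends the effect on \<open>D\<close> is found by the mean value
  theorem, near them it is only bounded.\<close>

lemma good:
  fixes \<epsilon> \<delta> \<eta> e m M :: real
  assumes u: "u \<in> unitcube" and y: "y = vmix L (\<chi> k. Fn k (u $ k)) u"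
    and w0: "w0f al u \<le> m" and eps: "0 < \<epsilon>"
    and w1: "w1f s (offset_grid J \<epsilon>) al u \<le> 1" and M: "M = of_int J * \<epsilon>" "(2 * m + 4) / p \<le> M"
    and delta: "0 < \<delta>" and large: "M / s \<le> \<delta> / 2" "M / s \<le> \<eta>" and e: "0 \<le> e" "e \<le> 1"
    and UC: "\<And>k z z'. z \<in> unitcube \<Longrightarrow> z' \<in> unitcube \<Longrightarrow> \<delta> / 2 \<le> z $ k \<Longrightarrow> z $ k \<le> 1 - \<delta> / 2 \<Longrightarrow>
        \<delta> / 2 \<le> z' $ k \<Longrightarrow> z' $ k \<le> 1 - \<delta> / 2 \<Longrightarrow> (\<And>j. \<bar>z $ j - z' $ j\<bar> \<le> \<eta>) \<Longrightarrow> \<bar>g k z - g k z'\<bar> \<le> e"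
    and \<tau>: "\<tau> = w1f s (offset_grid J \<epsilon>) al u / p + real CARD('p) * \<epsilon> + (1 / p + 2 * m\<^sup>2 / p\<^sup>2) / s"
  shows "\<bar>s * (Chat y - D y / p) - Cop al u\<bar> \<le>
     2 / p * (w1f s (offset_grid J \<epsilon>) al u + p * real CARD('p) * \<epsilon>) + 2 * m\<^sup>2 / p\<^sup>2 / s
     + (real CARD('p) * (e * m / p + (1 + p) * \<tau>) / p
        + 2 * (\<Sum>k | u $ k < \<delta> \<or> 1 - \<delta> < u $ k. \<bar>bridge al k u\<bar> / p))
     + (m / p * (2 * real CARD('p) * M + 2 * m / p)) / s"
proof -
  define w where "w = w1f s (offset_grid J \<epsilon>) al u"
  define d where "d = real CARD('p)"
  have m0: "0 \<le> m" using w0 w0f_nonneg order_trans by blast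
  have w_nn: "0 \<le> w" by (simp add: w_def w1f_nonneg)
  have pM: "2 * m + 4 \<le> p * M" using M(2) p_pos by (simp add: pos_divide_le_eq mult.commute)
  have M0: "0 < M"
  proof -
    have "0 < p * M" using pM m0 by linarith
    then show ?thesis using p_pos by (simp add: zero_less_mult_iff)
  qed
  have tau0: "0 \<le> \<tau>" using w_nn p_pos eps s_pos m0 by (simp add: \<tau> w_def)
  obtain x where x: "x \<in> unitcube" "Chat y = En x / P" "\<And>k. k \<in> L \<Longrightarrow> x $ k = u $ k"
    "\<And>k. k \<notin> L \<Longrightarrow> En (vupd (vec 1) k (x $ k)) \<le> P * u $ k"
    "\<And>k. k \<notin> L \<Longrightarrow> P * u $ k - 1 / real n \<le> En (vupd (vec 1) k (x $ k))"
    using obtain_x[OF u y] by blast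
  have uk: "0 \<le> u $ k" "u $ k \<le> 1" for k using u by (auto simp: unitcube_iff)
  have xk: "0 \<le> x $ k" "x $ k \<le> 1" for k using x(1) by (auto simp: unitcube_iff)
  have br: "\<bar>bridge al k u\<bar> \<le> m" for k using bridge_le[OF u, of al k] w0 by linarith
  have a1: "\<bar>al (vec 1)\<bar> \<le> m" using w0f_ge(3)[of al u] w0 by linarith
  have au: "\<bar>al u\<bar> \<le> m" using w0f_ge(1)[of al u] w0 by linarith
  have xu: "\<bar>x $ k - u $ k\<bar> \<le> M / s" for k
  proof (cases "k \<in> L")
    case True then show ?thesis using x(3) M0 s_pos by simp
  next
    case False
    show ?thesis by (rule localise[OF u w0 eps w1 M xk x(4)[OF False] x(5)[OF False]])
  qed
  have yu: "\<bar>y $ k - u $ k\<bar> \<le> M / s" for k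
  proof (cases "k \<in> L")
    case True
    have "s * \<bar>y $ k - u $ k\<bar> \<le> 2 * \<bar>bridge al k u\<bar> / p" using Fn_minus_le[OF u, of k] True by (simp add: y)
    also have "\<dots> \<le> M" using br[of k] pM p_pos by (simp add: pos_divide_le_eq mult.commute)
    finally show ?thesis using s_pos by (simp add: pos_le_divide_eq mult.commute)
  next
    case False then show ?thesis using M0 s_pos by (simp add: y)
  qed
  have y1: "y \<in> unitcube"
  proof -
    have "0 \<le> Fn k t" "Fn k t \<le> 1" for k t
      unfolding Fn_def using card_a_pos card_mono[OF a_fin, of "{j \<in> a. U j $ k \<le> t}"]
      by (auto simp: divide_le_eq_1)
    then show ?thesis using u by (simp add: unitcube_iff y)
  qed
  have alx: "\<bar>al x - al u\<bar> \<le> w + p * d * \<epsilon>"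
    using sandwich[OF eps, of x u J] xu w1f_ge(1)[of s "offset_grid J \<epsilon>" al u] unfolding M(1) w_def d_def
    by fastforce
  have alk: "\<bar>al (vupd (vec 1) k (x $ k)) - al (vupd (vec 1) k (u $ k))\<bar> \<le> w + p * d * \<epsilon>" for k
  proof -
    have "\<bar>vupd (vec 1) k (x $ k) $ j - vupd (vec 1) k (u $ k) $ j\<bar> \<le> of_int J * \<epsilon> / s" for j
      using xu[of k] M0 s_pos unfolding M(1) by simp
    from sandwich[OF eps this] show ?thesis
      using w1f_ge(2)[of s "offset_grid J \<epsilon>" al k u] unfolding w_def d_def by linarith
  qed
  have iP: "\<bar>1 / P - 1 / p\<bar> \<le> 2 * m / p\<^sup>2 / s"
  proof -
    have "s * \<bar>1 / P - 1 / p\<bar> = \<bar>s * (1 / P - 1 / p)\<bar>" using s_pos by (simp add: abs_mult)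
    also have "\<dots> = \<bar>al (vec 1)\<bar> / p / P"
      unfolding inverse_P_diff using p_pos P_pos by (simp add: abs_divide abs_mult)
    also have "\<dots> \<le> m / p / P" using a1 p_pos P_pos by (intro divide_right_mono) auto
    also have "\<dots> \<le> 2 * (m / p) / p" using m0 p_pos by (intro div_P_le) auto
    finally have "\<bar>1 / P - 1 / p\<bar> * s \<le> 2 * m / p\<^sup>2"
      by (simp add: mult.commute[of s] power2_eq_square)
    then show ?thesis using s_pos by (simp only: pos_le_divide_eq)
  qed
  \<comment> \<open>For \<open>k\<close> in \<open>L\<close> the point \<open>y\<close> carries the
    rank of \<open>x $ k = u $ k\<close>; otherwise \<open>x\<close> carries a quantile of
    \<open>y $ k = u $ k\<close>. Either way \<open>x\<close> lies off \<open>y\<close> by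
    \<open>- bridge / p\<close> after scaling.\<close>
  have xy: "\<bar>s * (x $ k - y $ k) + bridge al k u / p\<bar> \<le> \<tau>" for k
  proof (cases "k \<in> L")
    case True
    have "s * (x $ k - y $ k) = - (s * (Fn k (u $ k) - u $ k))" using True x(3)[OF True] by (simp add: y algebra_simps)
    also have "s * (Fn k (u $ k) - u $ k) = bridge al k u / P" unfolding Fn_minus[OF u] using s_pos by simp
    finally have "s * (x $ k - y $ k) + bridge al k u / p = - (bridge al k u * (1 / P - 1 / p))"
      by (simp add: algebra_simps)
    then have "\<bar>s * (x $ k - y $ k) + bridge al k u / p\<bar> = \<bar>bridge al k u\<bar> * \<bar>1 / P - 1 / p\<bar>"
      by (simp add: abs_mult)
    also have "\<dots> \<le> m * (2 * m / p\<^sup>2 / s)" using br iP m0 by (intro mult_mono) auto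
    also have "\<dots> = (2 * m\<^sup>2 / p\<^sup>2) / s" by (simp add: power2_eq_square)
    also have "\<dots> \<le> (1 / p + 2 * m\<^sup>2 / p\<^sup>2) / s" using p_pos s_pos by (intro divide_right_mono) auto
    also have "\<dots> \<le> \<tau>" using w_nn p_pos eps by (simp add: \<tau> w_def)
    finally show ?thesis .
  next
    case False
    have eu: "s * (P * u $ k) = s * (p * u $ k) + u $ k * al (vec 1)"
      unfolding P_al using s_pos by (simp add: algebra_simps)
    have ex: "s * En (vupd (vec 1) k (x $ k)) = s * (p * x $ k) + al (vupd (vec 1) k (x $ k))"
      using xk by (simp add: al_def D_marg algebra_simps)
    have "s * En (vupd (vec 1) k (x $ k)) \<le> s * (P * u $ k)"
      using x(4)[OF False] s_pos by (intro mult_left_mono) auto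
    moreover have "s * (P * u $ k) - 1 / s \<le> s * En (vupd (vec 1) k (x $ k))"
      using mult_left_mono[OF x(5)[OF False], of s] s_pos by (simp only: right_diff_distrib s_div_n)
    ultimately have "\<bar>s * (p * x $ k) + al (vupd (vec 1) k (x $ k)) - s * (p * u $ k) - u $ k * al (vec 1)\<bar> \<le> 1 / s"
      using ex eu by linarith
    then have "\<bar>s * (p * x $ k) - s * (p * u $ k) + bridge al k u\<bar> \<le> 1 / s + (w + p * d * \<epsilon>)"
      using alk[of k] unfolding bridge_def by linarith
    moreover have "s * (p * x $ k) - s * (p * u $ k) + bridge al k u = p * (s * (x $ k - y $ k) + bridge al k u / p)"
      using False p_pos by (simp add: y algebra_simps)
    ultimately have "p * \<bar>s * (x $ k - y $ k) + bridge al k u / p\<bar> \<le> 1 / s + (w + p * d * \<epsilon>)"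
      using p_pos by (simp add: abs_mult)
    then have "\<bar>s * (x $ k - y $ k) + bridge al k u / p\<bar> \<le> (1 / s + (w + p * d * \<epsilon>)) / p"
      using p_pos by (simp add: pos_le_divide_eq mult.commute)
    also have "\<dots> = w / p + d * \<epsilon> + 1 / p / s" using p_pos by (simp add: add_divide_distrib)
    also have "\<dots> \<le> \<tau>" using s_pos p_pos
      by (simp add: \<tau> w_def d_def add_divide_distrib)
    finally show ?thesis .
  qed
  \<comment> \<open>Coordinates near an end, where \<open>g\<close> has no modulus of continuity.
    The increment of \<open>D\<close> and the linear term are then bounded separately, whence the
    factor 2.\<close>
  define bd where "bd = {k. u $ k < \<delta> \<or> 1 - \<delta> < u $ k}"
  have tel: "\<bar>s * (D x - D y) - (\<Sum>k\<in>UNIV. - (g k u * (bridge al k u / p)))\<bar>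
      \<le> (\<Sum>k\<in>UNIV. e * m / p + (1 + p) * \<tau> + (if k \<in> bd then 2 * p * (\<bar>bridge al k u\<bar> / p) else 0))"
  proof (rule telescope)
    fix k and S :: "'p set" assume "k \<notin> S"
    define z where "z = vmix S x y"
    have z: "z \<in> unitcube" using x(1) y1 by (simp add: z_def unitcube_iff)
    have gb: "\<bar>g k u\<bar> \<le> p" by (rule g_bound[OF u])
    have bp: "\<bar>bridge al k u / p\<bar> \<le> m / p" using br[of k] p_pos by (simp add: abs_divide divide_right_mono)
    have sxy: "\<bar>s * (x $ k - y $ k)\<bar> \<le> \<bar>bridge al k u / p\<bar> + \<tau>" using xy[of k] by linarith
    show "\<bar>s * (D (vupd (vmix S x y) k (x $ k)) - D (vupd (vmix S x y) k (y $ k))) - - (g k u * (bridge al k u / p))\<bar>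
        \<le> e * m / p + (1 + p) * \<tau> + (if k \<in> bd then 2 * p * (\<bar>bridge al k u\<bar> / p) else 0)"
    proof (cases "k \<in> bd")
      case True
      have "\<bar>s * (D (vupd z k (x $ k)) - D (vupd z k (y $ k)))\<bar> \<le> s * (p * \<bar>x $ k - y $ k\<bar>)"
        unfolding abs_mult using s_pos D_lip1 by (intro mult_mono) auto
      also have "\<dots> = p * \<bar>s * (x $ k - y $ k)\<bar>" using s_pos by (simp add: abs_mult)
      also have "\<dots> \<le> p * (\<bar>bridge al k u / p\<bar> + \<tau>)" using sxy p_pos by (intro mult_left_mono) auto
      finally have 1: "\<bar>s * (D (vupd z k (x $ k)) - D (vupd z k (y $ k)))\<bar> \<le> p * \<bar>bridge al k u / p\<bar> + p * \<tau>"
        by (simp add: distrib_left)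
      have 2: "\<bar>g k u * (bridge al k u / p)\<bar> \<le> p * \<bar>bridge al k u / p\<bar>"
        unfolding abs_mult using gb by (intro mult_right_mono) auto
      have 3: "p * \<tau> \<le> (1 + p) * \<tau>" "0 \<le> e * m / p"
        using tau0 e m0 p_pos by (auto intro: mult_right_mono)
      have 4: "p * \<bar>bridge al k u / p\<bar> + p * \<tau> + p * \<bar>bridge al k u / p\<bar>
          = p * \<tau> + 2 * p * (\<bar>bridge al k u\<bar> / p)"
        using p_pos by (simp add: abs_divide)
      show ?thesis
        unfolding z_def[symmetric] if_P[OF True]
        using abs_minus_minus_le[OF 1 2, unfolded 4] by (rule order_trans) (use 3 in simp)
    next
      case False
      then have int: "\<delta> \<le> u $ k" "u $ k \<le> 1 - \<delta>" by (auto simp: bd_def)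
      have xy_int: "\<delta> / 2 \<le> x $ k" "x $ k \<le> 1 - \<delta> / 2" "\<delta> / 2 \<le> y $ k" "y $ k \<le> 1 - \<delta> / 2"
        using xu[of k] yu[of k] int large(1) by linarith+
      define lo where "lo = min (x $ k) (y $ k)"
      define hi where "hi = max (x $ k) (y $ k)"
      obtain c where c: "lo \<le> c" "c \<le> hi"
        "D (vupd z k (x $ k)) - D (vupd z k (y $ k)) = g k (vupd z k c) * (x $ k - y $ k)"
      proof (rule mvt_coord[OF z, of lo hi "x $ k" "y $ k" k])
        show "0 < lo" "hi < 1" using xy_int delta by (auto simp: lo_def hi_def)
      qed (auto simp: lo_def hi_def)
      have cu: "\<bar>c - u $ k\<bar> \<le> M / s" using c(1,2) xu[of k] yu[of k] by (auto simp: lo_def hi_def)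
      have "\<bar>g k (vupd z k c) - g k u\<bar> \<le> e"
      proof (rule UC)
        show "vupd z k c \<in> unitcube" "\<delta> / 2 \<le> vupd z k c $ k" "vupd z k c $ k \<le> 1 - \<delta> / 2"
          using z c(1,2) xy_int delta by (auto simp: unitcube_iff lo_def hi_def min_def max_def split: if_splits)
        show "\<bar>vupd z k c $ j - u $ j\<bar> \<le> \<eta>" for j
          using cu xu[of j] yu[of j] large(2) by (auto simp: z_def)
      qed (use u int delta in auto)
      then have 1: "\<bar>(g k (vupd z k c) - g k u) * (s * (x $ k - y $ k))\<bar> \<le> e * (m / p + \<tau>)"
        unfolding abs_mult[of "g k (vupd z k c) - g k u"] using order_trans[OF sxy add_right_mono[OF bp]] e
        by (intro mult_mono) auto
      have 2: "\<bar>g k u * (s * (x $ k - y $ k) + bridge al k u / p)\<bar> \<le> p * \<tau>"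
        unfolding abs_mult[of "g k u"] using gb xy[of k] p_pos by (intro mult_mono) auto
      have 3: "s * (D (vupd z k (x $ k)) - D (vupd z k (y $ k))) - - (g k u * (bridge al k u / p))
         = (g k (vupd z k c) - g k u) * (s * (x $ k - y $ k)) + g k u * (s * (x $ k - y $ k) + bridge al k u / p)"
        unfolding c(3) by (simp add: algebra_simps)
      have 4: "e * (m / p + \<tau>) + p * \<tau> \<le> e * m / p + (1 + p) * \<tau> + 0"
        using mult_right_mono[OF e(2) tau0] by (simp add: algebra_simps)
      show ?thesis
        unfolding z_def[symmetric] if_not_P[OF False] 3
        by (rule order_trans[OF abs_add2_le[OF 1 2] 4])
    qed
  qed
  have ii: "\<bar>(s * (D x - D y) + (\<Sum>k\<in>UNIV. g k u * bridge al k u / p)) / p\<bar>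
      \<le> d * (e * m / p + (1 + p) * \<tau>) / p + 2 * (\<Sum>k\<in>bd. \<bar>bridge al k u\<bar> / p)"
  proof -
    have "(\<Sum>k\<in>UNIV. e * m / p + (1 + p) * \<tau> + (if k \<in> bd then 2 * p * (\<bar>bridge al k u\<bar> / p) else 0))
       = d * (e * m / p + (1 + p) * \<tau>) + (\<Sum>k\<in>bd. 2 * p * (\<bar>bridge al k u\<bar> / p))"
      by (simp only: sum.distrib sum_constant d_def sum.If_cases[OF finite] sum.neutral_const) (simp add: distrib_left)
    also have "(\<Sum>k\<in>bd. 2 * p * (\<bar>bridge al k u\<bar> / p)) = p * (2 * (\<Sum>k\<in>bd. \<bar>bridge al k u\<bar> / p))"
      by (simp add: sum_distrib_left)
    finally have "\<bar>s * (D x - D y) + (\<Sum>k\<in>UNIV. g k u * bridge al k u / p)\<bar>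
       \<le> d * (e * m / p + (1 + p) * \<tau>) + p * (2 * (\<Sum>k\<in>bd. \<bar>bridge al k u\<bar> / p))"
      using tel by (simp add: sum_negf)
    then have "\<bar>s * (D x - D y) + (\<Sum>k\<in>UNIV. g k u * bridge al k u / p)\<bar> / p
       \<le> (d * (e * m / p + (1 + p) * \<tau>) + p * (2 * (\<Sum>k\<in>bd. \<bar>bridge al k u\<bar> / p))) / p"
      using p_pos by (intro divide_right_mono) auto
    then show ?thesis
      unfolding abs_divide[of _ p] abs_of_pos[OF p_pos] using p_pos by (simp add: add_divide_distrib)
  qed
  have i: "\<bar>al x / P - al u / p\<bar> \<le> 2 / p * (w + p * d * \<epsilon>) + 2 * m\<^sup>2 / p\<^sup>2 / s"
  proof -
    have "al x / P - al u / p = (al x - al u) / P + al u * (1 / P - 1 / p)"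
      by (simp add: algebra_simps diff_divide_distrib)
    moreover have "\<bar>(al x - al u) / P\<bar> \<le> 2 / p * (w + p * d * \<epsilon>)"
    proof -
      have "\<bar>(al x - al u) / P\<bar> \<le> (w + p * d * \<epsilon>) / P"
        using alx P_pos by (simp add: abs_divide divide_right_mono)
      also have "\<dots> \<le> 2 * (w + p * d * \<epsilon>) / p" using w_nn eps p_pos by (intro div_P_le) (simp add: d_def)
      finally show ?thesis by simp
    qed
    moreover have "\<bar>al u * (1 / P - 1 / p)\<bar> \<le> m * (2 * m / p\<^sup>2 / s)"
      unfolding abs_mult using au iP m0 by (intro mult_mono) auto
    moreover have "m * (2 * m / p\<^sup>2 / s) = 2 * m\<^sup>2 / p\<^sup>2 / s" by (simp add: power2_eq_square)
    ultimately show ?thesis by linarith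
  qed
  have iii: "\<bar>D u * al (vec 1) / p\<^sup>2 - D x * al (vec 1) / (p * P)\<bar> \<le> (m / p * (2 * d * M + 2 * m / p)) / s"
  proof -
    have Dxu: "\<bar>D x - D u\<bar> \<le> p * (d * (M / s))"
    proof -
      have "\<bar>D x - D u\<bar> \<le> p * (\<Sum>k\<in>(UNIV::'p set). M / s)"
        using p_pos xu by (intro order_trans[OF D_lip] mult_left_mono sum_mono) auto
      then show ?thesis by (simp add: d_def)
    qed
    have "\<bar>(D x - D u) / P\<bar> = \<bar>D x - D u\<bar> / P" using P_pos by (simp add: abs_divide)
    also have "\<dots> \<le> p * (d * (M / s)) / P" by (rule divide_right_mono[OF Dxu]) (use P_pos in simp)
    also have "\<dots> \<le> 2 * (p * (d * (M / s))) / p" using p_pos M0 s_pos by (intro div_P_le) (simp add: d_def)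
    also have "\<dots> = 2 * d * M / s" using p_pos by simp
    finally have 1: "\<bar>(D x - D u) / P\<bar> \<le> 2 * d * M / s" .
    have 2: "\<bar>D u * (1 / P - 1 / p)\<bar> \<le> p * (2 * m / p\<^sup>2 / s)"
      unfolding abs_mult using D_nonneg D_le iP p_pos by (intro mult_mono) auto
    have 2: "\<bar>D u * (1 / P - 1 / p)\<bar> \<le> 2 * m / p / s"
      using 2 p_pos by (simp add: power2_eq_square)
    have "D u * al (vec 1) / p\<^sup>2 - D x * al (vec 1) / (p * P)
        = - (al (vec 1) / p) * ((D x - D u) / P + D u * (1 / P - 1 / p))"
      by (simp add: algebra_simps diff_divide_distrib add_divide_distrib power2_eq_square)
    then have "\<bar>D u * al (vec 1) / p\<^sup>2 - D x * al (vec 1) / (p * P)\<bar>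
        = \<bar>al (vec 1) / p\<bar> * \<bar>(D x - D u) / P + D u * (1 / P - 1 / p)\<bar>"
      by (simp add: abs_mult)
    also have "\<dots> \<le> m / p * (2 * d * M / s + 2 * m / p / s)"
    proof (rule mult_mono)
      show "\<bar>al (vec 1) / p\<bar> \<le> m / p" using a1 p_pos by (simp add: abs_divide divide_right_mono)
      show "\<bar>(D x - D u) / P + D u * (1 / P - 1 / p)\<bar> \<le> 2 * d * M / s + 2 * m / p / s"
        by (rule abs_add2_le[OF 1 2])
    qed (use m0 p_pos in auto)
    finally show ?thesis by (simp add: algebra_simps add_divide_distrib)
  qed
  \<comment> \<open>Fluctuation at \<open>x\<close>, displacement of \<open>D\<close> and correction
    of the random mass; \<open>i\<close>, \<open>ii\<close> and \<open>iii\<close> match them with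
    the three terms of \<open>Cop\<close>.\<close>
  have "s * (Chat y - D y / p) = s * (En x - D x) / P + s * (D x - D y) / p + D x * (s * (1 / P - 1 / p))"
    unfolding x(2) by (simp add: algebra_simps diff_divide_distrib)
  also have "\<dots> = al x / P + s * (D x - D y) / p - D x * al (vec 1) / (p * P)"
    unfolding inverse_P_diff by (simp add: al_def)
  finally have "s * (Chat y - D y / p) - Cop al u = (al x / P - al u / p)
      + (s * (D x - D y) + (\<Sum>k\<in>UNIV. g k u * bridge al k u / p)) / p
      + (D u * al (vec 1) / p\<^sup>2 - D x * al (vec 1) / (p * P))"
    unfolding Cop_def by (simp add: add_divide_distrib sum_divide_distrib power2_eq_square)
  then show ?thesis
    unfolding w_def[symmetric] d_def[symmetric] bd_def[symmetric]
    by (simp only:) (rule abs_add3_le[OF i ii iii])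
qed

end

context copula_fun
begin

text \<open>Away from the ends of coordinate \<open>k\<close> the domain is compact; the least of
  the finitely many moduli serves all coordinates.\<close>

lemma g_uniform:
  assumes "0 < \<delta>" "0 < e"
  obtains \<eta> where "0 < \<eta>"
    "\<And>k z z'. z \<in> unitcube \<Longrightarrow> z' \<in> unitcube \<Longrightarrow> \<delta> \<le> z $ k \<Longrightarrow> z $ k \<le> 1 - \<delta> \<Longrightarrow>
        \<delta> \<le> z' $ k \<Longrightarrow> z' $ k \<le> 1 - \<delta> \<Longrightarrow> (\<And>j. \<bar>z $ j - z' $ j\<bar> \<le> \<eta>) \<Longrightarrow> \<bar>g k z - g k z'\<bar> \<le> e"
proof -
  define T where "T k = {z \<in> unitcube. \<delta> \<le> z $ k \<and> z $ k \<le> 1 - \<delta>}" for k :: 'p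
  have comp: "compact (T k)" for k
  proof -
    have "T k = unitcube \<inter> ({z. \<delta> \<le> z $ k} \<inter> {z. z $ k \<le> 1 - \<delta>})" by (auto simp: T_def)
    then show ?thesis
      by (auto intro!: compact_Int_closed closed_Int closed_Collect_le continuous_intros)
  qed
  have "uniformly_continuous_on (T k) (g k)" for k
  proof (rule compact_uniformly_continuous[OF _ comp])
    show "continuous_on (T k) (g k)"
      by (rule continuous_on_subset[OF g_cont]) (use assms in \<open>auto simp: T_def\<close>)
  qed
  then have "\<forall>k. \<exists>d>0. \<forall>z\<in>T k. \<forall>z'\<in>T k. dist z' z < d \<longrightarrow> dist (g k z') (g k z) < e"
    using assms by (simp add: uniformly_continuous_on_def)
  then obtain d where d: "\<And>k. 0 < d k"
    "\<And>k z z'. z \<in> T k \<Longrightarrow> z' \<in> T k \<Longrightarrow> dist z' z < d k \<Longrightarrow> dist (g k z') (g k z) < e"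
    by metis
  define m where "m = Min (range d)"
  have m: "0 < m" "\<And>k. m \<le> d k" using d(1) by (auto simp: m_def)
  show thesis
  proof (rule that[of "m / (2 * real CARD('p))"])
    show "0 < m / (2 * real CARD('p))" using m by simp
    fix k and z z' :: "real^'p"
    assume *: "z \<in> unitcube" "z' \<in> unitcube" "\<delta> \<le> z $ k" "z $ k \<le> 1 - \<delta>"
      "\<delta> \<le> z' $ k" "z' $ k \<le> 1 - \<delta>" "\<And>j. \<bar>z $ j - z' $ j\<bar> \<le> m / (2 * real CARD('p))"
    have "dist z z' \<le> (\<Sum>j\<in>UNIV. \<bar>(z - z') $ j\<bar>)" unfolding dist_norm by (rule norm_le_l1_cart)
    also have "\<dots> \<le> (\<Sum>j\<in>(UNIV::'p set). m / (2 * real CARD('p)))"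
      by (rule sum_mono) (use *(7) in simp)
    also have "\<dots> < d k" using m(1) m(2)[of k] by simp
    finally have "dist (g k z) (g k z') < e" using * by (intro d(2)) (auto simp: T_def)
    then show "\<bar>g k z - g k z'\<bar> \<le> e" by (simp add: dist_real_def)
  qed
qed

text \<open>The order of the quantifiers matters: \<open>c1\<close> depends on \<epsilon> alone, so
  that \<delta> can be chosen afterwards to make the boundary term small in mean. Paths that are
  large or oscillate strongly are absorbed by the quadratic terms.\<close>

lemma linearisation:
  assumes "0 < \<epsilon>"
  obtains c1 where "0 \<le> c1" "\<forall>\<delta>>0. \<exists>Gr C n0. finite Gr \<and> 0 \<le> C \<and>
     (\<forall>n a U L u y. n0 \<le> n \<longrightarrow> sample D p g n a U \<longrightarrow> u \<in> unitcube \<longrightarrow>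
        y = vmix L (\<chi> k. sample.Fn a U k (u $ k)) u \<longrightarrow>
        \<bar>sqrt (real n) * (sample.Chat a U y - D y / p) - Cop (sample.al D n a U) u\<bar>
        \<le> \<epsilon> * (1 + (w0f (sample.al D n a U) u)\<^sup>2) + C * (w1f (sqrt (real n)) Gr (sample.al D n a U) u)\<^sup>2
          + c1 * (\<Sum>k | u $ k < \<delta> \<or> 1 - \<delta> < u $ k. (bridge (sample.al D n a U) k u)\<^sup>2))"
proof -
  define d where "d = real CARD('p)"
  have d1: "1 \<le> d" by (simp add: d_def Suc_le_eq)
  define \<epsilon>1 where "\<epsilon>1 = \<epsilon> / (3 + d)"
  have e1: "0 < \<epsilon>1" "(3 + d) * \<epsilon>1 = \<epsilon>" using assms d1 by (auto simp: \<epsilon>1_def)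
  define CC where "CC = (5 * d + 6) / p"
  have CC: "0 < CC" using d1 p_pos by (simp add: CC_def)
  \<comment> \<open>Beyond this size the linear bound \<open>CC * (1 + w0)\<close> falls below the
    quadratic \<open>\<epsilon>1 * (1 + w0\<^sup>2)\<close>.\<close>
  define m where "m = 2 * CC / \<epsilon>1"
  have m0: "0 < m" using CC e1 by (simp add: m_def)
  define e where "e = min 1 (\<epsilon>1 * p\<^sup>2 / (2 * d * m))"
  have e: "0 < e" "e \<le> 1" "d * (e * m / p) / p \<le> \<epsilon>1 / 2"
  proof -
    show "0 < e" "e \<le> 1" using e1 p_pos d1 m0 by (auto simp: e_def)
    have "e \<le> \<epsilon>1 * p\<^sup>2 / (2 * d * m)" by (simp add: e_def)
    then show "d * (e * m / p) / p \<le> \<epsilon>1 / 2"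
      using d1 m0 p_pos by (simp add: field_simps power2_eq_square)
  qed
  \<comment> \<open>Collects the factors with which the lattice mesh \<open>h\<close> enters the
    bound of \<open>good\<close>.\<close>
  define q where "q = 2 * d + d * (1 + p) * d / p"
  define h where "h = \<epsilon>1 / 2 / q"
  have "0 < q" using d1 p_pos by (simp add: q_def add_pos_nonneg)
  then have h: "0 < h" "(2 * d + d * (1 + p) * d / p) * h = \<epsilon>1 / 2"
    unfolding q_def[symmetric] using e1 by (auto simp: h_def)
  define J where "J = \<lceil>(2 * m + 4) / (p * h)\<rceil>"
  define M where "M = of_int J * h"
  have M: "(2 * m + 4) / p \<le> M"
  proof -
    have "(2 * m + 4) / (p * h) \<le> of_int J" by (simp add: J_def)
    then have "(2 * m + 4) / (p * h) * h \<le> of_int J * h" using h by (intro mult_right_mono) auto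
    then show ?thesis using h by (simp add: M_def)
  qed
  have M0: "0 < M" using M m0 p_pos by (smt (verit) divide_pos_pos)
  \<comment> \<open>\<open>B\<close> collects the terms of \<open>good\<close> that are divided by
    \<open>s\<close>, and \<open>Ca\<close> below the factors of the oscillation.\<close>
  define B where "B = 2 * m\<^sup>2 / p\<^sup>2 + d * (1 + p) * (1 / p + 2 * m\<^sup>2 / p\<^sup>2) / p + m / p * (2 * d * M + 2 * m / p)"
  have B: "0 \<le> B" using d1 p_pos m0 M0 by (simp add: B_def)
  define Ca where "Ca = 2 / p + d * (1 + p) / p / p"
  have Ca: "0 \<le> Ca" using d1 p_pos by (simp add: Ca_def)
  define Gr where "Gr = (offset_grid J h :: (real^'p) set)"
  define C where "C = CC * (1 + m) + Ca\<^sup>2 / \<epsilon>1"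
  have C0: "0 \<le> C" using CC m0 e1 by (simp add: C_def)
  show thesis
  proof (rule that[of "1 / (\<epsilon>1 * p\<^sup>2)"], rule_tac [2] allI, rule_tac [2] impI)
    show "0 \<le> 1 / (\<epsilon>1 * p\<^sup>2)" using e1 by simp
    fix \<delta> :: real assume \<delta>: "0 < \<delta>"
    obtain \<eta> where eta: "0 < \<eta>"
      "\<And>k z z'. z \<in> unitcube \<Longrightarrow> z' \<in> unitcube \<Longrightarrow> \<delta> / 2 \<le> z $ k \<Longrightarrow> z $ k \<le> 1 - \<delta> / 2 \<Longrightarrow>
        \<delta> / 2 \<le> z' $ k \<Longrightarrow> z' $ k \<le> 1 - \<delta> / 2 \<Longrightarrow> (\<And>j. \<bar>z $ j - z' $ j\<bar> \<le> \<eta>) \<Longrightarrow> \<bar>g k z - g k z'\<bar> \<le> e"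
      using g_uniform[of "\<delta> / 2" e] \<delta> e by (metis half_gt_zero)
    \<comment> \<open>Three lower bounds for sqrt n: the displacement \<open>M / s\<close> must keep
      within the slab and within the modulus of \<open>g\<close>, and the remainder
      \<open>B / s\<close> below \<open>\<epsilon>1\<close>.\<close>
    define X where "X = max (M / (\<delta> / 2)) (max (M / \<eta>) (B / \<epsilon>1))"
    define n0 where "n0 = nat \<lceil>X\<^sup>2\<rceil>"
    show "\<exists>Gr C n0. finite Gr \<and> 0 \<le> C \<and>
     (\<forall>n a U L u y. n0 \<le> n \<longrightarrow> sample D p g n a U \<longrightarrow> u \<in> unitcube \<longrightarrow>
        y = vmix L (\<chi> k. sample.Fn a U k (u $ k)) u \<longrightarrow>
        \<bar>sqrt (real n) * (sample.Chat a U y - D y / p) - Cop (sample.al D n a U) u\<bar>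
        \<le> \<epsilon> * (1 + (w0f (sample.al D n a U) u)\<^sup>2) + C * (w1f (sqrt (real n)) Gr (sample.al D n a U) u)\<^sup>2
          + 1 / (\<epsilon>1 * p\<^sup>2) * (\<Sum>k | u $ k < \<delta> \<or> 1 - \<delta> < u $ k. (bridge (sample.al D n a U) k u)\<^sup>2))"
    proof (intro exI[of _ Gr] exI[of _ C] exI[of _ n0] conjI allI impI)
      show "finite Gr" unfolding Gr_def by (rule finite_offset_grid)
      show "0 \<le> C" by (rule C0)
      fix n a U L u y
      assume n: "n0 \<le> n" and S: "sample D p g n a U" and u: "u \<in> unitcube"
        and y: "y = vmix L (\<chi> k. sample.Fn a U k (u $ k)) u"
      interpret sample D p g n a U by (rule S)
      have Xs: "X \<le> s"
      proof -
        have "X\<^sup>2 \<le> real n" using n unfolding n0_def by linarith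
        then show ?thesis by (rule real_le_rsqrt)
      qed
      have lg: "M / s \<le> \<delta> / 2" "M / s \<le> \<eta>" "B / s \<le> \<epsilon>1"
      proof -
        have "M / (\<delta> / 2) \<le> s" "M / \<eta> \<le> s" "B / \<epsilon>1 \<le> s" using Xs by (auto simp: X_def)
        then show "M / s \<le> \<delta> / 2" "M / s \<le> \<eta>" "B / s \<le> \<epsilon>1"
          using s_pos \<delta> eta(1) e1(1) by (simp_all add: pos_divide_le_eq mult.commute)
      qed
      define w0 where "w0 = w0f al u"
      define w1 where "w1 = w1f s Gr al u"
      define bd where "bd = {k. u $ k < \<delta> \<or> 1 - \<delta> < u $ k}"
      define R where "R = s * (Chat y - D y / p) - Cop al u"
      define Sb where "Sb = 1 / (\<epsilon>1 * p\<^sup>2) * (\<Sum>k\<in>bd. (bridge al k u)\<^sup>2)"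
      have Sb0: "0 \<le> Sb" using e1 by (simp add: Sb_def sum_nonneg)
      have w0_nn: "0 \<le> w0" by (simp add: w0_def w0f_nonneg)
      have e10: "0 \<le> \<epsilon>1" using e1 by simp
      have Rc: "\<bar>R\<bar> \<le> CC * (1 + w0)"
      proof -
        have "\<bar>R\<bar> \<le> (4 * d + 4) * (1 + w0) / p + (2 + d) * w0 / p"
          using crude[OF u y] Cop_bound[OF u, of al] unfolding R_def w0_def d_def by linarith
        also have "\<dots> = ((4 * d + 4) * (1 + w0) + (2 + d) * w0) / p" by (simp add: add_divide_distrib)
        also have "\<dots> \<le> ((5 * d + 6) * (1 + w0)) / p"
          using p_pos w0_nn d1 by (intro divide_right_mono) (auto simp: algebra_simps)
        finally show ?thesis by (simp add: CC_def)
      qed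
      have eps_ge: "c * \<epsilon>1 \<le> \<epsilon>" if "c \<le> 3 + d" for c
        using mult_right_mono[OF that e10] e1(2) by simp
      have main: "\<bar>R\<bar> \<le> \<epsilon> * (1 + w0\<^sup>2) + C * w1\<^sup>2 + Sb"
      proof (cases "w0 \<le> m")
        case False
        have "CC * (1 + w0) \<le> CC * (1 + w0) * (w0 / m)"
          using False CC w0_nn m0 by (simp add: mult_le_cancel_left1 pos_le_divide_eq)
        also have "\<dots> = \<epsilon>1 * ((1 + w0) * w0 / 2)"
          using CC e1 by (simp add: m_def field_simps)
        also have "\<dots> \<le> \<epsilon>1 * (1 + w0\<^sup>2)"
        proof (rule mult_left_mono[OF _ e10])
          have "0 \<le> (w0 - 1)\<^sup>2" by simp
          then have "w0 \<le> 1 + w0\<^sup>2" by (simp add: power2_diff) (smt (verit) w0_nn)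
          then show "(1 + w0) * w0 / 2 \<le> 1 + w0\<^sup>2" by (simp add: algebra_simps power2_eq_square)
        qed
        also have "\<dots> \<le> \<epsilon> * (1 + w0\<^sup>2)" using eps_ge[of 1] d1 by (intro mult_right_mono) auto
        also have "\<dots> \<le> \<epsilon> * (1 + w0\<^sup>2) + C * w1\<^sup>2 + Sb" using C0 Sb0 by simp
        finally show ?thesis using Rc by linarith
      next
        case w0m: True
        show ?thesis
        proof (cases "w1 \<le> 1")
          case False
          have "CC * (1 + w0) \<le> CC * (1 + m)" using w0m CC by (intro mult_left_mono) auto
          also have "\<dots> \<le> C * 1" using e1 by (simp add: C_def)
          also have "\<dots> \<le> C * w1\<^sup>2" using C0 False by (intro mult_left_mono) (auto simp: one_le_power)
          also have "\<dots> \<le> \<epsilon> * (1 + w0\<^sup>2) + C * w1\<^sup>2 + Sb" using assms Sb0 by simp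
          finally show ?thesis using Rc by linarith
        next
          case True
          define \<tau> where "\<tau> = w1 / p + d * h + (1 / p + 2 * m\<^sup>2 / p\<^sup>2) / s"
          have "\<bar>R\<bar> \<le> 2 / p * (w1 + p * d * h) + 2 * m\<^sup>2 / p\<^sup>2 / s
             + (d * (e * m / p + (1 + p) * \<tau>) / p + 2 * (\<Sum>k\<in>bd. \<bar>bridge al k u\<bar> / p))
             + (m / p * (2 * d * M + 2 * m / p)) / s"
            unfolding R_def w1_def Gr_def d_def bd_def
          proof (rule good[OF u y])
            show "w0f al u \<le> m" using w0m by (simp add: w0_def)
            show "w1f s (offset_grid J h) al u \<le> 1" using True by (simp add: w1_def Gr_def)
            show "\<tau> = w1f s (offset_grid J h) al u / p + real CARD('p) * h + (1 / p + 2 * m\<^sup>2 / p\<^sup>2) / s"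
              by (simp add: \<tau>_def w1_def Gr_def d_def)
          qed (use h M_def M \<delta> lg e eta in auto)
          also have "\<dots> = Ca * w1 + (2 * d + d * (1 + p) * d / p) * h + d * (e * m / p) / p + B / s
              + (\<Sum>k\<in>bd. 2 * (\<bar>bridge al k u\<bar> / p))"
            unfolding \<tau>_def Ca_def B_def sum_distrib_left using p_pos s_pos
            by (simp add: field_simps)
          also have "\<dots> \<le> (\<epsilon>1 + Ca\<^sup>2 / \<epsilon>1 * w1\<^sup>2) + \<epsilon>1 / 2 + \<epsilon>1 / 2 + \<epsilon>1 + (d * \<epsilon>1 + Sb)"
          proof (intro add_mono)
            \<comment> \<open>Completing the square turns the terms linear in the oscillation, and
              below those linear in the bridges, into squares, whose means can be computed.\<close>
            have "0 \<le> (\<epsilon>1 - Ca * w1)\<^sup>2" by simp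
            then have "2 * \<epsilon>1 * (Ca * w1) \<le> \<epsilon>1\<^sup>2 + (Ca * w1)\<^sup>2" by (simp add: power2_diff)
            moreover have "0 \<le> \<epsilon>1 * (Ca * w1)"
              using e10 Ca w1f_nonneg[of s Gr al u] unfolding w1_def by (intro mult_nonneg_nonneg)
            ultimately have "\<epsilon>1 * (Ca * w1) \<le> \<epsilon>1\<^sup>2 + (Ca * w1)\<^sup>2" by linarith
            then show "Ca * w1 \<le> \<epsilon>1 + Ca\<^sup>2 / \<epsilon>1 * w1\<^sup>2"
              using e1(1) by (simp add: field_simps power2_eq_square)
            have each: "2 * (\<bar>bridge al k u\<bar> / p) \<le> \<epsilon>1 + 1 / (\<epsilon>1 * p\<^sup>2) * (bridge al k u)\<^sup>2" for k
            proof -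
              define b where "b = \<bar>bridge al k u\<bar> / p"
              have "0 \<le> (\<epsilon>1 - b)\<^sup>2" by simp
              then have "2 * b * \<epsilon>1 \<le> \<epsilon>1 * \<epsilon>1 + b\<^sup>2" by (simp add: power2_eq_square algebra_simps)
              then have "2 * b \<le> \<epsilon>1 + b\<^sup>2 / \<epsilon>1"
                using e1(1) by (simp add: field_simps)
              moreover have "b\<^sup>2 / \<epsilon>1 = 1 / (\<epsilon>1 * p\<^sup>2) * (bridge al k u)\<^sup>2"
                by (simp add: b_def power_divide)
              ultimately show ?thesis by (simp add: b_def)
            qed
            have "(\<Sum>k\<in>bd. 2 * (\<bar>bridge al k u\<bar> / p)) \<le> (\<Sum>k\<in>bd. \<epsilon>1 + 1 / (\<epsilon>1 * p\<^sup>2) * (bridge al k u)\<^sup>2)"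
              by (rule sum_mono) (rule each)
            also have "\<dots> = real (card bd) * \<epsilon>1 + Sb"
              by (simp add: sum.distrib Sb_def sum_distrib_left)
            also have "\<dots> \<le> d * \<epsilon>1 + Sb"
              using e10 card_mono[of UNIV bd] by (intro add_right_mono mult_right_mono) (auto simp: d_def)
            finally show "(\<Sum>k\<in>bd. 2 * (\<bar>bridge al k u\<bar> / p)) \<le> d * \<epsilon>1 + Sb" .
          qed (use h e lg in auto)
          also have "\<dots> = (3 + d) * \<epsilon>1 + Ca\<^sup>2 / \<epsilon>1 * w1\<^sup>2 + Sb" by (simp add: algebra_simps)
          also have "\<dots> \<le> \<epsilon> * (1 + w0\<^sup>2) + C * w1\<^sup>2 + Sb"
            using e1(2) assms CC m0 by (intro add_mono mult_right_mono) (auto simp: C_def algebra_simps)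
          finally show ?thesis .
        qed
      qed
      then show "\<bar>s * (Chat y - D y / p) - Cop al u\<bar>
        \<le> \<epsilon> * (1 + (w0f al u)\<^sup>2) + C * (w1f s Gr al u)\<^sup>2
          + 1 / (\<epsilon>1 * p\<^sup>2) * (\<Sum>k | u $ k < \<delta> \<or> 1 - \<delta> < u $ k. (bridge al k u)\<^sup>2)"
        by (simp only: R_def w0_def w1_def Sb_def bd_def)
    qed
  qed
qed

end

section \<open>Grids, quasi-volumes and Riemann--Stieltjes integrals\<close>

lemma finite_vec_box:
  assumes "\<And>j. finite (S j)"
  shows "finite {v :: real^'p::finite. \<forall>j. v $ j \<in> S j}"
proof (rule finite_subset)
  show "{v :: real^'p. \<forall>j. v $ j \<in> S j} \<subseteq> (\<lambda>f. \<chi> j. f j) ` (Pi\<^sub>E UNIV S)"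
  proof
    fix v :: "real^'p" assume "v \<in> {v. \<forall>j. v $ j \<in> S j}"
    then have "v = (\<chi> j. (\<lambda>j. v $ j) j)" "(\<lambda>j. v $ j) \<in> Pi\<^sub>E UNIV S" by auto
    then show "v \<in> (\<lambda>f. \<chi> j. f j) ` (Pi\<^sub>E UNIV S)" by blast
  qed
  show "finite ((\<lambda>f. \<chi> j. f j :: real^'p) ` (Pi\<^sub>E UNIV S))"
    using assms by (intro finite_imageI finite_PiE) auto
qed

section \<open>Cells of product grids and additivity of quasi-volumes\<close>

definition steps :: "real set \<Rightarrow> (real \<times> real) set" where
  "steps F = {(s, t). s \<in> F \<and> t \<in> F \<and> s < t \<and> {s<..<t} \<inter> F = {}}"

lemma finite_steps: "finite F \<Longrightarrow> finite (steps F)"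
  by (rule finite_subset[of _ "F \<times> F"]) (auto simp: steps_def)

text \<open>Induction on the number of grid points in [a, b): the step that ends at \<open>b\<close>
  starts at the last of them, \<open>m\<close>, and all other steps below \<open>b\<close> lie below
  \<open>m\<close>.\<close>

lemma steps_telescope:
  fixes \<phi> :: "real \<Rightarrow> real"
  assumes "finite F" "a \<in> F" "b \<in> F" "a \<le> b"
  shows "(\<Sum>(s, t)\<in>steps F. if a \<le> s \<and> t \<le> b then \<phi> t - \<phi> s else 0) = \<phi> b - \<phi> a"
  using assms(3,4)
proof (induction "card (F \<inter> {a..<b})" arbitrary: b rule: less_induct)
  case less
  have fin: "finite (steps F)" by (rule finite_steps[OF assms(1)])
  show ?case
  proof (cases "a = b")
    case True
    have "(\<Sum>(s, t)\<in>steps F. if a \<le> s \<and> t \<le> b then \<phi> t - \<phi> s else 0) = (\<Sum>(s, t)\<in>steps F. 0)"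
      using True by (intro sum.cong) (auto simp: steps_def)
    then show ?thesis using True by simp
  next
    case False
    define m where "m = Max (F \<inter> {a..<b})"
    have ne: "finite (F \<inter> {a..<b})" "F \<inter> {a..<b} \<noteq> {}"
      using assms(1,2) False less(3) by auto
    have m: "m \<in> F" "a \<le> m" "m < b" using Max_in[OF ne] by (auto simp: m_def)
    have m_max: "x \<le> m" if "x \<in> F" "a \<le> x" "x < b" for x
      using that ne by (auto simp: m_def)
    have mb: "(m, b) \<in> steps F"
      using m less(2) m_max by (auto simp: steps_def) (metis less_le_trans not_less order_less_imp_le)
    have "F \<inter> {a..<m} \<subset> F \<inter> {a..<b}" using m by auto
    then have "card (F \<inter> {a..<m}) < card (F \<inter> {a..<b})" using ne by (intro psubset_card_mono)
    note IH = less(1)[OF this m(1,2)]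
    have iff: "a \<le> s \<and> t \<le> b \<longleftrightarrow> (s, t) = (m, b) \<or> a \<le> s \<and> t \<le> m" if "(s, t) \<in> steps F" for s t
    proof
      assume st: "a \<le> s \<and> t \<le> b"
      show "(s, t) = (m, b) \<or> a \<le> s \<and> t \<le> m"
      proof (cases "t = b")
        case True
        have "s \<le> m" using that st True by (intro m_max) (auto simp: steps_def)
        moreover have "\<not> s < m" using that m True by (auto simp: steps_def)
        ultimately show ?thesis using True by simp
      next
        case False
        then have "t \<le> m" using that st by (intro m_max) (auto simp: steps_def)
        then show ?thesis using st by simp
      qed
    next
      assume "(s, t) = (m, b) \<or> a \<le> s \<and> t \<le> m"
      then show "a \<le> s \<and> t \<le> b" using m by auto
    qed
    have "(\<Sum>(s, t)\<in>steps F. if a \<le> s \<and> t \<le> b then \<phi> t - \<phi> s else 0)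
        = (\<Sum>st\<in>steps F. (if st = (m, b) then \<phi> b - \<phi> m else 0)
            + (case st of (s, t) \<Rightarrow> if a \<le> s \<and> t \<le> m then \<phi> t - \<phi> s else 0))"
    proof (rule sum.cong[OF refl])
      fix st assume st: "st \<in> steps F"
      obtain s t where [simp]: "st = (s, t)" by (cases st)
      show "(case st of (s, t) \<Rightarrow> if a \<le> s \<and> t \<le> b then \<phi> t - \<phi> s else 0) = (if st = (m, b) then \<phi> b - \<phi> m else 0)
            + (case st of (s, t) \<Rightarrow> if a \<le> s \<and> t \<le> m then \<phi> t - \<phi> s else 0)"
        using iff[of s t] st m by auto
    qed
    also have "\<dots> = (\<phi> b - \<phi> m) + (\<phi> m - \<phi> a)"
      unfolding sum.distrib IH using fin mb by simp
    finally show ?thesis by simp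
  qed
qed

lemma finite_grid_cells:
  assumes "\<And>j. j \<in> J \<Longrightarrow> finite (g j)"
  shows "finite (grid_cells J g)"
proof (rule finite_subset)
  define V where "V = {v :: real^'a. \<forall>j. v $ j \<in> (if j \<in> J then g j else {1})}"
  show "grid_cells J g \<subseteq> V \<times> V" by (auto simp: grid_cells_def V_def)
  show "finite (V \<times> V)" unfolding V_def
    by (intro finite_cartesian_product finite_vec_box) (use assms in auto)
qed

text \<open>A cell of the larger face is a cell of the smaller one together with a step in direction
  \<open>j\<close>. Cells carry 1 outside their face, so the projection resets coordinate
  \<open>j\<close> to 1.\<close>

lemma sum_grid_cells_insert:
  assumes "j \<notin> J"
  shows "(\<Sum>c\<in>grid_cells (insert j J) g. F c) =
    (\<Sum>(s, t)\<in>steps (g j). \<Sum>c\<in>grid_cells J g. F (vupd (fst c) j s, vupd (snd c) j t))"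
proof -
  have "(\<Sum>c\<in>grid_cells (insert j J) g. F c) =
     (\<Sum>(st, c)\<in>steps (g j) \<times> grid_cells J g. F (vupd (fst c) j (fst st), vupd (snd c) j (snd st)))"
  proof (rule sum.reindex_bij_witness[symmetric,
      where i = "\<lambda>c. ((fst c $ j, snd c $ j), (vupd (fst c) j 1, vupd (snd c) j 1))"
        and j = "\<lambda>(st, c). (vupd (fst c) j (fst st), vupd (snd c) j (snd st))"])
    fix x assume "x \<in> steps (g j) \<times> grid_cells J g"
    then obtain s t a b where x: "x = ((s, t), (a, b))" "(s, t) \<in> steps (g j)" "(a, b) \<in> grid_cells J g"
      by auto
    have a1: "vupd (vupd a j s) j 1 = a" "vupd (vupd b j t) j 1 = b"
      using x(3) assms by (auto simp: vec_eq_iff grid_cells_def)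
    then show "(\<lambda>c. ((fst c $ j, snd c $ j), vupd (fst c) j 1, vupd (snd c) j 1))
        ((\<lambda>(st, c). (vupd (fst c) j (fst st), vupd (snd c) j (snd st))) x) = x"
      by (simp add: x(1))
    show "(\<lambda>(st, c). (vupd (fst c) j (fst st), vupd (snd c) j (snd st))) x \<in> grid_cells (insert j J) g"
      using x(2,3) assms by (auto simp: x(1) grid_cells_def steps_def)
    show "F ((\<lambda>(st, c). (vupd (fst c) j (fst st), vupd (snd c) j (snd st))) x)
        = (case x of (st, c) \<Rightarrow> F (vupd (fst c) j (fst st), vupd (snd c) j (snd st)))"
      by (simp add: x(1))
  next
    fix c assume c: "c \<in> grid_cells (insert j J) g"
    show "(\<lambda>(st, c). (vupd (fst c) j (fst st), vupd (snd c) j (snd st)))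
        ((\<lambda>c. ((fst c $ j, snd c $ j), vupd (fst c) j 1, vupd (snd c) j 1)) c) = c"
      by (cases c) (simp add: vec_eq_iff)
    show "((fst c $ j, snd c $ j), vupd (fst c) j 1, vupd (snd c) j 1) \<in> steps (g j) \<times> grid_cells J g"
      using c assms by (auto simp: grid_cells_def steps_def) (metis disjoint_iff greaterThanLessThan_iff)
  qed
  then show ?thesis by (simp add: sum.cartesian_product split_def)
qed

text \<open>Splitting the subsets by membership of \<open>j\<close> exhibits a quasi-volume as a
  difference, in direction \<open>j\<close>, of quasi-volumes of one dimension less.\<close>

lemma qvol_insert:
  assumes "finite J" "j \<notin> J"
  shows "qvol (insert j J) f a b = qvol J (\<lambda>x. f (vupd x j (b $ j))) a b - qvol J (\<lambda>x. f (vupd x j (a $ j))) a b"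
proof -
  have inj: "inj_on (insert j) (Pow J)" using assms by (auto simp: inj_on_def)
  have "qvol (insert j J) f a b = (\<Sum>S\<in>Pow J. (-1) ^ card S * f (vmix S a b))
      + (\<Sum>S\<in>Pow J. (-1) ^ card (insert j S) * f (vmix (insert j S) a b))"
    unfolding qvol_def Pow_insert using assms
    by (subst sum.union_disjoint) (auto simp: sum.reindex[OF inj])
  also have "(\<Sum>S\<in>Pow J. (-1) ^ card S * f (vmix S a b)) = qvol J (\<lambda>x. f (vupd x j (b $ j))) a b"
    unfolding qvol_def
  proof (rule sum.cong[OF refl])
    fix S assume "S \<in> Pow J"
    then have "vupd (vmix S a b) j (b $ j) = vmix S a b" using assms by (auto simp: vec_eq_iff)
    then show "(-1) ^ card S * f (vmix S a b) = (-1) ^ card S * f (vupd (vmix S a b) j (b $ j))" by simp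
  qed
  also have "(\<Sum>S\<in>Pow J. (-1) ^ card (insert j S) * f (vmix (insert j S) a b)) = - qvol J (\<lambda>x. f (vupd x j (a $ j))) a b"
    unfolding qvol_def sum_negf[symmetric]
  proof (rule sum.cong[OF refl])
    fix S assume S: "S \<in> Pow J"
    then have "vupd (vmix S a b) j (a $ j) = vmix (insert j S) a b" by (auto simp: vec_eq_iff)
    moreover have "card (insert j S) = Suc (card S)" using S assms finite_subset by (subst card_insert_disjoint) auto
    ultimately show "(-1) ^ card (insert j S) * f (vmix (insert j S) a b)
        = - ((-1) ^ card S * f (vupd (vmix S a b) j (a $ j)))" by simp
  qed
  finally show ?thesis by simp
qed

lemma qvol_vupd:
  assumes "j \<notin> J"
  shows "qvol J (\<lambda>x. f (vupd x j r)) (vupd a j s) (vupd b j t) = qvol J (\<lambda>x. f (vupd x j r)) a b"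
proof -
  have "vupd (vmix S (vupd a j s) (vupd b j t)) j r = vupd (vmix S a b) j r" for S
    by (auto simp: vec_eq_iff)
  then show ?thesis by (simp add: qvol_def)
qed

text \<open>Induction on the face, telescoping in the new direction. Outside \<open>J\<close> a
  quasi-volume reads \<open>f\<close> at the coordinates of the upper corner, which are 1 for a
  cell; hence the second assumption.\<close>

lemma qvol_additive:
  fixes f :: "real^'p::finite \<Rightarrow> real"
  assumes "\<And>j. j \<in> J \<Longrightarrow> finite (g j) \<and> a $ j \<in> g j \<and> b $ j \<in> g j \<and> a $ j \<le> b $ j"
    and "\<And>j. j \<notin> J \<Longrightarrow> b $ j = 1"
  shows "(\<Sum>c\<in>grid_cells J g. if \<forall>j\<in>J. a $ j \<le> fst c $ j \<and> snd c $ j \<le> b $ j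
      then qvol J f (fst c) (snd c) else 0) = qvol J f a b"
proof -
  have "finite J" by simp
  then show ?thesis using assms
  proof (induction J arbitrary: f b rule: finite_induct)
    case empty
    have "grid_cells {} g = {(vec 1, vec 1)}" by (auto simp: grid_cells_def vec_eq_iff)
    moreover have "b = vec 1" using empty by (simp add: vec_eq_iff)
    moreover have "onK {} x = vec 1" for x :: "real^'p" by (simp add: vec_eq_iff)
    ultimately show ?case by (simp add: qvol_def)
  next
    case (insert j J)
    \<comment> \<open>The induction hypothesis wants 1 in direction \<open>j\<close>, which lies
      outside the smaller face; by \<open>qvol_vupd\<close> this coordinate is never read.\<close>
    define b' where "b' = vupd b j 1"
    have b'J: "\<And>i. i \<in> J \<Longrightarrow> b' $ i = b $ i" using insert(2) by (auto simp: b'_def)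
    define \<Phi> where "\<Phi> t = qvol J (\<lambda>x. f (vupd x j t)) a b" for t
    have qb: "qvol J (\<lambda>x. f (vupd x j t)) a b' = \<Phi> t" for t
      using qvol_vupd[OF insert(2), of f t a "a $ j" b 1] by (simp add: b'_def \<Phi>_def)
    have IH: "(\<Sum>c\<in>grid_cells J g. if \<forall>i\<in>J. a $ i \<le> fst c $ i \<and> snd c $ i \<le> b $ i
      then qvol J (\<lambda>x. f (vupd x j t)) (fst c) (snd c) else 0) = \<Phi> t" for t
    proof -
      have "(\<Sum>c\<in>grid_cells J g. if \<forall>i\<in>J. a $ i \<le> fst c $ i \<and> snd c $ i \<le> b' $ i
        then qvol J (\<lambda>x. f (vupd x j t)) (fst c) (snd c) else 0) = qvol J (\<lambda>x. f (vupd x j t)) a b'"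
        by (rule insert(3)) (use insert(4,5) b'J in \<open>auto simp: b'_def\<close>)
      then show ?thesis using b'J by (simp add: qb)
    qed
    have "(\<Sum>c\<in>grid_cells (insert j J) g. if \<forall>i\<in>insert j J. a $ i \<le> fst c $ i \<and> snd c $ i \<le> b $ i
        then qvol (insert j J) f (fst c) (snd c) else 0)
      = (\<Sum>(s, t)\<in>steps (g j). \<Sum>c\<in>grid_cells J g. if a $ j \<le> s \<and> t \<le> b $ j then
          (if \<forall>i\<in>J. a $ i \<le> fst c $ i \<and> snd c $ i \<le> b $ i then qvol J (\<lambda>x. f (vupd x j t)) (fst c) (snd c) else 0)
          - (if \<forall>i\<in>J. a $ i \<le> fst c $ i \<and> snd c $ i \<le> b $ i then qvol J (\<lambda>x. f (vupd x j s)) (fst c) (snd c) else 0)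
         else 0)"
      unfolding sum_grid_cells_insert[OF insert(2)]
    proof (intro sum.cong refl, clarify, intro sum.cong refl)
      fix s t c
      have "(\<forall>i\<in>insert j J. a $ i \<le> vupd (fst c) j s $ i \<and> vupd (snd c) j t $ i \<le> b $ i) \<longleftrightarrow>
         a $ j \<le> s \<and> t \<le> b $ j \<and> (\<forall>i\<in>J. a $ i \<le> fst c $ i \<and> snd c $ i \<le> b $ i)"
        using insert(2) by auto
      then show "(if \<forall>i\<in>insert j J. a $ i \<le> fst (vupd (fst c) j s, vupd (snd c) j t) $ i \<and> snd (vupd (fst c) j s, vupd (snd c) j t) $ i \<le> b $ i
        then qvol (insert j J) f (fst (vupd (fst c) j s, vupd (snd c) j t)) (snd (vupd (fst c) j s, vupd (snd c) j t)) else 0)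
        = (if a $ j \<le> s \<and> t \<le> b $ j then
          (if \<forall>i\<in>J. a $ i \<le> fst c $ i \<and> snd c $ i \<le> b $ i then qvol J (\<lambda>x. f (vupd x j t)) (fst c) (snd c) else 0)
          - (if \<forall>i\<in>J. a $ i \<le> fst c $ i \<and> snd c $ i \<le> b $ i then qvol J (\<lambda>x. f (vupd x j s)) (fst c) (snd c) else 0)
         else 0)"
        by (simp only: fst_conv snd_conv qvol_insert[OF insert(1,2)] vupd_nth qvol_vupd[OF insert(2)] if_True refl) simp
    qed
    also have "\<dots> = (\<Sum>(s, t)\<in>steps (g j). if a $ j \<le> s \<and> t \<le> b $ j then \<Phi> t - \<Phi> s else 0)"
    proof (intro sum.cong refl, clarify)
      fix s t
      show "(\<Sum>c\<in>grid_cells J g. if a $ j \<le> s \<and> t \<le> b $ j then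
          (if \<forall>i\<in>J. a $ i \<le> fst c $ i \<and> snd c $ i \<le> b $ i then qvol J (\<lambda>x. f (vupd x j t)) (fst c) (snd c) else 0)
          - (if \<forall>i\<in>J. a $ i \<le> fst c $ i \<and> snd c $ i \<le> b $ i then qvol J (\<lambda>x. f (vupd x j s)) (fst c) (snd c) else 0)
         else 0) = (if a $ j \<le> s \<and> t \<le> b $ j then \<Phi> t - \<Phi> s else 0)"
      proof (cases "a $ j \<le> s \<and> t \<le> b $ j")
        case True
        show ?thesis unfolding if_P[OF True] sum_subtractf IH ..
      qed (simp only: if_False sum.neutral_const)
    qed
    also have "\<dots> = \<Phi> (b $ j) - \<Phi> (a $ j)" using insert(4)[of j] by (intro steps_telescope) auto
    also have "\<dots> = qvol (insert j J) f a b" by (simp add: \<Phi>_def qvol_insert[OF insert(1,2)])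
    finally show ?case .
  qed
qed

lemma is_gridD:
  assumes "is_grid J g" "j \<in> J"
  shows "finite (g j)" "0 \<in> g j" "1 \<in> g j" "x \<in> g j \<Longrightarrow> 0 \<le> x" "x \<in> g j \<Longrightarrow> x \<le> 1"
proof -
  have "finite (g j)" "0 \<in> g j" "1 \<in> g j" "g j \<subseteq> {0..1}" using assms by (auto simp: is_grid_def)
  then show "finite (g j)" "0 \<in> g j" "1 \<in> g j" "x \<in> g j \<Longrightarrow> 0 \<le> x" "x \<in> g j \<Longrightarrow> x \<le> 1" by auto
qed

lemma finite_cells: "is_grid J g \<Longrightarrow> finite (grid_cells J g)"
  by (rule finite_grid_cells) (auto simp: is_grid_def)

lemma grid_cellsD:
  assumes "c \<in> grid_cells J g" "j \<in> J"
  shows "fst c $ j \<in> g j" "snd c $ j \<in> g j" "fst c $ j < snd c $ j" "x \<in> g j \<Longrightarrow> fst c $ j < x \<Longrightarrow> snd c $ j \<le> x"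
    "x \<in> g j \<Longrightarrow> x < snd c $ j \<Longrightarrow> x \<le> fst c $ j"
proof -
  have *: "fst c $ j \<in> g j" "snd c $ j \<in> g j" "fst c $ j < snd c $ j" "{fst c $ j<..<snd c $ j} \<inter> g j = {}"
    using assms unfolding grid_cells_def by (simp_all add: split_beta)
  then show "fst c $ j \<in> g j" "snd c $ j \<in> g j" "fst c $ j < snd c $ j" by auto
  show "x \<in> g j \<Longrightarrow> fst c $ j < x \<Longrightarrow> snd c $ j \<le> x" "x \<in> g j \<Longrightarrow> x < snd c $ j \<Longrightarrow> x \<le> fst c $ j"
    using *(4) by (meson disjoint_iff greaterThanLessThan_iff not_le)+
qed

lemma grid_cells_outside:
  assumes "c \<in> grid_cells J g" "j \<notin> J"
  shows "fst c $ j = 1" "snd c $ j = 1"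
  using assms by (auto simp: grid_cells_def)

lemma grid_cell_cube:
  assumes "is_grid J g" "c \<in> grid_cells J g" "\<And>j. fst c $ j \<le> x $ j \<and> x $ j \<le> snd c $ j"
  shows "x \<in> unitcube"
  unfolding unitcube_iff
proof
  fix j
  show "0 \<le> x $ j \<and> x $ j \<le> 1"
  proof (cases "j \<in> J")
    case True
    then show ?thesis
      using assms(3)[of j] grid_cellsD(1,2)[OF assms(2) True] is_gridD(4,5)[OF assms(1) True] by (meson order_trans)
  qed (use assms(3)[of j] grid_cells_outside[OF assms(2)] in auto)
qed

lemma grid_mesh_ge:
  assumes "is_grid J g" "c \<in> grid_cells J g"
  shows "snd c $ j - fst c $ j \<le> grid_mesh J g"
proof -
  have "{b $ j - a $ j |a b j. (a, b) \<in> grid_cells J g \<and> j \<in> J} = (\<lambda>(c, j). snd c $ j - fst c $ j) ` (grid_cells J g \<times> J)"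
    by force
  then have fin: "finite ({0} \<union> {b $ j - a $ j |a b j. (a, b) \<in> grid_cells J g \<and> j \<in> J})"
    using finite_cells[OF assms(1)] by simp
  show ?thesis
  proof (cases "j \<in> J")
    case True
    then show ?thesis unfolding grid_mesh_def using fin assms(2) by (intro Max_ge) (auto, metis prod.collapse)
  next
    case False
    then show ?thesis unfolding grid_mesh_def using fin grid_cells_outside[OF assms(2)] by (intro Max_ge) auto
  qed
qed

lemma grid_mesh_le:
  assumes "is_grid J g" "0 \<le> e" "\<And>c j. c \<in> grid_cells J g \<Longrightarrow> j \<in> J \<Longrightarrow> snd c $ j - fst c $ j \<le> e"
  shows "grid_mesh J g \<le> e"
proof -
  have "{b $ j - a $ j |a b j. (a, b) \<in> grid_cells J g \<and> j \<in> J} = (\<lambda>(c, j). snd c $ j - fst c $ j) ` (grid_cells J g \<times> J)"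
    by force
  then have fin: "finite ({0} \<union> {b $ j - a $ j |a b j. (a, b) \<in> grid_cells J g \<and> j \<in> J})"
    using finite_cells[OF assms(1)] by simp
  show ?thesis unfolding grid_mesh_def
    by (rule Max.boundedI[OF fin]) (use assms in auto)
qed

section \<open>Riemann--Stieltjes sums and integrals\<close>

definition RSsum :: "'p::finite set \<Rightarrow> ('p \<Rightarrow> real set) \<Rightarrow> ((real^'p) \<times> (real^'p) \<Rightarrow> real^'p) \<Rightarrow>
    (real^'p \<Rightarrow> real) \<Rightarrow> (real^'p \<Rightarrow> real) \<Rightarrow> real" where
  "RSsum J gr tag G f = (\<Sum>c\<in>grid_cells J gr. G (tag c) * qvol J f (fst c) (snd c))"

definition tagged :: "'p::finite set \<Rightarrow> ('p \<Rightarrow> real set) \<Rightarrow> ((real^'p) \<times> (real^'p) \<Rightarrow> real^'p) \<Rightarrow> bool" where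
  "tagged J gr tag \<longleftrightarrow> (\<forall>c\<in>grid_cells J gr. \<forall>j. fst c $ j \<le> tag c $ j \<and> tag c $ j \<le> snd c $ j)"

lemma has_RS_alt: "has_RS J G f I \<longleftrightarrow> (\<forall>\<epsilon>>0. \<exists>\<delta>>0. \<forall>gr tag. is_grid J gr \<longrightarrow> grid_mesh J gr < \<delta> \<longrightarrow>
    tagged J gr tag \<longrightarrow> \<bar>RSsum J gr tag G f - I\<bar> < \<epsilon>)"
  unfolding has_RS_def RSsum_def tagged_def by blast

text \<open>The corners are the nearest points of \<open>g\<close> below and above the finer cell. A
  point of \<open>g\<close> strictly between them would be a point of \<open>g'\<close> inside that
  cell.\<close>

lemma containing_cell:
  assumes g: "is_grid J g" and g': "is_grid J g'" and sub: "\<And>j. j \<in> J \<Longrightarrow> g j \<subseteq> g' j"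
    and c': "c' \<in> grid_cells J g'"
  shows "\<exists>!c. c \<in> grid_cells J g \<and> (\<forall>j\<in>J. fst c $ j \<le> fst c' $ j \<and> snd c' $ j \<le> snd c $ j)"
proof (rule ex_ex1I)
  define a where "a = (\<chi> j. if j \<in> J then Max {x \<in> g j. x \<le> fst c' $ j} else 1)"
  define b where "b = (\<chi> j. if j \<in> J then Min {x \<in> g j. snd c' $ j \<le> x} else 1)"
  have a: "a $ j \<in> g j" "a $ j \<le> fst c' $ j" "\<And>x. x \<in> g j \<Longrightarrow> x \<le> fst c' $ j \<Longrightarrow> x \<le> a $ j"
    and b: "b $ j \<in> g j" "snd c' $ j \<le> b $ j" "\<And>x. x \<in> g j \<Longrightarrow> snd c' $ j \<le> x \<Longrightarrow> b $ j \<le> x"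
    if j: "j \<in> J" for j
  proof -
    have fin: "finite {x \<in> g j. x \<le> fst c' $ j}" "finite {x \<in> g j. snd c' $ j \<le> x}"
      using is_gridD(1)[OF g j] by auto
    have "0 \<in> {x \<in> g j. x \<le> fst c' $ j}" "1 \<in> {x \<in> g j. snd c' $ j \<le> x}"
      using is_gridD(2,3)[OF g j] is_gridD(4,5)[OF g' j] grid_cellsD(1,2)[OF c' j] by auto
    then have ne: "{x \<in> g j. x \<le> fst c' $ j} \<noteq> {}" "{x \<in> g j. snd c' $ j \<le> x} \<noteq> {}" by auto
    show "a $ j \<in> g j" "a $ j \<le> fst c' $ j" "b $ j \<in> g j" "snd c' $ j \<le> b $ j"
      using Max_in[OF fin(1) ne(1)] Min_in[OF fin(2) ne(2)] j by (auto simp: a_def b_def)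
    show "\<And>x. x \<in> g j \<Longrightarrow> x \<le> fst c' $ j \<Longrightarrow> x \<le> a $ j" "\<And>x. x \<in> g j \<Longrightarrow> snd c' $ j \<le> x \<Longrightarrow> b $ j \<le> x"
      using fin j by (auto simp: a_def b_def)
  qed
  have "(a, b) \<in> grid_cells J g"
    unfolding grid_cells_def mem_Collect_eq case_prod_conv
  proof (intro conjI ballI allI impI)
    fix j assume j: "j \<in> J"
    show "a $ j \<in> g j" "b $ j \<in> g j" using a b j by auto
    show "a $ j < b $ j" using a(2)[OF j] b(2)[OF j] grid_cellsD(3)[OF c' j] by linarith
    show "{a $ j<..<b $ j} \<inter> g j = {}"
    proof (rule equals0I)
      fix x assume x: "x \<in> {a $ j<..<b $ j} \<inter> g j"
      then have "fst c' $ j < x" using a(3)[OF j, of x] by force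
      moreover have "x < snd c' $ j" using x b(3)[OF j, of x] by force
      ultimately show False using grid_cellsD(4)[OF c' j, of x] x sub[OF j] by force
    qed
  qed (auto simp: a_def b_def)
  then show "\<exists>c. c \<in> grid_cells J g \<and> (\<forall>j\<in>J. fst c $ j \<le> fst c' $ j \<and> snd c' $ j \<le> snd c $ j)"
    using a(2) b(2) by (intro exI[of _ "(a, b)"]) auto
next
  fix c d
  assume c: "c \<in> grid_cells J g \<and> (\<forall>j\<in>J. fst c $ j \<le> fst c' $ j \<and> snd c' $ j \<le> snd c $ j)"
    and d: "d \<in> grid_cells J g \<and> (\<forall>j\<in>J. fst d $ j \<le> fst c' $ j \<and> snd c' $ j \<le> snd d $ j)"
  have "fst c $ j = fst d $ j \<and> snd c $ j = snd d $ j" for j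
  proof (cases "j \<in> J")
    case True
    have o: "fst c $ j < snd d $ j" "fst d $ j < snd c $ j"
      using c d True grid_cellsD(3)[OF c' True] by (meson le_less_trans less_le_trans)+
    have "fst c $ j \<le> fst d $ j" "snd c $ j \<le> snd d $ j" "fst d $ j \<le> fst c $ j" "snd d $ j \<le> snd c $ j"
      using grid_cellsD[of c J g j] grid_cellsD[of d J g j] o c d True by metis+
    then show ?thesis by linarith
  qed (use c d grid_cells_outside in metis)
  then show "c = d" by (simp add: prod_eq_iff vec_eq_iff)
qed

text \<open>Additivity spreads each coarse quasi-volume over the finer cells. There both tags lie in
  one coarse cell and differ by at most the mesh, so \<open>G\<close> changes by at most
  \<open>e\<close>; summing absolute quasi-volumes brings in the variation.\<close>

lemma RSsum_refine:
  assumes g: "is_grid J g" and g': "is_grid J g'" and sub: "\<And>j. j \<in> J \<Longrightarrow> g j \<subseteq> g' j"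
    and tag: "tagged J g tag" "tagged J g' tag'" and mesh: "grid_mesh J g \<le> \<delta>"
    and V: "(\<Sum>c\<in>grid_cells J g'. \<bar>qvol J f (fst c) (snd c)\<bar>) \<le> V"
    and G: "\<And>x y. x \<in> unitcube \<Longrightarrow> y \<in> unitcube \<Longrightarrow> (\<And>j. \<bar>x $ j - y $ j\<bar> \<le> \<delta>) \<Longrightarrow> \<bar>G x - G y\<bar> \<le> e"
    and e: "0 \<le> e"
  shows "\<bar>RSsum J g tag G f - RSsum J g' tag' G f\<bar> \<le> e * V"
proof -
  define in_c where "in_c c' c \<longleftrightarrow> (\<forall>j\<in>J. fst c $ j \<le> fst c' $ j \<and> snd c' $ j \<le> snd c $ j)" for c' c :: "(real^'a) \<times> (real^'a)"
  have ex1: "\<exists>!c. c \<in> grid_cells J g \<and> in_c c' c" if "c' \<in> grid_cells J g'" for c'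
    unfolding in_c_def by (rule containing_cell[OF g g' sub that])
  have "RSsum J g tag G f = (\<Sum>c\<in>grid_cells J g. G (tag c) *
      (\<Sum>c'\<in>grid_cells J g'. if in_c c' c then qvol J f (fst c') (snd c') else 0))"
    unfolding RSsum_def
  proof (rule sum.cong[OF refl])
    fix c assume c: "c \<in> grid_cells J g"
    have "(\<Sum>c'\<in>grid_cells J g'. if in_c c' c then qvol J f (fst c') (snd c') else 0) = qvol J f (fst c) (snd c)"
      unfolding in_c_def
    proof (rule qvol_additive)
      fix j
      show "j \<in> J \<Longrightarrow> finite (g' j) \<and> fst c $ j \<in> g' j \<and> snd c $ j \<in> g' j \<and> fst c $ j \<le> snd c $ j"
        using is_gridD(1)[OF g', of j] grid_cellsD(1-3)[OF c, of j] sub[of j] by auto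
      show "j \<notin> J \<Longrightarrow> snd c $ j = 1" using grid_cells_outside[OF c] by simp
    qed
    then show "G (tag c) * qvol J f (fst c) (snd c) = G (tag c) *
      (\<Sum>c'\<in>grid_cells J g'. if in_c c' c then qvol J f (fst c') (snd c') else 0)" by simp
  qed
  also have "\<dots> = (\<Sum>c'\<in>grid_cells J g'. \<Sum>c\<in>grid_cells J g. if in_c c' c then G (tag c) * qvol J f (fst c') (snd c') else 0)"
    unfolding sum_distrib_left by (subst sum.swap) (intro sum.cong refl, auto)
  finally have "RSsum J g tag G f - RSsum J g' tag' G f = (\<Sum>c'\<in>grid_cells J g'.
      (\<Sum>c\<in>grid_cells J g. if in_c c' c then G (tag c) * qvol J f (fst c') (snd c') else 0) - G (tag' c') * qvol J f (fst c') (snd c'))"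
    by (simp add: RSsum_def sum_subtractf)
  also have "\<bar>\<dots>\<bar> \<le> (\<Sum>c'\<in>grid_cells J g'. e * \<bar>qvol J f (fst c') (snd c')\<bar>)"
  proof (rule order_trans[OF sum_abs], rule sum_mono)
    fix c' assume c': "c' \<in> grid_cells J g'"
    obtain c where c: "c \<in> grid_cells J g" "in_c c' c" and un: "\<And>d. d \<in> grid_cells J g \<Longrightarrow> in_c c' d \<Longrightarrow> d = c"
      using ex1[OF c'] by blast
    have "(\<Sum>c\<in>grid_cells J g. if in_c c' c then G (tag c) * qvol J f (fst c') (snd c') else 0)
       = (\<Sum>d\<in>grid_cells J g. if d = c then G (tag c) * qvol J f (fst c') (snd c') else 0)"
    proof (rule sum.cong[OF refl])
      fix d assume "d \<in> grid_cells J g"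
      then have "in_c c' d \<longleftrightarrow> d = c" using c un by blast
      then show "(if in_c c' d then G (tag d) * qvol J f (fst c') (snd c') else 0)
        = (if d = c then G (tag c) * qvol J f (fst c') (snd c') else 0)" by simp
    qed
    also have "\<dots> = G (tag c) * qvol J f (fst c') (snd c')" using c(1) finite_cells[OF g] by simp
    finally have eq: "(\<Sum>c\<in>grid_cells J g. if in_c c' c then G (tag c) * qvol J f (fst c') (snd c') else 0)
      = G (tag c) * qvol J f (fst c') (snd c')" .
    have t: "fst c $ j \<le> tag c $ j \<and> tag c $ j \<le> snd c $ j" "fst c' $ j \<le> tag' c' $ j \<and> tag' c' $ j \<le> snd c' $ j" for j
      using tag c(1) c' by (auto simp: tagged_def)
    have "\<bar>G (tag c) - G (tag' c')\<bar> \<le> e"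
    proof (rule G)
      show "tag c \<in> unitcube" using grid_cell_cube[OF g c(1)] t by blast
      show "tag' c' \<in> unitcube" using grid_cell_cube[OF g' c'] t by blast
      fix j
      have "fst c $ j \<le> tag' c' $ j" "tag' c' $ j \<le> snd c $ j"
        using t(2)[of j] c(2) grid_cells_outside[OF c(1)] grid_cells_outside[OF c']
        by (cases "j \<in> J"; force simp: in_c_def)+
      then show "\<bar>tag c $ j - tag' c' $ j\<bar> \<le> \<delta>"
        using t(1)[of j] grid_mesh_ge[OF g c(1), of j] mesh by linarith
    qed
    then have "\<bar>G (tag c) - G (tag' c')\<bar> * \<bar>qvol J f (fst c') (snd c')\<bar> \<le> e * \<bar>qvol J f (fst c') (snd c')\<bar>"
      by (rule mult_right_mono) simp
    then show "\<bar>(\<Sum>c\<in>grid_cells J g. if in_c c' c then G (tag c) * qvol J f (fst c') (snd c') else 0) - G (tag' c') * qvol J f (fst c') (snd c')\<bar>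
      \<le> e * \<bar>qvol J f (fst c') (snd c')\<bar>"
      unfolding eq by (simp add: left_diff_distrib[symmetric] abs_mult)
  qed
  also have "\<dots> \<le> e * V" unfolding sum_distrib_left[symmetric] using V e by (rule mult_left_mono)
  finally show ?thesis .
qed

definition ugrid :: "nat \<Rightarrow> 'p \<Rightarrow> real set" where
  "ugrid m = (\<lambda>_. (\<lambda>l. real l / real m) ` {..m})"

lemma is_grid_ugrid: "0 < m \<Longrightarrow> is_grid J (ugrid m)"
  by (auto simp: is_grid_def ugrid_def image_iff divide_simps intro: bexI[of _ 0] bexI[of _ m])

lemma mesh_ugrid:
  assumes "0 < m" shows "grid_mesh J (ugrid m) \<le> 1 / real m"
proof (rule grid_mesh_le[OF is_grid_ugrid[OF assms]])
  fix c j assume c: "c \<in> grid_cells J (ugrid m)" and j: "j \<in> J"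
  obtain l where l: "l \<le> m" "fst c $ j = real l / real m"
    using grid_cellsD(1)[OF c j] by (auto simp: ugrid_def)
  obtain l' where l': "l' \<le> m" "snd c $ j = real l' / real m"
    using grid_cellsD(2)[OF c j] by (auto simp: ugrid_def)
  have "l < l'" using grid_cellsD(3)[OF c j] l l' assms by (simp add: divide_less_cancel)
  then have "real (Suc l) / real m \<in> ugrid m j" unfolding ugrid_def using l' by (intro imageI) simp
  moreover have "fst c $ j < real (Suc l) / real m" using l assms by (simp add: divide_strict_right_mono)
  ultimately have "snd c $ j \<le> real (Suc l) / real m" using grid_cellsD(4)[OF c j] by blast
  then show "snd c $ j - fst c $ j \<le> 1 / real m" using l by (simp add: add_divide_distrib)
qed simp

lemma tagged_fst: "is_grid J gr \<Longrightarrow> tagged J gr fst"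
  unfolding tagged_def
proof (intro ballI allI conjI order_refl)
  fix c j assume c: "c \<in> grid_cells J gr"
  show "fst c $ j \<le> snd c $ j"
    using grid_cellsD(3)[OF c, of j] grid_cells_outside[OF c, of j] by (cases "j \<in> J") auto
qed

lemma cube_modulus:
  fixes G :: "real^'p::finite \<Rightarrow> real"
  assumes "continuous_on unitcube G" "0 < e"
  obtains \<delta> where "0 < \<delta>"
    "\<And>x y. x \<in> unitcube \<Longrightarrow> y \<in> unitcube \<Longrightarrow> (\<And>j. \<bar>x $ j - y $ j\<bar> \<le> \<delta>) \<Longrightarrow> \<bar>G x - G y\<bar> \<le> e"
proof -
  have "uniformly_continuous_on unitcube G"
    by (rule compact_uniformly_continuous[OF assms(1)]) simp
  then obtain d where d: "0 < d" "\<And>x y. x \<in> unitcube \<Longrightarrow> y \<in> unitcube \<Longrightarrow> dist y x < d \<Longrightarrow> dist (G y) (G x) < e"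
    using assms(2) unfolding uniformly_continuous_on_def by metis
  show thesis
  proof (rule that[of "d / (2 * real CARD('p))"])
    show "0 < d / (2 * real CARD('p))" using d by simp
    fix x y :: "real^'p"
    assume *: "x \<in> unitcube" "y \<in> unitcube" "\<And>j. \<bar>x $ j - y $ j\<bar> \<le> d / (2 * real CARD('p))"
    have "dist x y \<le> (\<Sum>j\<in>UNIV. \<bar>(x - y) $ j\<bar>)" unfolding dist_norm by (rule norm_le_l1_cart)
    also have "\<dots> \<le> (\<Sum>j\<in>(UNIV::'p set). d / (2 * real CARD('p)))"
      by (rule sum_mono) (use *(3) in simp)
    also have "\<dots> < d" using d(1) by simp
    finally have "dist (G x) (G y) < e" using * by (intro d(2)) auto
    then show "\<bar>G x - G y\<bar> \<le> e" by (simp add: dist_real_def)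
  qed
qed

lemma vitali_bvD:
  assumes "vitali_bv J f"
  obtains V where "0 \<le> V" "\<And>g. is_grid J g \<Longrightarrow> (\<Sum>c\<in>grid_cells J g. \<bar>qvol J f (fst c) (snd c)\<bar>) \<le> V"
proof -
  obtain V where V: "\<And>g. is_grid J g \<Longrightarrow> (\<Sum>c\<in>grid_cells J g. \<bar>qvol J f (fst c) (snd c)\<bar>) \<le> V"
    using assms unfolding vitali_bv_def bdd_above_def by blast
  show thesis
    by (rule that[of "max 0 V"]) (use V in \<open>auto simp: le_max_iff_disj\<close>)
qed

text \<open>Both sums are compared with the lower-corner sum over the common refinement of the two
  grids.\<close>

lemma RS_close:
  fixes G :: "real^'p::finite \<Rightarrow> real"
  assumes "continuous_on unitcube G" "vitali_bv J f" "0 < e"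
  obtains \<delta> where "0 < \<delta>"
    "\<And>g tag g' tag'. is_grid J g \<Longrightarrow> tagged J g tag \<Longrightarrow> grid_mesh J g \<le> \<delta> \<Longrightarrow> is_grid J g' \<Longrightarrow> tagged J g' tag' \<Longrightarrow>
       grid_mesh J g' \<le> \<delta> \<Longrightarrow> \<bar>RSsum J g tag G f - RSsum J g' tag' G f\<bar> \<le> e"
proof -
  obtain V where V: "0 \<le> V" "\<And>g. is_grid J g \<Longrightarrow> (\<Sum>c\<in>grid_cells J g. \<bar>qvol J f (fst c) (snd c)\<bar>) \<le> V"
    by (rule vitali_bvD[OF assms(2)]) blast
  define e' where "e' = e / (2 * (V + 1))"
  have e': "0 < e'" "2 * (e' * V) \<le> e" using assms(3) V(1) by (auto simp: e'_def field_simps)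
  obtain \<delta> where \<delta>: "0 < \<delta>"
    "\<And>x y. x \<in> unitcube \<Longrightarrow> y \<in> unitcube \<Longrightarrow> (\<And>j. \<bar>x $ j - y $ j\<bar> \<le> \<delta>) \<Longrightarrow> \<bar>G x - G y\<bar> \<le> e'"
    using cube_modulus[OF assms(1) e'(1)] by metis
  show thesis
  proof (rule that[OF \<delta>(1)])
    fix g g' :: "'p \<Rightarrow> real set" and tag tag'
    assume g: "is_grid J g" "tagged J g tag" "grid_mesh J g \<le> \<delta>"
      and g': "is_grid J g'" "tagged J g' tag'" "grid_mesh J g' \<le> \<delta>"
    define h where "h j = g j \<union> g' j" for j
    have h: "is_grid J h" using g(1) g'(1) by (auto simp: is_grid_def h_def)
    have "\<bar>RSsum J g tag G f - RSsum J h fst G f\<bar> \<le> e' * V"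
      by (rule RSsum_refine[OF g(1) h _ g(2) tagged_fst[OF h] g(3) V(2)[OF h] \<delta>(2)])
        (use e' in \<open>auto simp: h_def\<close>)
    moreover have "\<bar>RSsum J g' tag' G f - RSsum J h fst G f\<bar> \<le> e' * V"
      by (rule RSsum_refine[OF g'(1) h _ g'(2) tagged_fst[OF h] g'(3) V(2)[OF h] \<delta>(2)])
        (use e' in \<open>auto simp: h_def\<close>)
    ultimately show "\<bar>RSsum J g tag G f - RSsum J g' tag' G f\<bar> \<le> e" using e'(2) by linarith
  qed
qed

lemma ugrid_mesh_small:
  assumes "0 < \<delta>"
  obtains m0 where "\<And>m J. m0 \<le> m \<Longrightarrow> 0 < m \<and> grid_mesh J (ugrid m :: 'p::finite \<Rightarrow> real set) < \<delta>"
proof -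
  obtain m0 :: nat where m0: "1 / \<delta> < real m0" using reals_Archimedean2 by blast
  show thesis
  proof (rule that[of m0])
    fix m J assume m: "m0 \<le> m"
    have "1 / \<delta> < real m" using m m0 by linarith
    moreover have "0 < 1 / \<delta>" using assms by simp
    ultimately have "0 < real m" by linarith
    then have "0 < m" "1 / real m < \<delta>"
      using assms \<open>1 / \<delta> < real m\<close> by (auto simp: pos_divide_less_eq mult.commute)
    then show "0 < m \<and> grid_mesh J (ugrid m :: 'p \<Rightarrow> real set) < \<delta>"
      using mesh_ugrid[of m J] by (meson le_less_trans)
  qed
qed

text \<open>The uniform grids provide one concrete sequence along which the integral is identified,
  and later shown to be measurable in a parameter.\<close>

lemma has_RS_limit:
  assumes "has_RS J G f I"
  shows "(\<lambda>m. RSsum J (ugrid m) fst G f) \<longlonglongrightarrow> I"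
proof (rule LIMSEQ_I)
  fix e :: real assume "0 < e"
  then obtain \<delta> where \<delta>: "0 < \<delta>" "\<And>gr tag. is_grid J gr \<Longrightarrow> grid_mesh J gr < \<delta> \<Longrightarrow> tagged J gr tag \<Longrightarrow> \<bar>RSsum J gr tag G f - I\<bar> < e"
    using assms unfolding has_RS_alt by blast
  obtain m0 where "\<And>m. m0 \<le> m \<Longrightarrow> 0 < m \<and> grid_mesh J (ugrid m) < \<delta>"
    using ugrid_mesh_small[OF \<delta>(1)] by metis
  then show "\<exists>no. \<forall>n\<ge>no. norm (RSsum J (ugrid n) fst G f - I) < e"
    using \<delta>(2)[OF is_grid_ugrid _ tagged_fst[OF is_grid_ugrid]] by (intro exI[of _ m0]) auto
qed

lemma has_RS_unique: "has_RS J G f I \<Longrightarrow> has_RS J G f I' \<Longrightarrow> I = I'"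
  using has_RS_limit LIMSEQ_unique by blast

lemma RS_int_eq: "has_RS J G f I \<Longrightarrow> RS_int J G f = I"
  unfolding RS_int_def using has_RS_unique by blast

text \<open>The sums over uniform grids form a Cauchy sequence, and \<open>RS_close\<close> carries
  their limit over to arbitrary tagged grids.\<close>

lemma RS_exists:
  fixes G :: "real^'p::finite \<Rightarrow> real"
  assumes "continuous_on unitcube G" "vitali_bv J f"
  shows "\<exists>I. has_RS J G f I"
proof -
  have "Cauchy (\<lambda>m. RSsum J (ugrid m) fst G f)"
  proof (rule CauchyI)
    fix e :: real assume e: "0 < e"
    obtain \<delta> where \<delta>: "0 < \<delta>"
      "\<And>g tag g' tag'. is_grid J g \<Longrightarrow> tagged J g tag \<Longrightarrow> grid_mesh J g \<le> \<delta> \<Longrightarrow> is_grid J g' \<Longrightarrow> tagged J g' tag' \<Longrightarrow>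
       grid_mesh J g' \<le> \<delta> \<Longrightarrow> \<bar>RSsum J g tag G f - RSsum J g' tag' G f\<bar> \<le> e / 2"
      using RS_close[OF assms half_gt_zero[OF e]] by metis
    obtain m0 where m0: "\<And>m. m0 \<le> m \<Longrightarrow> 0 < m \<and> grid_mesh J (ugrid m) < \<delta>"
      using ugrid_mesh_small[OF \<delta>(1)] by metis
    show "\<exists>M. \<forall>m\<ge>M. \<forall>n\<ge>M. norm (RSsum J (ugrid m) fst G f - RSsum J (ugrid n) fst G f) < e"
    proof (intro exI[of _ m0] allI impI)
      fix m n assume "m0 \<le> m" "m0 \<le> n"
      then have "\<bar>RSsum J (ugrid m) fst G f - RSsum J (ugrid n) fst G f\<bar> \<le> e / 2"
        using m0[of m] m0[of n] by (intro \<delta>(2) is_grid_ugrid tagged_fst) auto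
      then show "norm (RSsum J (ugrid m) fst G f - RSsum J (ugrid n) fst G f) < e" using e by simp
    qed
  qed
  then obtain I where I: "(\<lambda>m. RSsum J (ugrid m) fst G f) \<longlonglongrightarrow> I"
    using real_Cauchy_convergent convergent_def by blast
  have "has_RS J G f I"
    unfolding has_RS_alt
  proof (intro allI impI)
    fix e :: real assume e: "0 < e"
    obtain \<delta> where \<delta>: "0 < \<delta>"
      "\<And>g tag g' tag'. is_grid J g \<Longrightarrow> tagged J g tag \<Longrightarrow> grid_mesh J g \<le> \<delta> \<Longrightarrow> is_grid J g' \<Longrightarrow> tagged J g' tag' \<Longrightarrow>
       grid_mesh J g' \<le> \<delta> \<Longrightarrow> \<bar>RSsum J g tag G f - RSsum J g' tag' G f\<bar> \<le> e / 3"
      using RS_close[OF assms, of "e / 3"] e by auto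
    obtain m0 where m0: "\<And>m. m0 \<le> m \<Longrightarrow> 0 < m \<and> grid_mesh J (ugrid m) < \<delta>"
      using ugrid_mesh_small[OF \<delta>(1)] by metis
    obtain m1 where m1: "\<And>m. m1 \<le> m \<Longrightarrow> \<bar>RSsum J (ugrid m) fst G f - I\<bar> < e / 3"
      using LIMSEQ_D[OF I, of "e / 3"] e by auto
    define m where "m = max m0 m1"
    show "\<exists>\<delta>>0. \<forall>gr tag. is_grid J gr \<longrightarrow> grid_mesh J gr < \<delta> \<longrightarrow> tagged J gr tag \<longrightarrow> \<bar>RSsum J gr tag G f - I\<bar> < e"
    proof (intro exI[of _ \<delta>] conjI allI impI)
      fix gr tag assume gr: "is_grid J gr" "grid_mesh J gr < \<delta>" "tagged J gr tag"
      have "\<bar>RSsum J gr tag G f - RSsum J (ugrid m) fst G f\<bar> \<le> e / 3"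
        using gr m0[of m] by (intro \<delta>(2) is_grid_ugrid tagged_fst) (auto simp: m_def)
      moreover have "\<bar>RSsum J (ugrid m) fst G f - I\<bar> < e / 3" using m1[of m] by (simp add: m_def)
      ultimately show "\<bar>RSsum J gr tag G f - I\<bar> < e" using e by linarith
    qed (rule \<delta>(1))
  qed
  then show ?thesis by blast
qed

lemma has_RS_lin:
  assumes "has_RS J G f I" "has_RS J G' f I'"
  shows "has_RS J (\<lambda>x. c * G x + c' * G' x) f (c * I + c' * I')"
  unfolding has_RS_alt
proof (intro allI impI)
  fix e :: real assume e: "0 < e"
  \<comment> \<open>The added 1 makes \<open>k\<close> positive and the final inequality
    strict.\<close>
  define k where "k = \<bar>c\<bar> + \<bar>c'\<bar> + 1"
  have k: "0 < k" by (simp add: k_def)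
  have ek: "0 < e / k" using e k by simp
  obtain \<delta> where \<delta>: "0 < \<delta>" "\<And>gr tag. is_grid J gr \<Longrightarrow> grid_mesh J gr < \<delta> \<Longrightarrow> tagged J gr tag \<Longrightarrow> \<bar>RSsum J gr tag G f - I\<bar> < e / k"
    using assms(1)[unfolded has_RS_alt, rule_format, OF ek] by blast
  obtain \<delta>' where \<delta>': "0 < \<delta>'" "\<And>gr tag. is_grid J gr \<Longrightarrow> grid_mesh J gr < \<delta>' \<Longrightarrow> tagged J gr tag \<Longrightarrow> \<bar>RSsum J gr tag G' f - I'\<bar> < e / k"
    using assms(2)[unfolded has_RS_alt, rule_format, OF ek] by blast
  show "\<exists>\<delta>>0. \<forall>gr tag. is_grid J gr \<longrightarrow> grid_mesh J gr < \<delta> \<longrightarrow> tagged J gr tag \<longrightarrow>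
      \<bar>RSsum J gr tag (\<lambda>x. c * G x + c' * G' x) f - (c * I + c' * I')\<bar> < e"
  proof (intro exI[of _ "min \<delta> \<delta>'"] conjI allI impI)
    show "0 < min \<delta> \<delta>'" using \<delta> \<delta>' by simp
    fix gr tag assume gr: "is_grid J gr" "grid_mesh J gr < min \<delta> \<delta>'" "tagged J gr tag"
    have "RSsum J gr tag (\<lambda>x. c * G x + c' * G' x) f = c * RSsum J gr tag G f + c' * RSsum J gr tag G' f"
      by (simp add: RSsum_def sum_distrib_left sum.distrib algebra_simps)
    then have "\<bar>RSsum J gr tag (\<lambda>x. c * G x + c' * G' x) f - (c * I + c' * I')\<bar>
       = \<bar>c * (RSsum J gr tag G f - I) + c' * (RSsum J gr tag G' f - I')\<bar>" by (simp add: algebra_simps)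
    also have "\<dots> \<le> \<bar>c\<bar> * (e / k) + \<bar>c'\<bar> * (e / k)"
    proof (rule abs_add2_le)
      have "grid_mesh J gr < \<delta>" "grid_mesh J gr < \<delta>'" using gr(2) by auto
      then have "\<bar>RSsum J gr tag G f - I\<bar> \<le> e / k" "\<bar>RSsum J gr tag G' f - I'\<bar> \<le> e / k"
        using \<delta>(2)[OF gr(1) _ gr(3)] \<delta>'(2)[OF gr(1) _ gr(3)] by (auto intro: less_imp_le)
      then show "\<bar>c * (RSsum J gr tag G f - I)\<bar> \<le> \<bar>c\<bar> * (e / k)" "\<bar>c' * (RSsum J gr tag G' f - I')\<bar> \<le> \<bar>c'\<bar> * (e / k)"
        unfolding abs_mult by (meson abs_ge_zero mult_left_mono)+
    qed
    also have "\<dots> = (\<bar>c\<bar> + \<bar>c'\<bar>) * (e / k)" by (simp only: distrib_right)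
    also have "\<dots> = (k - 1) * (e / k)" by (simp add: k_def)
    also have "\<dots> < e" using k e by (simp add: field_simps)
    finally show "\<bar>RSsum J gr tag (\<lambda>x. c * G x + c' * G' x) f - (c * I + c' * I')\<bar> < e" .
  qed
qed

text \<open>If some \<open>k\<close> of \<open>K\<close> is missing from \<open>S\<close>, adding or
  deleting \<open>k\<close> pairs the supersets with opposite signs.\<close>

lemma sum_supersets_alternating:
  assumes "finite K" "S \<subseteq> K"
  shows "(\<Sum>J\<in>Pow K. if S \<subseteq> J then (-1) ^ card J else 0 :: real) = (if S = K then (-1) ^ card K else 0)"
proof (cases "S = K")
  case True
  then have "(\<Sum>J\<in>Pow K. if S \<subseteq> J then (-1) ^ card J else 0 :: real) = (\<Sum>J\<in>Pow K. if J = K then (-1) ^ card K else 0)"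
    by (intro sum.cong) auto
  then show ?thesis using True assms by simp
next
  case False
  then obtain k where k: "k \<in> K" "k \<notin> S" using assms by auto
  define K0 where "K0 = K - {k}"
  have K0: "K = insert k K0" "k \<notin> K0" "finite K0" using k assms by (auto simp: K0_def)
  have inj: "inj_on (insert k) (Pow K0)" using K0 by (auto simp: inj_on_def)
  have "(\<Sum>J\<in>Pow K. if S \<subseteq> J then (-1) ^ card J else 0 :: real)
     = (\<Sum>J\<in>Pow K0. if S \<subseteq> J then (-1) ^ card J else 0) + (\<Sum>J\<in>Pow K0. if S \<subseteq> insert k J then (-1) ^ card (insert k J) else 0)"
    unfolding K0(1) Pow_insert using K0
    by (subst sum.union_disjoint) (auto simp: sum.reindex[OF inj])
  also have "(\<Sum>J\<in>Pow K0. if S \<subseteq> insert k J then (-1) ^ card (insert k J) else 0 :: real)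
     = (\<Sum>J\<in>Pow K0. - (if S \<subseteq> J then (-1) ^ card J else 0))"
  proof (rule sum.cong[OF refl])
    fix J assume J: "J \<in> Pow K0"
    then have "finite J" "k \<notin> J" using K0 finite_subset by auto
    then show "(if S \<subseteq> insert k J then (-1) ^ card (insert k J) else 0 :: real) = - (if S \<subseteq> J then (-1) ^ card J else 0)"
      using k by (auto simp: subset_insert)
  qed
  finally show ?thesis using False by (simp add: sum_negf)
qed

text \<open>Summation by parts: evaluation at a grid point is a signed combination of the quasi-volumes
  of the cells above it, over all faces.\<close>
lemma abel_summation:
  fixes \<phi> :: "real^'p::finite \<Rightarrow> real"
  assumes dep: "\<And>x. \<phi> (onK K x) = \<phi> x" and g: "is_grid K g" and x: "\<And>j. j \<in> K \<Longrightarrow> x $ j \<in> g j"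
  shows "\<phi> x = (\<Sum>J\<in>Pow K. (-1) ^ card J * (\<Sum>c\<in>grid_cells J g.
      (if \<forall>j\<in>J. x $ j \<le> fst c $ j then 1 else 0) * qvol J (\<lambda>x. \<phi> (onK J x)) (fst c) (snd c)))"
proof -
  \<comment> \<open>Within one face the cells above \<open>x\<close> fill the box from
    \<open>x\<close> to the all-ones corner, so additivity leaves a signed sum over the vertices of
    that box.\<close>
  have face: "(\<Sum>c\<in>grid_cells J g. (if \<forall>j\<in>J. x $ j \<le> fst c $ j then 1 else 0) * qvol J (\<lambda>x. \<phi> (onK J x)) (fst c) (snd c))
      = (\<Sum>S\<in>Pow K. if S \<subseteq> J then (-1) ^ card S * \<phi> (onK S x) else 0)" if J: "J \<in> Pow K" for J
  proof -
    have gJ: "is_grid J g" using g J by (auto simp: is_grid_def)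
    have "(\<Sum>c\<in>grid_cells J g. (if \<forall>j\<in>J. x $ j \<le> fst c $ j then 1 else 0) * qvol J (\<lambda>x. \<phi> (onK J x)) (fst c) (snd c))
       = (\<Sum>c\<in>grid_cells J g. if \<forall>j\<in>J. x $ j \<le> fst c $ j \<and> snd c $ j \<le> vec 1 $ j
            then qvol J (\<lambda>x. \<phi> (onK J x)) (fst c) (snd c) else 0)"
    proof (rule sum.cong[OF refl])
      fix c assume "c \<in> grid_cells J g"
      then have "snd c $ j \<le> 1" if "j \<in> J" for j using grid_cellsD(2) is_gridD(5)[OF gJ] that by blast
      then show "(if \<forall>j\<in>J. x $ j \<le> fst c $ j then 1 else 0) * qvol J (\<lambda>x. \<phi> (onK J x)) (fst c) (snd c)
        = (if \<forall>j\<in>J. x $ j \<le> fst c $ j \<and> snd c $ j \<le> vec 1 $ j then qvol J (\<lambda>x. \<phi> (onK J x)) (fst c) (snd c) else 0)"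
        by simp
    qed
    also have "\<dots> = qvol J (\<lambda>x. \<phi> (onK J x)) x (vec 1)"
      using is_gridD[OF gJ] x J by (intro qvol_additive) auto
    also have "\<dots> = (\<Sum>S\<in>Pow J. (-1) ^ card S * \<phi> (onK S x))"
    proof -
      have "onK J (onK S x) = onK S x" if "S \<subseteq> J" for S using that by (auto simp: vec_eq_iff)
      then show ?thesis unfolding qvol_def by (intro sum.cong) auto
    qed
    also have "\<dots> = (\<Sum>S\<in>Pow K. if S \<subseteq> J then (-1) ^ card S * \<phi> (onK S x) else 0)"
      using J by (intro sum.mono_neutral_cong_left) auto
    finally show ?thesis .
  qed
  have "(\<Sum>J\<in>Pow K. (-1) ^ card J * (\<Sum>c\<in>grid_cells J g.
      (if \<forall>j\<in>J. x $ j \<le> fst c $ j then 1 else 0) * qvol J (\<lambda>x. \<phi> (onK J x)) (fst c) (snd c)))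
     = (\<Sum>J\<in>Pow K. \<Sum>S\<in>Pow K. (-1) ^ card S * \<phi> (onK S x) * (if S \<subseteq> J then (-1) ^ card J else 0))"
  proof (rule sum.cong[OF refl])
    fix J assume J: "J \<in> Pow K"
    show "(-1) ^ card J * (\<Sum>c\<in>grid_cells J g.
      (if \<forall>j\<in>J. x $ j \<le> fst c $ j then 1 else 0) * qvol J (\<lambda>x. \<phi> (onK J x)) (fst c) (snd c))
      = (\<Sum>S\<in>Pow K. (-1) ^ card S * \<phi> (onK S x) * (if S \<subseteq> J then (-1) ^ card J else 0))"
      unfolding face[OF J] sum_distrib_left by (intro sum.cong) auto
  qed
  \<comment> \<open>Only \<open>S = K\<close> survives the sum over faces, and there the two signs
    cancel.\<close>
  also have "\<dots> = (\<Sum>S\<in>Pow K. (-1) ^ card S * \<phi> (onK S x) * (if S = K then (-1) ^ card K else 0))"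
    by (subst sum.swap) (intro sum.cong refl, simp only: sum_distrib_left[symmetric], subst sum_supersets_alternating, auto)
  also have "\<dots> = (\<Sum>S\<in>Pow K. if S = K then \<phi> (onK K x) else 0)"
    by (intro sum.cong) (auto simp: power_add[symmetric] mult_2[symmetric])
  also have "\<dots> = \<phi> x" using dep by simp
  finally show ?thesis by simp
qed

section \<open>Gaussian limits and second moments of iid sums\<close>

lemma real_distribution_normal_meas: "real_distribution (normal_meas v)"
proof -
  interpret real_distribution std_normal_distribution by (rule real_dist_normal_dist)
  show ?thesis unfolding normal_meas_def by (rule real_distribution_distr) simp
qed

lemma char_normal_meas:
  assumes "0 \<le> v"
  shows "char (normal_meas v) t = complex_of_real (exp (- (v * t\<^sup>2) / 2))"
proof -
  have "char (normal_meas v) t = char std_normal_distribution (t * sqrt v)"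
    unfolding normal_meas_def char_def by (subst integral_distr) (simp_all add: mult.assoc)
  also have "\<dots> = complex_of_real (exp (- (v * t\<^sup>2) / 2))"
    using assms by (simp add: char_std_normal_distribution power_mult_distrib mult.commute)
  finally show ?thesis .
qed

lemma scaled_moments:
  assumes "real_distribution Q" "integrable Q (\<lambda>x. x)" "integrable Q (\<lambda>x. x\<^sup>2)"
  shows "integrable (distr Q borel (\<lambda>x. c * x)) (\<lambda>x. x)" "integrable (distr Q borel (\<lambda>x. c * x)) (\<lambda>x. x\<^sup>2)"
    "(\<integral>x. x \<partial>distr Q borel (\<lambda>x. c * x)) = c * (\<integral>x. x \<partial>Q)"
    "(\<integral>x. x\<^sup>2 \<partial>distr Q borel (\<lambda>x. c * x)) = c\<^sup>2 * (\<integral>x. x\<^sup>2 \<partial>Q)"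
proof -
  interpret real_distribution Q by fact
  have m: "(\<lambda>x. c * x) \<in> measurable Q borel" by simp
  show "integrable (distr Q borel (\<lambda>x. c * x)) (\<lambda>x. x)"
    by (subst integrable_distr_eq[OF m]) (simp, rule integrable_mult_right[OF assms(2)])
  show "integrable (distr Q borel (\<lambda>x. c * x)) (\<lambda>x. x\<^sup>2)"
    by (subst integrable_distr_eq[OF m]) (simp, unfold power_mult_distrib, rule integrable_mult_right[OF assms(3)])
  show "(\<integral>x. x \<partial>distr Q borel (\<lambda>x. c * x)) = c * (\<integral>x. x \<partial>Q)"
    by (subst integral_distr[OF m]) auto
  show "(\<integral>x. x\<^sup>2 \<partial>distr Q borel (\<lambda>x. c * x)) = c\<^sup>2 * (\<integral>x. x\<^sup>2 \<partial>Q)"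
    by (subst integral_distr[OF m]) (auto simp: power_mult_distrib)
qed

lemma normal_meas_moments:
  assumes "0 \<le> v"
  shows "integrable (normal_meas v) (\<lambda>x. x)" "(\<integral>x. x \<partial>normal_meas v) = 0"
    "integrable (normal_meas v) (\<lambda>x. x\<^sup>2)" "(\<integral>x. x\<^sup>2 \<partial>normal_meas v) = v"
proof -
  have i: "integrable std_normal_distribution (\<lambda>x. x)" "integrable std_normal_distribution (\<lambda>x. x\<^sup>2)"
    using integrable_std_normal_distribution_moment[of 1] integrable_std_normal_distribution_moment[of 2] by simp_all
  have "(\<integral>x. x ^ (2 * 1) \<partial>std_normal_distribution) = fact (2 * 1) / (2 ^ 1 * fact 1)"
    by (rule std_normal_distribution_even_moments(1))
  then have e2: "(\<integral>x. x\<^sup>2 \<partial>std_normal_distribution) = 1" by (simp add: fact_numeral)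
  have e1: "(\<integral>x. x \<partial>std_normal_distribution) = 0"
    using integral_std_normal_distribution_moment_odd[of 1] by simp
  show "integrable (normal_meas v) (\<lambda>x. x)" "integrable (normal_meas v) (\<lambda>x. x\<^sup>2)"
    "(\<integral>x. x \<partial>normal_meas v) = 0" "(\<integral>x. x\<^sup>2 \<partial>normal_meas v) = v"
    unfolding normal_meas_def
    using scaled_moments[OF real_dist_normal_dist i, of "sqrt v"] e1 e2 assms by simp_all
qed

lemma gaussian_moments:
  assumes "Y \<in> borel_measurable N" "distr N borel Y = normal_meas v" "0 \<le> v"
  shows "integrable N Y" "(\<integral>x. Y x \<partial>N) = 0" "integrable N (\<lambda>x. (Y x)\<^sup>2)" "(\<integral>x. (Y x)\<^sup>2 \<partial>N) = v"
  using normal_meas_moments[OF assms(3)] assms(1)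
  unfolding assms(2)[symmetric]
  by (simp_all add: integrable_distr_eq integral_distr)

lemma (in prob_space) char_tendsto:
  assumes [measurable]: "\<And>n. Y n \<in> borel_measurable M" "Y' \<in> borel_measurable M"
    and lim: "AE x in M. (\<lambda>n. Y n x) \<longlonglongrightarrow> Y' x"
  shows "(\<lambda>n. char (distr M borel (Y n)) t) \<longlonglongrightarrow> char (distr M borel Y') t"
proof -
  have "(\<lambda>n. \<integral>x. iexp (t * Y n x) \<partial>M) \<longlonglongrightarrow> (\<integral>x. iexp (t * Y' x) \<partial>M)"
  proof (rule integral_dominated_convergence[where w = "\<lambda>_. 1"])
    show "AE x in M. (\<lambda>n. iexp (t * Y n x)) \<longlonglongrightarrow> iexp (t * Y' x)"
      using lim by eventually_elim (auto intro!: tendsto_intros)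
  qed auto
  then show ?thesis by (simp add: char_def integral_distr)
qed

text \<open>Almost sure limits of centred Gaussians are centred Gaussian: the characteristic function
  of the limit is nonzero near the origin, so the variances converge.\<close>
lemma gaussian_limit:
  assumes "prob_space N" and Ym: "\<And>n. Y n \<in> borel_measurable N" "Y' \<in> borel_measurable N"
    and lim: "AE x in N. (\<lambda>n. Y n x) \<longlonglongrightarrow> Y' x"
    and gauss: "\<And>n. distr N borel (Y n) = normal_meas (v n)" "\<And>n. 0 \<le> v n"
  shows "v \<longlonglongrightarrow> (\<integral>x. (Y' x)\<^sup>2 \<partial>N)" "0 \<le> (\<integral>x. (Y' x)\<^sup>2 \<partial>N)"
    "distr N borel Y' = normal_meas (\<integral>x. (Y' x)\<^sup>2 \<partial>N)"
proof -
  interpret N: prob_space N by fact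
  interpret D: real_distribution "distr N borel Y'" by (rule N.real_distribution_distr[OF Ym(2)])
  have conv: "(\<lambda>n. complex_of_real (exp (- (v n * t\<^sup>2) / 2))) \<longlonglongrightarrow> char (distr N borel Y') t" for t
    using N.char_tendsto[OF Ym lim, of t] by (simp add: gauss char_normal_meas)
  have "isCont (char (distr N borel Y')) 0" by (rule D.isCont_char)
  then have "eventually (\<lambda>t. dist (char (distr N borel Y') t) 1 < 1 / 2) (at 0)"
    using tendstoD[of "char (distr N borel Y')" 1 "at 0" "1 / 2"] D.char_zero by (simp add: isCont_def)
  then obtain d where d: "0 < d" "\<And>t. t \<noteq> 0 \<Longrightarrow> dist t 0 < d \<Longrightarrow> dist (char (distr N borel Y') t) 1 < 1 / 2"
    unfolding eventually_at by auto
  \<comment> \<open>Any nonzero argument will do at which the limiting characteristic function has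
    positive real part; the logarithm there recovers the variances.\<close>
  define t where "t = d / 2"
  have t: "t \<noteq> 0" "dist (char (distr N borel Y') t) 1 < 1 / 2" using d(1) d(2)[of t] by (auto simp: t_def)
  define r where "r = Re (char (distr N borel Y') t)"
  have "\<bar>Re (char (distr N borel Y') t - 1)\<bar> < 1 / 2"
    using t(2) abs_Re_le_cmod[of "char (distr N borel Y') t - 1"] by (simp add: dist_norm)
  then have r: "0 < r" unfolding r_def minus_complex.sel one_complex.sel by linarith
  have "(\<lambda>n. exp (- (v n * t\<^sup>2) / 2)) \<longlonglongrightarrow> r"
    using tendsto_Re[OF conv[of t]] by (simp add: r_def)
  then have "(\<lambda>n. ln (exp (- (v n * t\<^sup>2) / 2))) \<longlonglongrightarrow> ln r" using r by (intro tendsto_ln) auto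
  then have "(\<lambda>n. - (v n * t\<^sup>2) / 2) \<longlonglongrightarrow> ln r" by (simp only: ln_exp)
  from tendsto_mult[OF tendsto_const[of "- 2 / t\<^sup>2"] this]
  have v: "v \<longlonglongrightarrow> - 2 / t\<^sup>2 * ln r" using t(1) by simp
  define v' where "v' = - 2 / t\<^sup>2 * ln r"
  have v'0: "0 \<le> v'" using gauss(2) by (intro LIMSEQ_le_const[OF v[folded v'_def]]) auto
  have eq: "distr N borel Y' = normal_meas v'"
  proof (rule Levy_uniqueness[OF D.real_distribution_axioms real_distribution_normal_meas], rule ext)
    fix t
    have "(\<lambda>n. complex_of_real (exp (- (v n * t\<^sup>2) / 2))) \<longlonglongrightarrow> complex_of_real (exp (- (v' * t\<^sup>2) / 2))"
      using v[folded v'_def] by (intro tendsto_intros) auto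
    from LIMSEQ_unique[OF conv this] show "char (distr N borel Y') t = char (normal_meas v') t"
      by (simp add: char_normal_meas[OF v'0])
  qed
  have "(\<integral>x. (Y' x)\<^sup>2 \<partial>N) = v'" by (rule gaussian_moments(4)[OF Ym(2) eq v'0])
  then show "v \<longlonglongrightarrow> (\<integral>x. (Y' x)\<^sup>2 \<partial>N)" "0 \<le> (\<integral>x. (Y' x)\<^sup>2 \<partial>N)"
    "distr N borel Y' = normal_meas (\<integral>x. (Y' x)\<^sup>2 \<partial>N)"
    using v v'0 eq by (simp_all add: v'_def)
qed

lemma (in prob_space) indep_integral:
  fixes G :: "_ \<Rightarrow> real"
  assumes ind: "indep_var S X T Y" and G[measurable]: "G \<in> borel_measurable (S \<Otimes>\<^sub>M T)"
    and b: "\<And>x. \<bar>G x\<bar> \<le> b"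
  shows "(\<integral>\<xi>. G (X \<xi>, Y \<xi>) \<partial>M) = (\<integral>\<xi>. (\<integral>x. G (x, Y \<xi>) \<partial>distr M S X) \<partial>M)"
proof -
  have [measurable]: "random_variable S X" "random_variable T Y"
    and eq: "distr M S X \<Otimes>\<^sub>M distr M T Y = distr M (S \<Otimes>\<^sub>M T) (\<lambda>x. (X x, Y x))"
    using ind unfolding indep_var_distribution_eq by auto
  interpret X: prob_space "distr M S X" by (rule prob_space_distr) simp
  interpret Y: prob_space "distr M T Y" by (rule prob_space_distr) simp
  interpret XY: pair_prob_space "distr M S X" "distr M T Y" ..
  have "(\<integral>\<xi>. G (X \<xi>, Y \<xi>) \<partial>M) = (\<integral>z. G z \<partial>(distr M S X \<Otimes>\<^sub>M distr M T Y))"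
    unfolding eq by (subst integral_distr) auto
  also have "\<dots> = (\<integral>y. (\<integral>x. G (x, y) \<partial>distr M S X) \<partial>distr M T Y)"
  proof -
    have "integrable (distr M S X \<Otimes>\<^sub>M distr M T Y) G"
      by (rule XY.integrable_const_bound[where B = b]) (use b in auto)
    then show ?thesis using XY.integral_snd[of "\<lambda>x y. G (x, y)"] by (simp add: split_def)
  qed
  also have "\<dots> = (\<integral>\<xi>. (\<integral>x. G (x, Y \<xi>) \<partial>distr M S X) \<partial>M)"
    by (subst integral_distr) auto
  finally show ?thesis .
qed

section \<open>Second moments of iid sums, evaluated at an observation\<close>

locale iid_seq = prob_space M for M :: "'a measure" +
  fixes E :: "nat \<Rightarrow> 'a \<Rightarrow> 'e::second_countable_topology" and Pd :: "'e measure"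
  assumes indep: "indep_vars (\<lambda>_. borel) E UNIV"
    and law: "\<And>j. distr M borel (E j) = Pd"
begin

lemma E_measurable [measurable]: "E j \<in> borel_measurable M"
  using indep by (auto simp: indep_vars_def)

lemma sets_Pd [measurable_cong]: "sets Pd = sets borel"
  using law[of 0] by (metis sets_distr)

lemma prob_space_Pd: "prob_space Pd"
  using law[of 0] prob_space_distr[OF E_measurable[of 0]] by simp

lemma integral_one:
  assumes "f \<in> borel_measurable borel"
  shows "(\<integral>\<xi>. f (E j \<xi>) \<partial>M) = (\<integral>x. (f x :: real) \<partial>Pd)"
  using assms unfolding law[of j, symmetric] by (subst integral_distr) auto

lemma integral_pair:
  assumes "i \<noteq> j" "G \<in> borel_measurable (borel \<Otimes>\<^sub>M borel)" "\<And>x. \<bar>G x\<bar> \<le> (b::real)"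
  shows "(\<integral>\<xi>. G (E j \<xi>, E i \<xi>) \<partial>M) = (\<integral>\<xi>. (\<integral>x. G (x, E i \<xi>) \<partial>Pd) \<partial>M)"
proof -
  have "indep_var borel ((\<lambda>f. f j) \<circ> (\<lambda>\<xi>. restrict (\<lambda>i. E i \<xi>) {j}))
     borel ((\<lambda>f. f i) \<circ> (\<lambda>\<xi>. restrict (\<lambda>i. E i \<xi>) {i}))"
    using assms(1) by (intro indep_var_compose[OF indep_var_restrict[OF indep]]) auto
  then have "indep_var borel (E j) borel (E i)" by (simp add: comp_def)
  from indep_integral[OF this assms(2,3)] show ?thesis by (simp add: law)
qed

lemma integral_triple:
  assumes "j \<noteq> i" "j \<noteq> l" "G \<in> borel_measurable (borel \<Otimes>\<^sub>M (borel \<Otimes>\<^sub>M borel))" "\<And>x. \<bar>G x\<bar> \<le> (b::real)"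
  shows "(\<integral>\<xi>. G (E j \<xi>, (E i \<xi>, E l \<xi>)) \<partial>M) = (\<integral>\<xi>. (\<integral>x. G (x, (E i \<xi>, E l \<xi>)) \<partial>Pd) \<partial>M)"
proof -
  note [measurable] = assms(3)
  \<comment> \<open>The two variables of \<open>indep_var\<close> share one value type, so
    \<open>E j\<close> is doubled to match the pair.\<close>
  have "indep_var (borel \<Otimes>\<^sub>M borel) ((\<lambda>f. (f j, f j)) \<circ> (\<lambda>\<xi>. restrict (\<lambda>i. E i \<xi>) {j}))
     (borel \<Otimes>\<^sub>M borel) ((\<lambda>f. (f i, f l)) \<circ> (\<lambda>\<xi>. restrict (\<lambda>i. E i \<xi>) {i, l}))"
    using assms(1,2) by (intro indep_var_compose[OF indep_var_restrict[OF indep]]) auto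
  then have ind: "indep_var (borel \<Otimes>\<^sub>M borel) (\<lambda>\<xi>. (E j \<xi>, E j \<xi>)) (borel \<Otimes>\<^sub>M borel) (\<lambda>\<xi>. (E i \<xi>, E l \<xi>))"
    by (simp add: comp_def)
  have "(\<integral>\<xi>. G (E j \<xi>, (E i \<xi>, E l \<xi>)) \<partial>M)
     = (\<integral>\<xi>. (\<integral>x. G (fst x, (E i \<xi>, E l \<xi>)) \<partial>distr M (borel \<Otimes>\<^sub>M borel) (\<lambda>\<xi>. (E j \<xi>, E j \<xi>))) \<partial>M)"
    using indep_integral[OF ind, of "\<lambda>z. G (fst (fst z), snd z)" b] assms(4) by simp
  also have "\<dots> = (\<integral>\<xi>. (\<integral>x. G (x, (E i \<xi>, E l \<xi>)) \<partial>Pd) \<partial>M)"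
    by (intro Bochner_Integration.integral_cong refl) (simp add: integral_distr law[of j, symmetric])
  finally show ?thesis .
qed

text \<open>The second argument is an observation from the same sample. The terms with
  \<open>j \<noteq> i\<close> have vanishing cross moments, by integrating out one of the two free
  observations, so only their variances remain. The term \<open>j = i\<close> is merely bounded by
  \<open>b\<close>, which costs order \<open>1 / n\<close>.\<close>

lemma second_moment_at_sample:
  fixes f :: "'e \<Rightarrow> 'e \<Rightarrow> real"
  assumes f[measurable]: "(\<lambda>(x, y). f x y) \<in> borel_measurable (borel \<Otimes>\<^sub>M borel)"
    and b: "\<And>x y. \<bar>f x y\<bar> \<le> b" and zero: "\<And>y. (\<integral>x. f x y \<partial>Pd) = 0"
    and s: "\<And>y. (\<integral>x. (f x y)\<^sup>2 \<partial>Pd) \<le> s" and i: "i < n"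
  shows "integrable M (\<lambda>\<xi>. ((\<Sum>j<n. f (E j \<xi>) (E i \<xi>)) / sqrt (real n))\<^sup>2)"
    "(\<integral>\<xi>. ((\<Sum>j<n. f (E j \<xi>) (E i \<xi>)) / sqrt (real n))\<^sup>2 \<partial>M) \<le> 2 * s + 2 * b\<^sup>2 / real n"
proof -
  interpret Pd: prob_space Pd by (rule prob_space_Pd)
  have fm[measurable]: "(\<lambda>\<xi>. f (E j \<xi>) (E l \<xi>)) \<in> borel_measurable M" for j l
    using measurable_compose[OF measurable_Pair[OF E_measurable[of j] E_measurable[of l]] f] by simp
  have fm2[measurable]: "(\<lambda>x. f (h x) (h' x)) \<in> borel_measurable Q"
    if "h \<in> borel_measurable Q" "h' \<in> borel_measurable Q" for h h' and Q :: "'c measure"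
    using measurable_compose[OF measurable_Pair[OF that] f] by simp
  have b0: "0 \<le> b" using b[of undefined undefined] by linarith
  have b2: "\<bar>x * y\<bar> \<le> b * b" if "\<bar>x\<bar> \<le> b" "\<bar>y\<bar> \<le> b" for x y :: real
    unfolding abs_mult using that b0 by (intro mult_mono) auto
  define T where "T \<xi> = (\<Sum>j\<in>{..<n} - {i}. f (E j \<xi>) (E i \<xi>))" for \<xi>
  have Tb: "\<bar>T \<xi>\<bar> \<le> real n * b" for \<xi>
  proof -
    have "\<bar>T \<xi>\<bar> \<le> (\<Sum>j\<in>{..<n} - {i}. b)" unfolding T_def
      by (rule order_trans[OF sum_abs]) (intro sum_mono b)
    also have "\<dots> \<le> real n * b" using b0 i by (simp add: mult_right_mono)
    finally show ?thesis .
  qed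
  have T_int: "integrable M (\<lambda>\<xi>. (T \<xi>)\<^sup>2)"
  proof (rule integrable_const_bound[where B = "(real n * b)\<^sup>2"])
    show "AE \<xi> in M. norm ((T \<xi>)\<^sup>2) \<le> (real n * b)\<^sup>2"
      using Tb by (auto simp: abs_le_square_iff[symmetric] b0)
  qed (simp add: T_def)
  have cross: "(\<integral>\<xi>. f (E j \<xi>) (E i \<xi>) * f (E l \<xi>) (E i \<xi>) \<partial>M) = 0"
    if "j \<noteq> i" "l \<noteq> i" "j \<noteq> l" for j l
  proof -
    have "(\<integral>\<xi>. f (E j \<xi>) (E i \<xi>) * f (E l \<xi>) (E i \<xi>) \<partial>M)
        = (\<integral>\<xi>. (\<integral>x. f x (E i \<xi>) * f (E l \<xi>) (E i \<xi>) \<partial>Pd) \<partial>M)"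
      using integral_triple[OF that(1,3), of "\<lambda>x. f (fst x) (fst (snd x)) * f (snd (snd x)) (fst (snd x))" "b * b"]
        b2[OF b b] by simp
    also have "\<dots> = 0" by (simp add: zero)
    finally show ?thesis .
  qed
  have diag: "(\<integral>\<xi>. f (E j \<xi>) (E i \<xi>) * f (E j \<xi>) (E i \<xi>) \<partial>M) \<le> s" if "j \<noteq> i" for j
  proof -
    have "(\<integral>\<xi>. f (E j \<xi>) (E i \<xi>) * f (E j \<xi>) (E i \<xi>) \<partial>M) = (\<integral>\<xi>. (\<integral>x. (f x (E i \<xi>))\<^sup>2 \<partial>Pd) \<partial>M)"
      using integral_pair[OF that[symmetric], where G = "\<lambda>x. f (fst x) (snd x) * f (fst x) (snd x)", OF _ b2[OF b b]]
      by (simp add: power2_eq_square)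
    also have "\<dots> \<le> (\<integral>\<xi>. s \<partial>M)"
    proof (rule integral_mono)
      have "(\<lambda>y. \<integral>x. (f x y)\<^sup>2 \<partial>Pd) \<in> borel_measurable borel"
        by (rule Pd.borel_measurable_lebesgue_integral) measurable
      then have "(\<lambda>\<xi>. \<integral>x. (f x (E i \<xi>))\<^sup>2 \<partial>Pd) \<in> borel_measurable M"
        by measurable
      then show "integrable M (\<lambda>\<xi>. \<integral>x. (f x (E i \<xi>))\<^sup>2 \<partial>Pd)"
        by (rule integrable_const_bound[where B = s, rotated]) (use s in simp)
    qed (use s in auto)
    also have "\<dots> = s" by (simp add: prob_space)
    finally show ?thesis .
  qed
  have s0: "0 \<le> s" using s[of undefined] by (rule order_trans[rotated]) simp
  have "(\<integral>\<xi>. (T \<xi>)\<^sup>2 \<partial>M) = (\<integral>\<xi>. (\<Sum>j\<in>{..<n} - {i}. \<Sum>l\<in>{..<n} - {i}. f (E j \<xi>) (E i \<xi>) * f (E l \<xi>) (E i \<xi>)) \<partial>M)"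
    by (simp add: T_def power2_eq_square sum_product)
  also have "\<dots> = (\<Sum>j\<in>{..<n} - {i}. \<Sum>l\<in>{..<n} - {i}. \<integral>\<xi>. f (E j \<xi>) (E i \<xi>) * f (E l \<xi>) (E i \<xi>) \<partial>M)"
    by (intro Bochner_Integration.integral_sum[THEN trans] sum.cong refl Bochner_Integration.integrable_sum
        integrable_const_bound[where B = "b * b"]) (use b2[OF b b] in auto)
  also have "\<dots> \<le> (\<Sum>j\<in>{..<n} - {i}. \<Sum>l\<in>{..<n} - {i}. if l = j then s else 0)"
    using cross diag by (intro sum_mono) auto
  also have "\<dots> \<le> real n * s" using s0 i by (simp add: mult_right_mono)
  finally have ET: "(\<integral>\<xi>. (T \<xi>)\<^sup>2 \<partial>M) \<le> real n * s" .
  have split: "(\<Sum>j<n. f (E j \<xi>) (E i \<xi>)) = f (E i \<xi>) (E i \<xi>) + T \<xi>" for \<xi>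
    unfolding T_def using i by (subst sum.remove[of _ i]) auto
  have n: "0 < real n" using i by simp
  have dom: "((\<Sum>j<n. f (E j \<xi>) (E i \<xi>)) / sqrt (real n))\<^sup>2 \<le> (2 * b\<^sup>2 + 2 * (T \<xi>)\<^sup>2) / real n" for \<xi>
  proof -
    have "0 \<le> (f (E i \<xi>) (E i \<xi>) - T \<xi>)\<^sup>2" by simp
    then have "(f (E i \<xi>) (E i \<xi>) + T \<xi>)\<^sup>2 \<le> 2 * (f (E i \<xi>) (E i \<xi>))\<^sup>2 + 2 * (T \<xi>)\<^sup>2"
      by (simp add: power2_eq_square algebra_simps)
    also have "(f (E i \<xi>) (E i \<xi>))\<^sup>2 \<le> b\<^sup>2" using b[of "E i \<xi>" "E i \<xi>"] b0 by (simp add: abs_le_square_iff[symmetric])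
    finally show ?thesis unfolding split power_divide using n by (simp add: divide_right_mono)
  qed
  have di: "integrable M (\<lambda>\<xi>. (2 * b\<^sup>2 + 2 * (T \<xi>)\<^sup>2) / real n)"
    using T_int by auto
  show int: "integrable M (\<lambda>\<xi>. ((\<Sum>j<n. f (E j \<xi>) (E i \<xi>)) / sqrt (real n))\<^sup>2)"
    by (rule Bochner_Integration.integrable_bound[OF di]) (use dom in \<open>auto simp: abs_of_nonneg\<close>)
  have "(\<integral>\<xi>. ((\<Sum>j<n. f (E j \<xi>) (E i \<xi>)) / sqrt (real n))\<^sup>2 \<partial>M) \<le> (\<integral>\<xi>. (2 * b\<^sup>2 + 2 * (T \<xi>)\<^sup>2) / real n \<partial>M)"
    using int di dom by (rule integral_mono)
  also have "\<dots> = (2 * b\<^sup>2 + 2 * (\<integral>\<xi>. (T \<xi>)\<^sup>2 \<partial>M)) / real n"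
    using T_int by (simp add: prob_space)
  also have "\<dots> \<le> (2 * b\<^sup>2 + 2 * (real n * s)) / real n" using ET n by (intro divide_right_mono) auto
  also have "\<dots> = 2 * s + 2 * b\<^sup>2 / real n" using n by (simp add: add_divide_distrib)
  finally show "(\<integral>\<xi>. ((\<Sum>j<n. f (E j \<xi>) (E i \<xi>)) / sqrt (real n))\<^sup>2 \<partial>M) \<le> 2 * s + 2 * b\<^sup>2 / real n" .
qed

end

section \<open>The sampling model\<close>

lemma borel_measurable_vec_lambda [measurable]:
  assumes "\<And>k. (\<lambda>x. f x k) \<in> borel_measurable M"
  shows "(\<lambda>x. (\<chi> k. f x k) :: real^'p::finite) \<in> borel_measurable M"
proof (subst borel_measurable_euclidean_space, intro ballI)
  fix i :: "real^'p" assume "i \<in> Basis"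
  then obtain k where "i = axis k 1" by (auto simp: Basis_vec_def)
  then show "(\<lambda>x. (\<chi> k. f x k) \<bullet> i) \<in> borel_measurable M" using assms by (simp add: inner_axis)
qed

lemma borel_measurable_vec_nth [measurable]:
  "f \<in> borel_measurable M \<Longrightarrow> (\<lambda>x. (f x :: real^'p::finite) $ k) \<in> borel_measurable M"
  by (rule borel_measurable_continuous_on[of "\<lambda>x. x $ k"]) (auto intro!: continuous_intros)

lemma borel_measurable_vupd [measurable]:
  assumes [measurable]: "f \<in> borel_measurable M" "h \<in> borel_measurable M"
  shows "(\<lambda>x. vupd (f x) k (h x)) \<in> borel_measurable M"
  unfolding vupd_def by measurable

lemma borel_measurable_vmix [measurable]:
  assumes [measurable]: "f \<in> borel_measurable M" "h \<in> borel_measurable M"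
  shows "(\<lambda>x. vmix S (f x) (h x)) \<in> borel_measurable M"
  unfolding vmix_def by measurable

lemma measurable_fst_snd_borel [measurable]:
  "fst \<in> borel_measurable (borel :: ('c::second_countable_topology \<times> 'd::second_countable_topology) measure)"
  "snd \<in> borel_measurable (borel :: ('c::second_countable_topology \<times> 'd::second_countable_topology) measure)"
  unfolding borel_prod[symmetric] by measurable

section \<open>The transformed sample and its law\<close>

locale cop_data = prob_space M for M :: "'a measure" +
  fixes X :: "'a \<Rightarrow> real^'p::finite" and Z :: "'a \<Rightarrow> real^'q::finite"
    and Xs :: "nat \<Rightarrow> 'a \<Rightarrow> real^'p" and Zs :: "nat \<Rightarrow> 'a \<Rightarrow> real^'q"
    and A :: "(real^'q) set"
  assumes X_meas [measurable]: "X \<in> borel_measurable M" and Z_meas [measurable]: "Z \<in> borel_measurable M"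
    and Xs_meas [measurable]: "\<And>i. Xs i \<in> borel_measurable M"
    and Zs_meas [measurable]: "\<And>i. Zs i \<in> borel_measurable M"
    and XZ_indep: "indep_vars (\<lambda>_. borel) (\<lambda>i \<xi>. (Xs i \<xi>, Zs i \<xi>)) UNIV"
    and XZ_law: "\<And>i. distr M borel (\<lambda>\<xi>. (Xs i \<xi>, Zs i \<xi>)) = distr M borel (\<lambda>\<xi>. (X \<xi>, Z \<xi>))"
    and A_sets [measurable]: "A \<in> sets borel"
    and pA_pos: "pA M Z A > 0"
    and F_cont: "\<And>k. continuous_on UNIV (condF M X Z A k)"
    and cond_C: "condition_C M X Z A"
begin

abbreviation "p \<equiv> pA M Z A"
abbreviation "D \<equiv> DA M X Z A"
abbreviation "F \<equiv> condF M X Z A"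
abbreviation "U \<equiv> UA M X Z A"

text \<open>The value 0 off the open interval keeps \<open>g\<close> bounded and Borel on the cube;
  at the ends \<open>pdD\<close> is a two-sided derivative that may not exist.\<close>

definition g :: "'p \<Rightarrow> real^'p \<Rightarrow> real" where
  "g k u = (if 0 < u $ k \<and> u $ k < 1 then pdD M X Z A k u else 0)"

definition Us :: "nat \<Rightarrow> 'a \<Rightarrow> real^'p" where
  "Us j \<xi> = (\<chi> k. F k (Xs j \<xi> $ k))"

definition E :: "nat \<Rightarrow> 'a \<Rightarrow> (real^'p) \<times> (real^'q)" where
  "E j \<xi> = (Us j \<xi>, Zs j \<xi>)"

definition Pd :: "((real^'p) \<times> (real^'q)) measure" where
  "Pd = distr M borel (\<lambda>\<xi>. (U \<xi>, Z \<xi>))"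

definition Ind :: "'p \<Rightarrow> real \<Rightarrow> (real^'p) \<times> (real^'q) \<Rightarrow> real" where
  "Ind k t e = (if fst e $ k \<le> t \<and> snd e \<in> A then 1 else 0)"

definition H :: "(real^'p) \<times> (real^'q) \<Rightarrow> real^'p \<Rightarrow> real" where
  "H e u = (if (\<forall>k. fst e $ k \<le> u $ k) \<and> snd e \<in> A then 1 else 0)"

lemma F_meas [measurable]: "F k \<in> borel_measurable borel"
  using F_cont by (rule borel_measurable_continuous_onI)

lemma U_meas [measurable]: "U \<in> borel_measurable M"
  unfolding UA_def by measurable

lemma F_mono: "s \<le> t \<Longrightarrow> F k s \<le> F k t"
  unfolding condF_def using pA_pos by (intro divide_right_mono finite_measure_mono) auto

lemma F_bounds: "0 \<le> F k t" "F k t \<le> 1"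
proof -
  show "0 \<le> F k t" unfolding condF_def using pA_pos by (intro divide_nonneg_pos) auto
  have "measure M {\<xi> \<in> space M. X \<xi> $ k \<le> t \<and> Z \<xi> \<in> A} \<le> p"
    unfolding pA_def by (intro finite_measure_mono) auto
  then show "F k t \<le> 1" unfolding condF_def using pA_pos by (simp add: divide_le_eq)
qed

lemma U_cube: "U \<xi> \<in> unitcube" and Us_cube: "Us j \<xi> \<in> unitcube"
  using F_bounds by (auto simp: unitcube_iff UA_def Us_def)

text \<open>\<open>F k\<close> is the distribution function of the k-th coordinate under the
  conditional law given that \<open>Z\<close> lies in \<open>A\<close>, realised as a uniform
  measure on that event.\<close>

lemma F_limits: "(F k \<longlongrightarrow> 0) at_bot" "(F k \<longlongrightarrow> 1) at_top"
proof -
  define Ae where "Ae = {\<xi> \<in> space M. Z \<xi> \<in> A}"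
  have Ae[measurable]: "Ae \<in> sets M" unfolding Ae_def by measurable
  have em: "emeasure M Ae \<noteq> 0" using pA_pos by (simp add: emeasure_eq_measure pA_def Ae_def)
  define Q where "Q = uniform_measure M Ae"
  interpret Q: prob_space Q unfolding Q_def by (rule prob_space_uniform_measure) (use em in auto)
  have sQ [measurable_cong]: "sets Q = sets M" by (simp add: Q_def)
  have sp: "space Q = space M" by (simp add: Q_def)
  have Xk: "(\<lambda>\<xi>. X \<xi> $ k) \<in> borel_measurable Q" by measurable
  interpret R: real_distribution "distr Q borel (\<lambda>\<xi>. X \<xi> $ k)" by (rule Q.real_distribution_distr[OF Xk])
  have "cdf (distr Q borel (\<lambda>\<xi>. X \<xi> $ k)) t = F k t" for t
  proof -
    have "cdf (distr Q borel (\<lambda>\<xi>. X \<xi> $ k)) t = measure Q {\<xi> \<in> space M. X \<xi> $ k \<le> t}"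
      unfolding cdf_def by (subst measure_distr[OF Xk]) (auto simp: sp intro!: arg_cong[where f = "measure Q"])
    also have "\<dots> = measure M (Ae \<inter> {\<xi> \<in> space M. X \<xi> $ k \<le> t}) / measure M Ae"
      unfolding Q_def by (subst measure_uniform_measure) (use em in auto)
    also have "Ae \<inter> {\<xi> \<in> space M. X \<xi> $ k \<le> t} = {\<xi> \<in> space M. X \<xi> $ k \<le> t \<and> Z \<xi> \<in> A}" by (auto simp: Ae_def)
    finally show ?thesis by (simp add: condF_def pA_def Ae_def)
  qed
  then have "cdf (distr Q borel (\<lambda>\<xi>. X \<xi> $ k)) = F k" by auto
  then show "(F k \<longlongrightarrow> 0) at_bot" "(F k \<longlongrightarrow> 1) at_top"
    using R.cdf_lim_at_bot R.cdf_lim_at_top_prob by auto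
qed

text \<open>The probability integral transform. By continuity the sublevel set of \<open>F k\<close>
  at \<open>t\<close> is a closed half line with \<open>F k\<close> equal to \<open>t\<close> at its
  end point, even if \<open>F k\<close> has flat pieces.\<close>

lemma prob_transform_inner:
  assumes t: "0 < t" "t < 1"
  shows "measure M {\<xi> \<in> space M. U \<xi> $ k \<le> t \<and> Z \<xi> \<in> A} = p * t"
proof -
  have "eventually (\<lambda>x. F k x < t) at_bot" using order_tendstoD(2)[OF F_limits(1)] t by auto
  then obtain x0 where x0: "F k x0 < t" unfolding eventually_at_bot_linorder by blast
  have "eventually (\<lambda>x. t < F k x) at_top" using order_tendstoD(1)[OF F_limits(2)] t by auto
  then obtain y0 where y0: "t < F k y0" unfolding eventually_at_top_linorder by blast
  define S where "S = {x. F k x \<le> t}"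
  have "x0 \<le> y0" using x0 y0 F_mono[of y0 x0 k] by (meson less_le_trans nle_le not_less_iff_gr_or_eq order_less_imp_le)
  then obtain x1 where x1: "F k x1 = t"
    using IVT'[of "F k" x0 t y0] x0 y0 continuous_on_subset[OF F_cont] by auto
  have "closed S"
  proof -
    have "S = F k -` {..t}" by (auto simp: S_def)
    moreover have "closed (F k -` {..t})"
      using continuous_closed_vimage[of "{..t}" "F k"] F_cont by (auto simp: continuous_on_eq_continuous_at)
    ultimately show ?thesis by simp
  qed
  moreover have bdd: "bdd_above S"
    unfolding bdd_above_def S_def using y0 F_mono[of y0] by (metis mem_Collect_eq less_le_trans nle_le not_less)
  moreover have "x1 \<in> S" using x1 by (simp add: S_def)
  ultimately have sS: "Sup S \<in> S" by (intro closed_contains_Sup) auto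
  have "x1 \<le> Sup S" using \<open>x1 \<in> S\<close> bdd by (rule cSup_upper)
  then have Fs: "F k (Sup S) = t" using sS x1 F_mono[of x1 "Sup S" k] by (simp add: S_def)
  have "F k x \<le> t \<longleftrightarrow> x \<le> Sup S" for x
    using cSup_upper[OF _ bdd, of x] F_mono[of x "Sup S" k] Fs by (auto simp: S_def)
  then have "{\<xi> \<in> space M. U \<xi> $ k \<le> t \<and> Z \<xi> \<in> A} = {\<xi> \<in> space M. X \<xi> $ k \<le> Sup S \<and> Z \<xi> \<in> A}"
    by (simp add: UA_def)
  then show ?thesis using Fs pA_pos by (simp add: condF_def field_simps)
qed

text \<open>At \<open>t = 0\<close> the sublevel set of \<open>F k\<close> may be empty, so the
  value is squeezed from above by small positive levels.\<close>

lemma prob_transform: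
  "measure M {\<xi> \<in> space M. U \<xi> $ k \<le> t \<and> Z \<xi> \<in> A} = p * max 0 (min 1 t)"
proof -
  consider "t < 0" | "t = 0" | "0 < t" "t < 1" | "1 \<le> t" by linarith
  then show ?thesis
  proof cases
    case 1
    have "\<not> U \<xi> $ k \<le> t" for \<xi> using 1 U_cube[of \<xi>] unitcube_iff by (metis not_le less_le_trans)
    then show ?thesis using 1 by simp
  next
    case 2
    have "measure M {\<xi> \<in> space M. U \<xi> $ k \<le> 0 \<and> Z \<xi> \<in> A} \<le> p * r" if "0 < r" "r < 1" for r
      unfolding prob_transform_inner[OF that, of k, symmetric] using that by (intro finite_measure_mono) auto
    then have "measure M {\<xi> \<in> space M. U \<xi> $ k \<le> 0 \<and> Z \<xi> \<in> A} \<le> 0 + e" if "0 < e" for e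
    proof -
      define r where "r = min (1 / 2) (e / p)"
      have "0 < r" "r < 1" "p * r \<le> e" using that pA_pos by (auto simp: r_def min_def field_simps)
      then show ?thesis
        using \<open>\<And>r. 0 < r \<Longrightarrow> r < 1 \<Longrightarrow> measure M {\<xi> \<in> space M. U \<xi> $ k \<le> 0 \<and> Z \<xi> \<in> A} \<le> p * r\<close>[of r] by simp
    qed
    then have "measure M {\<xi> \<in> space M. U \<xi> $ k \<le> 0 \<and> Z \<xi> \<in> A} \<le> 0" by (rule field_le_epsilon)
    then show ?thesis using 2 measure_nonneg[of M "{\<xi> \<in> space M. U \<xi> $ k \<le> 0 \<and> Z \<xi> \<in> A}"] by simp
  next
    case 3 then show ?thesis using prob_transform_inner by simp
  next
    case 4
    then have "U \<xi> $ k \<le> t" for \<xi> using U_cube[of \<xi>] unitcube_iff order_trans by metis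
    then show ?thesis using 4 by (simp add: pA_def)
  qed
qed

lemma sets_Pd' [measurable_cong]: "sets Pd = sets borel"
  by (simp add: Pd_def)

lemma law_E: "distr M borel (E j) = Pd"
proof -
  define \<Phi> where "\<Phi> = (\<lambda>(x :: real^'p, z :: real^'q). ((\<chi> k. F k (x $ k)) :: real^'p, z))"
  have [measurable]: "\<Phi> \<in> borel_measurable borel"
    unfolding \<Phi>_def borel_prod[symmetric] by measurable
  have "distr M borel (E j) = distr (distr M borel (\<lambda>\<xi>. (Xs j \<xi>, Zs j \<xi>))) borel \<Phi>"
  proof -
    have "E j = \<Phi> \<circ> (\<lambda>\<xi>. (Xs j \<xi>, Zs j \<xi>))" by (auto simp: E_def Us_def \<Phi>_def)
    then show ?thesis by (subst distr_distr) (auto intro!: borel_measurable_Pair)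
  qed
  also have "\<dots> = Pd" unfolding XZ_law Pd_def
  proof -
    have "(\<lambda>\<xi>. (U \<xi>, Z \<xi>)) = \<Phi> \<circ> (\<lambda>\<xi>. (X \<xi>, Z \<xi>))" by (auto simp: UA_def \<Phi>_def)
    then show "distr (distr M borel (\<lambda>\<xi>. (X \<xi>, Z \<xi>))) borel \<Phi> = distr M borel (\<lambda>\<xi>. (U \<xi>, Z \<xi>))"
      by (subst distr_distr) (auto intro!: borel_measurable_Pair)
  qed
  finally show ?thesis .
qed

lemma indep_E: "indep_vars (\<lambda>_. borel) E UNIV"
proof -
  define \<Phi> where "\<Phi> = (\<lambda>(x :: real^'p, z :: real^'q). ((\<chi> k. F k (x $ k)) :: real^'p, z))"
  have [measurable]: "\<Phi> \<in> borel_measurable borel"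
    unfolding \<Phi>_def borel_prod[symmetric] by measurable
  have "indep_vars (\<lambda>_. borel) (\<lambda>i \<xi>. \<Phi> (Xs i \<xi>, Zs i \<xi>)) UNIV"
    by (rule indep_vars_compose2[OF XZ_indep]) simp
  then show ?thesis by (simp add: \<Phi>_def E_def[abs_def] Us_def)
qed

sublocale iid_seq M E Pd
  by unfold_locales (use indep_E law_E in auto)

sublocale Pd: prob_space Pd
  by (rule prob_space_Pd)

lemma Ind_meas [measurable]: "(\<lambda>z. Ind k (fst z) (snd z)) \<in> borel_measurable (borel \<Otimes>\<^sub>M borel)"
  unfolding Ind_def by measurable

lemma H_meas [measurable]: "(\<lambda>z. H (fst z) (snd z)) \<in> borel_measurable (borel \<Otimes>\<^sub>M borel)"
  unfolding H_def by measurable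

lemma H_meas1 [measurable]: "h \<in> borel_measurable Q \<Longrightarrow> v \<in> borel_measurable Q \<Longrightarrow> (\<lambda>x. H (h x) (v x)) \<in> borel_measurable Q"
  using measurable_compose[OF measurable_Pair H_meas, of h Q v] by simp

lemma Ind_meas1 [measurable]: "h \<in> borel_measurable Q \<Longrightarrow> (\<lambda>x. Ind k t (h x)) \<in> borel_measurable Q"
  using measurable_compose[OF measurable_Pair Ind_meas, of "\<lambda>_. t" Q h] by simp

lemma integral_Ind: "(\<integral>e. Ind k t e \<partial>Pd) = p * max 0 (min 1 t)"
proof -
  have "(\<integral>e. Ind k t e \<partial>Pd) = (\<integral>\<xi>. Ind k t (U \<xi>, Z \<xi>) \<partial>M)"
    unfolding Pd_def by (subst integral_distr) (auto intro!: borel_measurable_Pair)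
  also have "\<dots> = (\<integral>\<xi>. indicator {\<xi> \<in> space M. U \<xi> $ k \<le> t \<and> Z \<xi> \<in> A} \<xi> \<partial>M)"
    by (intro Bochner_Integration.integral_cong) (auto simp: Ind_def)
  also have "\<dots> = measure M {\<xi> \<in> space M. U \<xi> $ k \<le> t \<and> Z \<xi> \<in> A}" by simp
  finally show ?thesis by (simp add: prob_transform)
qed

lemma integral_H: "(\<integral>e. H e u \<partial>Pd) = D u"
proof -
  have "(\<integral>e. H e u \<partial>Pd) = (\<integral>\<xi>. H (U \<xi>, Z \<xi>) u \<partial>M)"
    unfolding Pd_def by (subst integral_distr) (auto intro!: borel_measurable_Pair)
  also have "\<dots> = (\<integral>\<xi>. indicator {\<xi> \<in> space M. (\<forall>k. U \<xi> $ k \<le> u $ k) \<and> Z \<xi> \<in> A} \<xi> \<partial>M)"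
    by (intro Bochner_Integration.integral_cong) (auto simp: H_def)
  also have "\<dots> = D u" unfolding DA_def by simp
  finally show ?thesis .
qed

lemma H_bounds: "0 \<le> H e u" "H e u \<le> 1" "\<bar>H e u\<bar> \<le> 1"
  by (auto simp: H_def)

lemma H_integrable: "integrable Pd (\<lambda>e. H e u)"
  by (rule Pd.integrable_const_bound[where B = 1]) (auto simp: H_bounds)

lemma Ind_integrable: "integrable Pd (Ind k t)"
  by (rule Pd.integrable_const_bound[where B = 1]) (auto simp: Ind_def)

text \<open>Two lower orthants differ only inside the coordinate strips between them, and uniform
  margins give a strip mass at most \<open>p\<close> times its width.\<close>

lemma H_diff: "(\<integral>e. \<bar>H e u - H e v\<bar> \<partial>Pd) \<le> p * (\<Sum>k\<in>UNIV. \<bar>u $ k - v $ k\<bar>)"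
proof -
  have pt: "\<bar>H e u - H e v\<bar> \<le> (\<Sum>k\<in>UNIV. \<bar>Ind k (u $ k) e - Ind k (v $ k) e\<bar>)" for e
  proof (cases "H e u = H e v")
    case True then show ?thesis by (simp add: sum_nonneg)
  next
    case False
    then obtain k where "snd e \<in> A" "(fst e $ k \<le> u $ k) \<noteq> (fst e $ k \<le> v $ k)"
      unfolding H_def by metis
    then have "1 \<le> \<bar>Ind k (u $ k) e - Ind k (v $ k) e\<bar>" by (auto simp: Ind_def)
    also have "\<dots> \<le> (\<Sum>k\<in>UNIV. \<bar>Ind k (u $ k) e - Ind k (v $ k) e\<bar>)"
      by (rule member_le_sum) auto
    finally show ?thesis by (auto simp: H_def)
  qed
  have each: "(\<integral>e. \<bar>Ind k s e - Ind k t e\<bar> \<partial>Pd) \<le> p * \<bar>s - t\<bar>" for k s t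
  proof -
    have main: "(\<integral>e. \<bar>Ind k t e - Ind k s e\<bar> \<partial>Pd) \<le> p * (t - s)" if "s \<le> t" for s t
    proof -
      have "\<bar>Ind k t e - Ind k s e\<bar> = Ind k t e - Ind k s e" for e using that by (auto simp: Ind_def)
      then have "(\<integral>e. \<bar>Ind k t e - Ind k s e\<bar> \<partial>Pd) = p * max 0 (min 1 t) - p * max 0 (min 1 s)"
        by (simp add: Bochner_Integration.integral_diff Ind_integrable integral_Ind)
      also have "\<dots> = p * (max 0 (min 1 t) - max 0 (min 1 s))" by (simp add: right_diff_distrib)
      also have "\<dots> \<le> p * (t - s)" using pA_pos that by (intro mult_left_mono) auto
      finally show ?thesis .
    qed
    show ?thesis
    proof (cases "s \<le> t")
      case True then show ?thesis using main[OF True] by (simp add: abs_minus_commute)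
    next
      case False then show ?thesis using main[of t s] by simp
    qed
  qed
  have int: "integrable Pd (\<lambda>e. \<bar>Ind k s e - Ind k t e\<bar>)" for k s t
    using Ind_integrable by (intro integrable_abs Bochner_Integration.integrable_diff)
  have "(\<integral>e. \<bar>H e u - H e v\<bar> \<partial>Pd) \<le> (\<integral>e. (\<Sum>k\<in>UNIV. \<bar>Ind k (u $ k) e - Ind k (v $ k) e\<bar>) \<partial>Pd)"
  proof (rule integral_mono)
    show "integrable Pd (\<lambda>e. \<bar>H e u - H e v\<bar>)"
      using H_integrable by (intro integrable_abs Bochner_Integration.integrable_diff)
    show "integrable Pd (\<lambda>e. \<Sum>k\<in>UNIV. \<bar>Ind k (u $ k) e - Ind k (v $ k) e\<bar>)"
      using int by (intro Bochner_Integration.integrable_sum)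
  qed (rule pt)
  also have "\<dots> = (\<Sum>k\<in>UNIV. \<integral>e. \<bar>Ind k (u $ k) e - Ind k (v $ k) e\<bar> \<partial>Pd)"
    using int by (intro Bochner_Integration.integral_sum) auto
  also have "\<dots> \<le> (\<Sum>k\<in>UNIV. p * \<bar>u $ k - v $ k\<bar>)" by (intro sum_mono each)
  finally show ?thesis by (simp add: sum_distrib_left)
qed

lemma D_one': "D (vec 1) = p"
proof -
  have "(\<forall>k. U \<xi> $ k \<le> vec 1 $ k)" for \<xi> using U_cube[of \<xi>] by (simp add: unitcube_iff)
  then show ?thesis by (simp add: DA_def pA_def)
qed

sublocale copula_fun D p g
proof
  show "0 < p" by (rule pA_pos)
  show "\<bar>D u - D v\<bar> \<le> p * (\<Sum>k\<in>UNIV. \<bar>u $ k - v $ k\<bar>)" for u v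
  proof -
    have "D u - D v = (\<integral>e. H e u - H e v \<partial>Pd)" using H_integrable by (simp add: integral_H)
    also have "\<bar>\<dots>\<bar> \<le> (\<integral>e. \<bar>H e u - H e v\<bar> \<partial>Pd)" by (rule integral_abs_bound)
    also have "\<dots> \<le> p * (\<Sum>k\<in>UNIV. \<bar>u $ k - v $ k\<bar>)" by (rule H_diff)
    finally show ?thesis .
  qed
  show "D (vupd (vec 1) k t) = p * t" if "0 \<le> t" "t \<le> 1" for k t
  proof -
    have "(\<forall>j. U \<xi> $ j \<le> vupd (vec 1) k t $ j) \<longleftrightarrow> U \<xi> $ k \<le> t" for \<xi>
      using U_cube[of \<xi>] by (auto simp: unitcube_iff dest: spec[of _ k])
    then show ?thesis using prob_transform[of k t] that by (simp add: DA_def)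
  qed
  show "0 \<le> D u" for u by (simp add: DA_def)
  show "D u \<le> p" for u unfolding DA_def pA_def by (intro finite_measure_mono) auto
  show "((\<lambda>t. D (vupd u k t)) has_real_derivative g k u) (at (u $ k))"
    if "u \<in> unitcube" "0 < u $ k" "u $ k < 1" for k u
  proof -
    have "(\<lambda>t. D (vupd u k t)) differentiable (at (u $ k))"
      using cond_C that unfolding condition_C_def by blast
    then show ?thesis using that by (simp add: g_def pdD_def DERIV_deriv_iff_real_differentiable)
  qed
  show "continuous_on {u \<in> unitcube. 0 < u $ k \<and> u $ k < 1} (g k)" for k
  proof -
    have "continuous_on {u \<in> unitcube. 0 < u $ k \<and> u $ k < 1} (pdD M X Z A k)"
      using cond_C unfolding condition_C_def by blast
    then show ?thesis by (rule continuous_on_eq) (simp add: g_def)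
  qed
  show "g k u = 0" if "\<not> (0 < u $ k \<and> u $ k < 1)" for k u unfolding g_def using that by (simp only: if_False)
qed

lemma D_cont: "continuous_on S D"
proof (rule continuous_on_subset[of UNIV])
  show "continuous_on UNIV D"
    unfolding continuous_on_iff
  proof (intro ballI allI impI)
    fix u :: "real^'p" and e :: real assume e: "0 < e"
    define d where "d = e / (p * real CARD('p) + 1)"
    have c: "0 \<le> p * real CARD('p)" using p_pos by simp
    have d: "0 < d" using e c by (simp add: d_def)
    show "\<exists>d>0. \<forall>v\<in>UNIV. dist v u < d \<longrightarrow> dist (D v) (D u) < e"
    proof (intro exI[of _ d] conjI ballI impI d)
      fix v assume v: "dist v u < d"
      have "\<bar>v $ k - u $ k\<bar> \<le> d" for k
        using component_le_norm_cart[of "v - u" k] v by (simp add: dist_norm)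
      then have "\<bar>D v - D u\<bar> \<le> p * (\<Sum>k\<in>(UNIV::'p set). d)"
        using p_pos by (intro order_trans[OF D_lip] mult_left_mono sum_mono) auto
      also have "\<dots> = p * real CARD('p) * d" by simp
      also have "\<dots> < (p * real CARD('p) + 1) * d" using d by (simp add: distrib_right)
      also have "\<dots> = e" using c by (simp add: d_def)
      finally show "dist (D v) (D u) < e" by (simp add: dist_real_def)
    qed
  qed
qed simp

lemma D_meas [measurable]: "D \<in> borel_measurable borel"
  by (rule borel_measurable_continuous_onI[OF D_cont])

text \<open>The slab on which \<open>g\<close> is continuous is a Borel set, and \<open>g\<close>
  vanishes on the rest of the cube.\<close>

lemma g_meas: "(\<lambda>u. indicator unitcube u * g k u) \<in> borel_measurable borel"
proof -
  have S: "{u \<in> unitcube. 0 < u $ k \<and> u $ k < 1} \<in> sets borel"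
  proof -
    have "{u \<in> unitcube. 0 < u $ k \<and> u $ k < 1} = unitcube \<inter> ({u. 0 < u $ k} \<inter> {u. u $ k < 1})" by auto
    also have "\<dots> \<in> sets borel"
    proof (intro sets.Int)
      show "unitcube \<in> sets (borel :: (real^'p) measure)" by simp
      show "{u :: real^'p. 0 < u $ k} \<in> sets borel" "{u :: real^'p. u $ k < 1} \<in> sets borel"
        by (rule borel_open, intro open_Collect_less continuous_intros)+
    qed
    finally show ?thesis .
  qed
  have "(\<lambda>u. indicator {u \<in> unitcube. 0 < u $ k \<and> u $ k < 1} u *\<^sub>R g k u) \<in> borel_measurable borel"
    by (rule borel_measurable_continuous_on_indicator[OF S g_cont])
  moreover have "indicator {u \<in> unitcube. 0 < u $ k \<and> u $ k < 1} u *\<^sub>R g k u = indicator unitcube u * g k u" for u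
    using g_zero[of u k] by (auto simp: indicator_def)
  ultimately show ?thesis by (simp only:)
qed

end

section \<open>Quadratic envelopes and their means under the empirical process\<close>

definition Q0 :: "(real^'p::finite \<Rightarrow> real) \<Rightarrow> real^'p \<Rightarrow> real" where
  "Q0 b u = 3 * ((b u)\<^sup>2 + real CARD('p) * (\<Sum>k\<in>UNIV. (b (vupd (vec 1) k (u $ k)))\<^sup>2) + (b (vec 1))\<^sup>2)"

definition oscq :: "real \<Rightarrow> (real^'p::finite) set \<Rightarrow> (real^'p \<Rightarrow> real) \<Rightarrow> real^'p \<Rightarrow> real" where
  "oscq s Gr b u = real (card Gr) * (\<Sum>v\<in>Gr. (b (u + (1 / s) *\<^sub>R v) - b u)\<^sup>2)"

definition Q1 :: "real \<Rightarrow> (real^'p::finite) set \<Rightarrow> (real^'p \<Rightarrow> real) \<Rightarrow> real^'p \<Rightarrow> real" where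
  "Q1 s Gr b u = 2 * (oscq s Gr b u + real CARD('p) * (\<Sum>k\<in>UNIV. oscq s Gr b (vupd (vec 1) k (u $ k))))"

lemma Q0_nonneg: "0 \<le> Q0 b u"
  by (simp add: Q0_def sum_nonneg)

lemma Q1_nonneg: "0 \<le> Q1 s Gr b u"
  by (simp add: Q1_def oscq_def sum_nonneg)

lemma sum_abs_sq: "(\<Sum>i\<in>I. \<bar>f i\<bar>)\<^sup>2 \<le> real (card I) * (\<Sum>i\<in>I. (f i :: real)\<^sup>2)"
  using sum_squared_le_sum_of_squares[of "\<lambda>i. \<bar>f i\<bar>" I] by (simp add: mult.commute)

lemma sq_add_le: "(a + b)\<^sup>2 \<le> 2 * (a\<^sup>2 + (b::real)\<^sup>2)"
proof -
  have "0 \<le> (a - b)\<^sup>2" by simp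
  then show ?thesis by (simp add: power2_eq_square algebra_simps)
qed

lemma sq_add3_le: "(a + b + c)\<^sup>2 \<le> 3 * (a\<^sup>2 + b\<^sup>2 + (c::real)\<^sup>2)"
proof -
  have "0 \<le> (a - b)\<^sup>2 + (a - c)\<^sup>2 + (b - c)\<^sup>2" by simp
  then show ?thesis by (simp add: power2_eq_square algebra_simps)
qed

lemma w0f_sq: "(w0f b u)\<^sup>2 \<le> Q0 b u"
proof -
  have "(w0f b u)\<^sup>2 \<le> 3 * (\<bar>b u\<bar>\<^sup>2 + (\<Sum>k\<in>UNIV. \<bar>b (vupd (vec 1) k (u $ k))\<bar>)\<^sup>2 + \<bar>b (vec 1)\<bar>\<^sup>2)"
    unfolding w0f_def by (rule sq_add3_le)
  also have "\<dots> \<le> Q0 b u"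
    unfolding Q0_def using sum_abs_sq[of "\<lambda>k. b (vupd (vec 1) k (u $ k))" UNIV] by simp
  finally show ?thesis .
qed

lemma oscf_sq: "(oscf s Gr b u)\<^sup>2 \<le> oscq s Gr b u"
  unfolding oscf_def oscq_def by (rule sum_abs_sq)

lemma w1f_sq: fixes u :: "real^'p::finite" shows "(w1f s Gr b u)\<^sup>2 \<le> Q1 s Gr b u"
proof -
  have "(\<Sum>k\<in>UNIV. oscf s Gr b (vupd (vec 1) k (u $ k)))\<^sup>2
      \<le> real CARD('p) * (\<Sum>k\<in>UNIV. (oscf s Gr b (vupd (vec 1) k (u $ k)))\<^sup>2)"
    using sum_squared_le_sum_of_squares[of "\<lambda>k. oscf s Gr b (vupd (vec 1) k (u $ k))" UNIV] by (simp add: mult.commute)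
  also have "\<dots> \<le> real CARD('p) * (\<Sum>k\<in>UNIV. oscq s Gr b (vupd (vec 1) k (u $ k)))"
    by (intro mult_left_mono sum_mono oscf_sq) simp
  finally have "(\<Sum>k\<in>UNIV. oscf s Gr b (vupd (vec 1) k (u $ k)))\<^sup>2
     \<le> real CARD('p) * (\<Sum>k\<in>UNIV. oscq s Gr b (vupd (vec 1) k (u $ k)))" .
  then show ?thesis
    unfolding w1f_def Q1_def using oscf_sq[of s Gr b u]
    by (intro order_trans[OF sq_add_le] mult_left_mono add_mono) auto
qed

context cop_data
begin

definition hc :: "(real^'p) \<times> (real^'q) \<Rightarrow> real^'p \<Rightarrow> real" where
  "hc e u = H e u - D u"

definition alpha :: "nat \<Rightarrow> 'a \<Rightarrow> real^'p \<Rightarrow> real" where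
  "alpha n \<xi> u = (\<Sum>j<n. hc (E j \<xi>) u) / sqrt (real n)"

lemma p_le1: "p \<le> 1"
  by (simp add: pA_def)

lemma hc_bound: "\<bar>hc e u\<bar> \<le> 1"
  using H_bounds[of e u] D_nonneg[of u] D_le[of u] p_le1 unfolding hc_def by linarith

lemma hc_meas [measurable]:
  assumes [measurable]: "h \<in> borel_measurable Q" "v \<in> borel_measurable Q"
  shows "(\<lambda>x. hc (h x) (v x)) \<in> borel_measurable Q"
  unfolding hc_def by measurable

lemma hc_integrable: "integrable Pd (\<lambda>e. hc e u)"
  by (rule Pd.integrable_const_bound[where B = 1]) (auto simp: hc_bound)

lemma hc_mean: "(\<integral>e. hc e u \<partial>Pd) = 0"
  unfolding hc_def using H_integrable by (simp add: integral_H Pd.prob_space)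

lemma hc_var: "(\<integral>e. (hc e u)\<^sup>2 \<partial>Pd) \<le> 1"
proof -
  have b: "(hc e u)\<^sup>2 \<le> 1" for e using hc_bound[of e u] by (simp add: abs_square_le_1)
  have "(\<integral>e. (hc e u)\<^sup>2 \<partial>Pd) \<le> (\<integral>e. 1 \<partial>Pd)"
    by (rule integral_mono) (auto intro!: Pd.integrable_const_bound[where B = 1] simp: b)
  then show ?thesis by (simp add: Pd.prob_space)
qed

text \<open>A difference of indicators has values -1, 0 and 1, so its square is its absolute value
  and \<open>H_diff\<close> bounds the variance.\<close>

lemma hc_diff: "(\<integral>e. (hc e u - hc e v)\<^sup>2 \<partial>Pd) \<le> p * (\<Sum>k\<in>UNIV. \<bar>u $ k - v $ k\<bar>)"
proof -
  define Y where "Y e = H e u - H e v" for e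
  define m where "m = D u - D v"
  have Yb: "\<bar>Y e\<bar> \<le> 1" for e by (auto simp: Y_def H_def)
  have Y_meas [measurable]: "Y \<in> borel_measurable Pd" unfolding Y_def by measurable
  have Yi: "integrable Pd Y" by (rule Pd.integrable_const_bound[where B = 1]) (auto simp: Yb)
  have Y2: "(Y e)\<^sup>2 = \<bar>Y e\<bar>" for e by (auto simp: Y_def H_def)
  have EY: "(\<integral>e. Y e \<partial>Pd) = m" unfolding Y_def m_def using H_integrable by (simp add: integral_H)
  have "(hc e u - hc e v)\<^sup>2 = \<bar>Y e\<bar> - 2 * m * Y e + m\<^sup>2" for e
  proof -
    have "hc e u - hc e v = Y e - m" by (simp add: hc_def Y_def m_def)
    then show ?thesis by (simp add: power2_diff Y2)
  qed
  then have "(\<integral>e. (hc e u - hc e v)\<^sup>2 \<partial>Pd) = (\<integral>e. \<bar>Y e\<bar> - 2 * m * Y e + m\<^sup>2 \<partial>Pd)" by simp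
  also have "\<dots> = (\<integral>e. \<bar>Y e\<bar> \<partial>Pd) - 2 * m * m + m\<^sup>2" using Yi by (simp add: EY Pd.prob_space)
  also have "\<dots> \<le> (\<integral>e. \<bar>Y e\<bar> \<partial>Pd)" by (simp add: power2_eq_square)
  also have "\<dots> \<le> p * (\<Sum>k\<in>UNIV. \<bar>u $ k - v $ k\<bar>)" unfolding Y_def by (rule H_diff)
  finally show ?thesis .
qed

lemma AE_Pd_le1: "AE e in Pd. \<forall>k. fst e $ k \<le> 1"
proof -
  have "AE \<xi> in M. \<forall>k. fst (U \<xi>, Z \<xi>) $ k \<le> 1" using U_cube by (auto simp: unitcube_iff)
  then show ?thesis unfolding Pd_def
    by (subst AE_distr_iff) (auto intro!: borel_measurable_Pair)
qed

text \<open>The centring constants cancel, because \<open>D\<close> is \<open>p * u $ k\<close> at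
  the marginal point and \<open>p\<close> at the all-ones point. What remains lives on the event of
  \<open>A\<close>, where it is a centred Bernoulli variable.\<close>

lemma hc_bridge:
  assumes u: "u \<in> unitcube"
  shows "(\<integral>e. (bridge (hc e) k u)\<^sup>2 \<partial>Pd) = p * (u $ k * (1 - u $ k))"
proof -
  have uk: "0 \<le> u $ k" "u $ k \<le> 1" using u by (auto simp: unitcube_iff)
  have "(\<integral>e. (bridge (hc e) k u)\<^sup>2 \<partial>Pd) = (\<integral>e. (1 - 2 * u $ k) * Ind k (u $ k) e + (u $ k)\<^sup>2 * Ind k 1 e \<partial>Pd)"
  proof (rule integral_cong_AE)
    show "AE e in Pd. (bridge (hc e) k u)\<^sup>2 = (1 - 2 * u $ k) * Ind k (u $ k) e + (u $ k)\<^sup>2 * Ind k 1 e"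
      using AE_Pd_le1
    proof eventually_elim
      fix e :: "(real^'p) \<times> (real^'q)" assume e: "\<forall>k. fst e $ k \<le> 1"
      have H1: "H e (vupd (vec 1) k (u $ k)) = Ind k (u $ k) e"
        unfolding H_def Ind_def using e by (auto dest: spec[of _ k])
      have H2: "H e (vec 1) = Ind k 1 e" unfolding H_def Ind_def using e by simp
      have br: "bridge (hc e) k u = Ind k (u $ k) e - u $ k * Ind k 1 e"
        unfolding bridge_def hc_def H1 H2 using uk by (simp add: D_marg D_one algebra_simps)
      show "(bridge (hc e) k u)\<^sup>2 = (1 - 2 * u $ k) * Ind k (u $ k) e + (u $ k)\<^sup>2 * Ind k 1 e"
        unfolding br using uk e by (auto simp: Ind_def power2_eq_square algebra_simps)
    qed
  qed (unfold bridge_def, measurable)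
  also have "\<dots> = p * (u $ k * (1 - u $ k))"
    using Ind_integrable uk by (simp add: integral_Ind power2_eq_square algebra_simps)
  finally show ?thesis .
qed

lemma alpha_meas [measurable]:
  assumes [measurable]: "h \<in> measurable Q M" "v \<in> borel_measurable Q"
  shows "(\<lambda>x. alpha n (h x) (v x)) \<in> borel_measurable Q"
  unfolding alpha_def by measurable

lemma mom_alpha:
  assumes [measurable]: "v \<in> borel_measurable borel" and i: "i < n"
  shows "integrable M (\<lambda>\<xi>. (alpha n \<xi> (v (E i \<xi>)))\<^sup>2)" "(\<integral>\<xi>. (alpha n \<xi> (v (E i \<xi>)))\<^sup>2 \<partial>M) \<le> 4"
proof -
  note m = second_moment_at_sample[of "\<lambda>x y. hc x (v y)" 1 1 i n, folded alpha_def, OF _ hc_bound hc_mean hc_var i]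
  show "integrable M (\<lambda>\<xi>. (alpha n \<xi> (v (E i \<xi>)))\<^sup>2)" by (rule m) measurable
  have "(\<integral>\<xi>. (alpha n \<xi> (v (E i \<xi>)))\<^sup>2 \<partial>M) \<le> 2 * 1 + 2 * 1\<^sup>2 / real n" by (rule m) measurable
  also have "\<dots> \<le> 4" using i by (simp add: field_simps)
  finally show "(\<integral>\<xi>. (alpha n \<xi> (v (E i \<xi>)))\<^sup>2 \<partial>M) \<le> 4" .
qed

lemma alpha_lin: "alpha n \<xi> u - c * alpha n \<xi> v = (\<Sum>j<n. hc (E j \<xi>) u - c * hc (E j \<xi>) v) / sqrt (real n)"
  unfolding alpha_def by (simp add: sum_subtractf sum_distrib_left diff_divide_distrib)

lemma mom_diff:
  assumes [measurable]: "v \<in> borel_measurable borel" and i: "i < n"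
  shows "integrable M (\<lambda>\<xi>. (alpha n \<xi> (v (E i \<xi>) + c) - alpha n \<xi> (v (E i \<xi>)))\<^sup>2)"
    "(\<integral>\<xi>. (alpha n \<xi> (v (E i \<xi>) + c) - alpha n \<xi> (v (E i \<xi>)))\<^sup>2 \<partial>M) \<le> 2 * (p * (\<Sum>k\<in>UNIV. \<bar>c $ k\<bar>)) + 8 / real n"
proof -
  have eq: "alpha n \<xi> (v (E i \<xi>) + c) - alpha n \<xi> (v (E i \<xi>))
     = (\<Sum>j<n. hc (E j \<xi>) (v (E i \<xi>) + c) - hc (E j \<xi>) (v (E i \<xi>))) / sqrt (real n)" for \<xi>
    using alpha_lin[of n \<xi> "v (E i \<xi>) + c" 1 "v (E i \<xi>)"] by simp
  have b: "\<bar>hc x (v y + c) - hc x (v y)\<bar> \<le> 2" for x y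
    using hc_bound[of x "v y + c"] hc_bound[of x "v y"] by linarith
  have z: "(\<integral>x. hc x (v y + c) - hc x (v y) \<partial>Pd) = 0" for y
    using hc_integrable by (simp add: hc_mean)
  have s: "(\<integral>x. (hc x (v y + c) - hc x (v y))\<^sup>2 \<partial>Pd) \<le> p * (\<Sum>k\<in>UNIV. \<bar>c $ k\<bar>)" for y
    using hc_diff[of "v y + c" "v y"] by simp
  note m = second_moment_at_sample[of "\<lambda>x y. hc x (v y + c) - hc x (v y)", OF _ b z s i]
  show "integrable M (\<lambda>\<xi>. (alpha n \<xi> (v (E i \<xi>) + c) - alpha n \<xi> (v (E i \<xi>)))\<^sup>2)"
    unfolding eq by (rule m) measurable
  have "(\<integral>\<xi>. (alpha n \<xi> (v (E i \<xi>) + c) - alpha n \<xi> (v (E i \<xi>)))\<^sup>2 \<partial>M) \<le> 2 * (p * (\<Sum>k\<in>UNIV. \<bar>c $ k\<bar>)) + 2 * 2\<^sup>2 / real n"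
    unfolding eq by (rule m) measurable
  then show "(\<integral>\<xi>. (alpha n \<xi> (v (E i \<xi>) + c) - alpha n \<xi> (v (E i \<xi>)))\<^sup>2 \<partial>M) \<le> 2 * (p * (\<Sum>k\<in>UNIV. \<bar>c $ k\<bar>)) + 8 / real n"
    by simp
qed

text \<open>The restriction to the boundary region depends on the evaluation point alone and can be
  moved into the summand; there \<open>u $ k * (1 - u $ k)\<close> is at most \<delta>.\<close>

lemma mom_bridge:
  assumes [measurable]: "v \<in> borel_measurable borel" and cube: "\<And>e. v e \<in> unitcube" and i: "i < n" and d: "0 < \<delta>"
  shows "integrable M (\<lambda>\<xi>. if v (E i \<xi>) $ k < \<delta> \<or> 1 - \<delta> < v (E i \<xi>) $ k then (bridge (alpha n \<xi>) k (v (E i \<xi>)))\<^sup>2 else 0)"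
    "(\<integral>\<xi>. (if v (E i \<xi>) $ k < \<delta> \<or> 1 - \<delta> < v (E i \<xi>) $ k then (bridge (alpha n \<xi>) k (v (E i \<xi>)))\<^sup>2 else 0) \<partial>M)
      \<le> 2 * (p * \<delta>) + 8 / real n"
proof -
  define f where "f x y = (if v y $ k < \<delta> \<or> 1 - \<delta> < v y $ k then bridge (hc x) k (v y) else 0)" for x y
  have fm: "(\<lambda>(x, y). f x y) \<in> borel_measurable (borel \<Otimes>\<^sub>M borel)"
    unfolding f_def bridge_def split_beta' by measurable
  have vk: "0 \<le> v y $ k" "v y $ k \<le> 1" for y using cube[of y] by (auto simp: unitcube_iff)
  have b: "\<bar>f x y\<bar> \<le> 2" for x y
  proof -
    have "\<bar>v y $ k * hc x (vec 1)\<bar> \<le> 1 * 1" unfolding abs_mult using vk hc_bound by (intro mult_mono) auto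
    then show ?thesis using hc_bound[of x "vupd (vec 1) k (v y $ k)"] by (auto simp: f_def bridge_def)
  qed
  have z: "(\<integral>x. f x y \<partial>Pd) = 0" for y
    using hc_integrable by (cases "v y $ k < \<delta> \<or> 1 - \<delta> < v y $ k") (simp_all add: f_def bridge_def hc_mean)
  have s: "(\<integral>x. (f x y)\<^sup>2 \<partial>Pd) \<le> p * \<delta>" for y
  proof (cases "v y $ k < \<delta> \<or> 1 - \<delta> < v y $ k")
    case True
    have "v y $ k * (1 - v y $ k) \<le> \<delta>"
      using True
    proof
      assume "v y $ k < \<delta>"
      then have "v y $ k * (1 - v y $ k) \<le> \<delta> * 1" using vk[of y] d by (intro mult_mono) auto
      then show ?thesis by simp
    next
      assume "1 - \<delta> < v y $ k"
      then have "v y $ k * (1 - v y $ k) \<le> 1 * \<delta>" using vk[of y] d by (intro mult_mono) auto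
      then show ?thesis by simp
    qed
    then have "p * (v y $ k * (1 - v y $ k)) \<le> p * \<delta>" using p_pos by simp
    then show ?thesis using True hc_bridge[OF cube, of k y] by (simp add: f_def)
  next
    case False then show ?thesis using p_pos d by (simp add: f_def)
  qed
  have eq: "(if v (E i \<xi>) $ k < \<delta> \<or> 1 - \<delta> < v (E i \<xi>) $ k then (bridge (alpha n \<xi>) k (v (E i \<xi>)))\<^sup>2 else 0)
     = ((\<Sum>j<n. f (E j \<xi>) (E i \<xi>)) / sqrt (real n))\<^sup>2" for \<xi>
    by (auto simp: f_def bridge_def alpha_lin)
  note m = second_moment_at_sample[OF fm b z s i]
  show "integrable M (\<lambda>\<xi>. if v (E i \<xi>) $ k < \<delta> \<or> 1 - \<delta> < v (E i \<xi>) $ k then (bridge (alpha n \<xi>) k (v (E i \<xi>)))\<^sup>2 else 0)"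
    unfolding eq by (rule m)
  show "(\<integral>\<xi>. (if v (E i \<xi>) $ k < \<delta> \<or> 1 - \<delta> < v (E i \<xi>) $ k then (bridge (alpha n \<xi>) k (v (E i \<xi>)))\<^sup>2 else 0) \<partial>M)
      \<le> 2 * (p * \<delta>) + 8 / real n"
    unfolding eq using m(2) by simp
qed

lemma exp_Q0:
  assumes v[measurable]: "v \<in> borel_measurable borel" and i: "i < n"
  shows "integrable M (\<lambda>\<xi>. Q0 (alpha n \<xi>) (v (E i \<xi>)))"
    "(\<integral>\<xi>. Q0 (alpha n \<xi>) (v (E i \<xi>)) \<partial>M) \<le> 24 + 12 * (real CARD('p))\<^sup>2"
proof -
  have vk: "(\<lambda>e. vupd (vec 1) k (v e $ k)) \<in> borel_measurable borel" for k by measurable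
  have v1: "(\<lambda>e::(real^'p) \<times> (real^'q). vec 1 :: real^'p) \<in> borel_measurable borel" by measurable
  note m = mom_alpha[OF v i] mom_alpha[OF vk i] mom_alpha[OF v1 i]
  show "integrable M (\<lambda>\<xi>. Q0 (alpha n \<xi>) (v (E i \<xi>)))"
    unfolding Q0_def using m by auto
  have "(\<integral>\<xi>. Q0 (alpha n \<xi>) (v (E i \<xi>)) \<partial>M) = 3 * ((\<integral>\<xi>. (alpha n \<xi> (v (E i \<xi>)))\<^sup>2 \<partial>M)
     + real CARD('p) * (\<Sum>k\<in>UNIV. \<integral>\<xi>. (alpha n \<xi> (vupd (vec 1) k (v (E i \<xi>) $ k)))\<^sup>2 \<partial>M) + (\<integral>\<xi>. (alpha n \<xi> (vec 1))\<^sup>2 \<partial>M))"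
    unfolding Q0_def using m by simp
  also have "\<dots> \<le> 3 * (4 + real CARD('p) * (\<Sum>k\<in>(UNIV::'p set). 4) + 4)"
    using m by (intro mult_left_mono add_mono sum_mono) auto
  finally show "(\<integral>\<xi>. Q0 (alpha n \<xi>) (v (E i \<xi>)) \<partial>M) \<le> 24 + 12 * (real CARD('p))\<^sup>2"
    by (simp add: power2_eq_square)
qed

text \<open>An offset of order 1/sqrt n moves the process by a variance of the same order, and
  finitely many offsets preserve this rate.\<close>

lemma exp_oscq:
  assumes v[measurable]: "v \<in> borel_measurable borel" and i: "i < n"
  shows "integrable M (\<lambda>\<xi>. oscq (sqrt (real n)) Gr (alpha n \<xi>) (v (E i \<xi>)))"
    "(\<integral>\<xi>. oscq (sqrt (real n)) Gr (alpha n \<xi>) (v (E i \<xi>)) \<partial>M)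
      \<le> real (card Gr) * (\<Sum>c\<in>Gr. 2 * p * (\<Sum>k\<in>UNIV. \<bar>c $ k\<bar>) + 8) / sqrt (real n)"
proof -
  note m = mom_diff[OF v i]
  show "integrable M (\<lambda>\<xi>. oscq (sqrt (real n)) Gr (alpha n \<xi>) (v (E i \<xi>)))"
    unfolding oscq_def using m by auto
  have n: "1 \<le> sqrt (real n)" using i by simp
  have "(\<integral>\<xi>. oscq (sqrt (real n)) Gr (alpha n \<xi>) (v (E i \<xi>)) \<partial>M)
     = real (card Gr) * (\<Sum>c\<in>Gr. \<integral>\<xi>. (alpha n \<xi> (v (E i \<xi>) + (1 / sqrt (real n)) *\<^sub>R c) - alpha n \<xi> (v (E i \<xi>)))\<^sup>2 \<partial>M)"
    unfolding oscq_def using m by simp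
  also have "\<dots> \<le> real (card Gr) * (\<Sum>c\<in>Gr. (2 * p * (\<Sum>k\<in>UNIV. \<bar>c $ k\<bar>) + 8) / sqrt (real n))"
  proof (intro mult_left_mono sum_mono)
    fix c :: "real^'p"
    have "1 / real n \<le> 1 / sqrt (real n)"
    proof (intro divide_left_mono)
      have "sqrt (real n) * 1 \<le> sqrt (real n) * sqrt (real n)" using n by (intro mult_left_mono) auto
      then show "sqrt (real n) \<le> real n" by simp
    qed (use i in auto)
    moreover have "(\<Sum>k\<in>UNIV. \<bar>((1 / sqrt (real n)) *\<^sub>R c) $ k\<bar>) = (\<Sum>k\<in>UNIV. \<bar>c $ k\<bar>) / sqrt (real n)"
      by (simp add: abs_mult sum_divide_distrib)
    ultimately show "(\<integral>\<xi>. (alpha n \<xi> (v (E i \<xi>) + (1 / sqrt (real n)) *\<^sub>R c) - alpha n \<xi> (v (E i \<xi>)))\<^sup>2 \<partial>M)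
      \<le> (2 * p * (\<Sum>k\<in>UNIV. \<bar>c $ k\<bar>) + 8) / sqrt (real n)"
      using m(2)[of "(1 / sqrt (real n)) *\<^sub>R c"] by (simp add: add_divide_distrib)
  qed simp
  finally show "(\<integral>\<xi>. oscq (sqrt (real n)) Gr (alpha n \<xi>) (v (E i \<xi>)) \<partial>M)
      \<le> real (card Gr) * (\<Sum>c\<in>Gr. 2 * p * (\<Sum>k\<in>UNIV. \<bar>c $ k\<bar>) + 8) / sqrt (real n)"
    by (simp only: sum_divide_distrib[symmetric] times_divide_eq_right)
qed

lemma exp_Q1:
  assumes v[measurable]: "v \<in> borel_measurable borel" and i: "i < n"
  shows "integrable M (\<lambda>\<xi>. Q1 (sqrt (real n)) Gr (alpha n \<xi>) (v (E i \<xi>)))"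
    "(\<integral>\<xi>. Q1 (sqrt (real n)) Gr (alpha n \<xi>) (v (E i \<xi>)) \<partial>M) \<le>
      2 * (1 + (real CARD('p))\<^sup>2) * (real (card Gr) * (\<Sum>c\<in>Gr. 2 * p * (\<Sum>k\<in>UNIV. \<bar>c $ k\<bar>) + 8)) / sqrt (real n)"
proof -
  have vk: "(\<lambda>e. vupd (vec 1) k (v e $ k)) \<in> borel_measurable borel" for k by measurable
  note m = exp_oscq[OF v i, of Gr] exp_oscq[OF vk i, of Gr]
  define q where "q = real (card Gr) * (\<Sum>c\<in>Gr. 2 * p * (\<Sum>k\<in>UNIV. \<bar>c $ k\<bar>) + 8) / sqrt (real n)"
  show "integrable M (\<lambda>\<xi>. Q1 (sqrt (real n)) Gr (alpha n \<xi>) (v (E i \<xi>)))"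
    unfolding Q1_def using m by auto
  have "(\<integral>\<xi>. Q1 (sqrt (real n)) Gr (alpha n \<xi>) (v (E i \<xi>)) \<partial>M)
     = 2 * ((\<integral>\<xi>. oscq (sqrt (real n)) Gr (alpha n \<xi>) (v (E i \<xi>)) \<partial>M)
        + real CARD('p) * (\<Sum>k\<in>UNIV. \<integral>\<xi>. oscq (sqrt (real n)) Gr (alpha n \<xi>) (vupd (vec 1) k (v (E i \<xi>) $ k)) \<partial>M))"
    unfolding Q1_def using m by simp
  also have "\<dots> \<le> 2 * (q + real CARD('p) * (\<Sum>k\<in>(UNIV::'p set). q))"
    unfolding q_def using m by (intro mult_left_mono add_mono sum_mono) auto
  also have "\<dots> = 2 * (1 + (real CARD('p))\<^sup>2) * q" by (simp add: power2_eq_square algebra_simps)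
  finally show "(\<integral>\<xi>. Q1 (sqrt (real n)) Gr (alpha n \<xi>) (v (E i \<xi>)) \<partial>M) \<le>
      2 * (1 + (real CARD('p))\<^sup>2) * (real (card Gr) * (\<Sum>c\<in>Gr. 2 * p * (\<Sum>k\<in>UNIV. \<bar>c $ k\<bar>) + 8)) / sqrt (real n)"
    by (simp add: q_def)
qed

section \<open>Mean bounds for the linearisation error\<close>

definition aset :: "nat \<Rightarrow> 'a \<Rightarrow> nat set" where
  "aset n \<xi> = {j. j < n \<and> Zs j \<xi> \<in> A}"

abbreviation "dense n \<xi> \<equiv> p / 2 \<le> real (card (aset n \<xi>)) / real n"

definition good :: "nat \<Rightarrow> 'a \<Rightarrow> bool" where
  "good n \<xi> \<longleftrightarrow> sample D p g n (aset n \<xi>) (\<lambda>j. Us j \<xi>)"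

abbreviation "Fnw n \<xi> \<equiv> sample.Fn (aset n \<xi>) (\<lambda>j. Us j \<xi>)"
abbreviation "Chw n \<xi> \<equiv> sample.Chat (aset n \<xi>) (\<lambda>j. Us j \<xi>)"

lemma al_eq:
  assumes "good n \<xi>"
  shows "sample.al D n (aset n \<xi>) (\<lambda>j. Us j \<xi>) = alpha n \<xi>"
proof
  fix u
  interpret sample D p g n "aset n \<xi>" "\<lambda>j. Us j \<xi>" using assms by (simp add: good_def)
  have "{j \<in> aset n \<xi>. \<forall>k. Us j \<xi> $ k \<le> u $ k} = {j \<in> {..<n}. (\<forall>k. Us j \<xi> $ k \<le> u $ k) \<and> Zs j \<xi> \<in> A}"
    by (auto simp: aset_def)
  then have "En u = (\<Sum>j<n. H (E j \<xi>) u) / real n"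
    unfolding En_def H_def E_def by (simp add: sum.If_cases Int_def)
  then have "al u = sqrt (real n) * ((\<Sum>j<n. H (E j \<xi>) u) / real n - D u)" by (simp add: al_def)
  also have "\<dots> = (\<Sum>j<n. H (E j \<xi>) u) / sqrt (real n) - sqrt (real n) * D u"
  proof -
    have "s * (S / real n) = S * (s * (1 / real n))" for S by simp
    then have "s * (S / real n) = S / s" for S unfolding s_div_n by simp
    then show ?thesis by (simp only: right_diff_distrib)
  qed
  also have "\<dots> = ((\<Sum>j<n. H (E j \<xi>) u) - real n * D u) / sqrt (real n)"
  proof -
    have "real n * D u = s * (s * D u)" by (simp only: ss mult.assoc[symmetric])
    then have "real n * D u / s = s * D u"
      using nonzero_mult_div_cancel_left[of s "s * D u"] s_pos by (simp only:)
    then show ?thesis by (simp only: diff_divide_distrib)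
  qed
  also have "\<dots> = alpha n \<xi> u" by (simp add: alpha_def hc_def sum_subtractf)
  finally show "al u = alpha n \<xi> u" .
qed

definition Bd :: "real \<Rightarrow> real \<Rightarrow> real \<Rightarrow> real \<Rightarrow> (real^'p) set \<Rightarrow> nat \<Rightarrow> 'a \<Rightarrow> real^'p \<Rightarrow> real" where
  "Bd \<epsilon> C c1 \<delta> Gr n \<xi> u = \<epsilon> * (1 + Q0 (alpha n \<xi>) u) + C * Q1 (sqrt (real n)) Gr (alpha n \<xi>) u
     + c1 * (\<Sum>k\<in>UNIV. if u $ k < \<delta> \<or> 1 - \<delta> < u $ k then (bridge (alpha n \<xi>) k u)\<^sup>2 else 0)"

lemma Bd_meas [measurable]:
  assumes [measurable]: "h \<in> measurable Q M" "v \<in> borel_measurable Q"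
  shows "(\<lambda>x. Bd \<epsilon> C c1 \<delta> Gr n (h x) (v x)) \<in> borel_measurable Q"
  unfolding Bd_def Q0_def Q1_def oscq_def bridge_def by measurable

lemma Q0_meas [measurable]:
  assumes [measurable]: "h \<in> measurable Q M" "v \<in> borel_measurable Q"
  shows "(\<lambda>x. Q0 (alpha n (h x)) (v x)) \<in> borel_measurable Q"
  unfolding Q0_def by measurable

text \<open>\<open>linearisation\<close> with an error whose mean is at most
  \<open>\<epsilon>0\<close> at every point computed from one observation. The statistic averages
  over such points, so this takes the place of a supremum over the cube.\<close>

lemma unif_lin:
  assumes e0: "0 < \<epsilon>0"
  obtains \<epsilon> C c1 \<delta> Gr n0 where
    "\<And>n \<xi> u. 0 \<le> Bd \<epsilon> C c1 \<delta> Gr n \<xi> u"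
    "\<And>n \<xi> L u. n0 \<le> n \<Longrightarrow> good n \<xi> \<Longrightarrow> u \<in> unitcube \<Longrightarrow>
       \<bar>sqrt (real n) * (Chw n \<xi> (vmix L (\<chi> k. Fnw n \<xi> k (u $ k)) u) - D (vmix L (\<chi> k. Fnw n \<xi> k (u $ k)) u) / p)
         - Cop (alpha n \<xi>) u\<bar> \<le> Bd \<epsilon> C c1 \<delta> Gr n \<xi> u"
    "\<And>n i v. n0 \<le> n \<Longrightarrow> i < n \<Longrightarrow> v \<in> borel_measurable borel \<Longrightarrow> (\<And>e. v e \<in> unitcube) \<Longrightarrow>
       integrable M (\<lambda>\<xi>. Bd \<epsilon> C c1 \<delta> Gr n \<xi> (v (E i \<xi>)))"
    "\<And>n i v. n0 \<le> n \<Longrightarrow> i < n \<Longrightarrow> v \<in> borel_measurable borel \<Longrightarrow> (\<And>e. v e \<in> unitcube) \<Longrightarrow>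
       (\<integral>\<xi>. Bd \<epsilon> C c1 \<delta> Gr n \<xi> (v (E i \<xi>)) \<partial>M) \<le> \<epsilon>0"
proof -
  define d where "d = real CARD('p)"
  have d1: "1 \<le> d" by (simp add: d_def Suc_le_eq)
  \<comment> \<open>Bounds the mean of \<open>1 + Q0\<close>, by \<open>exp_Q0\<close>.\<close>
  define c0 where "c0 = 25 + 12 * d\<^sup>2"
  define \<epsilon> where "\<epsilon> = \<epsilon>0 / 3 / c0"
  have "0 < c0" by (simp add: c0_def add_pos_nonneg)
  then have e: "0 < \<epsilon>" "\<epsilon> * (25 + 12 * d\<^sup>2) = \<epsilon>0 / 3"
    unfolding c0_def[symmetric] using e0 by (auto simp: \<epsilon>_def)
  obtain c1 where c1: "0 \<le> c1" and lin: "\<forall>\<delta>>0. \<exists>Gr C n0. finite Gr \<and> 0 \<le> C \<and>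
     (\<forall>n a U L u y. n0 \<le> n \<longrightarrow> sample D p g n a U \<longrightarrow> u \<in> unitcube \<longrightarrow>
        y = vmix L (\<chi> k. sample.Fn a U k (u $ k)) u \<longrightarrow>
        \<bar>sqrt (real n) * (sample.Chat a U y - D y / p) - Cop (sample.al D n a U) u\<bar>
        \<le> \<epsilon> * (1 + (w0f (sample.al D n a U) u)\<^sup>2) + C * (w1f (sqrt (real n)) Gr (sample.al D n a U) u)\<^sup>2
          + c1 * (\<Sum>k | u $ k < \<delta> \<or> 1 - \<delta> < u $ k. (bridge (sample.al D n a U) k u)\<^sup>2))"
    by (rule linearisation[OF e(1)]) (erule (1) that)
  \<comment> \<open>The added 1 keeps the divisor positive when \<open>c1 = 0\<close>.\<close>
  define r where "r = c1 * d * p + 1"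
  define \<delta> where "\<delta> = \<epsilon>0 / 12 / r"
  have r: "0 < r" using c1 d1 p_pos by (simp add: r_def add_nonneg_pos)
  have del: "0 < \<delta>" "c1 * d * (2 * (p * \<delta>)) \<le> \<epsilon>0 / 6"
  proof -
    show "0 < \<delta>" using e0 r by (simp add: \<delta>_def)
    then have "2 * ((r - 1) * \<delta>) \<le> 2 * (r * \<delta>)" by (simp add: left_diff_distrib)
    also have "\<dots> = \<epsilon>0 / 6" using r by (simp add: \<delta>_def)
    finally show "c1 * d * (2 * (p * \<delta>)) \<le> \<epsilon>0 / 6" by (simp add: r_def mult_ac)
  qed
  obtain Gr C n1 where G: "finite Gr" "0 \<le> C" "\<And>n a U L u y. n1 \<le> n \<Longrightarrow> sample D p g n a U \<Longrightarrow> u \<in> unitcube \<Longrightarrow>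
        y = vmix L (\<chi> k. sample.Fn a U k (u $ k)) u \<Longrightarrow>
        \<bar>sqrt (real n) * (sample.Chat a U y - D y / p) - Cop (sample.al D n a U) u\<bar>
        \<le> \<epsilon> * (1 + (w0f (sample.al D n a U) u)\<^sup>2) + C * (w1f (sqrt (real n)) Gr (sample.al D n a U) u)\<^sup>2
          + c1 * (\<Sum>k | u $ k < \<delta> \<or> 1 - \<delta> < u $ k. (bridge (sample.al D n a U) k u)\<^sup>2)"
    using lin[rule_format, OF del(1)] by blast
  define q where "q = 2 * (1 + d\<^sup>2) * (real (card Gr) * (\<Sum>c\<in>Gr. 2 * p * (\<Sum>k\<in>UNIV. \<bar>c $ k\<bar>) + 8))"
  have q0: "0 \<le> q" unfolding q_def using p_pos by (intro mult_nonneg_nonneg sum_nonneg add_nonneg_nonneg) auto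
  define X where "X = max 1 (max (C * q / (\<epsilon>0 / 3)) (c1 * d * 8 / (\<epsilon>0 / 6)))"
  define n0 where "n0 = max n1 (nat \<lceil>X\<^sup>2\<rceil>)"
  have nn: "0 \<le> Bd \<epsilon> C c1 \<delta> Gr n \<xi> u" for n \<xi> u
    unfolding Bd_def using e G(2) c1 Q0_nonneg Q1_nonneg by (intro add_nonneg_nonneg mult_nonneg_nonneg sum_nonneg) auto
  show thesis
  proof (rule that[of \<epsilon> C c1 \<delta> Gr n0])
    show "0 \<le> Bd \<epsilon> C c1 \<delta> Gr n \<xi> u" for n \<xi> u by (rule nn)
  next
    fix n \<xi> L and u :: "real^'p" assume n: "n0 \<le> n" and go: "good n \<xi>" and u: "u \<in> unitcube"
    have "(\<Sum>k | u $ k < \<delta> \<or> 1 - \<delta> < u $ k. (bridge (alpha n \<xi>) k u)\<^sup>2)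
        = (\<Sum>k\<in>UNIV. if u $ k < \<delta> \<or> 1 - \<delta> < u $ k then (bridge (alpha n \<xi>) k u)\<^sup>2 else 0)"
      by (simp add: sum.If_cases)
    moreover have "\<epsilon> * (1 + (w0f (alpha n \<xi>) u)\<^sup>2) \<le> \<epsilon> * (1 + Q0 (alpha n \<xi>) u)"
      using e w0f_sq by (intro mult_left_mono) auto
    moreover have "C * (w1f (sqrt (real n)) Gr (alpha n \<xi>) u)\<^sup>2 \<le> C * Q1 (sqrt (real n)) Gr (alpha n \<xi>) u"
      using G(2) w1f_sq by (intro mult_left_mono) auto
    ultimately show "\<bar>sqrt (real n) * (Chw n \<xi> (vmix L (\<chi> k. Fnw n \<xi> k (u $ k)) u) - D (vmix L (\<chi> k. Fnw n \<xi> k (u $ k)) u) / p)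
         - Cop (alpha n \<xi>) u\<bar> \<le> Bd \<epsilon> C c1 \<delta> Gr n \<xi> u"
      using G(3)[OF _ go[unfolded good_def] u refl, of L] n unfolding al_eq[OF go] Bd_def n0_def by simp
  next
    fix n i and v :: "(real^'p) \<times> (real^'q) \<Rightarrow> real^'p"
    assume n: "n0 \<le> n" and i: "i < n" and v: "v \<in> borel_measurable borel" "\<And>e. v e \<in> unitcube"
    note m = exp_Q0[OF v(1) i] exp_Q1[OF v(1) i, of Gr] mom_bridge[OF v i del(1)]
    have Xs: "X \<le> sqrt (real n)"
    proof (rule real_le_rsqrt)
      show "X\<^sup>2 \<le> real n" using n unfolding n0_def by linarith
    qed
    have s1: "1 \<le> sqrt (real n)" using Xs by (simp add: X_def)
    show "integrable M (\<lambda>\<xi>. Bd \<epsilon> C c1 \<delta> Gr n \<xi> (v (E i \<xi>)))"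
      unfolding Bd_def using m by (intro Bochner_Integration.integrable_add integrable_mult_right
          Bochner_Integration.integrable_sum) auto
    have "(\<integral>\<xi>. Bd \<epsilon> C c1 \<delta> Gr n \<xi> (v (E i \<xi>)) \<partial>M) = \<epsilon> * (1 + (\<integral>\<xi>. Q0 (alpha n \<xi>) (v (E i \<xi>)) \<partial>M))
       + C * (\<integral>\<xi>. Q1 (sqrt (real n)) Gr (alpha n \<xi>) (v (E i \<xi>)) \<partial>M)
       + c1 * (\<Sum>k\<in>UNIV. \<integral>\<xi>. (if v (E i \<xi>) $ k < \<delta> \<or> 1 - \<delta> < v (E i \<xi>) $ k then (bridge (alpha n \<xi>) k (v (E i \<xi>)))\<^sup>2 else 0) \<partial>M)"
      unfolding Bd_def using m(1,3,5)
      by (subst Bochner_Integration.integral_add | subst Bochner_Integration.integral_sum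
          | subst integral_mult_right_zero
          | intro Bochner_Integration.integrable_add integrable_mult_right Bochner_Integration.integrable_sum integrable_const
          | simp add: prob_space)+
    also have "\<dots> \<le> \<epsilon> * (1 + (24 + 12 * d\<^sup>2)) + C * (q / sqrt (real n)) + c1 * (\<Sum>k\<in>(UNIV::'p set). 2 * (p * \<delta>) + 8 / real n)"
      using m(2,4,6) e G(2) c1 unfolding q_def d_def by (intro add_mono mult_left_mono sum_mono) auto
    also have "\<dots> = \<epsilon>0 / 3 + C * q / sqrt (real n) + c1 * d * (2 * (p * \<delta>)) + c1 * d * 8 / real n"
      using e(2) by (simp add: d_def algebra_simps)
    also have "\<dots> \<le> \<epsilon>0 / 3 + \<epsilon>0 / 3 + \<epsilon>0 / 6 + \<epsilon>0 / 6"
    proof (intro add_mono)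
      have sp: "0 < sqrt (real n)" using s1 by linarith
      have "C * q / (\<epsilon>0 / 3) \<le> sqrt (real n)" using Xs by (simp add: X_def)
      then have "C * q \<le> sqrt (real n) * (\<epsilon>0 / 3)" using e0 by (simp add: pos_divide_le_eq)
      then show "C * q / sqrt (real n) \<le> \<epsilon>0 / 3" using sp by (simp only: pos_divide_le_eq mult.commute)
      have "c1 * d * 8 / (\<epsilon>0 / 6) \<le> sqrt (real n)" using Xs by (simp add: X_def)
      also have "\<dots> \<le> real n"
      proof -
        have "sqrt (real n) * 1 \<le> sqrt (real n) * sqrt (real n)" using s1 by (intro mult_left_mono) auto
        then show ?thesis by simp
      qed
      finally have "c1 * d * 8 \<le> real n * (\<epsilon>0 / 6)" using e0 by (simp add: pos_divide_le_eq)
      then show "c1 * d * 8 / real n \<le> \<epsilon>0 / 6" using i by (simp add: pos_divide_le_eq mult.commute)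
    qed (use del in auto)
    finally show "(\<integral>\<xi>. Bd \<epsilon> C c1 \<delta> Gr n \<xi> (v (E i \<xi>)) \<partial>M) \<le> \<epsilon>0" by simp
  qed
qed

end

section \<open>The statistic in terms of the empirical process\<close>

text \<open>On the unit cube Lebesgue measure is a probability measure; as a measure space of its
  own it can be paired with \<open>M\<close> in Fubini arguments.\<close>

definition Lc :: "(real^'p::finite) measure" where
  "Lc = restrict_space lborel unitcube"

lemma LINT_Lc: "(LINT w : unitcube | lborel. f w) = (\<integral>w. (f w :: real) \<partial>Lc)"
  unfolding Lc_def set_lebesgue_integral_def by (subst integral_restrict_space) auto

lemma space_Lc: "space Lc = unitcube"
  by (simp add: Lc_def space_restrict_space)

lemma prob_space_Lc: "prob_space (Lc :: (real^'p::finite) measure)"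
proof
  have ne: "(0 :: real^'p) \<in> unitcube" by (simp add: unitcube_iff)
  have "measure lborel (unitcube :: (real^'p) set) = 1"
    using content_cbox_cart[of "0 :: real^'p" "vec 1"] ne by auto
  moreover have "emeasure lborel (unitcube :: (real^'p) set) = ennreal (measure lborel (unitcube :: (real^'p) set))"
    by (rule emeasure_eq_ennreal_measure) (use emeasure_lborel_cbox_finite[of "0 :: real^'p" "vec 1"] in auto)
  ultimately have "emeasure lborel (unitcube :: (real^'p) set) = 1" by simp
  then show "emeasure (Lc :: (real^'p) measure) (space Lc) = 1"
    by (simp add: Lc_def space_restrict_space emeasure_restrict_space)
qed

lemma measurable_id_Lc [measurable]: "(\<lambda>w. w) \<in> borel_measurable Lc"
  unfolding Lc_def by (rule measurable_restrict_space1) simp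

interpretation Lc: prob_space Lc
  by (rule prob_space_Lc)

lemma cont_comp_meas:
  fixes \<psi> :: "real^'p::finite \<Rightarrow> real"
  assumes "continuous_on unitcube \<psi>" "v \<in> borel_measurable Q" "\<And>x. x \<in> space Q \<Longrightarrow> v x \<in> unitcube"
  shows "(\<lambda>x. \<psi> (v x)) \<in> borel_measurable Q"
proof -
  have "\<psi> \<in> borel_measurable (restrict_space borel unitcube)"
    by (rule borel_measurable_continuous_on_restrict[OF assms(1)])
  moreover have "v \<in> measurable Q (restrict_space borel unitcube)"
    using assms by (intro measurable_restrict_space2) auto
  ultimately show ?thesis by (rule measurable_compose[rotated])
qed

context cop_data
begin

text \<open>The hyperplane is contained in strips of every width \<open>r\<close>, whose mass is at
  most \<open>p * r\<close>.\<close>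

lemma integral_Ind_eq: "(\<integral>e. (if fst e $ k = t \<and> snd e \<in> A then 1 else 0) \<partial>Pd) = (0::real)"
proof -
  define f where "f e = (if fst e $ k = t \<and> snd e \<in> A then 1 else 0 :: real)" for e :: "(real^'p) \<times> (real^'q)"
  have [measurable]: "f \<in> borel_measurable Pd" unfolding f_def by measurable
  have fi: "integrable Pd f" by (rule Pd.integrable_const_bound[where B = 1]) (auto simp: f_def)
  have "(\<integral>e. f e \<partial>Pd) \<le> 0 + e" if e: "0 < e" for e
  proof -
    define r where "r = e / p"
    have r: "0 < r" "p * r = e" using e p_pos by (auto simp: r_def)
    have "(\<integral>e. f e \<partial>Pd) \<le> (\<integral>e. Ind k t e - Ind k (t - r) e \<partial>Pd)"
    proof (rule integral_mono[OF fi Bochner_Integration.integrable_diff[OF Ind_integrable Ind_integrable]])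
      show "f e \<le> Ind k t e - Ind k (t - r) e" for e using r by (auto simp: f_def Ind_def)
    qed
    also have "\<dots> = p * (max 0 (min 1 t) - max 0 (min 1 (t - r)))"
      using Ind_integrable by (simp add: integral_Ind right_diff_distrib)
    also have "\<dots> \<le> p * r" using p_pos r by (intro mult_left_mono) auto
    finally show ?thesis using r by simp
  qed
  then have "(\<integral>e. f e \<partial>Pd) \<le> 0" by (rule field_le_epsilon)
  moreover have "0 \<le> (\<integral>e. f e \<partial>Pd)" by (rule integral_nonneg_AE) (auto simp: f_def)
  ultimately have "(\<integral>e. f e \<partial>Pd) = 0" by linarith
  then show ?thesis unfolding f_def .
qed

definition no_ties :: "'a \<Rightarrow> bool" where
  "no_ties \<xi> \<longleftrightarrow> (\<forall>i j k. i \<noteq> j \<longrightarrow> Zs i \<xi> \<in> A \<longrightarrow> Zs j \<xi> \<in> A \<longrightarrow> Us i \<xi> $ k \<noteq> Us j \<xi> $ k) \<and>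
    (\<forall>j k. Zs j \<xi> \<in> A \<longrightarrow> 0 < Us j \<xi> $ k)"

text \<open>By independence a tie may be integrated with one of the two observations fixed, where it
  is a hyperplane event of mass 0. There are countably many pairs and coordinates to
  combine.\<close>

lemma AE_no_ties: "AE \<xi> in M. no_ties \<xi>"
proof -
  have 1: "AE \<xi> in M. Zs i \<xi> \<in> A \<longrightarrow> Zs j \<xi> \<in> A \<longrightarrow> Us i \<xi> $ k \<noteq> Us j \<xi> $ k" if "i \<noteq> j" for i j k
  proof -
    define G where "G z = (if fst (fst z) $ k = fst (snd z) $ k \<and> snd (fst z) \<in> A then 1 else 0 :: real)"
      for z :: "((real^'p) \<times> (real^'q)) \<times> ((real^'p) \<times> (real^'q))"
    have [measurable]: "G \<in> borel_measurable (borel \<Otimes>\<^sub>M borel)" unfolding G_def by measurable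
    have "(\<integral>\<xi>. G (E j \<xi>, E i \<xi>) \<partial>M) = (\<integral>\<xi>. (\<integral>x. G (x, E i \<xi>) \<partial>Pd) \<partial>M)"
      by (rule integral_pair[OF that, where b = 1]) (auto simp: G_def)
    also have "\<dots> = 0" unfolding G_def fst_conv snd_conv integral_Ind_eq by simp
    finally have "(\<integral>\<xi>. G (E j \<xi>, E i \<xi>) \<partial>M) = 0" .
    moreover have "integrable M (\<lambda>\<xi>. G (E j \<xi>, E i \<xi>))"
      by (rule integrable_const_bound[where B = 1]) (auto simp: G_def)
    ultimately have "AE \<xi> in M. G (E j \<xi>, E i \<xi>) = 0"
      by (subst (asm) integral_nonneg_eq_0_iff_AE) (auto simp: G_def)
    then show ?thesis by eventually_elim (auto simp: G_def E_def split: if_splits)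
  qed
  have 2: "AE \<xi> in M. Zs j \<xi> \<in> A \<longrightarrow> 0 < Us j \<xi> $ k" for j k
  proof -
    have "(\<integral>\<xi>. Ind k 0 (E j \<xi>) \<partial>M) = 0" using integral_one[of "Ind k 0" j] by (simp add: integral_Ind)
    moreover have "integrable M (\<lambda>\<xi>. Ind k 0 (E j \<xi>))"
      by (rule integrable_const_bound[where B = 1]) (auto simp: Ind_def)
    ultimately have "AE \<xi> in M. Ind k 0 (E j \<xi>) = 0"
      by (subst (asm) integral_nonneg_eq_0_iff_AE) (auto simp: Ind_def)
    then show ?thesis by eventually_elim (auto simp: Ind_def E_def not_le split: if_splits)
  qed
  have "AE \<xi> in M. \<forall>i j k. i \<noteq> j \<longrightarrow> Zs i \<xi> \<in> A \<longrightarrow> Zs j \<xi> \<in> A \<longrightarrow> Us i \<xi> $ k \<noteq> Us j \<xi> $ k"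
    unfolding AE_all_countable using 1 by auto
  moreover have "AE \<xi> in M. \<forall>j k. Zs j \<xi> \<in> A \<longrightarrow> 0 < Us j \<xi> $ k"
    unfolding AE_all_countable using 2 by auto
  ultimately show ?thesis unfolding no_ties_def by eventually_elim blast
qed

lemma card_aset: "real (card (aset n \<xi>)) = (\<Sum>j<n. indicator A (Zs j \<xi>))"
proof -
  have "aset n \<xi> = {j \<in> {..<n}. Zs j \<xi> \<in> A}" by (auto simp: aset_def)
  moreover have "(\<Sum>j<n. indicator A (Zs j \<xi>)) = (\<Sum>j<n. if Zs j \<xi> \<in> A then 1 else 0 :: real)"
    by (intro sum.cong) (auto simp: indicator_def)
  ultimately show ?thesis by (simp add: sum.If_cases Int_def)
qed

lemma finite_aset: "finite (aset n \<xi>)"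
  by (simp add: aset_def)

lemma n_phat: "0 < n \<Longrightarrow> real n * phatA Zs A n \<xi> = real (card (aset n \<xi>))"
  by (simp add: phatA_def card_aset)

lemma goodI:
  assumes "no_ties \<xi>" "0 < n" "dense n \<xi>"
  shows "good n \<xi>"
  unfolding good_def
proof
  show "Us j \<xi> $ k \<le> 1" for j k using Us_cube[of j \<xi>] by (auto simp: unitcube_iff)
qed (use assms finite_aset in \<open>auto simp: no_ties_def aset_def\<close>)

lemma H_one: "H (E j \<xi>) (vec 1) = indicator A (Zs j \<xi>)"
  using Us_cube[of j \<xi>] by (auto simp: H_def E_def unitcube_iff)

lemma card_aset_alpha: "0 < n \<Longrightarrow> real (card (aset n \<xi>)) / real n = p + alpha n \<xi> (vec 1) / sqrt (real n)"
  unfolding alpha_def hc_def H_one D_one sum_subtractf card_aset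
  by (simp add: diff_divide_distrib)

text \<open>Chebyshev's inequality: a share below \<open>p / 2\<close> forces the process at the
  all-ones point below \<open>- (p / 2) * sqrt n\<close>.\<close>

lemma not_good_prob:
  assumes "0 < n"
  shows "prob {\<xi> \<in> space M. \<not> dense n \<xi>} \<le> 16 / (p\<^sup>2 * real n)"
proof -
  have mm: "(\<lambda>e::(real^'p) \<times> (real^'q). vec 1 :: real^'p) \<in> borel_measurable borel" by measurable
  note m = mom_alpha[OF mm, of 0 n]
  have sub: "{\<xi> \<in> space M. \<not> dense n \<xi>}
      \<subseteq> {\<xi> \<in> space M. p\<^sup>2 / 4 * real n \<le> (alpha n \<xi> (vec 1))\<^sup>2}"
  proof safe
    fix \<xi> assume "\<not> dense n \<xi>"
    then have "alpha n \<xi> (vec 1) / sqrt (real n) < - (p / 2)" unfolding card_aset_alpha[OF assms] by linarith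
    then have "p / 2 * sqrt (real n) < - alpha n \<xi> (vec 1)"
      using assms by (simp add: pos_divide_less_eq)
    then have "(p / 2 * sqrt (real n))\<^sup>2 \<le> (- alpha n \<xi> (vec 1))\<^sup>2"
      using p_pos by (intro power_mono) auto
    then show "p\<^sup>2 / 4 * real n \<le> (alpha n \<xi> (vec 1))\<^sup>2" by (simp add: power_mult_distrib power_divide)
  qed
  have "prob {\<xi> \<in> space M. \<not> dense n \<xi>}
     \<le> prob {\<xi> \<in> space M. p\<^sup>2 / 4 * real n \<le> (alpha n \<xi> (vec 1))\<^sup>2}"
    by (rule finite_measure_mono[OF sub]) measurable
  also have "\<dots> \<le> (\<integral>\<xi>. (alpha n \<xi> (vec 1))\<^sup>2 \<partial>M) / (p\<^sup>2 / 4 * real n)"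
    using integral_Markov_inequality_measure[of M "\<lambda>\<xi>. (alpha n \<xi> (vec 1))\<^sup>2" "{}" "p\<^sup>2 / 4 * real n"] m assms p_pos
    by simp
  also have "\<dots> \<le> 4 / (p\<^sup>2 / 4 * real n)" using m(2) assms by (intro divide_right_mono) auto
  also have "\<dots> = 16 / (p\<^sup>2 * real n)" by simp
  finally show ?thesis .
qed

context
  fixes n \<xi> assumes go: "good n \<xi>" and nt: "no_ties \<xi>"
begin

interpretation S: sample D p g n "aset n \<xi>" "\<lambda>j. Us j \<xi>"
  using go by (simp add: good_def)

text \<open>\<open>F k\<close> may be constant on intervals and then preserves the order of the data
  only weakly. Without ties among the transformed data, the ranks before and after the
  transformation agree.\<close>

lemma pseudoU_eq:
  assumes "i \<in> aset n \<xi>"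
  shows "pseudoU Xs Zs A n \<xi> i = (\<chi> k. Fnw n \<xi> k (Us i \<xi> $ k))"
proof -
  have "empF Xs Zs A n \<xi> k (Xs i \<xi> $ k) = Fnw n \<xi> k (Us i \<xi> $ k)" for k
  proof -
    have "Xs j \<xi> $ k \<le> Xs i \<xi> $ k \<longleftrightarrow> Us j \<xi> $ k \<le> Us i \<xi> $ k" if j: "j \<in> aset n \<xi>" for j
    proof
      assume "Xs j \<xi> $ k \<le> Xs i \<xi> $ k"
      then show "Us j \<xi> $ k \<le> Us i \<xi> $ k" by (simp add: Us_def F_mono)
    next
      assume le: "Us j \<xi> $ k \<le> Us i \<xi> $ k"
      show "Xs j \<xi> $ k \<le> Xs i \<xi> $ k"
      proof (rule ccontr)
        assume "\<not> Xs j \<xi> $ k \<le> Xs i \<xi> $ k"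
        then have lt: "Xs i \<xi> $ k < Xs j \<xi> $ k" by simp
        then have "Us i \<xi> $ k \<le> Us j \<xi> $ k" by (simp add: Us_def F_mono)
        then have "Us i \<xi> $ k = Us j \<xi> $ k" using le by simp
        then have "i = j" using nt assms j by (auto simp: no_ties_def aset_def)
        then show False using lt by simp
      qed
    qed
    then have "{j \<in> {..<n}. Xs j \<xi> $ k \<le> Xs i \<xi> $ k \<and> Zs j \<xi> \<in> A} = {j \<in> aset n \<xi>. Us j \<xi> $ k \<le> Us i \<xi> $ k}"
      by (auto simp: aset_def)
    then have "(\<Sum>j<n. if Xs j \<xi> $ k \<le> Xs i \<xi> $ k \<and> Zs j \<xi> \<in> A then 1 else 0 :: real)
       = real (card {j \<in> aset n \<xi>. Us j \<xi> $ k \<le> Us i \<xi> $ k})"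
      by (simp add: sum.If_cases Int_def)
    then show ?thesis unfolding empF_def S.Fn_def n_phat[OF S.n_pos] by simp
  qed
  then show ?thesis by (simp add: pseudoU_def)
qed

lemma Fn_le1: "0 \<le> Fnw n \<xi> k t" "Fnw n \<xi> k t \<le> 1"
  unfolding S.Fn_def using S.card_a_pos card_mono[OF finite_aset, of "{j \<in> aset n \<xi>. Us j \<xi> $ k \<le> t}" n \<xi>]
  by (auto simp: divide_le_eq_1)

lemma empCop_eq: "empCop Xs Zs A n \<xi> S u = Chw n \<xi> (onK S u)"
proof -
  have "{i \<in> {..<n}. (\<forall>j\<in>S. pseudoU Xs Zs A n \<xi> i $ j \<le> u $ j) \<and> Zs i \<xi> \<in> A}
     = {i \<in> aset n \<xi>. \<forall>k. Fnw n \<xi> k (Us i \<xi> $ k) \<le> onK S u $ k}"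
    using Fn_le1 pseudoU_eq by (auto simp: aset_def split: if_splits)
  then have "(\<Sum>i<n. if (\<forall>j\<in>S. pseudoU Xs Zs A n \<xi> i $ j \<le> u $ j) \<and> Zs i \<xi> \<in> A then 1 else 0 :: real)
     = real (card {i \<in> aset n \<xi>. \<forall>k. Fnw n \<xi> k (Us i \<xi> $ k) \<le> onK S u $ k})"
    by (simp add: sum.If_cases Int_def)
  then show ?thesis unfolding empCop_def S.Chat_def n_phat[OF S.n_pos] by simp
qed

lemma Chw_meas [measurable]: "v \<in> borel_measurable Q \<Longrightarrow> (\<lambda>x. Chw n \<xi> (v x)) \<in> borel_measurable Q"
proof -
  assume [measurable]: "v \<in> borel_measurable Q"
  have "Chw n \<xi> y = (\<Sum>j\<in>aset n \<xi>. if \<forall>k. Fnw n \<xi> k (Us j \<xi> $ k) \<le> y $ k then 1 else 0) / real (card (aset n \<xi>))" for y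
    unfolding S.Chat_def using finite_aset by (simp add: sum.If_cases Int_def)
  then show ?thesis by simp
qed

lemma Chw_bound: "0 \<le> Chw n \<xi> y" "Chw n \<xi> y \<le> 1"
  unfolding S.Chat_def using S.card_a_pos
    card_mono[OF finite_aset, of "{j \<in> aset n \<xi>. \<forall>k. Fnw n \<xi> k (Us j \<xi> $ k) \<le> y $ k}" n \<xi>]
  by (auto simp: divide_le_eq_1)

end

text \<open>For fixed \<open>w\<close> the point \<open>vv (E i \<xi>) w\<close> is a function of
  one observation, so the moment bounds apply. Tonelli's theorem then averages over \<open>w\<close>
  and gives integrability in \<open>w\<close> for almost every sample.\<close>

lemma mean_over_Lc:
  fixes \<Phi> :: "'a \<Rightarrow> real^'p \<Rightarrow> real" and vv :: "(real^'p) \<times> (real^'q) \<Rightarrow> real^'p \<Rightarrow> real^'p"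
  assumes \<Phi>: "(\<lambda>(\<xi>, u). \<Phi> \<xi> u) \<in> borel_measurable (M \<Otimes>\<^sub>M borel)" and nn: "\<And>\<xi> u. 0 \<le> \<Phi> \<xi> u"
    and vv: "(\<lambda>(e, w). vv e w) \<in> borel_measurable (borel \<Otimes>\<^sub>M borel)"
    and cube: "\<And>e w. w \<in> unitcube \<Longrightarrow> vv e w \<in> unitcube"
    and int: "\<And>v. v \<in> borel_measurable borel \<Longrightarrow> (\<And>e. v e \<in> unitcube) \<Longrightarrow> integrable M (\<lambda>\<xi>. \<Phi> \<xi> (v (E i \<xi>)))"
    and le: "\<And>v. v \<in> borel_measurable borel \<Longrightarrow> (\<And>e. v e \<in> unitcube) \<Longrightarrow> (\<integral>\<xi>. \<Phi> \<xi> (v (E i \<xi>)) \<partial>M) \<le> b"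
  shows "integrable (M \<Otimes>\<^sub>M Lc) (\<lambda>(\<xi>, w). \<Phi> \<xi> (vv (E i \<xi>) w))"
    "integrable M (\<lambda>\<xi>. \<integral>w. \<Phi> \<xi> (vv (E i \<xi>) w) \<partial>Lc)" "(\<integral>\<xi>. (\<integral>w. \<Phi> \<xi> (vv (E i \<xi>) w) \<partial>Lc) \<partial>M) \<le> b"
    "AE \<xi> in M. integrable Lc (\<lambda>w. \<Phi> \<xi> (vv (E i \<xi>) w))"
proof -
  interpret P: pair_prob_space M Lc ..
  have m: "(\<lambda>(\<xi>, w). \<Phi> \<xi> (vv (E i \<xi>) w)) \<in> borel_measurable (M \<Otimes>\<^sub>M Lc)"
  proof -
    have 1: "(\<lambda>z. (E i (fst z), snd z)) \<in> measurable (M \<Otimes>\<^sub>M Lc) (borel \<Otimes>\<^sub>M borel)" by measurable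
    have 2: "(\<lambda>z. vv (E i (fst z)) (snd z)) \<in> borel_measurable (M \<Otimes>\<^sub>M Lc)"
      using measurable_compose[OF 1 vv] by simp
    have "(\<lambda>z. (fst z, vv (E i (fst z)) (snd z))) \<in> measurable (M \<Otimes>\<^sub>M Lc) (M \<Otimes>\<^sub>M borel)"
      using 2 by measurable
    from measurable_compose[OF this \<Phi>] show ?thesis by (simp add: split_beta')
  qed
  have vw: "(\<lambda>e. vv e w) \<in> borel_measurable borel" for w
    using measurable_compose[OF measurable_Pair[OF measurable_ident_sets[OF refl] measurable_const[of w borel borel]] vv] by simp
  have b0: "0 \<le> b"
  proof -
    have "0 \<le> (\<integral>\<xi>. \<Phi> \<xi> ((\<lambda>e. 0) (E i \<xi>)) \<partial>M)" using nn by simp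
    also have "\<dots> \<le> b" by (rule le) (auto simp: unitcube_iff)
    finally show ?thesis .
  qed
  have "(\<integral>\<^sup>+z. ennreal (case z of (\<xi>, w) \<Rightarrow> \<Phi> \<xi> (vv (E i \<xi>) w)) \<partial>(M \<Otimes>\<^sub>M Lc))
     = (\<integral>\<^sup>+w. (\<integral>\<^sup>+\<xi>. ennreal (\<Phi> \<xi> (vv (E i \<xi>) w)) \<partial>M) \<partial>Lc)"
    using m by (subst P.nn_integral_snd[symmetric]) auto
  also have "\<dots> \<le> (\<integral>\<^sup>+w. ennreal b \<partial>(Lc :: (real^'p) measure))"
  proof (rule nn_integral_mono)
    fix w :: "real^'p" assume "w \<in> space Lc"
    then have w: "\<And>e. vv e w \<in> unitcube" using cube by (simp add: space_Lc)
    have "(\<integral>\<^sup>+\<xi>. ennreal (\<Phi> \<xi> (vv (E i \<xi>) w)) \<partial>M) = ennreal (\<integral>\<xi>. \<Phi> \<xi> (vv (E i \<xi>) w) \<partial>M)"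
      by (rule nn_integral_eq_integral[OF int[OF vw w]]) (simp add: nn)
    also have "\<dots> \<le> ennreal b" by (intro ennreal_leI le[OF vw w])
    finally show "(\<integral>\<^sup>+\<xi>. ennreal (\<Phi> \<xi> (vv (E i \<xi>) w)) \<partial>M) \<le> ennreal b" .
  qed
  also have "\<dots> = ennreal b" by (simp add: Lc.emeasure_space_1)
  finally have nnb: "(\<integral>\<^sup>+z. ennreal (case z of (\<xi>, w) \<Rightarrow> \<Phi> \<xi> (vv (E i \<xi>) w)) \<partial>(M \<Otimes>\<^sub>M Lc)) \<le> ennreal b" .
  show I: "integrable (M \<Otimes>\<^sub>M Lc) (\<lambda>(\<xi>, w). \<Phi> \<xi> (vv (E i \<xi>) w))"
    unfolding integrable_iff_bounded
  proof
    have "(\<integral>\<^sup>+z. ennreal (norm (case z of (\<xi>, w) \<Rightarrow> \<Phi> \<xi> (vv (E i \<xi>) w))) \<partial>(M \<Otimes>\<^sub>M Lc))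
        = (\<integral>\<^sup>+z. ennreal (case z of (\<xi>, w) \<Rightarrow> \<Phi> \<xi> (vv (E i \<xi>) w)) \<partial>(M \<Otimes>\<^sub>M Lc))"
      by (intro nn_integral_cong) (auto simp: nn)
    also have "\<dots> < \<infinity>" using le_less_trans[OF nnb ennreal_less_top[of b]] by simp
    finally show "(\<integral>\<^sup>+z. ennreal (norm (case z of (\<xi>, w) \<Rightarrow> \<Phi> \<xi> (vv (E i \<xi>) w))) \<partial>(M \<Otimes>\<^sub>M Lc)) < \<infinity>" .
  qed (rule m)
  show "integrable M (\<lambda>\<xi>. \<integral>w. \<Phi> \<xi> (vv (E i \<xi>) w) \<partial>Lc)" by (rule P.integrable_fst[OF I])
  show "AE \<xi> in M. integrable Lc (\<lambda>w. \<Phi> \<xi> (vv (E i \<xi>) w))" by (rule P.AE_integrable_fst[OF I])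
  have "(\<integral>\<xi>. (\<integral>w. \<Phi> \<xi> (vv (E i \<xi>) w) \<partial>Lc) \<partial>M) = (\<integral>z. (case z of (\<xi>, w) \<Rightarrow> \<Phi> \<xi> (vv (E i \<xi>) w)) \<partial>(M \<Otimes>\<^sub>M Lc))"
    by (rule P.integral_fst[OF I])
  also have "\<dots> \<le> b"
    using nnb b0 nn_integral_eq_integral[OF I] nn by (simp add: split_beta' ennreal_le_iff)
  finally show "(\<integral>\<xi>. (\<integral>w. \<Phi> \<xi> (vv (E i \<xi>) w) \<partial>Lc) \<partial>M) \<le> b" .
qed

lemma Cop_meas [measurable]:
  assumes [measurable]: "h \<in> borel_measurable Q" "v \<in> borel_measurable Q" and "\<And>x. x \<in> space Q \<Longrightarrow> v x \<in> unitcube"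
  shows "(\<lambda>x. Cop (hc (h x)) (v x)) \<in> borel_measurable Q"
proof -
  have gm: "(\<lambda>x. g k (v x)) \<in> borel_measurable Q" for k
  proof -
    have "(\<lambda>x. indicator unitcube (v x) * g k (v x)) \<in> borel_measurable Q"
      using measurable_compose[OF assms(2) g_meas] .
    then show ?thesis by (subst measurable_cong[of Q _ "\<lambda>x. indicator unitcube (v x) * g k (v x)"]) (use assms in auto)
  qed
  show ?thesis unfolding Cop_def bridge_def using gm by measurable
qed

text \<open>Linearity in the path turns the limit term itself into a normalised iid sum, within
  reach of \<open>second_moment_at_sample\<close>.\<close>

lemma Cop_alpha: "Cop (alpha n \<xi>) u = (\<Sum>j<n. Cop (hc (E j \<xi>)) u) / sqrt (real n)"
proof -
  have br: "bridge (alpha n \<xi>) k u = (\<Sum>j<n. bridge (hc (E j \<xi>)) k u) / sqrt (real n)" for k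
    unfolding bridge_def alpha_lin ..
  show ?thesis
    unfolding Cop_def br alpha_def
    by (simp add: sum_subtractf sum_divide_distrib[symmetric] diff_divide_distrib sum_distrib_left[symmetric]
        sum.swap[of _ _ "{..<n}"])
qed

lemma Cop_alpha_meas [measurable]:
  assumes [measurable]: "h \<in> measurable Q M" "v \<in> borel_measurable Q" and "\<And>x. x \<in> space Q \<Longrightarrow> v x \<in> unitcube"
  shows "(\<lambda>x. Cop (alpha n (h x)) (v x)) \<in> borel_measurable Q"
  unfolding Cop_alpha using Cop_meas[of "\<lambda>x. E _ (h x)" Q v] assms by measurable

end

section \<open>The statistic and its split\<close>

locale cop_stat = cop_data M X Z Xs Zs A
  for M :: "'a measure" and X :: "'a \<Rightarrow> real^'p::finite" and Z :: "'a \<Rightarrow> real^'q::finite"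
    and Xs :: "nat \<Rightarrow> 'a \<Rightarrow> real^'p" and Zs :: "nat \<Rightarrow> 'a \<Rightarrow> real^'q" and A :: "(real^'q) set" +
  fixes \<psi> :: "real^'p \<Rightarrow> real" and K K' :: "'p set"
  assumes psi_cont: "continuous_on unitcube \<psi>"
    and phi_bv: "hk_bv K' (phiKK M X Z A \<psi> K K')"
begin

abbreviation "\<phi> \<equiv> phiKK M X Z A \<psi> K K'"
abbreviation "rho \<equiv> rhoKK M X Z A \<psi> K K'"

text \<open>For values \<open>e\<close> of the sample this is \<open>vmix K' (fst e) w\<close>. The
  truncation puts the result in the cube for every \<open>e\<close>, so that measurability and
  integrability hold without exceptional sets.\<close>

definition vK :: "(real^'p) \<times> (real^'q) \<Rightarrow> real^'p \<Rightarrow> real^'p" where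
  "vK e w = vmix K' (if fst e \<in> unitcube then fst e else vec 1) w"

definition stat :: "nat \<Rightarrow> 'a \<Rightarrow> real" where
  "stat n \<xi> = sqrt (real n) * (rhohat Xs Zs A \<psi> K K' n \<xi> - rho)"

definition S2 :: "nat \<Rightarrow> 'a \<Rightarrow> real" where
  "S2 n \<xi> = sqrt (real n) * ((\<Sum>i\<in>aset n \<xi>. \<phi> (pseudoU Xs Zs A n \<xi> i)) / real (card (aset n \<xi>)) - rho)"

text \<open>The first-order form of \<open>stat - S2\<close>: the linearised error of the integrand,
  with data in place of ranks and \<open>p\<close> in place of the sample share.\<close>

definition R1 :: "nat \<Rightarrow> 'a \<Rightarrow> real" where
  "R1 n \<xi> = (\<Sum>i<n. indicator A (Zs i \<xi>) * (\<integral>w. \<psi> (vK (E i \<xi>) w) * Cop (alpha n \<xi>) (onK K (vK (E i \<xi>) w)) \<partial>Lc) / p) / real n"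

lemma vK_E: "vK (E i \<xi>) w = vmix K' (Us i \<xi>) w"
  using Us_cube by (simp add: vK_def E_def)

lemma vK_cube: "w \<in> unitcube \<Longrightarrow> vK e w \<in> unitcube"
  by (auto simp: vK_def unitcube_iff)

lemma onK_cube: "u \<in> unitcube \<Longrightarrow> onK S u \<in> unitcube"
  by (auto simp: unitcube_iff)

lemma vmix_cube: "u \<in> unitcube \<Longrightarrow> v \<in> unitcube \<Longrightarrow> vmix S u v \<in> unitcube"
  by (auto simp: unitcube_iff)

lemma vK_meas: "(\<lambda>(e, w). vK e w) \<in> borel_measurable (borel \<Otimes>\<^sub>M borel)"
  unfolding vK_def split_beta' by measurable

lemma vK_meas1 [measurable]:
  assumes "h \<in> borel_measurable Q" "h' \<in> borel_measurable Q"
  shows "(\<lambda>x. vK (h x) (h' x)) \<in> borel_measurable Q"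
  using measurable_compose[OF measurable_Pair[OF assms] vK_meas] by simp

lemma psi_bound:
  obtains B where "0 < B" "\<And>u. u \<in> unitcube \<Longrightarrow> \<bar>\<psi> u\<bar> \<le> B"
proof -
  have "compact (\<psi> ` unitcube)" by (rule compact_continuous_image[OF psi_cont]) simp
  then obtain B where "\<And>x. x \<in> \<psi> ` unitcube \<Longrightarrow> norm x \<le> B"
    using compact_imp_bounded bounded_iff by metis
  then show thesis by (intro that[of "max 1 B"]) (auto simp: le_max_iff_disj)
qed

text \<open>The distance to which this is applied is random and controlled in mean only, so lack of
  closeness is paid for by a term linear in it.\<close>

lemma psi_modulus:
  assumes "0 < e"
  obtains C where "0 \<le> C"
    "\<And>x y. x \<in> unitcube \<Longrightarrow> y \<in> unitcube \<Longrightarrow> \<bar>\<psi> x - \<psi> y\<bar> \<le> e + C * (\<Sum>k\<in>UNIV. \<bar>x $ k - y $ k\<bar>)"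
proof -
  obtain B where B: "0 < B" "\<And>u. u \<in> unitcube \<Longrightarrow> \<bar>\<psi> u\<bar> \<le> B" using psi_bound by metis
  obtain \<delta> where \<delta>: "0 < \<delta>"
    "\<And>x y. x \<in> unitcube \<Longrightarrow> y \<in> unitcube \<Longrightarrow> (\<And>j. \<bar>x $ j - y $ j\<bar> \<le> \<delta>) \<Longrightarrow> \<bar>\<psi> x - \<psi> y\<bar> \<le> e"
    using cube_modulus[OF psi_cont assms] by metis
  show thesis
  proof (rule that[of "2 * B / \<delta>"])
    show "0 \<le> 2 * B / \<delta>" using B \<delta> by simp
    fix x y :: "real^'p" assume xy: "x \<in> unitcube" "y \<in> unitcube"
    have nn: "0 \<le> (\<Sum>k\<in>UNIV. \<bar>x $ k - y $ k\<bar>)" by (simp add: sum_nonneg)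
    show "\<bar>\<psi> x - \<psi> y\<bar> \<le> e + 2 * B / \<delta> * (\<Sum>k\<in>UNIV. \<bar>x $ k - y $ k\<bar>)"
    proof (cases "\<forall>j. \<bar>x $ j - y $ j\<bar> \<le> \<delta>")
      case True
      then have "\<bar>\<psi> x - \<psi> y\<bar> \<le> e" using \<delta>(2)[OF xy] by simp
      moreover have "0 \<le> 2 * B / \<delta> * (\<Sum>k\<in>UNIV. \<bar>x $ k - y $ k\<bar>)"
        using nn B \<delta> by (intro mult_nonneg_nonneg) auto
      ultimately show ?thesis by linarith
    next
      case False
      then obtain j where "\<delta> < \<bar>x $ j - y $ j\<bar>" by (auto simp: not_le)
      also have "\<dots> \<le> (\<Sum>k\<in>UNIV. \<bar>x $ k - y $ k\<bar>)" by (rule member_le_sum) auto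
      finally have "2 * B / \<delta> * \<delta> \<le> 2 * B / \<delta> * (\<Sum>k\<in>UNIV. \<bar>x $ k - y $ k\<bar>)"
        using B \<delta> by (intro mult_left_mono) auto
      then have "2 * B \<le> 2 * B / \<delta> * (\<Sum>k\<in>UNIV. \<bar>x $ k - y $ k\<bar>)" using \<delta> by simp
      moreover have "\<bar>\<psi> x - \<psi> y\<bar> \<le> 2 * B" using B(2)[OF xy(1)] B(2)[OF xy(2)] by linarith
      ultimately show ?thesis using assms by linarith
    qed
  qed
qed

lemma phi_eq: "\<phi> v = (\<integral>w. \<psi> (vmix K' v w) * (D (onK K (vmix K' v w)) / p) \<partial>Lc)"
  by (simp add: phiKK_def condCop_def LINT_Lc)

lemma rho_eq: "rho = (\<integral>\<xi>. indicator A (Z \<xi>) * \<phi> (U \<xi>) \<partial>M) / p"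
  by (simp add: rhoKK_def phiKK_def indicator_def)

lemma phi_dep: "\<phi> (onK K' x) = \<phi> x"
proof -
  have "vmix K' (onK K' x) w = vmix K' x w" for w by (simp add: vec_eq_iff)
  then show ?thesis by (simp add: phiKK_def)
qed

lemma Lc_psi_D_integrable:
  fixes v :: "real^'p \<Rightarrow> real^'p"
  assumes [measurable]: "v \<in> borel_measurable Lc" and "\<And>w. w \<in> unitcube \<Longrightarrow> v w \<in> unitcube"
  shows "integrable Lc (\<lambda>w. \<psi> (v w) * (D (onK K (v w)) / p))"
proof -
  obtain B where B: "0 < B" "\<And>u. u \<in> unitcube \<Longrightarrow> \<bar>\<psi> u\<bar> \<le> B" using psi_bound by metis
  have [measurable]: "(\<lambda>w. \<psi> (v w)) \<in> borel_measurable Lc"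
    by (rule cont_comp_meas[OF psi_cont assms(1)]) (use assms in \<open>simp add: space_Lc\<close>)
  show ?thesis
  proof (rule Lc.integrable_const_bound[where B = "B * 1"])
    show "AE w in Lc. norm (\<psi> (v w) * (D (onK K (v w)) / p)) \<le> B * 1"
    proof (rule AE_I2)
      fix w :: "real^'p" assume "w \<in> space Lc"
      then show "norm (\<psi> (v w) * (D (onK K (v w)) / p)) \<le> B * 1"
        unfolding norm_mult using B assms D_nonneg D_le p_pos
        by (intro mult_mono) (auto simp: space_Lc)
    qed
  qed measurable
qed

lemma phi_cont: "continuous_on unitcube \<phi>"
  unfolding continuous_on_iff
proof (intro ballI allI impI)
  fix x :: "real^'p" and e :: real assume x: "x \<in> unitcube" and e: "0 < e"
  define q where "q u = \<psi> u * (D (onK K u) / p)" for u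
  have onKc: "continuous_on unitcube (\<lambda>u. onK K u)"
    unfolding vmix_def
  proof (rule continuous_on_vec_lambda)
    show "continuous_on unitcube (\<lambda>u. if j \<in> K then u $ j else vec 1 $ j)" for j
      by (cases "j \<in> K") (auto intro!: continuous_intros)
  qed
  have "continuous_on unitcube (\<lambda>u. D (onK K u))"
    by (rule continuous_on_compose2[OF D_cont[of UNIV] onKc]) simp
  then have qc: "continuous_on unitcube q"
    unfolding q_def using p_pos by (intro continuous_intros psi_cont) auto
  obtain \<delta> where \<delta>: "0 < \<delta>"
    "\<And>x y. x \<in> unitcube \<Longrightarrow> y \<in> unitcube \<Longrightarrow> (\<And>j. \<bar>x $ j - y $ j\<bar> \<le> \<delta>) \<Longrightarrow> \<bar>q x - q y\<bar> \<le> e / 2"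
    using cube_modulus[OF qc, of "e / 2"] e by (metis half_gt_zero)
  show "\<exists>d>0. \<forall>x'\<in>unitcube. dist x' x < d \<longrightarrow> dist (\<phi> x') (\<phi> x) < e"
  proof (intro exI[of _ \<delta>] conjI ballI impI \<delta>(1))
    fix y :: "real^'p" assume y: "y \<in> unitcube" and d: "dist y x < \<delta>"
    have yx: "\<bar>y $ j - x $ j\<bar> \<le> \<delta>" for j
      using component_le_norm_cart[of "y - x" j] d by (simp add: dist_norm)
    have int: "integrable Lc (\<lambda>w. q (vmix K' z w))" if "z \<in> unitcube" for z
      unfolding q_def using that by (intro Lc_psi_D_integrable) (auto intro!: vmix_cube)
    have "\<phi> y - \<phi> x = (\<integral>w. q (vmix K' y w) - q (vmix K' x w) \<partial>Lc)"
      unfolding phi_eq q_def[symmetric] using int[OF x] int[OF y] by simp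
    also have "\<bar>\<dots>\<bar> \<le> (\<integral>w. \<bar>q (vmix K' y w) - q (vmix K' x w)\<bar> \<partial>Lc)" by (rule integral_abs_bound)
    also have "\<dots> \<le> (\<integral>w. e / 2 \<partial>(Lc :: (real^'p) measure))"
    proof (rule integral_mono)
      show "integrable Lc (\<lambda>w. \<bar>q (vmix K' y w) - q (vmix K' x w)\<bar>)" using int[OF x] int[OF y] by simp
      fix w :: "real^'p" assume "w \<in> space Lc"
      then have "vmix K' y w \<in> unitcube" "vmix K' x w \<in> unitcube" using x y by (auto simp: space_Lc vmix_cube)
      then show "\<bar>q (vmix K' y w) - q (vmix K' x w)\<bar> \<le> e / 2" by (rule \<delta>(2)) (use yx \<delta>(1) in auto)
    qed simp
    also have "\<dots> < e" using e by (simp add: Lc.prob_space)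
    finally show "dist (\<phi> y) (\<phi> x) < e" by (simp add: dist_real_def)
  qed
qed

text \<open>The assumption speaks of nonempty faces; on the empty face there is a single degenerate
  cell.\<close>

lemma phi_vitali: "J \<subseteq> K' \<Longrightarrow> vitali_bv J (\<lambda>x. \<phi> (onK J x))"
proof (cases "J = {}")
  case True
  have "grid_cells {} g = {(vec 1, vec 1)}" for g :: "'p \<Rightarrow> real set"
    by (auto simp: grid_cells_def vec_eq_iff)
  then have "{(\<Sum>c\<in>grid_cells {} g. \<bar>qvol {} (\<lambda>x. \<phi> (onK {} x)) (fst c) (snd c)\<bar>) | g. is_grid {} g}
     \<subseteq> {\<bar>qvol {} (\<lambda>x. \<phi> (onK {} x)) (vec 1) (vec 1)\<bar>}" by auto
  then show ?thesis unfolding True vitali_bv_def by (rule bdd_above_mono[rotated]) simp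
next
  case False
  assume "J \<subseteq> K'"
  then show ?thesis using phi_bv False unfolding hk_bv_def by blast
qed

lemma stat_eq:
  assumes go: "good n \<xi>" and nt: "no_ties \<xi>"
  shows "stat n \<xi> - S2 n \<xi> = (\<Sum>i\<in>aset n \<xi>. \<integral>w. \<psi> (vmix K' (pseudoU Xs Zs A n \<xi> i) w) *
      (sqrt (real n) * (Chw n \<xi> (onK K (vmix K' (pseudoU Xs Zs A n \<xi> i) w))
         - D (onK K (vmix K' (pseudoU Xs Zs A n \<xi> i) w)) / p)) \<partial>Lc) / real (card (aset n \<xi>))"
proof -
  interpret S: sample D p g n "aset n \<xi>" "\<lambda>j. Us j \<xi>" using go by (simp add: good_def)
  define P where "P i = pseudoU Xs Zs A n \<xi> i" for i
  define N where "N = real (card (aset n \<xi>))"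
  have Pc: "P i \<in> unitcube" if "i \<in> aset n \<xi>" for i
    unfolding P_def pseudoU_eq[OF go nt that] using Fn_le1[OF go nt] by (simp add: unitcube_iff)
  obtain B where B: "0 < B" "\<And>u. u \<in> unitcube \<Longrightarrow> \<bar>\<psi> u\<bar> \<le> B" using psi_bound by metis
  have i1: "integrable Lc (\<lambda>w. \<psi> (vmix K' (P i) w) * Chw n \<xi> (onK K (vmix K' (P i) w)))" if i: "i \<in> aset n \<xi>" for i
  proof -
    have [measurable]: "(\<lambda>w. \<psi> (vmix K' (P i) w)) \<in> borel_measurable Lc"
      by (rule cont_comp_meas[OF psi_cont]) (use Pc[OF i] in \<open>auto simp: space_Lc vmix_cube\<close>)
    note [measurable] = Chw_meas[OF go nt]
    show ?thesis
    proof (rule Lc.integrable_const_bound[where B = "B * 1"])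
      show "AE w in Lc. norm (\<psi> (vmix K' (P i) w) * Chw n \<xi> (onK K (vmix K' (P i) w))) \<le> B * 1"
        unfolding norm_mult using B Pc[OF i] Chw_bound[OF go nt]
        by (intro AE_I2 mult_mono) (auto simp: space_Lc vmix_cube)
    qed measurable
  qed
  have i2: "integrable Lc (\<lambda>w. \<psi> (vmix K' (P i) w) * (D (onK K (vmix K' (P i) w)) / p))" if i: "i \<in> aset n \<xi>" for i
    using Pc[OF i] by (intro Lc_psi_D_integrable) (auto simp: vmix_cube)
  have "rhohat Xs Zs A \<psi> K K' n \<xi> = (\<Sum>i<n. if Zs i \<xi> \<in> A then
        (\<integral>w. \<psi> (vmix K' (P i) w) * Chw n \<xi> (onK K (vmix K' (P i) w)) \<partial>Lc) else 0) / N"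
    unfolding rhohat_def n_phat[OF S.n_pos] empCop_eq[OF go nt] LINT_Lc P_def N_def ..
  also have "(\<Sum>i<n. if Zs i \<xi> \<in> A then (\<integral>w. \<psi> (vmix K' (P i) w) * Chw n \<xi> (onK K (vmix K' (P i) w)) \<partial>Lc) else 0)
     = (\<Sum>i\<in>aset n \<xi>. \<integral>w. \<psi> (vmix K' (P i) w) * Chw n \<xi> (onK K (vmix K' (P i) w)) \<partial>Lc)"
    by (rule sum.mono_neutral_cong_right) (auto simp: aset_def)
  finally have rh: "rhohat Xs Zs A \<psi> K K' n \<xi> = (\<Sum>i\<in>aset n \<xi>. \<integral>w. \<psi> (vmix K' (P i) w) * Chw n \<xi> (onK K (vmix K' (P i) w)) \<partial>Lc) / N" .
  have "stat n \<xi> - S2 n \<xi> = sqrt (real n) * ((\<Sum>i\<in>aset n \<xi>. \<integral>w. \<psi> (vmix K' (P i) w) * Chw n \<xi> (onK K (vmix K' (P i) w)) \<partial>Lc) / N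
      - (\<Sum>i\<in>aset n \<xi>. \<phi> (P i)) / N)"
    unfolding stat_def S2_def rh P_def[symmetric] N_def[symmetric] by (simp add: algebra_simps)
  also have "\<dots> = (\<Sum>i\<in>aset n \<xi>. sqrt (real n) * ((\<integral>w. \<psi> (vmix K' (P i) w) * Chw n \<xi> (onK K (vmix K' (P i) w)) \<partial>Lc) - \<phi> (P i))) / N"
    by (simp add: sum_subtractf sum_distrib_left[symmetric] diff_divide_distrib right_diff_distrib)
  also have "\<dots> = (\<Sum>i\<in>aset n \<xi>. \<integral>w. \<psi> (vmix K' (P i) w) * (sqrt (real n) * (Chw n \<xi> (onK K (vmix K' (P i) w))
         - D (onK K (vmix K' (P i) w)) / p)) \<partial>Lc) / N"
  proof (intro arg_cong2[where f = "(/)"] sum.cong refl)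
    fix i assume i: "i \<in> aset n \<xi>"
    have eq1: "(\<integral>w. \<psi> (vmix K' (P i) w) * Chw n \<xi> (onK K (vmix K' (P i) w)) \<partial>Lc) - \<phi> (P i)
       = (\<integral>w. \<psi> (vmix K' (P i) w) * Chw n \<xi> (onK K (vmix K' (P i) w)) - \<psi> (vmix K' (P i) w) * (D (onK K (vmix K' (P i) w)) / p) \<partial>Lc)"
      unfolding phi_eq using i1[OF i] i2[OF i] by simp
    have "sqrt (real n) * (\<integral>w. \<psi> (vmix K' (P i) w) * Chw n \<xi> (onK K (vmix K' (P i) w)) - \<psi> (vmix K' (P i) w) * (D (onK K (vmix K' (P i) w)) / p) \<partial>Lc)
       = (\<integral>w. sqrt (real n) * (\<psi> (vmix K' (P i) w) * Chw n \<xi> (onK K (vmix K' (P i) w)) - \<psi> (vmix K' (P i) w) * (D (onK K (vmix K' (P i) w)) / p)) \<partial>Lc)"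
      by (rule integral_mult_right_zero[symmetric])
    also have "\<dots> = (\<integral>w. \<psi> (vmix K' (P i) w) * (sqrt (real n) * (Chw n \<xi> (onK K (vmix K' (P i) w))
         - D (onK K (vmix K' (P i) w)) / p)) \<partial>Lc)"
    proof (rule Bochner_Integration.integral_cong[OF refl])
      have "r * (a * b - a * c) = a * (r * (b - c))" for r a b c :: real by (simp add: algebra_simps)
      then show "sqrt (real n) * (\<psi> (vmix K' (P i) w) * Chw n \<xi> (onK K (vmix K' (P i) w)) - \<psi> (vmix K' (P i) w) * (D (onK K (vmix K' (P i) w)) / p))
        = \<psi> (vmix K' (P i) w) * (sqrt (real n) * (Chw n \<xi> (onK K (vmix K' (P i) w)) - D (onK K (vmix K' (P i) w)) / p))" for w .
    qed
    finally show "sqrt (real n) * ((\<integral>w. \<psi> (vmix K' (P i) w) * Chw n \<xi> (onK K (vmix K' (P i) w)) \<partial>Lc) - \<phi> (P i))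
       = (\<integral>w. \<psi> (vmix K' (P i) w) * (sqrt (real n) * (Chw n \<xi> (onK K (vmix K' (P i) w))
         - D (onK K (vmix K' (P i) w)) / p)) \<partial>Lc)" unfolding eq1 .
  qed
  finally show ?thesis by (simp add: P_def N_def)
qed

text \<open>Three replacements with one error each: the linearisation, \<psi> at the ranks against
  \<psi> at the data, and the sample share against \<open>p\<close>.\<close>

lemma S1_pointwise:
  assumes go: "good n \<xi>" and nt: "no_ties \<xi>" and i: "i \<in> aset n \<xi>" and w: "w \<in> unitcube"
    and B: "0 < B" "\<And>u. u \<in> unitcube \<Longrightarrow> \<bar>\<psi> u\<bar> \<le> B"
    and C: "0 \<le> C" "\<And>x y. x \<in> unitcube \<Longrightarrow> y \<in> unitcube \<Longrightarrow> \<bar>\<psi> x - \<psi> y\<bar> \<le> e + C * (\<Sum>k\<in>UNIV. \<bar>x $ k - y $ k\<bar>)"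
    and e: "0 < e"
    and V: "V = vmix K' (Us i \<xi>) w" "V' = vmix K' (pseudoU Xs Zs A n \<xi> i) w" and u: "u = onK K V"
    and bd: "\<bar>sqrt (real n) * (Chw n \<xi> (vmix K' (\<chi> k. Fnw n \<xi> k (u $ k)) u) - D (vmix K' (\<chi> k. Fnw n \<xi> k (u $ k)) u) / p)
         - Cop (alpha n \<xi>) u\<bar> \<le> b"
  shows "\<bar>\<psi> V' * (sqrt (real n) * (Chw n \<xi> (onK K V') - D (onK K V') / p)) / (real (card (aset n \<xi>)) / real n)
      - \<psi> V * Cop (alpha n \<xi>) u / p\<bar>
    \<le> 2 * B / p * b + 2 * e / p * ((2 + real CARD('p)) / p) * (1 + Q0 (alpha n \<xi>) u)
      + (4 * C * real CARD('p) / p\<^sup>2 + 2 * B / p\<^sup>2) * ((2 + real CARD('p)) / p) / sqrt (real n) * (Q0 (alpha n \<xi>) V + Q0 (alpha n \<xi>) u)"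
proof -
  interpret S: sample D p g n "aset n \<xi>" "\<lambda>j. Us j \<xi>" using go by (simp add: good_def)
  note al = al_eq[OF go]
  define d where "d = real CARD('p)"
  define cC where "cC = (2 + d) / p"
  have cC0: "0 \<le> cC" using p_pos by (simp add: cC_def d_def)
  have Vc: "V \<in> unitcube" using Us_cube w by (simp add: V vmix_cube)
  have V'c: "V' \<in> unitcube"
    unfolding V pseudoU_eq[OF go nt i] using Fn_le1[OF go nt] w by (intro vmix_cube) (auto simp: unitcube_iff)
  have uc: "u \<in> unitcube" unfolding u by (rule onK_cube[OF Vc])
  have F1: "Fnw n \<xi> k 1 = 1" for k
  proof -
    have "{j \<in> aset n \<xi>. Us j \<xi> $ k \<le> 1} = aset n \<xi>" using S.U_le by auto
    then show ?thesis using S.card_a_pos by (simp add: S.Fn_def)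
  qed
  \<comment> \<open>Coordinates outside \<open>K\<close> are 1 and remain 1 on passing to ranks, by
    \<open>F1\<close>. Thus the linearisation applies with \<open>L = K'\<close>.\<close>
  have yV: "onK K V' = vmix K' (\<chi> k. Fnw n \<xi> k (u $ k)) u"
    unfolding u V pseudoU_eq[OF go nt i] by (simp add: vec_eq_iff F1)
  define W where "W = sqrt (real n) * (Chw n \<xi> (onK K V') - D (onK K V') / p)"
  define c where "c = Cop (alpha n \<xi>) u"
  define wu where "wu = w0f (alpha n \<xi>) u"
  define wV where "wV = w0f (alpha n \<xi>) V"
  have wnn: "0 \<le> wu" "0 \<le> wV" by (auto simp: wu_def wV_def w0f_nonneg)
  have Wc: "\<bar>W - c\<bar> \<le> b" using bd unfolding W_def c_def yV .
  have cb: "\<bar>c\<bar> \<le> cC * wu" unfolding c_def cC_def wu_def d_def using Cop_bound[OF uc, of "alpha n \<xi>"] by simp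
  have dV: "\<bar>V' $ k - V $ k\<bar> \<le> 2 * wV / p / S.s" for k
  proof (cases "k \<in> K'")
    case True
    have "S.s * \<bar>Fnw n \<xi> k (V $ k) - V $ k\<bar> \<le> 2 * \<bar>bridge (alpha n \<xi>) k V\<bar> / p"
      using S.Fn_minus_le[OF Vc, of k] unfolding al .
    also have "\<dots> \<le> 2 * wV / p" using bridge_le[OF Vc, of "alpha n \<xi>" k] p_pos
      by (intro divide_right_mono) (auto simp: wV_def)
    finally have "\<bar>Fnw n \<xi> k (V $ k) - V $ k\<bar> * S.s \<le> 2 * wV / p" by (simp only: mult.commute[of S.s])
    then have "\<bar>Fnw n \<xi> k (V $ k) - V $ k\<bar> \<le> 2 * wV / p / S.s"
      using S.s_pos by (simp only: pos_le_divide_eq)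
    then show ?thesis using True by (simp add: V pseudoU_eq[OF go nt i])
  next
    case False then show ?thesis using wnn p_pos S.s_pos by (simp add: V)
  qed
  have psd: "\<bar>\<psi> V' - \<psi> V\<bar> \<le> e + C * (d * (2 * wV / p / S.s))"
  proof -
    have "(\<Sum>k\<in>UNIV. \<bar>V' $ k - V $ k\<bar>) \<le> (\<Sum>k\<in>(UNIV::'p set). 2 * wV / p / S.s)" by (rule sum_mono) (rule dV)
    also have "\<dots> = d * (2 * wV / p / S.s)" by (simp add: d_def)
    finally show ?thesis using C(2)[OF V'c Vc] C(1) by (meson add_left_mono mult_left_mono order_trans)
  qed
  have iP: "\<bar>1 / S.P - 1 / p\<bar> \<le> 2 * wu / p\<^sup>2 / S.s"
  proof -
    have "S.s * \<bar>1 / S.P - 1 / p\<bar> = \<bar>S.s * (1 / S.P - 1 / p)\<bar>" using S.s_pos by (simp add: abs_mult)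
    also have "\<dots> = \<bar>alpha n \<xi> (vec 1)\<bar> / p / S.P"
      unfolding S.inverse_P_diff al using p_pos S.P_pos by (simp add: abs_divide abs_mult)
    also have "\<dots> \<le> wu / p / S.P"
      using w0f_ge(3)[of "alpha n \<xi>" u] p_pos S.P_pos by (intro divide_right_mono) (auto simp: wu_def)
    also have "\<dots> \<le> 2 * (wu / p) / p" using wnn p_pos by (intro S.div_P_le) auto
    finally have "\<bar>1 / S.P - 1 / p\<bar> * S.s \<le> 2 * wu / p\<^sup>2" by (simp add: mult.commute[of S.s] power2_eq_square)
    then show ?thesis using S.s_pos by (simp only: pos_le_divide_eq)
  qed
  have Q: "wu \<le> 1 + Q0 (alpha n \<xi>) u" "wV * wu \<le> Q0 (alpha n \<xi>) V + Q0 (alpha n \<xi>) u" "wu * wu \<le> Q0 (alpha n \<xi>) V + Q0 (alpha n \<xi>) u"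
  proof -
    have q: "wu\<^sup>2 \<le> Q0 (alpha n \<xi>) u" "wV\<^sup>2 \<le> Q0 (alpha n \<xi>) V" by (simp_all add: wu_def wV_def w0f_sq)
    have "0 \<le> (wu - 1)\<^sup>2" "0 \<le> (wu - wV)\<^sup>2" by simp_all
    then have "2 * wu \<le> 1 + wu\<^sup>2" "2 * (wV * wu) \<le> wu\<^sup>2 + wV\<^sup>2"
      by (auto simp: power2_diff power2_eq_square algebra_simps)
    moreover have "0 \<le> wV * wu" using wnn by simp
    ultimately show "wu \<le> 1 + Q0 (alpha n \<xi>) u" "wV * wu \<le> Q0 (alpha n \<xi>) V + Q0 (alpha n \<xi>) u"
      using q wnn by linarith+
    show "wu * wu \<le> Q0 (alpha n \<xi>) V + Q0 (alpha n \<xi>) u"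
      using q(1) Q0_nonneg[of "alpha n \<xi>" V] by (simp add: power2_eq_square)
  qed
  define QQ where "QQ = Q0 (alpha n \<xi>) V + Q0 (alpha n \<xi>) u"
  have t1: "\<bar>\<psi> V' * (W - c) / S.P\<bar> \<le> 2 * B / p * b"
  proof -
    have b0: "0 \<le> b" using Wc by linarith
    have "\<bar>\<psi> V' * (W - c) / S.P\<bar> = \<bar>\<psi> V'\<bar> * \<bar>W - c\<bar> / S.P" using S.P_pos by (simp add: abs_mult abs_divide)
    also have "\<dots> \<le> B * b / S.P" using B V'c Wc S.P_pos by (intro divide_right_mono mult_mono) auto
    also have "\<dots> \<le> 2 * (B * b) / p" using B b0 by (intro S.div_P_le) auto
    finally show ?thesis by simp
  qed
  have t2: "\<bar>(\<psi> V' - \<psi> V) * c / S.P\<bar> \<le> 2 * e / p * cC * (1 + Q0 (alpha n \<xi>) u) + 4 * C * d / p\<^sup>2 * cC / S.s * QQ"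
  proof -
    have "\<bar>(\<psi> V' - \<psi> V) * c / S.P\<bar> = \<bar>\<psi> V' - \<psi> V\<bar> * \<bar>c\<bar> / S.P" using S.P_pos by (simp add: abs_mult abs_divide)
    also have "\<dots> \<le> (e + C * (d * (2 * wV / p / S.s))) * (cC * wu) / S.P"
      using psd cb S.P_pos cC0 wnn by (intro divide_right_mono mult_mono) auto
    also have "\<dots> \<le> 2 * ((e + C * (d * (2 * wV / p / S.s))) * (cC * wu)) / p"
      using e C(1) wnn p_pos S.s_pos cC0 by (intro S.div_P_le mult_nonneg_nonneg add_nonneg_nonneg) (auto simp: d_def)
    also have "\<dots> = 2 * e / p * cC * wu + 4 * C * d / p\<^sup>2 * cC / S.s * (wV * wu)"
      by (simp add: algebra_simps add_divide_distrib power2_eq_square)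
    also have "\<dots> \<le> 2 * e / p * cC * (1 + Q0 (alpha n \<xi>) u) + 4 * C * d / p\<^sup>2 * cC / S.s * QQ"
      unfolding QQ_def using Q e C(1) p_pos cC0 S.s_pos by (intro add_mono mult_left_mono) (auto simp: d_def)
    finally show ?thesis .
  qed
  have t3: "\<bar>\<psi> V * c * (1 / S.P - 1 / p)\<bar> \<le> 2 * B / p\<^sup>2 * cC / S.s * QQ"
  proof -
    have "\<bar>\<psi> V * c * (1 / S.P - 1 / p)\<bar> \<le> B * (cC * wu) * (2 * wu / p\<^sup>2 / S.s)"
      unfolding abs_mult using B Vc cb iP cC0 wnn by (intro mult_mono) auto
    also have "\<dots> = 2 * B / p\<^sup>2 * cC / S.s * (wu * wu)" by simp
    also have "\<dots> \<le> 2 * B / p\<^sup>2 * cC / S.s * QQ"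
      unfolding QQ_def using Q(3) B p_pos cC0 S.s_pos by (intro mult_left_mono) auto
    finally show ?thesis .
  qed
  have "\<psi> V' * W / S.P - \<psi> V * c / p = \<psi> V' * (W - c) / S.P + (\<psi> V' - \<psi> V) * c / S.P + \<psi> V * c * (1 / S.P - 1 / p)"
    by (simp add: algebra_simps diff_divide_distrib)
  also have "\<bar>\<dots>\<bar> \<le> 2 * B / p * b + (2 * e / p * cC * (1 + Q0 (alpha n \<xi>) u) + 4 * C * d / p\<^sup>2 * cC / S.s * QQ) + 2 * B / p\<^sup>2 * cC / S.s * QQ"
    by (rule abs_add3_le[OF t1 t2 t3])
  also have "\<dots> = 2 * B / p * b + 2 * e / p * cC * (1 + Q0 (alpha n \<xi>) u) + (4 * C * d / p\<^sup>2 + 2 * B / p\<^sup>2) * cC / S.s * QQ"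
    by (simp add: distrib_right add_divide_distrib)
  finally show ?thesis unfolding W_def c_def S.P_def cC_def d_def QQ_def .
qed

end

lemma abs_diff_chain: "\<bar>a - b\<bar> \<le> x \<Longrightarrow> \<bar>b - c\<bar> \<le> y \<Longrightarrow> \<bar>a - c\<bar> \<le> x + (y::real)"
  by linarith

text \<open>Bounds a mean absolute value by a second moment without square roots.\<close>

lemma abs_le_square_div:
  assumes "0 < (e::real)" shows "\<bar>x\<bar> \<le> e + x\<^sup>2 / e"
proof -
  have "0 \<le> (e - \<bar>x\<bar>)\<^sup>2" "0 \<le> e * \<bar>x\<bar>" using assms by auto
  moreover have "(e - \<bar>x\<bar>)\<^sup>2 = e\<^sup>2 + x\<^sup>2 - 2 * (e * \<bar>x\<bar>)" by (simp add: power2_diff)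
  ultimately have "e * \<bar>x\<bar> \<le> e\<^sup>2 + x\<^sup>2" by linarith
  then have "e * \<bar>x\<bar> \<le> e * (e + x\<^sup>2 / e)" using assms by (simp add: distrib_left power2_eq_square)
  then show ?thesis using assms by (simp only: mult_le_cancel_left_pos)
qed

context cop_data
begin

text \<open>An error small in mean off the event of too few observations. Measurability and
  integrability are carried by the dominating \<open>Y\<close>, so that only an almost sure
  inequality remains to be checked for \<open>f\<close>.\<close>

definition approx :: "nat \<Rightarrow> ('a \<Rightarrow> real) \<Rightarrow> real \<Rightarrow> bool" where
  "approx n f b \<longleftrightarrow> (\<exists>Y. (\<forall>\<xi>. 0 \<le> Y \<xi>) \<and> integrable M Y \<and> (\<integral>\<xi>. Y \<xi> \<partial>M) \<le> b \<and>
     (AE \<xi> in M. dense n \<xi> \<longrightarrow> \<bar>f \<xi>\<bar> \<le> Y \<xi>))"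

lemma approxI:
  assumes "\<And>\<xi>. 0 \<le> Y \<xi>" "integrable M Y" "(\<integral>\<xi>. Y \<xi> \<partial>M) \<le> b"
    "AE \<xi> in M. dense n \<xi> \<longrightarrow> \<bar>f \<xi>\<bar> \<le> Y \<xi>"
  shows "approx n f b"
  unfolding approx_def using assms by blast

lemma approx_add:
  assumes "approx n f a" "approx n h b"
  shows "approx n (\<lambda>\<xi>. f \<xi> + h \<xi>) (a + b)"
proof -
  obtain Y Y' where nn: "\<And>\<xi>. 0 \<le> Y \<xi>" "\<And>\<xi>. 0 \<le> Y' \<xi>" and Y: "integrable M Y" "(\<integral>\<xi>. Y \<xi> \<partial>M) \<le> a"
      "AE \<xi> in M. dense n \<xi> \<longrightarrow> \<bar>f \<xi>\<bar> \<le> Y \<xi>"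
    and Y': "integrable M Y'" "(\<integral>\<xi>. Y' \<xi> \<partial>M) \<le> b"
      "AE \<xi> in M. dense n \<xi> \<longrightarrow> \<bar>h \<xi>\<bar> \<le> Y' \<xi>"
    using assms unfolding approx_def by blast
  show ?thesis
  proof (rule approxI[of "\<lambda>\<xi>. Y \<xi> + Y' \<xi>"])
    show "AE \<xi> in M. dense n \<xi> \<longrightarrow> \<bar>f \<xi> + h \<xi>\<bar> \<le> Y \<xi> + Y' \<xi>"
      using Y(3) Y'(3) by eventually_elim auto
  qed (use nn Y Y' in auto)
qed

lemma approx_mono: "approx n f a \<Longrightarrow> a \<le> b \<Longrightarrow> approx n f b"
  unfolding approx_def by (meson order_trans)

lemma Cop_hc_bound:
  assumes "u \<in> unitcube"
  shows "\<bar>Cop (hc e) u\<bar> \<le> (2 + real CARD('p))\<^sup>2 / p"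
proof -
  have "w0f (hc e) u \<le> 1 + (\<Sum>k\<in>(UNIV::'p set). 1) + 1"
    unfolding w0f_def by (intro add_mono sum_mono hc_bound)
  then have "(2 + real CARD('p)) * w0f (hc e) u / p \<le> (2 + real CARD('p)) * (2 + real CARD('p)) / p"
    using p_pos by (intro divide_right_mono mult_left_mono) auto
  then show ?thesis using Cop_bound[OF assms, of "hc e"] by (simp add: power2_eq_square)
qed

lemma Cop_hc_integrable: "integrable Pd (\<lambda>e. Cop (hc e) u)"
  unfolding Cop_def bridge_def using hc_integrable by auto

lemma Cop_hc_mean: "(\<integral>e. Cop (hc e) u \<partial>Pd) = 0"
  unfolding Cop_def bridge_def using hc_integrable by (simp add: hc_mean)

end

context cop_stat
begin

text \<open>The bound of \<open>S1_pointwise\<close> is averaged over the observations and over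
  \<open>w\<close>; \<open>mean_over_Lc\<close> computes the mean of this average.\<close>

lemma S1_approx:
  assumes eps: "0 < \<epsilon>"
  shows "\<exists>n0. \<forall>n\<ge>n0. approx n (\<lambda>\<xi>. stat n \<xi> - S2 n \<xi> - R1 n \<xi>) \<epsilon>"
proof -
  define d where "d = real CARD('p)"
  define cC where "cC = (2 + d) / p"
  have cC0: "0 < cC" using p_pos by (simp add: cC_def d_def add_pos_nonneg)
  define q where "q = 25 + 12 * d\<^sup>2"
  have q0: "0 < q" by (simp add: q_def add_pos_nonneg)
  obtain B where B: "0 < B" "\<And>u. u \<in> unitcube \<Longrightarrow> \<bar>\<psi> u\<bar> \<le> B" using psi_bound by metis
  \<comment> \<open>The tolerances \<open>e\<close> and \<open>\<epsilon>0\<close> below take a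
    third of \<epsilon> each; the last third goes to the terms of order 1/sqrt n.\<close>
  define r where "r = 2 / p * cC * q"
  define e where "e = \<epsilon> / 3 / r"
  have r: "0 < r" using p_pos cC0 q0 by (simp add: r_def)
  have e: "0 < e" "2 * e / p * cC * q = \<epsilon> / 3"
  proof -
    show "0 < e" using eps r by (simp add: e_def)
    have "2 * e / p * cC * q = r * e" by (simp add: r_def)
    then show "2 * e / p * cC * q = \<epsilon> / 3" using r by (simp add: e_def)
  qed
  obtain C where C: "0 \<le> C" "\<And>x y. x \<in> unitcube \<Longrightarrow> y \<in> unitcube \<Longrightarrow> \<bar>\<psi> x - \<psi> y\<bar> \<le> e + C * (\<Sum>k\<in>UNIV. \<bar>x $ k - y $ k\<bar>)"
    using psi_modulus[OF e(1)] by metis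
  define r' where "r' = 2 * B / p"
  define \<epsilon>0 where "\<epsilon>0 = \<epsilon> / 3 / r'"
  have "0 < r'" using B p_pos by (simp add: r'_def)
  then have e0: "0 < \<epsilon>0" "2 * B / p * \<epsilon>0 = \<epsilon> / 3"
    unfolding r'_def[symmetric] using eps by (auto simp: \<epsilon>0_def)
  obtain \<epsilon>1 C1 c1 \<delta> Gr n1 where nn: "\<And>n \<xi> u. 0 \<le> Bd \<epsilon>1 C1 c1 \<delta> Gr n \<xi> u"
    and lin: "\<And>n \<xi> L u. n1 \<le> n \<Longrightarrow> good n \<xi> \<Longrightarrow> u \<in> unitcube \<Longrightarrow>
       \<bar>sqrt (real n) * (Chw n \<xi> (vmix L (\<chi> k. Fnw n \<xi> k (u $ k)) u) - D (vmix L (\<chi> k. Fnw n \<xi> k (u $ k)) u) / p)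
         - Cop (alpha n \<xi>) u\<bar> \<le> Bd \<epsilon>1 C1 c1 \<delta> Gr n \<xi> u"
    and Bint: "\<And>n i v. n1 \<le> n \<Longrightarrow> i < n \<Longrightarrow> v \<in> borel_measurable borel \<Longrightarrow> (\<And>e. v e \<in> unitcube) \<Longrightarrow>
       integrable M (\<lambda>\<xi>. Bd \<epsilon>1 C1 c1 \<delta> Gr n \<xi> (v (E i \<xi>)))"
    and Ble: "\<And>n i v. n1 \<le> n \<Longrightarrow> i < n \<Longrightarrow> v \<in> borel_measurable borel \<Longrightarrow> (\<And>e. v e \<in> unitcube) \<Longrightarrow>
       (\<integral>\<xi>. Bd \<epsilon>1 C1 c1 \<delta> Gr n \<xi> (v (E i \<xi>)) \<partial>M) \<le> \<epsilon>0"
    using unif_lin[OF e0(1)] by blast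
  define cc where "cc = (4 * C * d / p\<^sup>2 + 2 * B / p\<^sup>2) * cC"
  have cc0: "0 \<le> cc" using C B cC0 by (simp add: cc_def d_def)
  define n0 where "n0 = max n1 (max 1 (nat \<lceil>(cc * (2 * q) / (\<epsilon> / 3))\<^sup>2\<rceil>))"
  show ?thesis
  proof (intro exI[of _ n0] allI impI)
    fix n assume n: "n0 \<le> n"
    then have n1: "n1 \<le> n" and npos: "0 < n" by (auto simp: n0_def)
    define s where "s = sqrt (real n)"
    have s: "0 < s" using npos by (simp add: s_def)
    have cs: "cc / s * (2 * q) \<le> \<epsilon> / 3"
    proof -
      have "(cc * (2 * q) / (\<epsilon> / 3))\<^sup>2 \<le> real n" using n unfolding n0_def by linarith
      then have "cc * (2 * q) / (\<epsilon> / 3) \<le> s" unfolding s_def by (rule real_le_rsqrt)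
      then have "cc * (2 * q) \<le> \<epsilon> / 3 * s" using eps by (simp add: pos_divide_le_eq mult.commute)
      then have "cc * (2 * q) / s \<le> \<epsilon> / 3" using s by (simp only: pos_divide_le_eq)
      then show ?thesis by simp
    qed
    define Er where "Er \<xi> v = 2 * B / p * Bd \<epsilon>1 C1 c1 \<delta> Gr n \<xi> (onK K v)
       + 2 * e / p * cC * (1 + Q0 (alpha n \<xi>) (onK K v)) + cc / s * (Q0 (alpha n \<xi>) v + Q0 (alpha n \<xi>) (onK K v))" for \<xi> v
    have Er_meas: "(\<lambda>(\<xi>, u). Er \<xi> u) \<in> borel_measurable (M \<Otimes>\<^sub>M borel)"
      unfolding Er_def split_beta' by measurable
    have Er_nn: "0 \<le> Er \<xi> u" for \<xi> u
      unfolding Er_def using B p_pos nn e cC0 cc0 s Q0_nonneg by (intro add_nonneg_nonneg mult_nonneg_nonneg) auto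
    have Er_int: "integrable M (\<lambda>\<xi>. Er \<xi> (v (E i \<xi>)))" and Er_le: "(\<integral>\<xi>. Er \<xi> (v (E i \<xi>)) \<partial>M) \<le> \<epsilon>"
      if i: "i < n" and v[measurable]: "v \<in> borel_measurable borel" and vc: "\<And>e. v e \<in> unitcube" for i v
    proof -
      have vK[measurable]: "(\<lambda>e. onK K (v e)) \<in> borel_measurable borel" by measurable
      have b: "integrable M (\<lambda>\<xi>. Bd \<epsilon>1 C1 c1 \<delta> Gr n \<xi> (onK K (v (E i \<xi>))))"
        "(\<integral>\<xi>. Bd \<epsilon>1 C1 c1 \<delta> Gr n \<xi> (onK K (v (E i \<xi>))) \<partial>M) \<le> \<epsilon>0"
        using Bint[OF n1 i vK] Ble[OF n1 i vK] onK_cube[OF vc] by auto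
      note Q = exp_Q0[OF v i] exp_Q0[OF vK i]
      show "integrable M (\<lambda>\<xi>. Er \<xi> (v (E i \<xi>)))"
        unfolding Er_def using b Q by (intro Bochner_Integration.integrable_add integrable_mult_right integrable_const)
      have "(\<integral>\<xi>. Er \<xi> (v (E i \<xi>)) \<partial>M) = 2 * B / p * (\<integral>\<xi>. Bd \<epsilon>1 C1 c1 \<delta> Gr n \<xi> (onK K (v (E i \<xi>))) \<partial>M)
         + 2 * e / p * cC * (1 + (\<integral>\<xi>. Q0 (alpha n \<xi>) (onK K (v (E i \<xi>))) \<partial>M))
         + cc / s * ((\<integral>\<xi>. Q0 (alpha n \<xi>) (v (E i \<xi>)) \<partial>M) + (\<integral>\<xi>. Q0 (alpha n \<xi>) (onK K (v (E i \<xi>))) \<partial>M))"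
        unfolding Er_def using b(1) Q(1,3)
        by (simp add: prob_space)
      also have "\<dots> \<le> 2 * B / p * \<epsilon>0 + 2 * e / p * cC * (1 + (24 + 12 * d\<^sup>2)) + cc / s * ((24 + 12 * d\<^sup>2) + (24 + 12 * d\<^sup>2))"
        unfolding d_def using b(2) Q(2,4) B p_pos e cC0 cc0 s
        by (intro add_mono mult_left_mono) auto
      also have "\<dots> \<le> 2 * B / p * \<epsilon>0 + 2 * e / p * cC * q + cc / s * (2 * q)"
        using cc0 s e(1) cC0 p_pos by (intro add_mono order_refl mult_left_mono) (auto simp: q_def)
      also have "\<dots> \<le> \<epsilon> / 3 + \<epsilon> / 3 + \<epsilon> / 3" unfolding e0(2) e(2) using cs by (rule add_left_mono)
      finally show "(\<integral>\<xi>. Er \<xi> (v (E i \<xi>)) \<partial>M) \<le> \<epsilon>" by simp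
    qed
    have mean: "integrable M (\<lambda>\<xi>. \<integral>w. Er \<xi> (vK (E i \<xi>) w) \<partial>Lc)" "(\<integral>\<xi>. (\<integral>w. Er \<xi> (vK (E i \<xi>) w) \<partial>Lc) \<partial>M) \<le> \<epsilon>"
      "AE \<xi> in M. integrable Lc (\<lambda>w. Er \<xi> (vK (E i \<xi>) w))" if i: "i < n" for i
      by (rule mean_over_Lc[where \<Phi> = Er and vv = vK and i = i and b = \<epsilon>, OF Er_meas Er_nn vK_meas vK_cube];
        (assumption | rule Er_int[OF i] Er_le[OF i]; assumption))+
    show "approx n (\<lambda>\<xi>. stat n \<xi> - S2 n \<xi> - R1 n \<xi>) \<epsilon>"
    proof (rule approxI[of "\<lambda>\<xi>. (\<Sum>i<n. \<integral>w. Er \<xi> (vK (E i \<xi>) w) \<partial>Lc) / real n"])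
      show "0 \<le> (\<Sum>i<n. \<integral>w. Er \<xi> (vK (E i \<xi>) w) \<partial>Lc) / real n" for \<xi>
        by (intro divide_nonneg_nonneg sum_nonneg integral_nonneg_AE) (auto simp: Er_nn)
      show "integrable M (\<lambda>\<xi>. (\<Sum>i<n. \<integral>w. Er \<xi> (vK (E i \<xi>) w) \<partial>Lc) / real n)"
        by (intro integrable_divide Bochner_Integration.integrable_sum mean(1)) simp
      have "(\<integral>\<xi>. (\<Sum>i<n. \<integral>w. Er \<xi> (vK (E i \<xi>) w) \<partial>Lc) / real n \<partial>M)
          = (\<Sum>i<n. \<integral>\<xi>. (\<integral>w. Er \<xi> (vK (E i \<xi>) w) \<partial>Lc) \<partial>M) / real n"
        by (subst integral_divide_zero, subst Bochner_Integration.integral_sum) (auto intro: mean(1))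
      also have "\<dots> \<le> (\<Sum>i<n. \<epsilon>) / real n"
        using mean(2) by (intro divide_right_mono sum_mono) auto
      finally show "(\<integral>\<xi>. (\<Sum>i<n. \<integral>w. Er \<xi> (vK (E i \<xi>) w) \<partial>Lc) / real n \<partial>M) \<le> \<epsilon>" using npos by simp
      have AEi: "AE \<xi> in M. \<forall>i\<in>{..<n}. integrable Lc (\<lambda>w. Er \<xi> (vK (E i \<xi>) w))"
        using mean(3) by (intro AE_finite_allI) auto
      show "AE \<xi> in M. dense n \<xi> \<longrightarrow>
          \<bar>stat n \<xi> - S2 n \<xi> - R1 n \<xi>\<bar> \<le> (\<Sum>i<n. \<integral>w. Er \<xi> (vK (E i \<xi>) w) \<partial>Lc) / real n"
        using AEi AE_no_ties AE_space
      proof eventually_elim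
        fix \<xi> assume ai: "\<forall>i\<in>{..<n}. integrable Lc (\<lambda>w. Er \<xi> (vK (E i \<xi>) w))" and nt: "no_ties \<xi>" and om: "\<xi> \<in> space M"
        show "dense n \<xi> \<longrightarrow>
          \<bar>stat n \<xi> - S2 n \<xi> - R1 n \<xi>\<bar> \<le> (\<Sum>i<n. \<integral>w. Er \<xi> (vK (E i \<xi>) w) \<partial>Lc) / real n"
        proof
          assume "dense n \<xi>"
          then have go: "good n \<xi>" using nt npos by (intro goodI)
          interpret S: sample D p g n "aset n \<xi>" "\<lambda>j. Us j \<xi>" using go by (simp add: good_def)
          define f where "f i w = \<psi> (vmix K' (pseudoU Xs Zs A n \<xi> i) w) *
             (sqrt (real n) * (Chw n \<xi> (onK K (vmix K' (pseudoU Xs Zs A n \<xi> i) w))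
              - D (onK K (vmix K' (pseudoU Xs Zs A n \<xi> i) w)) / p))" for i w
          define h where "h i w = \<psi> (vK (E i \<xi>) w) * Cop (alpha n \<xi>) (onK K (vK (E i \<xi>) w))" for i w
          have pw: "\<bar>f i w / S.P - h i w / p\<bar> \<le> Er \<xi> (vK (E i \<xi>) w)" if i: "i \<in> aset n \<xi>" and w: "w \<in> unitcube" for i w
          proof -
            have uc: "onK K (vmix K' (Us i \<xi>) w) \<in> unitcube" by (intro onK_cube vmix_cube Us_cube w)
            from S1_pointwise[OF go nt i w B C e(1) refl refl refl lin[OF n1 go uc]]
            show ?thesis unfolding f_def h_def vK_E S.P_def Er_def cc_def cC_def d_def s_def .
          qed
          have fm: "integrable Lc (f i)" if i: "i \<in> aset n \<xi>" for i
          proof -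
            have Pc: "pseudoU Xs Zs A n \<xi> i \<in> unitcube"
              unfolding pseudoU_eq[OF go nt i] using Fn_le1[OF go nt] by (simp add: unitcube_iff)
            have [measurable]: "(\<lambda>w. \<psi> (vmix K' (pseudoU Xs Zs A n \<xi> i) w)) \<in> borel_measurable Lc"
              by (rule cont_comp_meas[OF psi_cont]) (use Pc in \<open>auto simp: space_Lc vmix_cube\<close>)
            note [measurable] = Chw_meas[OF go nt]
            show ?thesis
            proof (rule Lc.integrable_const_bound[where B = "B * (s * 1)"])
              have "\<bar>Chw n \<xi> y - D y / p\<bar> \<le> 1" for y
              proof -
                have "0 \<le> D y / p" "D y / p \<le> 1" using D_nonneg[of y] D_le[of y] p_pos by (auto simp: divide_le_eq_1)
                then show ?thesis using Chw_bound[OF go nt, of y] by linarith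
              qed
              then show "AE w in Lc. norm (f i w) \<le> B * (s * 1)"
                unfolding f_def norm_mult s_def using B Pc
                by (intro AE_I2 mult_mono) (auto simp: space_Lc vmix_cube)
            qed (unfold f_def, measurable)
          qed
          \<comment> \<open>The pointwise estimate dominates \<open>h\<close> by the bounded
            \<open>f\<close> and the integrable \<open>Er\<close>.\<close>
          have hm: "integrable Lc (h i)" if i: "i \<in> aset n \<xi>" for i
          proof (rule Bochner_Integration.integrable_bound)
            have i': "i < n" using i by (simp add: aset_def)
            show "integrable Lc (\<lambda>w. p * (\<bar>f i w / S.P\<bar> + Er \<xi> (vK (E i \<xi>) w)))"
              using fm[OF i] ai i' by (intro integrable_mult_right Bochner_Integration.integrable_add integrable_abs) auto
            have [measurable]: "(\<lambda>w. \<psi> (vK (E i \<xi>) w)) \<in> borel_measurable Lc"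
              by (rule cont_comp_meas[OF psi_cont]) (auto simp: space_Lc vK_cube)
            have [measurable]: "(\<lambda>w. Cop (alpha n \<xi>) (onK K (vK (E i \<xi>) w))) \<in> borel_measurable Lc"
              by (rule Cop_alpha_meas[of "\<lambda>_. \<xi>"]) (use om in \<open>auto simp: space_Lc vK_cube onK_cube\<close>)
            show "h i \<in> borel_measurable Lc" unfolding h_def by measurable
            show "AE w in Lc. norm (h i w) \<le> norm (p * (\<bar>f i w / S.P\<bar> + Er \<xi> (vK (E i \<xi>) w)))"
            proof (rule AE_I2)
              fix w :: "real^'p" assume w: "w \<in> space Lc"
              have "\<bar>h i w / p\<bar> \<le> \<bar>f i w / S.P\<bar> + Er \<xi> (vK (E i \<xi>) w)"
                using pw[OF i w[unfolded space_Lc]] by linarith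
              then have "\<bar>h i w\<bar> \<le> p * (\<bar>f i w / S.P\<bar> + Er \<xi> (vK (E i \<xi>) w))"
                using p_pos by (simp only: abs_divide abs_of_pos[OF p_pos] pos_divide_le_eq mult.commute)
              also have "\<dots> \<le> norm (p * (\<bar>f i w / S.P\<bar> + Er \<xi> (vK (E i \<xi>) w)))" by simp
              finally show "norm (h i w) \<le> norm (p * (\<bar>f i w / S.P\<bar> + Er \<xi> (vK (E i \<xi>) w)))" by simp
            qed
          qed
          have 1: "stat n \<xi> - S2 n \<xi> = (\<Sum>i\<in>aset n \<xi>. (\<integral>w. f i w \<partial>Lc) / S.P) / real n"
            unfolding stat_eq[OF go nt] f_def[symmetric] S.P_def sum_divide_distrib[symmetric]
            using npos by simp
          have 2: "R1 n \<xi> = (\<Sum>i\<in>aset n \<xi>. (\<integral>w. h i w \<partial>Lc) / p) / real n"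
            unfolding R1_def h_def[symmetric]
            by (intro arg_cong2[where f = "(/)"] refl sum.mono_neutral_cong_right) (auto simp: aset_def indicator_def)
          have "stat n \<xi> - S2 n \<xi> - R1 n \<xi> = (\<Sum>i\<in>aset n \<xi>. (\<integral>w. f i w \<partial>Lc) / S.P - (\<integral>w. h i w \<partial>Lc) / p) / real n"
            unfolding 1 2 by (simp add: sum_subtractf diff_divide_distrib)
          then have "\<bar>stat n \<xi> - S2 n \<xi> - R1 n \<xi>\<bar> \<le> (\<Sum>i\<in>aset n \<xi>. \<bar>(\<integral>w. f i w \<partial>Lc) / S.P - (\<integral>w. h i w \<partial>Lc) / p\<bar>) / real n"
            by (simp add: abs_divide divide_right_mono)
          also have "\<dots> \<le> (\<Sum>i\<in>aset n \<xi>. \<integral>w. Er \<xi> (vK (E i \<xi>) w) \<partial>Lc) / real n"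
          proof (intro divide_right_mono sum_mono)
            fix i assume i: "i \<in> aset n \<xi>"
            have i': "i < n" using i by (simp add: aset_def)
            have "(\<integral>w. f i w \<partial>Lc) / S.P - (\<integral>w. h i w \<partial>Lc) / p = (\<integral>w. f i w / S.P - h i w / p \<partial>Lc)"
              using fm[OF i] hm[OF i] by simp
            also have "\<bar>\<dots>\<bar> \<le> (\<integral>w. \<bar>f i w / S.P - h i w / p\<bar> \<partial>Lc)" by (rule integral_abs_bound)
            also have "\<dots> \<le> (\<integral>w. Er \<xi> (vK (E i \<xi>) w) \<partial>Lc)"
            proof (rule integral_mono)
              show "integrable Lc (\<lambda>w. \<bar>f i w / S.P - h i w / p\<bar>)"
                using fm[OF i] hm[OF i] by (intro integrable_abs Bochner_Integration.integrable_diff) auto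
            qed (use ai i' pw[OF i] in \<open>auto simp: space_Lc\<close>)
            finally show "\<bar>(\<integral>w. f i w \<partial>Lc) / S.P - (\<integral>w. h i w \<partial>Lc) / p\<bar> \<le> (\<integral>w. Er \<xi> (vK (E i \<xi>) w) \<partial>Lc)" .
          qed simp
          also have "\<dots> \<le> (\<Sum>i<n. \<integral>w. Er \<xi> (vK (E i \<xi>) w) \<partial>Lc) / real n"
            by (intro divide_right_mono sum_mono2 integral_nonneg_AE) (auto simp: aset_def Er_nn)
          finally show "\<bar>stat n \<xi> - S2 n \<xi> - R1 n \<xi>\<bar> \<le> (\<Sum>i<n. \<integral>w. Er \<xi> (vK (E i \<xi>) w) \<partial>Lc) / real n" .
        qed
      qed
    qed
  qed
qed

text \<open>The Riemann sum, with lower corners as tags, of the integral by parts of \<phi> against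
  \<open>Cop b\<close>. Corners carry 1 outside their face, so \<open>Cop b\<close> is read on the
  face without a projection.\<close>

definition T2 :: "nat \<Rightarrow> (real^'p \<Rightarrow> real) \<Rightarrow> real" where
  "T2 m b = (\<Sum>J\<in>Pow K'. (-1) ^ card J * (\<Sum>c\<in>grid_cells J (ugrid m).
      Cop b (fst c) * qvol J (\<lambda>x. \<phi> (onK J x)) (fst c) (snd c)))"

definition up :: "nat \<Rightarrow> real^'p \<Rightarrow> real^'p" where
  "up m x = (\<chi> k. of_int \<lceil>real m * x $ k\<rceil> / real m)"

lemma up_props:
  assumes m: "0 < m" and x: "x \<in> unitcube"
  shows "up m x $ k \<in> ugrid m k" "\<bar>up m x $ k - x $ k\<bar> \<le> 1 / real m" "up m x \<in> unitcube"
    "c \<in> ugrid m k \<Longrightarrow> up m x $ k \<le> c \<longleftrightarrow> x $ k \<le> c"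
proof -
  have xk: "0 \<le> x $ k" "x $ k \<le> 1" for k using x by (auto simp: unitcube_iff)
  have c: "0 \<le> \<lceil>real m * x $ k\<rceil>" "\<lceil>real m * x $ k\<rceil> \<le> int m" for k
  proof -
    have "0 \<le> real m * x $ k" using xk by simp
    then show "0 \<le> \<lceil>real m * x $ k\<rceil>" by linarith
    have "real m * x $ k \<le> real m * 1" using xk by (intro mult_left_mono) auto
    then show "\<lceil>real m * x $ k\<rceil> \<le> int m" by (simp add: ceiling_le_iff)
  qed
  show g: "up m x $ k \<in> ugrid m k" for k
  proof -
    have "up m x $ k = real (nat \<lceil>real m * x $ k\<rceil>) / real m" using c[of k] by (simp add: up_def)
    moreover have "nat \<lceil>real m * x $ k\<rceil> \<le> m" using c[of k] by linarith
    ultimately show ?thesis by (auto simp: ugrid_def)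
  qed
  show "up m x \<in> unitcube"
    unfolding unitcube_iff
  proof
    fix k show "0 \<le> up m x $ k \<and> up m x $ k \<le> 1"
      using is_gridD(4,5)[OF is_grid_ugrid[OF m, of UNIV], of k] g[of k] by auto
  qed
  have "x $ k * real m \<le> of_int \<lceil>real m * x $ k\<rceil>" "of_int \<lceil>real m * x $ k\<rceil> \<le> x $ k * real m + 1"
    by (simp_all add: mult.commute)
  then have "x $ k \<le> up m x $ k" "up m x $ k \<le> x $ k + 1 / real m"
    using m by (auto simp: up_def pos_le_divide_eq pos_divide_le_eq distrib_right)
  then show "\<bar>up m x $ k - x $ k\<bar> \<le> 1 / real m" by linarith
  assume "c \<in> ugrid m k"
  then obtain l where l: "c = real l / real m" by (auto simp: ugrid_def)
  have "up m x $ k \<le> c \<longleftrightarrow> real_of_int \<lceil>real m * x $ k\<rceil> \<le> of_int (int l)"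
    using m by (simp add: up_def l divide_le_cancel)
  also have "\<dots> \<longleftrightarrow> real m * x $ k \<le> real l" by (simp only: of_int_le_iff ceiling_le_iff) simp
  also have "\<dots> \<longleftrightarrow> x $ k \<le> c" using m by (simp add: l pos_le_divide_eq mult.commute)
  finally show "up m x $ k \<le> c \<longleftrightarrow> x $ k \<le> c" .
qed

text \<open>Rounding up preserves every comparison with a grid point, so after summation by parts
  the indicators may be written for \<open>x\<close> itself. Averaged over the sample they become
  the empirical copula, and under the law \<open>D\<close>.\<close>

lemma phi_up:
  assumes m: "0 < m" and x: "x \<in> unitcube"
  shows "\<phi> (up m x) = (\<Sum>J\<in>Pow K'. (-1) ^ card J * (\<Sum>c\<in>grid_cells J (ugrid m).
      (if \<forall>k. x $ k \<le> fst c $ k then 1 else 0) * qvol J (\<lambda>x. \<phi> (onK J x)) (fst c) (snd c)))"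
proof -
  have "(\<forall>j\<in>J. up m x $ j \<le> fst c $ j) \<longleftrightarrow> (\<forall>k. x $ k \<le> fst c $ k)" if c: "c \<in> grid_cells J (ugrid m)" for J c
  proof -
    have "up m x $ j \<le> fst c $ j \<longleftrightarrow> x $ j \<le> fst c $ j" if "j \<in> J" for j
      using grid_cellsD(1)[OF c that] up_props(4)[OF m x] by blast
    moreover have "x $ j \<le> fst c $ j" if "j \<notin> J" for j
      using grid_cells_outside(1)[OF c that] x by (simp add: unitcube_iff)
    ultimately show ?thesis by blast
  qed
  then show ?thesis
    using up_props(1)[OF m x]
    by (subst abel_summation[where \<phi> = \<phi> and K = K' and x = "up m x", OF phi_dep is_grid_ugrid[OF m]]) (auto intro!: sum.cong)
qed

text \<open>The mesh is chosen after \<open>n\<close>, because the rounding error of \<phi> is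
  multiplied by sqrt n. The linearisation is applied at the grid corners, weighted by quasi-volumes
  whose absolute sum is bounded independently of \<open>m\<close>.\<close>

lemma S2_approx:
  assumes eps: "0 < \<epsilon>"
  shows "\<exists>n0. \<forall>n\<ge>n0. \<exists>m0. \<forall>m\<ge>m0. approx n (\<lambda>\<xi>. S2 n \<xi> - T2 m (alpha n \<xi>)) \<epsilon>"
proof -
  have "\<forall>J\<in>Pow K'. \<exists>V\<ge>0. \<forall>g. is_grid J g \<longrightarrow> (\<Sum>c\<in>grid_cells J g. \<bar>qvol J (\<lambda>x. \<phi> (onK J x)) (fst c) (snd c)\<bar>) \<le> V"
  proof
    fix J assume "J \<in> Pow K'"
    then have "vitali_bv J (\<lambda>x. \<phi> (onK J x))" by (intro phi_vitali) simp
    then obtain V where "0 \<le> V" "\<And>g. is_grid J g \<Longrightarrow> (\<Sum>c\<in>grid_cells J g. \<bar>qvol J (\<lambda>x. \<phi> (onK J x)) (fst c) (snd c)\<bar>) \<le> V"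
      by (rule vitali_bvD) blast
    then show "\<exists>V\<ge>0. \<forall>g. is_grid J g \<longrightarrow> (\<Sum>c\<in>grid_cells J g. \<bar>qvol J (\<lambda>x. \<phi> (onK J x)) (fst c) (snd c)\<bar>) \<le> V"
      by blast
  qed
  from bchoice[OF this] obtain V where V: "\<And>J. J \<in> Pow K' \<Longrightarrow> 0 \<le> V J"
    "\<And>J g. J \<in> Pow K' \<Longrightarrow> is_grid J g \<Longrightarrow> (\<Sum>c\<in>grid_cells J g. \<bar>qvol J (\<lambda>x. \<phi> (onK J x)) (fst c) (snd c)\<bar>) \<le> V J"
    by blast
  define VV where "VV = (\<Sum>J\<in>Pow K'. V J)"
  have VV: "0 \<le> VV" unfolding VV_def by (intro sum_nonneg V(1))
  define r where "r = VV + 1"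
  have r: "0 < r" using VV by (simp add: r_def)
  define \<epsilon>0 where "\<epsilon>0 = \<epsilon> / 2 / r"
  have e0: "0 < \<epsilon>0" "\<epsilon>0 * VV \<le> \<epsilon> / 2"
  proof -
    show "0 < \<epsilon>0" using eps r by (simp add: \<epsilon>0_def)
    then have "\<epsilon>0 * VV \<le> \<epsilon>0 * r" by (simp add: r_def)
    also have "\<dots> = \<epsilon> / 2" using r by (simp add: \<epsilon>0_def)
    finally show "\<epsilon>0 * VV \<le> \<epsilon> / 2" .
  qed
  obtain \<epsilon>1 C1 c1 \<delta> Gr n1 where nn: "\<And>n \<xi> u. 0 \<le> Bd \<epsilon>1 C1 c1 \<delta> Gr n \<xi> u"
    and lin: "\<And>n \<xi> L u. n1 \<le> n \<Longrightarrow> good n \<xi> \<Longrightarrow> u \<in> unitcube \<Longrightarrow>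
       \<bar>sqrt (real n) * (Chw n \<xi> (vmix L (\<chi> k. Fnw n \<xi> k (u $ k)) u) - D (vmix L (\<chi> k. Fnw n \<xi> k (u $ k)) u) / p)
         - Cop (alpha n \<xi>) u\<bar> \<le> Bd \<epsilon>1 C1 c1 \<delta> Gr n \<xi> u"
    and Bint: "\<And>n i v. n1 \<le> n \<Longrightarrow> i < n \<Longrightarrow> v \<in> borel_measurable borel \<Longrightarrow> (\<And>e. v e \<in> unitcube) \<Longrightarrow>
       integrable M (\<lambda>\<xi>. Bd \<epsilon>1 C1 c1 \<delta> Gr n \<xi> (v (E i \<xi>)))"
    and Ble: "\<And>n i v. n1 \<le> n \<Longrightarrow> i < n \<Longrightarrow> v \<in> borel_measurable borel \<Longrightarrow> (\<And>e. v e \<in> unitcube) \<Longrightarrow>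
       (\<integral>\<xi>. Bd \<epsilon>1 C1 c1 \<delta> Gr n \<xi> (v (E i \<xi>)) \<partial>M) \<le> \<epsilon>0"
    using unif_lin[OF e0(1)] by blast
  define n0 where "n0 = max n1 (max 1 (nat \<lceil>(4 / \<epsilon>)\<^sup>2\<rceil>))"
  show ?thesis
  proof (rule exI[of _ n0], intro allI impI)
    fix n assume n: "n0 \<le> n"
    then have n1: "n1 \<le> n" and npos: "0 < n" by (auto simp: n0_def)
    have rn: "0 < 1 / real n" using npos by simp
    have sn: "2 / sqrt (real n) \<le> \<epsilon> / 2"
    proof -
      have "(4 / \<epsilon>)\<^sup>2 \<le> real n" using n unfolding n0_def by linarith
      then have "4 / \<epsilon> \<le> sqrt (real n)" by (rule real_le_rsqrt)
      then have "4 \<le> sqrt (real n) * \<epsilon>" using eps by (simp add: pos_divide_le_eq)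
      then show ?thesis using npos by (simp add: pos_divide_le_eq mult.commute)
    qed
    \<comment> \<open>Rounding then costs at most \<open>1 / n\<close> for the sample and for the
      law, hence \<open>2 / sqrt n\<close> after scaling.\<close>
    obtain dd where dd: "0 < dd"
      "\<And>x y. x \<in> unitcube \<Longrightarrow> y \<in> unitcube \<Longrightarrow> (\<And>j. \<bar>x $ j - y $ j\<bar> \<le> dd) \<Longrightarrow> \<bar>\<phi> x - \<phi> y\<bar> \<le> 1 / real n"
      using cube_modulus[OF phi_cont rn] by metis
    obtain m0 :: nat where m0: "1 / dd < real m0" using reals_Archimedean2 by blast
    show "\<exists>m0. \<forall>m\<ge>m0. approx n (\<lambda>\<xi>. S2 n \<xi> - T2 m (alpha n \<xi>)) \<epsilon>"
    proof (intro exI[of _ "max 1 m0"] allI impI)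
      fix m assume m: "max 1 m0 \<le> m"
      then have mpos: "0 < m" by simp
      have "1 / dd < real m" using m m0 by linarith
      then have mdd: "1 / real m \<le> dd" using dd(1) mpos by (simp add: field_simps)
      have phi_close: "\<bar>\<phi> x - \<phi> (up m x)\<bar> \<le> 1 / real n" if x: "x \<in> unitcube" for x
      proof (rule dd(2)[OF x up_props(3)[OF mpos x]])
        show "\<bar>x $ j - up m x $ j\<bar> \<le> dd" for j
          using up_props(2)[OF mpos x, of j] mdd by linarith
      qed
      have grid: "is_grid J (ugrid m)" for J by (rule is_grid_ugrid[OF mpos])
      define q where "q J c = qvol J (\<lambda>x. \<phi> (onK J x)) (fst c) (snd c)" for J c
      have cellc: "fst c \<in> unitcube" if "c \<in> grid_cells J (ugrid m)" for J c
        using grid_cell_cube[OF grid that, of "fst c"] tagged_fst[OF grid, of J] that unfolding tagged_def by blast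
      define Y where "Y \<xi> = 2 / sqrt (real n) + (\<Sum>J\<in>Pow K'. \<Sum>c\<in>grid_cells J (ugrid m). \<bar>q J c\<bar> * Bd \<epsilon>1 C1 c1 \<delta> Gr n \<xi> (fst c))" for \<xi>
      have B1: "integrable M (\<lambda>\<xi>. Bd \<epsilon>1 C1 c1 \<delta> Gr n \<xi> u)" "(\<integral>\<xi>. Bd \<epsilon>1 C1 c1 \<delta> Gr n \<xi> u \<partial>M) \<le> \<epsilon>0"
        if u: "u \<in> unitcube" for u
        using Bint[OF n1 npos, of "\<lambda>_. u"] Ble[OF n1 npos, of "\<lambda>_. u"] u by auto
      show "approx n (\<lambda>\<xi>. S2 n \<xi> - T2 m (alpha n \<xi>)) \<epsilon>"
      proof (rule approxI[of Y])
        show "0 \<le> Y \<xi>" for \<xi> unfolding Y_def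
          by (intro add_nonneg_nonneg sum_nonneg mult_nonneg_nonneg nn) auto
        have int: "integrable M (\<lambda>\<xi>. \<Sum>J\<in>Pow K'. \<Sum>c\<in>grid_cells J (ugrid m). \<bar>q J c\<bar> * Bd \<epsilon>1 C1 c1 \<delta> Gr n \<xi> (fst c))"
          by (intro Bochner_Integration.integrable_sum integrable_mult_right B1 cellc)
        then show "integrable M Y" unfolding Y_def by simp
        have "(\<integral>\<xi>. Y \<xi> \<partial>M) = 2 / sqrt (real n) + (\<integral>\<xi>. (\<Sum>J\<in>Pow K'. \<Sum>c\<in>grid_cells J (ugrid m). \<bar>q J c\<bar> * Bd \<epsilon>1 C1 c1 \<delta> Gr n \<xi> (fst c)) \<partial>M)"
          unfolding Y_def using int by (simp add: prob_space)
        also have "(\<integral>\<xi>. (\<Sum>J\<in>Pow K'. \<Sum>c\<in>grid_cells J (ugrid m). \<bar>q J c\<bar> * Bd \<epsilon>1 C1 c1 \<delta> Gr n \<xi> (fst c)) \<partial>M)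
            = (\<Sum>J\<in>Pow K'. \<Sum>c\<in>grid_cells J (ugrid m). \<bar>q J c\<bar> * (\<integral>\<xi>. Bd \<epsilon>1 C1 c1 \<delta> Gr n \<xi> (fst c) \<partial>M))"
          by (intro Bochner_Integration.integral_sum[THEN trans] sum.cong refl Bochner_Integration.integrable_sum
              integrable_mult_right B1 cellc integral_mult_right_zero)
        also have "\<dots> \<le> (\<Sum>J\<in>Pow K'. \<Sum>c\<in>grid_cells J (ugrid m). \<bar>q J c\<bar> * \<epsilon>0)"
          by (intro sum_mono mult_left_mono B1(2) cellc) auto
        also have "\<dots> \<le> (\<Sum>J\<in>Pow K'. V J * \<epsilon>0)"
          unfolding sum_distrib_right[symmetric] q_def using V(2)[OF _ grid] e0(1)
          by (intro mult_right_mono sum_mono) auto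
        also have "\<dots> = \<epsilon>0 * VV" by (simp add: VV_def sum_distrib_left mult.commute)
        finally show "(\<integral>\<xi>. Y \<xi> \<partial>M) \<le> \<epsilon>" using e0(2) sn by linarith
        show "AE \<xi> in M. dense n \<xi> \<longrightarrow> \<bar>S2 n \<xi> - T2 m (alpha n \<xi>)\<bar> \<le> Y \<xi>"
          using AE_no_ties
        proof eventually_elim
          fix \<xi> assume nt: "no_ties \<xi>"
          show "dense n \<xi> \<longrightarrow> \<bar>S2 n \<xi> - T2 m (alpha n \<xi>)\<bar> \<le> Y \<xi>"
          proof
            assume "dense n \<xi>"
            then have go: "good n \<xi>" using nt npos by (intro goodI)
            interpret S: sample D p g n "aset n \<xi>" "\<lambda>j. Us j \<xi>" using go by (simp add: good_def)
            define N where "N = real (card (aset n \<xi>))"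
            have N: "0 < N" using S.card_a_pos by (simp add: N_def)
            define P where "P i = pseudoU Xs Zs A n \<xi> i" for i
            have Pc: "P i \<in> unitcube" if "i \<in> aset n \<xi>" for i
              unfolding P_def pseudoU_eq[OF go nt that] using Fn_le1[OF go nt] by (simp add: unitcube_iff)
            have a: "\<bar>(\<Sum>i\<in>aset n \<xi>. \<phi> (P i)) / N - (\<Sum>i\<in>aset n \<xi>. \<phi> (up m (P i))) / N\<bar> \<le> 1 / real n"
            proof -
              have "\<bar>(\<Sum>i\<in>aset n \<xi>. \<phi> (P i)) / N - (\<Sum>i\<in>aset n \<xi>. \<phi> (up m (P i))) / N\<bar>
                 = \<bar>\<Sum>i\<in>aset n \<xi>. \<phi> (P i) - \<phi> (up m (P i))\<bar> / N"
                using N by (simp add: sum_subtractf diff_divide_distrib[symmetric] abs_divide)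
              also have "\<dots> \<le> (\<Sum>i\<in>aset n \<xi>. 1 / real n) / N"
                using N Pc by (intro divide_right_mono order_trans[OF sum_abs] sum_mono phi_close) auto
              also have "\<dots> = 1 / real n" using N by (simp add: N_def)
              finally show ?thesis .
            qed
            have b: "\<bar>rho - (\<integral>\<xi>. indicator A (Z \<xi>) * \<phi> (up m (U \<xi>)) \<partial>M) / p\<bar> \<le> 1 / real n"
            proof -
              have [measurable]: "(\<lambda>\<xi>. \<phi> (U \<xi>)) \<in> borel_measurable M"
                by (rule cont_comp_meas[OF phi_cont]) (auto simp: U_cube)
              have [measurable]: "(\<lambda>\<xi>. up m (U \<xi>)) \<in> borel_measurable M" unfolding up_def by measurable
              have [measurable]: "(\<lambda>\<xi>. \<phi> (up m (U \<xi>))) \<in> borel_measurable M"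
                by (rule cont_comp_meas[OF phi_cont]) (auto simp: U_cube up_props[OF mpos])
              obtain B where B: "\<And>u. u \<in> unitcube \<Longrightarrow> \<bar>\<phi> u\<bar> \<le> B"
              proof -
                have "compact (\<phi> ` unitcube)" by (rule compact_continuous_image[OF phi_cont]) simp
                then obtain B where "\<And>x. x \<in> \<phi> ` unitcube \<Longrightarrow> norm x \<le> B"
                  using compact_imp_bounded bounded_iff by metis
                then show thesis by (intro that[of B]) auto
              qed
              have B0: "0 \<le> B" using B[OF U_cube, of undefined] by linarith
              have i1: "integrable M (\<lambda>\<xi>. indicator A (Z \<xi>) * \<phi> (U \<xi>))"
                "integrable M (\<lambda>\<xi>. indicator A (Z \<xi>) * \<phi> (up m (U \<xi>)))"
                using B[OF U_cube] B[OF up_props(3)[OF mpos U_cube]]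
                by (auto intro!: integrable_const_bound[where B = B] simp: indicator_def B0)
              have "rho - (\<integral>\<xi>. indicator A (Z \<xi>) * \<phi> (up m (U \<xi>)) \<partial>M) / p
                 = (\<integral>\<xi>. indicator A (Z \<xi>) * \<phi> (U \<xi>) - indicator A (Z \<xi>) * \<phi> (up m (U \<xi>)) \<partial>M) / p"
                unfolding rho_eq using i1 by (simp add: diff_divide_distrib)
              then have "\<bar>rho - (\<integral>\<xi>. indicator A (Z \<xi>) * \<phi> (up m (U \<xi>)) \<partial>M) / p\<bar>
                 = \<bar>\<integral>\<xi>. indicator A (Z \<xi>) * \<phi> (U \<xi>) - indicator A (Z \<xi>) * \<phi> (up m (U \<xi>)) \<partial>M\<bar> / p"
                using p_pos by (simp add: abs_divide)
              also have "\<dots> \<le> (\<integral>\<xi>. indicator A (Z \<xi>) * (1 / real n) \<partial>M) / p"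
              proof (intro divide_right_mono order_trans[OF integral_abs_bound] integral_mono)
                show "integrable M (\<lambda>\<xi>. \<bar>indicator A (Z \<xi>) * \<phi> (U \<xi>) - indicator A (Z \<xi>) * \<phi> (up m (U \<xi>))\<bar>)"
                  using i1 by simp
                show "integrable M (\<lambda>\<xi>. indicator A (Z \<xi>) * (1 / real n))"
                  by (rule integrable_const_bound[where B = "1 / real n"]) (auto simp: indicator_def)
                show "\<bar>indicator A (Z \<xi>) * \<phi> (U \<xi>) - indicator A (Z \<xi>) * \<phi> (up m (U \<xi>))\<bar> \<le> indicator A (Z \<xi>) * (1 / real n)" for \<xi>
                  using phi_close[OF U_cube, of \<xi>] by (simp add: indicator_def)
              qed (use p_pos in auto)
              also have "(\<integral>\<xi>. indicator A (Z \<xi>) * (1 / real n) \<partial>M) = p * (1 / real n)"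
              proof -
                have "(\<integral>\<xi>. indicator A (Z \<xi>) \<partial>M) = (\<integral>\<xi>. indicator {\<xi> \<in> space M. Z \<xi> \<in> A} \<xi> \<partial>M)"
                  by (intro Bochner_Integration.integral_cong) (auto simp: indicator_def)
                also have "\<dots> = p" by (simp add: pA_def)
                finally show ?thesis by simp
              qed
              finally show ?thesis using p_pos by simp
            qed
            have c: "(\<Sum>i\<in>aset n \<xi>. \<phi> (up m (P i))) / N = (\<Sum>J\<in>Pow K'. (-1) ^ card J * (\<Sum>c\<in>grid_cells J (ugrid m). Chw n \<xi> (fst c) * q J c))"
            proof -
              have "(\<Sum>i\<in>aset n \<xi>. \<phi> (up m (P i))) = (\<Sum>i\<in>aset n \<xi>. \<Sum>J\<in>Pow K'. (-1) ^ card J * (\<Sum>c\<in>grid_cells J (ugrid m).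
                  (if \<forall>k. P i $ k \<le> fst c $ k then 1 else 0) * q J c))"
                unfolding q_def by (intro sum.cong refl phi_up[OF mpos] Pc)
              also have "\<dots> = (\<Sum>J\<in>Pow K'. (-1) ^ card J * (\<Sum>c\<in>grid_cells J (ugrid m).
                  (\<Sum>i\<in>aset n \<xi>. if \<forall>k. P i $ k \<le> fst c $ k then 1 else 0) * q J c))"
                by (subst sum.swap) (simp only: sum_distrib_left[symmetric] sum_distrib_right sum.swap[of _ _ "aset n \<xi>"])
              also have "\<dots> = (\<Sum>J\<in>Pow K'. (-1) ^ card J * (\<Sum>c\<in>grid_cells J (ugrid m). (Chw n \<xi> (fst c) * N) * q J c))"
              proof (intro sum.cong refl arg_cong2[where f = "(*)"])
                fix c
                have "(\<Sum>i\<in>aset n \<xi>. if \<forall>k. P i $ k \<le> fst c $ k then 1 else 0 :: real) = real (card {i \<in> aset n \<xi>. \<forall>k. P i $ k \<le> fst c $ k})"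
                  using finite_aset by (simp add: sum.If_cases Int_def)
                also have "{i \<in> aset n \<xi>. \<forall>k. P i $ k \<le> fst c $ k} = {i \<in> aset n \<xi>. \<forall>k. Fnw n \<xi> k (Us i \<xi> $ k) \<le> fst c $ k}"
                  using pseudoU_eq[OF go nt] by (auto simp: P_def)
                also have "real (card \<dots>) = Chw n \<xi> (fst c) * N" unfolding S.Chat_def N_def[symmetric] using N by simp
                finally show "(\<Sum>i\<in>aset n \<xi>. if \<forall>k. P i $ k \<le> fst c $ k then 1 else 0 :: real) = Chw n \<xi> (fst c) * N" .
              qed
              also have "\<dots> = (\<Sum>J\<in>Pow K'. (-1) ^ card J * (\<Sum>c\<in>grid_cells J (ugrid m). Chw n \<xi> (fst c) * q J c)) * N"
                by (simp add: sum_distrib_right sum_distrib_left mult_ac)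
              finally show ?thesis using N by simp
            qed
            \<comment> \<open>The population counterpart of \<open>c\<close>: the indicators average
              to \<open>D\<close>.\<close>
            have dd: "(\<integral>\<xi>. indicator A (Z \<xi>) * \<phi> (up m (U \<xi>)) \<partial>M) / p
              = (\<Sum>J\<in>Pow K'. (-1) ^ card J * (\<Sum>c\<in>grid_cells J (ugrid m). (D (fst c) / p) * q J c))"
            proof -
              have HU: "integrable M (\<lambda>\<xi>. H (U \<xi>, Z \<xi>) u)" "(\<integral>\<xi>. H (U \<xi>, Z \<xi>) u \<partial>M) = D u" for u
              proof -
                have m: "(\<lambda>\<xi>. (U \<xi>, Z \<xi>)) \<in> borel_measurable M" by (intro borel_measurable_Pair) auto
                show "integrable M (\<lambda>\<xi>. H (U \<xi>, Z \<xi>) u)"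
                  using m by (intro integrable_const_bound[where B = 1]) (auto simp: H_bounds)
                show "(\<integral>\<xi>. H (U \<xi>, Z \<xi>) u \<partial>M) = D u"
                  using integral_H[of u] m unfolding Pd_def by (subst (asm) integral_distr) auto
              qed
              have "(\<integral>\<xi>. indicator A (Z \<xi>) * \<phi> (up m (U \<xi>)) \<partial>M)
                 = (\<integral>\<xi>. (\<Sum>J\<in>Pow K'. (-1) ^ card J * (\<Sum>c\<in>grid_cells J (ugrid m). H (U \<xi>, Z \<xi>) (fst c) * q J c)) \<partial>M)"
              proof (rule Bochner_Integration.integral_cong[OF refl])
                fix \<xi>
                show "indicator A (Z \<xi>) * \<phi> (up m (U \<xi>)) = (\<Sum>J\<in>Pow K'. (-1) ^ card J * (\<Sum>c\<in>grid_cells J (ugrid m). H (U \<xi>, Z \<xi>) (fst c) * q J c))"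
                  unfolding phi_up[OF mpos U_cube] q_def
                  by (cases "Z \<xi> \<in> A") (auto simp: H_def intro!: sum.cong)
              qed
              also have "\<dots> = (\<Sum>J\<in>Pow K'. (-1) ^ card J * (\<Sum>c\<in>grid_cells J (ugrid m). D (fst c) * q J c))"
                using HU by (simp add: Bochner_Integration.integral_sum)
              finally show ?thesis by (simp add: sum_divide_distrib sum_distrib_left)
            qed
            define W where "W = (\<Sum>J\<in>Pow K'. (-1) ^ card J * (\<Sum>c\<in>grid_cells J (ugrid m). (sqrt (real n) * (Chw n \<xi> (fst c) - D (fst c) / p)) * q J c))"
            have Weq: "W = sqrt (real n) * ((\<Sum>i\<in>aset n \<xi>. \<phi> (up m (P i))) / N - (\<integral>\<xi>. indicator A (Z \<xi>) * \<phi> (up m (U \<xi>)) \<partial>M) / p)"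
              unfolding c dd W_def
              by (simp add: sum_distrib_left sum_subtractf[symmetric] algebra_simps)
            have "\<bar>S2 n \<xi> - W\<bar> \<le> 2 / sqrt (real n)"
            proof -
              have "S2 n \<xi> - W = sqrt (real n) * (((\<Sum>i\<in>aset n \<xi>. \<phi> (P i)) / N - (\<Sum>i\<in>aset n \<xi>. \<phi> (up m (P i))) / N)
                 - (rho - (\<integral>\<xi>. indicator A (Z \<xi>) * \<phi> (up m (U \<xi>)) \<partial>M) / p))"
                unfolding S2_def Weq P_def[symmetric] N_def[symmetric] by (simp add: algebra_simps)
              then have "\<bar>S2 n \<xi> - W\<bar> = sqrt (real n) * \<bar>((\<Sum>i\<in>aset n \<xi>. \<phi> (P i)) / N - (\<Sum>i\<in>aset n \<xi>. \<phi> (up m (P i))) / N)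
                 - (rho - (\<integral>\<xi>. indicator A (Z \<xi>) * \<phi> (up m (U \<xi>)) \<partial>M) / p)\<bar>" by (simp add: abs_mult)
              also have "\<dots> \<le> sqrt (real n) * (1 / real n + 1 / real n)"
                by (intro mult_left_mono order_trans[OF abs_triangle_ineq4 add_mono[OF a b]]) auto
              also have "\<dots> = 2 / sqrt (real n)" using S.s_div_n by (simp only: distrib_left)
              finally show ?thesis .
            qed
            moreover have "\<bar>W - T2 m (alpha n \<xi>)\<bar> \<le> (\<Sum>J\<in>Pow K'. \<Sum>c\<in>grid_cells J (ugrid m). \<bar>q J c\<bar> * Bd \<epsilon>1 C1 c1 \<delta> Gr n \<xi> (fst c))"
            proof -
              have weq: "W - T2 m (alpha n \<xi>) = (\<Sum>J\<in>Pow K'. (-1) ^ card J * (\<Sum>c\<in>grid_cells J (ugrid m).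
                  (sqrt (real n) * (Chw n \<xi> (fst c) - D (fst c) / p) - Cop (alpha n \<xi>) (fst c)) * q J c))"
                unfolding W_def T2_def q_def by (simp only: sum_subtractf[symmetric] right_diff_distrib[symmetric] left_diff_distrib[symmetric])
              show ?thesis
                unfolding weq
              proof (rule order_trans[OF sum_abs], rule sum_mono)
                fix J assume "J \<in> Pow K'"
                have "\<bar>(-1) ^ card J * (\<Sum>c\<in>grid_cells J (ugrid m).
                  (sqrt (real n) * (Chw n \<xi> (fst c) - D (fst c) / p) - Cop (alpha n \<xi>) (fst c)) * q J c)\<bar>
                  \<le> (\<Sum>c\<in>grid_cells J (ugrid m). \<bar>(sqrt (real n) * (Chw n \<xi> (fst c) - D (fst c) / p) - Cop (alpha n \<xi>) (fst c)) * q J c\<bar>)"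
                  by (simp add: abs_mult power_abs) (rule order_trans[OF sum_abs], simp add: abs_mult)
                also have "\<dots> \<le> (\<Sum>c\<in>grid_cells J (ugrid m). \<bar>q J c\<bar> * Bd \<epsilon>1 C1 c1 \<delta> Gr n \<xi> (fst c))"
                proof (rule sum_mono)
                  fix c assume "c \<in> grid_cells J (ugrid m)"
                  then have uc: "fst c \<in> unitcube" by (rule cellc)
                  \<comment> \<open>With \<open>L\<close> empty the linearisation is read at the
                    corner itself, all coordinates being on the scale of the ranks.\<close>
                  have "vmix {} z (fst c) = fst c" for z by (simp add: vec_eq_iff)
                  then have "\<bar>sqrt (real n) * (Chw n \<xi> (fst c) - D (fst c) / p) - Cop (alpha n \<xi>) (fst c)\<bar> \<le> Bd \<epsilon>1 C1 c1 \<delta> Gr n \<xi> (fst c)"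
                    using lin[OF n1 go uc, of "{}"] by simp
                  then have "\<bar>sqrt (real n) * (Chw n \<xi> (fst c) - D (fst c) / p) - Cop (alpha n \<xi>) (fst c)\<bar> * \<bar>q J c\<bar>
                     \<le> Bd \<epsilon>1 C1 c1 \<delta> Gr n \<xi> (fst c) * \<bar>q J c\<bar>" by (rule mult_right_mono) simp
                  then show "\<bar>(sqrt (real n) * (Chw n \<xi> (fst c) - D (fst c) / p) - Cop (alpha n \<xi>) (fst c)) * q J c\<bar>
                     \<le> \<bar>q J c\<bar> * Bd \<epsilon>1 C1 c1 \<delta> Gr n \<xi> (fst c)" unfolding abs_mult by (simp only: mult.commute)
                qed
                finally show "\<bar>(-1) ^ card J * (\<Sum>c\<in>grid_cells J (ugrid m).
                  (sqrt (real n) * (Chw n \<xi> (fst c) - D (fst c) / p) - Cop (alpha n \<xi>) (fst c)) * q J c)\<bar>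
                  \<le> (\<Sum>c\<in>grid_cells J (ugrid m). \<bar>q J c\<bar> * Bd \<epsilon>1 C1 c1 \<delta> Gr n \<xi> (fst c))" .
              qed
            qed
            ultimately show "\<bar>S2 n \<xi> - T2 m (alpha n \<xi>)\<bar> \<le> Y \<xi>" unfolding Y_def by (rule abs_diff_chain)
          qed
        qed
      qed
    qed
  qed
qed

end

section \<open>Rounding the evaluation points to a finite grid\<close>

definition rd :: "nat \<Rightarrow> real^'p::finite \<Rightarrow> real^'p" where
  "rd m x = (\<chi> k. of_int \<lfloor>real m * x $ k\<rfloor> / real m)"

definition Gm :: "nat \<Rightarrow> (real^'p::finite) set" where
  "Gm m = {v. \<forall>k. v $ k \<in> ugrid m k}"

lemma finite_Gm: "finite (Gm m)"
  unfolding Gm_def by (rule finite_vec_box) (simp add: ugrid_def)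

lemma Gm_cube: "0 < m \<Longrightarrow> v \<in> Gm m \<Longrightarrow> v \<in> unitcube"
  unfolding Gm_def unitcube_iff using is_gridD(4,5)[OF is_grid_ugrid[of m UNIV]] by blast

lemma rd_props:
  assumes m: "0 < m" and x: "x \<in> unitcube"
  shows "rd m x \<in> Gm m" "\<bar>rd m x $ k - x $ k\<bar> \<le> 1 / real m" "rd m x \<in> unitcube"
proof -
  have xk: "0 \<le> x $ k" "x $ k \<le> 1" for k using x by (auto simp: unitcube_iff)
  show g: "rd m x \<in> Gm m"
    unfolding Gm_def mem_Collect_eq
  proof
    fix k
    have c: "0 \<le> \<lfloor>real m * x $ k\<rfloor>" "\<lfloor>real m * x $ k\<rfloor> \<le> int m"
    proof -
      show "0 \<le> \<lfloor>real m * x $ k\<rfloor>" using xk[of k] by simp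
      have "real m * x $ k \<le> real m * 1" using xk by (intro mult_left_mono) auto
      then show "\<lfloor>real m * x $ k\<rfloor> \<le> int m" by linarith
    qed
    have "rd m x $ k = real (nat \<lfloor>real m * x $ k\<rfloor>) / real m" using c by (simp add: rd_def)
    moreover have "nat \<lfloor>real m * x $ k\<rfloor> \<le> m" using c by linarith
    ultimately show "rd m x $ k \<in> ugrid m k" by (auto simp: ugrid_def)
  qed
  show "rd m x \<in> unitcube" by (rule Gm_cube[OF m g])
  have "of_int \<lfloor>real m * x $ k\<rfloor> \<le> x $ k * real m" "x $ k * real m - 1 \<le> of_int \<lfloor>real m * x $ k\<rfloor>"
    by (simp_all add: mult.commute)
  then have "rd m x $ k \<le> x $ k" "x $ k - 1 / real m \<le> rd m x $ k"
    using m by (auto simp: rd_def pos_le_divide_eq pos_divide_le_eq left_diff_distrib)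
  then show "\<bar>rd m x $ k - x $ k\<bar> \<le> 1 / real m" by linarith
qed

lemma rd_close:
  fixes G :: "real^'p::finite \<Rightarrow> real"
  assumes "continuous_on unitcube G" "0 < e"
  obtains n0 where "\<And>m u. n0 \<le> m \<Longrightarrow> u \<in> unitcube \<Longrightarrow> \<bar>G (rd (Suc m) u) - G u\<bar> \<le> e"
proof -
  obtain \<delta> where d: "0 < \<delta>" "\<And>x y. x \<in> unitcube \<Longrightarrow> y \<in> unitcube \<Longrightarrow> (\<And>j. \<bar>x $ j - y $ j\<bar> \<le> \<delta>) \<Longrightarrow> \<bar>G x - G y\<bar> \<le> e"
    using cube_modulus[OF assms] by metis
  obtain n0 where n0: "1 / real (Suc n0) < \<delta>" using nat_approx_posE[OF d(1)] by blast
  show thesis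
  proof (rule that[of n0])
    fix m and u :: "real^'p" assume m: "n0 \<le> m" and u: "u \<in> unitcube"
    have "1 / real (Suc m) \<le> 1 / real (Suc n0)" using m by (intro divide_left_mono) auto
    then have md: "1 / real (Suc m) \<le> \<delta>" using n0 by linarith
    show "\<bar>G (rd (Suc m) u) - G u\<bar> \<le> e"
      by (intro d(2) rd_props(3) u order_trans[OF rd_props(2) md]) simp_all
  qed
qed

lemma rd_meas [measurable]:
  assumes [measurable]: "f \<in> borel_measurable Q"
  shows "(\<lambda>x. rd m (f x)) \<in> borel_measurable Q"
  unfolding rd_def by measurable

context cop_stat
begin

text \<open>The share of observation \<open>e\<close> in the cell rounded down to \<open>v\<close>,
  the free coordinates being averaged out. Its mean \<open>mu\<close> is the mass of that cell under
  the integrating measure.\<close>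

definition zeta :: "nat \<Rightarrow> real^'p \<Rightarrow> (real^'p) \<times> (real^'q) \<Rightarrow> real" where
  "zeta m v e = indicator A (snd e) * (\<integral>w. (if \<forall>k. rd m (vK e w) $ k = v $ k then 1 else 0) \<partial>Lc) / p"

definition mu :: "nat \<Rightarrow> real^'p \<Rightarrow> real" where
  "mu m v = (\<integral>e. zeta m v e \<partial>Pd)"

definition T1 :: "nat \<Rightarrow> (real^'p \<Rightarrow> real) \<Rightarrow> real" where
  "T1 m b = (\<Sum>v\<in>Gm m. mu m v * (\<psi> v * Cop b (onK K v)))"

lemma cell_ind_meas: "(\<lambda>(e, w). if \<forall>k. rd m (vK e w) $ k = v $ k then 1 else 0 :: real) \<in> borel_measurable (borel \<Otimes>\<^sub>M Lc)"
  unfolding split_beta' by measurable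

lemma zeta_meas [measurable]: "zeta m v \<in> borel_measurable borel"
proof -
  have "(\<lambda>e. \<integral>w. (if \<forall>k. rd m (vK e w) $ k = v $ k then 1 else 0 :: real) \<partial>Lc) \<in> borel_measurable borel"
    using Lc.borel_measurable_lebesgue_integral[OF cell_ind_meas] .
  then show ?thesis unfolding zeta_def by measurable
qed

lemma cell_ind_integrable: "integrable Lc (\<lambda>w. if \<forall>k. rd m (vK e w) $ k = v $ k then 1 else 0 :: real)"
  by (rule Lc.integrable_const_bound[where B = 1]) auto

lemma zeta_bound: "\<bar>zeta m v e\<bar> \<le> 1 / p"
proof -
  have "\<bar>\<integral>w. (if \<forall>k. rd m (vK e w) $ k = v $ k then 1 else 0 :: real) \<partial>Lc\<bar> \<le> (\<integral>w. 1 \<partial>(Lc :: (real^'p) measure))"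
    by (rule order_trans[OF integral_abs_bound], rule integral_mono) (auto intro!: integrable_abs cell_ind_integrable)
  then have i: "\<bar>\<integral>w. (if \<forall>k. rd m (vK e w) $ k = v $ k then 1 else 0 :: real) \<partial>Lc\<bar> \<le> 1" by (simp add: Lc.prob_space)
  show ?thesis
  proof (cases "snd e \<in> A")
    case True then show ?thesis unfolding zeta_def using i p_pos by (simp add: abs_divide divide_right_mono)
  qed (use p_pos in \<open>simp add: zeta_def\<close>)
qed

lemma zeta_integrable: "integrable Pd (zeta m v)"
  by (rule Pd.integrable_const_bound[where B = "1 / p"]) (use zeta_bound in auto)

lemma round_sum:
  assumes m: "0 < m"
  shows "indicator A (snd e) * (\<integral>w. Q (rd m (vK e w)) \<partial>Lc) / p = (\<Sum>v\<in>Gm m. zeta m v e * Q v)"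
proof -
  have "(\<integral>w. Q (rd m (vK e w)) \<partial>Lc) = (\<integral>w. (\<Sum>v\<in>Gm m. (if \<forall>k. rd m (vK e w) $ k = v $ k then 1 else 0) * Q v) \<partial>Lc)"
  proof (rule Bochner_Integration.integral_cong[OF refl])
    fix w :: "real^'p" assume "w \<in> space Lc"
    then have "rd m (vK e w) \<in> Gm m" by (intro rd_props(1)[OF m] vK_cube) (simp add: space_Lc)
    then have "(\<Sum>v\<in>Gm m. if v = rd m (vK e w) then Q v else 0) = Q (rd m (vK e w))"
      by (subst sum.delta[OF finite_Gm]) simp
    moreover have "(\<Sum>v\<in>Gm m. (if \<forall>k. rd m (vK e w) $ k = v $ k then 1 else 0) * Q v) = (\<Sum>v\<in>Gm m. if v = rd m (vK e w) then Q v else 0)"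
      by (intro sum.cong refl) (auto simp: vec_eq_iff)
    ultimately show "Q (rd m (vK e w)) = (\<Sum>v\<in>Gm m. (if \<forall>k. rd m (vK e w) $ k = v $ k then 1 else 0) * Q v)" by simp
  qed
  also have "\<dots> = (\<Sum>v\<in>Gm m. (\<integral>w. (if \<forall>k. rd m (vK e w) $ k = v $ k then 1 else 0) \<partial>Lc) * Q v)"
    by (subst Bochner_Integration.integral_sum) (auto intro!: integrable_mult_left cell_ind_integrable)
  finally show ?thesis by (simp add: zeta_def sum_distrib_left sum_divide_distrib mult_ac)
qed

text \<open>The contribution of one observation \<open>x\<close> to the rounding error of the
  linearised integrand at \<open>u\<close>.\<close>

definition fD :: "nat \<Rightarrow> (real^'p) \<times> (real^'q) \<Rightarrow> real^'p \<Rightarrow> real" where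
  "fD m x u = \<psi> u * Cop (hc x) (onK K u) - \<psi> (rd m u) * Cop (hc x) (onK K (rd m u))"

lemma fD_meas:
  assumes m: "0 < m" and [measurable]: "h \<in> borel_measurable Q" "v \<in> borel_measurable Q" and vc: "\<And>x. x \<in> space Q \<Longrightarrow> v x \<in> unitcube"
  shows "(\<lambda>x. fD m (h x) (v x)) \<in> borel_measurable Q"
proof -
  have [measurable]: "(\<lambda>x. \<psi> (v x)) \<in> borel_measurable Q" "(\<lambda>x. \<psi> (rd m (v x))) \<in> borel_measurable Q"
    using vc rd_props(3)[OF m] by (auto intro!: cont_comp_meas[OF psi_cont])
  have [measurable]: "(\<lambda>x. Cop (hc (h x)) (onK K (v x))) \<in> borel_measurable Q"
    "(\<lambda>x. Cop (hc (h x)) (onK K (rd m (v x)))) \<in> borel_measurable Q"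
    using vc rd_props(3)[OF m] by (auto intro!: Cop_meas onK_cube)
  show ?thesis unfolding fD_def by measurable
qed

text \<open>Two replacements. Rounding the evaluation points has an error with second moment
  governed by \<open>s\<close>, and \<kappa> balances it against its square. Exchanging empirical
  cell weights for \<open>mu\<close> leaves finitely many products of two variables bounded in
  second moment, divided by sqrt n.\<close>

lemma R1_approx:
  assumes m: "0 < m" and kap: "0 < \<kappa>" and s: "\<And>u. u \<in> unitcube \<Longrightarrow> (\<integral>x. (fD m x u)\<^sup>2 \<partial>Pd) \<le> s"
  shows "\<exists>c. \<forall>n>0. approx n (\<lambda>\<xi>. R1 n \<xi> - T1 m (alpha n \<xi>)) ((\<kappa> + 2 * s / \<kappa>) / p + c / sqrt (real n))"
proof -
  obtain B where B: "0 < B" "\<And>u. u \<in> unitcube \<Longrightarrow> \<bar>\<psi> u\<bar> \<le> B" using psi_bound by metis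
  define bC where "bC = (2 + real CARD('p))\<^sup>2 / p"
  have bC0: "0 \<le> bC" using p_pos by (simp add: bC_def)
  have Cb: "\<bar>Cop (hc e) u\<bar> \<le> bC" if "u \<in> unitcube" for e u unfolding bC_def by (rule Cop_hc_bound[OF that])
  define b2 where "b2 = B * bC + B * bC"
  define bz where "bz = 2 / p"
  define c where "c = 2 * b2\<^sup>2 / \<kappa> / p + (\<Sum>v\<in>(Gm m :: (real^'p) set). B * (4 * bz\<^sup>2 + 4 * bC\<^sup>2))"
  have fDb: "\<bar>fD m x u\<bar> \<le> b2" if u: "u \<in> unitcube" for x u
  proof -
    have "\<bar>\<psi> u * Cop (hc x) (onK K u)\<bar> \<le> B * bC" "\<bar>\<psi> (rd m u) * Cop (hc x) (onK K (rd m u))\<bar> \<le> B * bC"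
      unfolding abs_mult using B u rd_props(3)[OF m u] by (auto intro!: mult_mono Cb onK_cube)
    then show ?thesis unfolding fD_def b2_def by linarith
  qed
  have fD0: "(\<integral>x. fD m x u \<partial>Pd) = 0" for u
    unfolding fD_def using Cop_hc_integrable by (simp add: Cop_hc_mean)
  show ?thesis
  proof (intro exI[of _ c] allI impI)
    fix n :: nat assume n: "0 < n"
    define sn where "sn = sqrt (real n)"
    have sn: "0 < sn" "1 \<le> sn" using n by (auto simp: sn_def)
    have rn: "1 / real n \<le> 1 / sn"
    proof (intro divide_left_mono)
      have "sn * 1 \<le> sn * sn" using sn by (intro mult_left_mono) auto
      then show "sn \<le> real n" by (simp add: sn_def)
    qed (use n sn in auto)
    define G where "G \<xi> u = \<psi> u * Cop (alpha n \<xi>) (onK K u)" for \<xi> u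
    have Gdiff: "G \<xi> u - G \<xi> (rd m u) = (\<Sum>j<n. fD m (E j \<xi>) u) / sqrt (real n)" for \<xi> u
      unfolding G_def fD_def Cop_alpha by (simp add: sum_subtractf sum_distrib_left diff_divide_distrib)
    \<comment> \<open>Makes the moment bounds, which hold at points of the cube, available for every
      argument.\<close>
    define cl where "cl u = (if u \<in> unitcube then u else 0)" for u :: "real^'p"
    have clc: "cl u \<in> unitcube" for u by (auto simp: cl_def unitcube_iff)
    have clm[measurable]: "cl \<in> borel_measurable borel" unfolding cl_def by measurable
    define \<Phi> where "\<Phi> \<xi> u = ((\<Sum>j<n. fD m (E j \<xi>) (cl u)) / sqrt (real n))\<^sup>2" for \<xi> u
    have Pm: "(\<lambda>(\<xi>, u). \<Phi> \<xi> u) \<in> borel_measurable (M \<Otimes>\<^sub>M borel)"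
    proof -
      have "(\<lambda>z. fD m (E j (fst z)) (cl (snd z))) \<in> borel_measurable (M \<Otimes>\<^sub>M borel)" for j
        by (rule fD_meas[OF m]) (auto simp: clc)
      then show ?thesis unfolding \<Phi>_def split_beta' by measurable
    qed
    have mom: "integrable M (\<lambda>\<xi>. \<Phi> \<xi> (v (E i \<xi>)))" "(\<integral>\<xi>. \<Phi> \<xi> (v (E i \<xi>)) \<partial>M) \<le> 2 * s + 2 * b2\<^sup>2 / real n"
      if i: "i < n" and v[measurable]: "v \<in> borel_measurable borel" for i v
    proof -
      have fm: "(\<lambda>(x, y). fD m x (cl (v y))) \<in> borel_measurable (borel \<Otimes>\<^sub>M borel)"
        unfolding split_beta' by (rule fD_meas[OF m]) (auto simp: clc)
      note sm = second_moment_at_sample[OF fm fDb[OF clc] fD0 s[OF clc] i]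
      show "integrable M (\<lambda>\<xi>. \<Phi> \<xi> (v (E i \<xi>)))" "(\<integral>\<xi>. \<Phi> \<xi> (v (E i \<xi>)) \<partial>M) \<le> 2 * s + 2 * b2\<^sup>2 / real n"
        unfolding \<Phi>_def by (rule sm)+
    qed
    have Pnn: "0 \<le> \<Phi> \<xi> u" for \<xi> u by (simp add: \<Phi>_def)
    have mean: "integrable M (\<lambda>\<xi>. \<integral>w. \<Phi> \<xi> (vK (E i \<xi>) w) \<partial>Lc)" "(\<integral>\<xi>. (\<integral>w. \<Phi> \<xi> (vK (E i \<xi>) w) \<partial>Lc) \<partial>M) \<le> 2 * s + 2 * b2\<^sup>2 / real n"
      "AE \<xi> in M. integrable Lc (\<lambda>w. \<Phi> \<xi> (vK (E i \<xi>) w))" if i: "i < n" for i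
      by (rule mean_over_Lc[where \<Phi> = \<Phi> and vv = vK and i = i and b = "2 * s + 2 * b2\<^sup>2 / real n", OF Pm Pnn vK_meas vK_cube];
        (assumption | rule mom[OF i]; assumption))+
    \<comment> \<open>The fluctuation of a cell weight, normalised so that its second moment stays
      bounded in \<open>n\<close>.\<close>
    define a where "a v \<xi> = (\<Sum>i<n. zeta m v (E i \<xi>) - mu m v) / sqrt (real n)" for v \<xi>
    have am: "integrable M (\<lambda>\<xi>. (a v \<xi>)\<^sup>2)" "(\<integral>\<xi>. (a v \<xi>)\<^sup>2 \<partial>M) \<le> 4 * bz\<^sup>2" for v
    proof -
      have mub: "\<bar>mu m v\<bar> \<le> 1 / p"
      proof -
        have "\<bar>mu m v\<bar> \<le> (\<integral>e. 1 / p \<partial>Pd)" unfolding mu_def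
          by (rule order_trans[OF integral_abs_bound], rule integral_mono) (auto intro!: integrable_abs zeta_integrable zeta_bound)
        then show ?thesis by (simp add: Pd.prob_space)
      qed
      have b: "\<bar>zeta m v x - mu m v\<bar> \<le> bz" for x
        using zeta_bound[of m v x] mub unfolding bz_def by (simp add: abs_le_iff)
      have z: "(\<integral>x. zeta m v x - mu m v \<partial>Pd) = 0" using zeta_integrable by (simp add: mu_def Pd.prob_space)
      have sq: "(\<integral>x. (zeta m v x - mu m v)\<^sup>2 \<partial>Pd) \<le> bz\<^sup>2"
      proof -
        have le: "(zeta m v x - mu m v)\<^sup>2 \<le> bz\<^sup>2" for x using b[of x] p_pos by (simp add: abs_le_square_iff[symmetric] bz_def)
        have "(\<integral>x. (zeta m v x - mu m v)\<^sup>2 \<partial>Pd) \<le> (\<integral>x. bz\<^sup>2 \<partial>Pd)"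
          by (rule integral_mono) (auto intro!: Pd.integrable_const_bound[where B = "bz\<^sup>2"] simp: le)
        then show ?thesis by (simp add: Pd.prob_space)
      qed
      \<comment> \<open>The summand ignores its second argument, so this is the ordinary second
        moment of an iid sum.\<close>
      note sm = second_moment_at_sample[of "\<lambda>x y. zeta m v x - mu m v", OF _ b z sq n]
      show "integrable M (\<lambda>\<xi>. (a v \<xi>)\<^sup>2)" unfolding a_def by (rule sm) measurable
      have "(\<integral>\<xi>. (a v \<xi>)\<^sup>2 \<partial>M) \<le> 2 * bz\<^sup>2 + 2 * bz\<^sup>2 / real n" unfolding a_def by (rule sm) measurable
      also have "\<dots> \<le> 4 * bz\<^sup>2" using n by (simp add: divide_le_eq mult_le_cancel_left1)
      finally show "(\<integral>\<xi>. (a v \<xi>)\<^sup>2 \<partial>M) \<le> 4 * bz\<^sup>2" .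
    qed
    have cm: "integrable M (\<lambda>\<xi>. (Cop (alpha n \<xi>) u)\<^sup>2)" "(\<integral>\<xi>. (Cop (alpha n \<xi>) u)\<^sup>2 \<partial>M) \<le> 4 * bC\<^sup>2" if u: "u \<in> unitcube" for u
    proof -
      have fm: "(\<lambda>(x, y). Cop (hc x) u) \<in> borel_measurable (borel \<Otimes>\<^sub>M (borel :: ((real^'p) \<times> (real^'q)) measure))"
        unfolding split_beta' by (rule Cop_meas) (auto simp: u)
      have sq: "(\<integral>x. (Cop (hc x) u)\<^sup>2 \<partial>Pd) \<le> bC\<^sup>2"
      proof -
        have le: "(Cop (hc x) u)\<^sup>2 \<le> bC\<^sup>2" for x using Cb[OF u, of x] bC0 by (simp add: abs_le_square_iff[symmetric])
        have [measurable]: "(\<lambda>x. Cop (hc x) u) \<in> borel_measurable Pd" by (rule Cop_meas) (auto simp: u)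
        have "(\<integral>x. (Cop (hc x) u)\<^sup>2 \<partial>Pd) \<le> (\<integral>x. bC\<^sup>2 \<partial>Pd)"
          by (rule integral_mono) (auto intro!: Pd.integrable_const_bound[where B = "bC\<^sup>2"] simp: le)
        then show ?thesis by (simp add: Pd.prob_space)
      qed
      note sm = second_moment_at_sample[of "\<lambda>x y. Cop (hc x) u", OF fm Cb[OF u] Cop_hc_mean sq n]
      show "integrable M (\<lambda>\<xi>. (Cop (alpha n \<xi>) u)\<^sup>2)" unfolding Cop_alpha by (rule sm)
      have "(\<integral>\<xi>. (Cop (alpha n \<xi>) u)\<^sup>2 \<partial>M) \<le> 2 * bC\<^sup>2 + 2 * bC\<^sup>2 / real n" unfolding Cop_alpha by (rule sm)
      also have "\<dots> \<le> 4 * bC\<^sup>2" using n by (simp add: divide_le_eq mult_le_cancel_left1)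
      finally show "(\<integral>\<xi>. (Cop (alpha n \<xi>) u)\<^sup>2 \<partial>M) \<le> 4 * bC\<^sup>2" .
    qed
    have Gmc: "onK K v \<in> unitcube" "v \<in> unitcube" if "v \<in> Gm m" for v using Gm_cube[OF m that] by (auto intro: onK_cube)
    define Y1 where "Y1 \<xi> = (\<Sum>i<n. (\<kappa> + (\<integral>w. \<Phi> \<xi> (vK (E i \<xi>) w) \<partial>Lc) / \<kappa>) / p) / real n" for \<xi>
    define Y2 where "Y2 \<xi> = (\<Sum>v\<in>Gm m. B * ((a v \<xi>)\<^sup>2 + (Cop (alpha n \<xi>) (onK K v))\<^sup>2) / sn)" for \<xi>
    show "approx n (\<lambda>\<xi>. R1 n \<xi> - T1 m (alpha n \<xi>)) ((\<kappa> + 2 * s / \<kappa>) / p + c / sqrt (real n))"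
    proof (rule approxI[of "\<lambda>\<xi>. Y1 \<xi> + Y2 \<xi>"])
      show "0 \<le> Y1 \<xi> + Y2 \<xi>" for \<xi> unfolding Y1_def Y2_def using kap p_pos B(1) sn
        by (intro add_nonneg_nonneg divide_nonneg_nonneg sum_nonneg mult_nonneg_nonneg integral_nonneg_AE) (auto simp: Pnn)
      have I1: "integrable M Y1" unfolding Y1_def
        by (intro integrable_divide Bochner_Integration.integrable_sum Bochner_Integration.integrable_add integrable_const mean(1)) simp
      have I2: "integrable M Y2" unfolding Y2_def
        using Gmc by (intro integrable_divide Bochner_Integration.integrable_sum integrable_mult_right Bochner_Integration.integrable_add am(1) cm(1))
      show "integrable M (\<lambda>\<xi>. Y1 \<xi> + Y2 \<xi>)" using I1 I2 by simp
      have E1: "(\<integral>\<xi>. Y1 \<xi> \<partial>M) \<le> (\<kappa> + 2 * s / \<kappa>) / p + 2 * b2\<^sup>2 / \<kappa> / p / sn"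
      proof -
        have "(\<integral>\<xi>. Y1 \<xi> \<partial>M) = (\<Sum>i<n. (\<kappa> + (\<integral>\<xi>. (\<integral>w. \<Phi> \<xi> (vK (E i \<xi>) w) \<partial>Lc) \<partial>M) / \<kappa>) / p) / real n"
        proof -
          have i1: "integrable M (\<lambda>\<xi>. (\<kappa> + (\<integral>w. \<Phi> \<xi> (vK (E i \<xi>) w) \<partial>Lc) / \<kappa>) / p)" if "i < n" for i
            by (intro integrable_divide Bochner_Integration.integrable_add integrable_const mean(1)[OF that])
          have i2: "(\<integral>\<xi>. (\<kappa> + (\<integral>w. \<Phi> \<xi> (vK (E i \<xi>) w) \<partial>Lc) / \<kappa>) / p \<partial>M)
             = (\<kappa> + (\<integral>\<xi>. (\<integral>w. \<Phi> \<xi> (vK (E i \<xi>) w) \<partial>Lc) \<partial>M) / \<kappa>) / p" if "i < n" for i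
            using mean(1)[OF that] by (simp add: prob_space)
          show ?thesis unfolding Y1_def integral_divide_zero[of M _ "real n"]
            by (subst Bochner_Integration.integral_sum) (auto simp only: i1 i2 lessThan_iff intro!: arg_cong2[where f = "(/)"] sum.cong)
        qed
        also have "\<dots> \<le> (\<Sum>i<n. (\<kappa> + (2 * s + 2 * b2\<^sup>2 / real n) / \<kappa>) / p) / real n"
          using mean(2) kap p_pos by (intro divide_right_mono sum_mono add_left_mono) auto
        also have "\<dots> = (\<kappa> + 2 * s / \<kappa>) / p + 2 * b2\<^sup>2 / \<kappa> / p * (1 / real n)" using n by (simp add: add_divide_distrib)
        also have "\<dots> \<le> (\<kappa> + 2 * s / \<kappa>) / p + 2 * b2\<^sup>2 / \<kappa> / p * (1 / sn)"
          using rn kap p_pos by (intro add_left_mono mult_left_mono) auto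
        finally show ?thesis by simp
      qed
      have E2: "(\<integral>\<xi>. Y2 \<xi> \<partial>M) \<le> (\<Sum>v\<in>(Gm m :: (real^'p) set). B * (4 * bz\<^sup>2 + 4 * bC\<^sup>2)) / sn"
      proof -
        have "(\<integral>\<xi>. Y2 \<xi> \<partial>M) = (\<Sum>v\<in>Gm m. B * ((\<integral>\<xi>. (a v \<xi>)\<^sup>2 \<partial>M) + (\<integral>\<xi>. (Cop (alpha n \<xi>) (onK K v))\<^sup>2 \<partial>M)) / sn)"
          unfolding Y2_def using am(1) cm(1)[OF Gmc(1)]
          by (subst Bochner_Integration.integral_sum) (auto intro!: sum.cong)
        also have "\<dots> \<le> (\<Sum>v\<in>(Gm m :: (real^'p) set). B * (4 * bz\<^sup>2 + 4 * bC\<^sup>2) / sn)"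
          using am(2) cm(2)[OF Gmc(1)] B(1) sn by (intro sum_mono divide_right_mono mult_left_mono add_mono) auto
        finally show ?thesis by (simp add: sum_divide_distrib)
      qed
      have "(\<integral>\<xi>. Y1 \<xi> + Y2 \<xi> \<partial>M) = (\<integral>\<xi>. Y1 \<xi> \<partial>M) + (\<integral>\<xi>. Y2 \<xi> \<partial>M)" using I1 I2 by simp
      then show "(\<integral>\<xi>. Y1 \<xi> + Y2 \<xi> \<partial>M) \<le> (\<kappa> + 2 * s / \<kappa>) / p + c / sqrt (real n)"
        using E1 E2 unfolding c_def sn_def[symmetric] by (simp add: add_divide_distrib)
      have AEi: "AE \<xi> in M. \<forall>i\<in>{..<n}. integrable Lc (\<lambda>w. \<Phi> \<xi> (vK (E i \<xi>) w))"
        using mean(3) by (intro AE_finite_allI) auto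
      show "AE \<xi> in M. dense n \<xi> \<longrightarrow> \<bar>R1 n \<xi> - T1 m (alpha n \<xi>)\<bar> \<le> Y1 \<xi> + Y2 \<xi>"
        using AEi AE_space
      proof eventually_elim
        fix \<xi> assume ai: "\<forall>i\<in>{..<n}. integrable Lc (\<lambda>w. \<Phi> \<xi> (vK (E i \<xi>) w))" and om: "\<xi> \<in> space M"
        have Gb: "\<bar>G \<xi> u\<bar> \<le> B * (real n * bC)" if u: "u \<in> unitcube" for u
        proof -
          have "\<bar>Cop (alpha n \<xi>) (onK K u)\<bar> \<le> (\<Sum>j<n. bC)"
          proof -
            have "\<bar>\<Sum>j<n. Cop (hc (E j \<xi>)) (onK K u)\<bar> \<le> (\<Sum>j<n. bC)"
              using u by (intro order_trans[OF sum_abs] sum_mono Cb onK_cube)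
            moreover have "\<bar>Cop (alpha n \<xi>) (onK K u)\<bar> \<le> \<bar>\<Sum>j<n. Cop (hc (E j \<xi>)) (onK K u)\<bar>"
              unfolding Cop_alpha sn_def[symmetric] abs_divide using sn by (simp add: divide_le_eq mult_le_cancel_left1)
            ultimately show ?thesis by linarith
          qed
          then show ?thesis unfolding G_def abs_mult using B u by (intro mult_mono) auto
        qed
        have Gm': "integrable Lc (\<lambda>w. G \<xi> (v w))" if [measurable]: "v \<in> borel_measurable Lc" and vc: "\<And>w. w \<in> unitcube \<Longrightarrow> v w \<in> unitcube" for v :: "real^'p \<Rightarrow> real^'p"
        proof (rule Lc.integrable_const_bound[where B = "B * (real n * bC)"])
          show "AE w in Lc. norm (G \<xi> (v w)) \<le> B * (real n * bC)" using Gb vc by (intro AE_I2) (auto simp: space_Lc)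
          have [measurable]: "(\<lambda>w. \<psi> (v w)) \<in> borel_measurable Lc"
            by (rule cont_comp_meas[OF psi_cont]) (use vc in \<open>auto simp: space_Lc\<close>)
          have [measurable]: "(\<lambda>w. Cop (alpha n \<xi>) (onK K (v w))) \<in> borel_measurable Lc"
            by (rule Cop_alpha_meas[of "\<lambda>_. \<xi>"]) (use om vc in \<open>auto simp: space_Lc onK_cube\<close>)
          show "(\<lambda>w. G \<xi> (v w)) \<in> borel_measurable Lc" unfolding G_def by measurable
        qed
        have i1: "integrable Lc (\<lambda>w. G \<xi> (vK (E i \<xi>) w))" "integrable Lc (\<lambda>w. G \<xi> (rd m (vK (E i \<xi>) w)))" for i
          by (rule Gm'; auto intro!: vK_cube rd_props(3)[OF m])+
        have first: "\<bar>indicator A (Zs i \<xi>) * ((\<integral>w. G \<xi> (vK (E i \<xi>) w) \<partial>Lc) - (\<integral>w. G \<xi> (rd m (vK (E i \<xi>) w)) \<partial>Lc)) / p\<bar>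
           \<le> (\<kappa> + (\<integral>w. \<Phi> \<xi> (vK (E i \<xi>) w) \<partial>Lc) / \<kappa>) / p" if i: "i < n" for i
        proof -
          define X where "X = (\<integral>w. G \<xi> (vK (E i \<xi>) w) \<partial>Lc) - (\<integral>w. G \<xi> (rd m (vK (E i \<xi>) w)) \<partial>Lc)"
          have "X = (\<integral>w. G \<xi> (vK (E i \<xi>) w) - G \<xi> (rd m (vK (E i \<xi>) w)) \<partial>Lc)" unfolding X_def using i1 by simp
          then have "\<bar>X\<bar> \<le> (\<integral>w. \<bar>G \<xi> (vK (E i \<xi>) w) - G \<xi> (rd m (vK (E i \<xi>) w))\<bar> \<partial>Lc)" using integral_abs_bound by metis
          also have "\<dots> \<le> (\<integral>w. \<kappa> + \<Phi> \<xi> (vK (E i \<xi>) w) / \<kappa> \<partial>Lc)"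
          proof (rule integral_mono)
            show "integrable Lc (\<lambda>w. \<bar>G \<xi> (vK (E i \<xi>) w) - G \<xi> (rd m (vK (E i \<xi>) w))\<bar>)" using i1 by simp
            show "integrable Lc (\<lambda>w. \<kappa> + \<Phi> \<xi> (vK (E i \<xi>) w) / \<kappa>)" using ai i by simp
            fix w :: "real^'p" assume "w \<in> space Lc"
            then have "cl (vK (E i \<xi>) w) = vK (E i \<xi>) w" using vK_cube by (simp add: cl_def space_Lc)
            then have "\<Phi> \<xi> (vK (E i \<xi>) w) = (G \<xi> (vK (E i \<xi>) w) - G \<xi> (rd m (vK (E i \<xi>) w)))\<^sup>2"
              by (simp add: \<Phi>_def Gdiff)
            then show "\<bar>G \<xi> (vK (E i \<xi>) w) - G \<xi> (rd m (vK (E i \<xi>) w))\<bar> \<le> \<kappa> + \<Phi> \<xi> (vK (E i \<xi>) w) / \<kappa>"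
              using abs_le_square_div[OF kap] by simp
          qed
          also have "\<dots> = \<kappa> + (\<integral>w. \<Phi> \<xi> (vK (E i \<xi>) w) \<partial>Lc) / \<kappa>" using ai i by (simp add: Lc.prob_space)
          finally have X: "\<bar>X\<bar> \<le> \<kappa> + (\<integral>w. \<Phi> \<xi> (vK (E i \<xi>) w) \<partial>Lc) / \<kappa>" .
          have "\<bar>indicator A (Zs i \<xi>) * X / p\<bar> \<le> \<bar>X\<bar> / p" using p_pos by (auto simp: abs_divide indicator_def)
          also have "\<dots> \<le> (\<kappa> + (\<integral>w. \<Phi> \<xi> (vK (E i \<xi>) w) \<partial>Lc) / \<kappa>) / p" using X p_pos by (intro divide_right_mono) auto
          finally show ?thesis unfolding X_def .
        qed
        have T1eq: "(\<Sum>i<n. indicator A (Zs i \<xi>) * (\<integral>w. G \<xi> (rd m (vK (E i \<xi>) w)) \<partial>Lc) / p) / real n - T1 m (alpha n \<xi>)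
           = (\<Sum>v\<in>Gm m. a v \<xi> / sn * G \<xi> v)"
        proof -
          have "indicator A (Zs i \<xi>) * (\<integral>w. G \<xi> (rd m (vK (E i \<xi>) w)) \<partial>Lc) / p = (\<Sum>v\<in>Gm m. zeta m v (E i \<xi>) * G \<xi> v)" for i
            using round_sum[OF m, of "E i \<xi>" "G \<xi>"] by (simp add: E_def)
          then have eqA: "(\<Sum>i<n. indicator A (Zs i \<xi>) * (\<integral>w. G \<xi> (rd m (vK (E i \<xi>) w)) \<partial>Lc) / p) / real n
             = (\<Sum>v\<in>Gm m. (\<Sum>i<n. zeta m v (E i \<xi>)) * G \<xi> v) / real n"
            by (simp add: sum.swap[of _ _ "{..<n}"] sum_distrib_right)
          have eqB: "(\<Sum>v\<in>Gm m. (\<Sum>i<n. zeta m v (E i \<xi>)) * G \<xi> v) / real n - T1 m (alpha n \<xi>) = (\<Sum>v\<in>Gm m. ((\<Sum>i<n. zeta m v (E i \<xi>)) / real n - mu m v) * G \<xi> v)"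
            unfolding T1_def G_def[symmetric]
            by (subst sum_divide_distrib) (simp add: sum_subtractf[symmetric] left_diff_distrib)
          have eqC: "(\<Sum>v\<in>Gm m. ((\<Sum>i<n. zeta m v (E i \<xi>)) / real n - mu m v) * G \<xi> v) = (\<Sum>v\<in>Gm m. a v \<xi> / sn * G \<xi> v)"
          proof (intro sum.cong refl arg_cong2[where f = "(*)"])
            fix v
            have "a v \<xi> / sn = ((\<Sum>i<n. zeta m v (E i \<xi>)) - real n * mu m v) / real n"
              unfolding a_def sn_def by (simp add: sum_subtractf)
            then show "(\<Sum>i<n. zeta m v (E i \<xi>)) / real n - mu m v = a v \<xi> / sn" using n by (simp add: diff_divide_distrib)
          qed
          show ?thesis unfolding eqA eqB eqC ..
        qed
        have second: "\<bar>\<Sum>v\<in>Gm m. a v \<xi> / sn * G \<xi> v\<bar> \<le> Y2 \<xi>"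
          unfolding Y2_def
        proof (rule order_trans[OF sum_abs], rule sum_mono)
          fix v :: "real^'p" assume v: "v \<in> Gm m"
          define x where "x = \<bar>a v \<xi>\<bar>"
          define y where "y = \<bar>Cop (alpha n \<xi>) (onK K v)\<bar>"
          have "\<bar>a v \<xi> / sn * G \<xi> v\<bar> = x / sn * (\<bar>\<psi> v\<bar> * y)" using sn by (simp add: G_def x_def y_def abs_mult abs_divide)
          also have "\<dots> \<le> x / sn * (B * y)"
            using B Gmc[OF v] sn by (intro mult_left_mono mult_right_mono) (auto simp: x_def y_def)
          also have "\<dots> = B * (x * y) / sn" by simp
          also have "\<dots> \<le> B * (x\<^sup>2 + y\<^sup>2) / sn"
          proof (intro divide_right_mono mult_left_mono)
            have "0 \<le> (x - y)\<^sup>2" "0 \<le> x * y" by (simp_all add: x_def y_def)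
            then show "x * y \<le> x\<^sup>2 + y\<^sup>2" by (simp add: power2_eq_square algebra_simps)
          qed (use B sn in auto)
          finally show "\<bar>a v \<xi> / sn * G \<xi> v\<bar> \<le> B * ((a v \<xi>)\<^sup>2 + (Cop (alpha n \<xi>) (onK K v))\<^sup>2) / sn" by (simp add: x_def y_def)
        qed
        define R' where "R' = (\<Sum>i<n. indicator A (Zs i \<xi>) * (\<integral>w. G \<xi> (rd m (vK (E i \<xi>) w)) \<partial>Lc) / p) / real n"
        have "R1 n \<xi> - R' = (\<Sum>i<n. indicator A (Zs i \<xi>) * ((\<integral>w. G \<xi> (vK (E i \<xi>) w) \<partial>Lc) - (\<integral>w. G \<xi> (rd m (vK (E i \<xi>) w)) \<partial>Lc)) / p) / real n"
          unfolding R1_def R'_def G_def by (simp add: sum_subtractf right_diff_distrib diff_divide_distrib)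
        then have "\<bar>R1 n \<xi> - R'\<bar> = \<bar>\<Sum>i<n. indicator A (Zs i \<xi>) * ((\<integral>w. G \<xi> (vK (E i \<xi>) w) \<partial>Lc) - (\<integral>w. G \<xi> (rd m (vK (E i \<xi>) w)) \<partial>Lc)) / p\<bar> / real n"
          by (simp only: abs_divide abs_of_nat)
        also have "\<dots> \<le> Y1 \<xi>"
          unfolding Y1_def by (intro divide_right_mono order_trans[OF sum_abs] sum_mono first) auto
        finally have "\<bar>R1 n \<xi> - R'\<bar> \<le> Y1 \<xi>" .
        moreover have "\<bar>R' - T1 m (alpha n \<xi>)\<bar> \<le> Y2 \<xi>" unfolding R'_def T1eq by (rule second)
        ultimately have "\<bar>R1 n \<xi> - T1 m (alpha n \<xi>)\<bar> \<le> Y1 \<xi> + Y2 \<xi>" by (rule abs_diff_chain)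
        then show "dense n \<xi> \<longrightarrow> \<bar>R1 n \<xi> - T1 m (alpha n \<xi>)\<bar> \<le> Y1 \<xi> + Y2 \<xi>" ..
      qed
    qed
  qed
qed

end

section \<open>The Gaussian limit\<close>

text \<open>For functionals of finitely many values the empirical process obeys a one-dimensional
  central limit theorem and the Gaussian process has an explicit law, with the same
  variance.\<close>

definition finlin :: "((real^'p::finite \<Rightarrow> real) \<Rightarrow> real) \<Rightarrow> bool" where
  "finlin T \<longleftrightarrow> (\<exists>S c. finite S \<and> S \<subseteq> unitcube \<and> (\<forall>b. T b = (\<Sum>u\<in>S. c u * b u)))"

lemma finlin_eval: "u \<in> unitcube \<Longrightarrow> finlin (\<lambda>b. b u)"
  unfolding finlin_def by (intro exI[of _ "{u}"] exI[of _ "\<lambda>_. 1"]) auto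

lemma finlin_scale:
  assumes "finlin T" shows "finlin (\<lambda>b. r * T b)"
proof -
  obtain S c where "finite S" "S \<subseteq> unitcube" "\<And>b. T b = (\<Sum>u\<in>S. c u * b u)" using assms unfolding finlin_def by blast
  then show ?thesis unfolding finlin_def
    by (intro exI[of _ S] exI[of _ "\<lambda>u. r * c u"]) (auto simp: sum_distrib_left mult.assoc)
qed

lemma finlin_add:
  assumes "finlin T" "finlin T'" shows "finlin (\<lambda>b. T b + T' b)"
proof -
  obtain S c where S: "finite S" "S \<subseteq> unitcube" "\<And>b. T b = (\<Sum>u\<in>S. c u * b u)" using assms(1) unfolding finlin_def by blast
  obtain S' c' where S': "finite S'" "S' \<subseteq> unitcube" "\<And>b. T' b = (\<Sum>u\<in>S'. c' u * b u)" using assms(2) unfolding finlin_def by blast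
  define d where "d u = (if u \<in> S then c u else 0) + (if u \<in> S' then c' u else 0)" for u
  have "T b + T' b = (\<Sum>u\<in>S \<union> S'. d u * b u)" for b
  proof -
    have "(\<Sum>u\<in>S. c u * b u) = (\<Sum>u\<in>S \<union> S'. (if u \<in> S then c u else 0) * b u)"
      using S S' by (intro sum.mono_neutral_cong_left) auto
    moreover have "(\<Sum>u\<in>S'. c' u * b u) = (\<Sum>u\<in>S \<union> S'. (if u \<in> S' then c' u else 0) * b u)"
      using S S' by (intro sum.mono_neutral_cong_left) auto
    ultimately show ?thesis by (simp add: S(3) S'(3) d_def distrib_right sum.distrib)
  qed
  then show ?thesis unfolding finlin_def using S S' by (intro exI[of _ "S \<union> S'"] exI[of _ d]) auto
qed

lemma finlin_diff: "finlin T \<Longrightarrow> finlin T' \<Longrightarrow> finlin (\<lambda>b. T b - T' b)"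
  using finlin_add[OF _ finlin_scale[of T' "-1"], of T] by simp

lemma finlin_mult: "finlin T \<Longrightarrow> finlin (\<lambda>b. T b * r)"
  using finlin_scale[of T r] by (simp add: mult.commute)

lemma finlin_div: "finlin T \<Longrightarrow> finlin (\<lambda>b. T b / r)"
  using finlin_scale[of T "1 / r"] by simp

lemma finlin_sum: "finite I \<Longrightarrow> (\<And>i. i \<in> I \<Longrightarrow> finlin (T i)) \<Longrightarrow> finlin (\<lambda>b. \<Sum>i\<in>I. T i b)"
proof (induction I rule: finite_induct)
  case empty
  show ?case unfolding finlin_def by (intro exI[of _ "{}"]) auto
next
  case (insert i I)
  then show ?case using finlin_add[of "T i" "\<lambda>b. \<Sum>i\<in>I. T i b"] by simp
qed

lemma marg_cube: "0 \<le> t \<Longrightarrow> t \<le> 1 \<Longrightarrow> vupd (vec 1) k t \<in> unitcube"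
  by (auto simp: unitcube_iff)

lemma one_cube: "(vec 1 :: real^'p::finite) \<in> unitcube"
  by (simp add: unitcube_iff)

lemma marg_cube': "u \<in> unitcube \<Longrightarrow> vupd (vec 1) k (u $ k) \<in> unitcube"
  by (rule marg_cube) (auto simp: unitcube_iff)

lemma (in copula_fun) finlin_Cop:
  assumes "u \<in> unitcube" shows "finlin (\<lambda>b. Cop b u)"
  unfolding Cop_def bridge_def
  by (intro finlin_diff finlin_div finlin_scale finlin_sum finlin_eval marg_cube'[OF assms] one_cube assms) auto

lemma has_RS_cong:
  assumes "\<And>x. x \<in> unitcube \<Longrightarrow> G x = G' x"
  shows "has_RS J G f I \<longleftrightarrow> has_RS J G' f I"
proof -
  have "RSsum J gr tag G f = RSsum J gr tag G' f" if "is_grid J gr" "tagged J gr tag" for gr tag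
    unfolding RSsum_def
  proof (intro sum.cong refl)
    fix c assume c: "c \<in> grid_cells J gr"
    have "tag c \<in> unitcube" using that(2) c by (intro grid_cell_cube[OF that(1) c]) (auto simp: tagged_def)
    then show "G (tag c) * qvol J f (fst c) (snd c) = G' (tag c) * qvol J f (fst c) (snd c)" by (simp add: assms)
  qed
  then show ?thesis unfolding has_RS_alt by (metis (no_types, lifting))
qed

lemma RS_int_cong: "(\<And>x. x \<in> unitcube \<Longrightarrow> G x = G' x) \<Longrightarrow> RS_int J G f = RS_int J G' f"
proof -
  assume "\<And>x. x \<in> unitcube \<Longrightarrow> G x = G' x"
  then have "has_RS J G f = has_RS J G' f" by (intro ext has_RS_cong)
  then show ?thesis by (simp add: RS_int_def)
qed

text \<open>The integrand may fail to be integrable on a null set of paths; the set of parameters for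
  which it is integrable is a linear subspace, hence measurable.\<close>
lemma RS_int_measurable:
  fixes q :: "'p::finite \<Rightarrow> real^'p \<Rightarrow> real" and Gc :: "'b \<Rightarrow> real^'p \<Rightarrow> real"
  assumes cont: "\<And>\<eta>. \<eta> \<in> space N \<Longrightarrow> continuous_on unitcube (Gc \<eta>)"
    and Gm: "\<And>u. u \<in> unitcube \<Longrightarrow> (\<lambda>\<eta>. Gc \<eta> u) \<in> borel_measurable N"
    and bm[measurable]: "\<And>k. bk k \<in> borel_measurable N" and bv: "vitali_bv J f"
  shows "(\<lambda>\<eta>. RS_int J (\<lambda>x. Gc \<eta> x - (\<Sum>k\<in>UNIV. bk k \<eta> * q k x)) f) \<in> borel_measurable N"
proof -
  \<comment> \<open>The part of the integrand that may fail to be integrable is linear in finitely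
    many coefficients, gathered in the vector \<open>b\<close>.\<close>
  define Q where "Q b x = (\<Sum>k\<in>UNIV. b $ k * q k x)" for b :: "real^'p" and x
  define W where "W = {b. \<exists>I. has_RS J (Q b) f I}"
  define l where "l b = RS_int J (Q b) f" for b
  have hl: "has_RS J (Q b) f (l b)" if "b \<in> W" for b using that RS_int_eq unfolding W_def l_def by blast
  have Qlin: "Q (c *\<^sub>R b + c' *\<^sub>R b') = (\<lambda>x. c * Q b x + c' * Q b' x)" for c c' b b'
    unfolding Q_def by (rule ext) (simp add: sum_distrib_left sum.distrib algebra_simps)
  have lin: "c *\<^sub>R b + c' *\<^sub>R b' \<in> W" "l (c *\<^sub>R b + c' *\<^sub>R b') = c * l b + c' * l b'" if "b \<in> W" "b' \<in> W" for c c' b b'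
  proof -
    have h: "has_RS J (Q (c *\<^sub>R b + c' *\<^sub>R b')) f (c * l b + c' * l b')"
      unfolding Qlin by (rule has_RS_lin[OF hl[OF that(1)] hl[OF that(2)]])
    then show "c *\<^sub>R b + c' *\<^sub>R b' \<in> W" by (auto simp: W_def)
    show "l (c *\<^sub>R b + c' *\<^sub>R b') = c * l b + c' * l b'" unfolding l_def[of "c *\<^sub>R b + c' *\<^sub>R b'"] by (rule RS_int_eq[OF h])
  qed
  have zero: "0 \<in> W" "l 0 = 0"
  proof -
    have "has_RS J (Q 0) f 0" unfolding has_RS_alt RSsum_def Q_def by (auto intro: exI[of _ 1])
    then show "0 \<in> W" "l 0 = 0" by (auto simp: W_def l_def RS_int_eq)
  qed
  have sub: "subspace W"
    unfolding subspace_def using zero(1) lin(1)[of _ _ 1 1] lin(1)[of _ 0 _ 0] zero by auto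
  obtain Bs where Bs: "Bs \<subseteq> W" "independent Bs" "W \<subseteq> span Bs" using basis_exists by metis
  \<comment> \<open>The integral is linear on \<open>W\<close>; its linear extension to the whole
    finite-dimensional space is continuous, hence Borel.\<close>
  obtain gl where gl: "linear gl" "\<And>x. x \<in> Bs \<Longrightarrow> gl x = l x"
    using linear_independent_extend[OF Bs(2), of l] by blast
  have gW: "gl b = l b" if "b \<in> W" for b
  proof -
    have "b \<in> span Bs" using Bs(3) that by blast
    then have "b \<in> W \<and> gl b = l b"
    proof (rule span_induct)
      show "x \<in> W \<and> gl x = l x" if "x \<in> Bs" for x using that Bs(1) gl(2) by blast
      show "subspace {x. x \<in> W \<and> gl x = l x}"
        unfolding subspace_def mem_Collect_eq
      proof (intro conjI ballI allI)
        fix x y assume xy: "x \<in> {x. x \<in> W \<and> gl x = l x}" "y \<in> {x. x \<in> W \<and> gl x = l x}"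
        then show "x + y \<in> W" using lin(1)[of x y 1 1] by simp
        show "gl (x + y) = l (x + y)" using xy lin(2)[of x y 1 1] linear_add[OF gl(1), of x y] by simp
      next
        fix c x assume x: "x \<in> {x. x \<in> W \<and> gl x = l x}"
        then show "c *\<^sub>R x \<in> W" using lin(1)[of x x c 0] by simp
        show "gl (c *\<^sub>R x) = l (c *\<^sub>R x)" using x lin(2)[of x x c 0] linear_cmul[OF gl(1), of c x] by simp
      qed (use zero linear_0[OF gl(1)] in auto)
    qed
    then show ?thesis by simp
  qed
  define L where "L \<eta> = RS_int J (Gc \<eta>) f" for \<eta>
  have hL: "has_RS J (Gc \<eta>) f (L \<eta>)" if "\<eta> \<in> space N" for \<eta>
    using RS_exists[OF cont[OF that] bv] RS_int_eq unfolding L_def by blast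
  have Lm: "L \<in> borel_measurable N"
  proof (rule borel_measurable_LIMSEQ_real)
    show "(\<lambda>m. RSsum J (ugrid (Suc m)) fst (Gc \<eta>) f) \<longlonglongrightarrow> L \<eta>" if "\<eta> \<in> space N" for \<eta>
      using has_RS_limit[OF hL[OF that]] by (rule LIMSEQ_Suc)
    show "(\<lambda>\<eta>. RSsum J (ugrid (Suc m)) fst (Gc \<eta>) f) \<in> borel_measurable N" for m
      unfolding RSsum_def
    proof (intro borel_measurable_sum borel_measurable_times borel_measurable_const Gm)
      have g: "is_grid J (ugrid (Suc m))" by (rule is_grid_ugrid) simp
      fix c assume c: "c \<in> grid_cells J (ugrid (Suc m))"
      show "fst c \<in> unitcube" using tagged_fst[OF g] c by (intro grid_cell_cube[OF g c]) (auto simp: tagged_def)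
    qed
  qed
  define bv where "bv \<eta> = (\<chi> k. bk k \<eta>)" for \<eta>
  have bvm [measurable]: "bv \<in> borel_measurable N" unfolding bv_def by measurable
  have W_sets [measurable]: "W \<in> sets borel" using closed_subspace[OF sub] by (rule borel_closed)
  have glm [measurable]: "gl \<in> borel_measurable borel"
    using linear_continuous_on[OF linear_linear[THEN iffD2, OF gl(1)]] by (intro borel_measurable_continuous_onI)
  \<comment> \<open>Off \<open>W\<close> the integral does not exist, and \<open>RS_int\<close>
    returns one fixed unspecified value.\<close>
  have eq: "RS_int J (\<lambda>x. Gc \<eta> x - (\<Sum>k\<in>UNIV. bk k \<eta> * q k x)) f
      = (if bv \<eta> \<in> W then L \<eta> - gl (bv \<eta>) else (THE I. False))" if \<eta>: "\<eta> \<in> space N" for \<eta>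
  proof -
    have Qb: "(\<lambda>x. Gc \<eta> x - (\<Sum>k\<in>UNIV. bk k \<eta> * q k x)) = (\<lambda>x. 1 * Gc \<eta> x + (-1) * Q (bv \<eta>) x)"
      by (rule ext) (simp add: Q_def bv_def)
    show ?thesis
    proof (cases "bv \<eta> \<in> W")
      case True
      then show ?thesis unfolding Qb using RS_int_eq[OF has_RS_lin[OF hL[OF \<eta>] hl[OF True], of 1 "-1"]] gW[OF True] by simp
    next
      case False
      have "\<not> has_RS J (\<lambda>x. 1 * Gc \<eta> x + (-1) * Q (bv \<eta>) x) f I" for I
      proof
        assume h: "has_RS J (\<lambda>x. 1 * Gc \<eta> x + (-1) * Q (bv \<eta>) x) f I"
        have "has_RS J (Q (bv \<eta>)) f (1 * L \<eta> + (-1) * I)" using has_RS_lin[OF hL[OF \<eta>] h, of 1 "-1"] by simp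
        then show False using False by (auto simp: W_def)
      qed
      then have "has_RS J (\<lambda>x. 1 * Gc \<eta> x + (-1) * Q (bv \<eta>) x) f = (\<lambda>I. False)" by blast
      then show ?thesis unfolding Qb RS_int_def using False by simp
    qed
  qed
  have "(\<lambda>\<eta>. if bv \<eta> \<in> W then L \<eta> - gl (bv \<eta>) else (THE I. False)) \<in> borel_measurable N"
    using Lm by measurable
  then show ?thesis using eq by (subst measurable_cong) auto
qed

section \<open>A continuous version of the limit process and its boundary terms\<close>

context cop_data
begin

text \<open>The value of the bridge at \<open>u $ k = 0\<close>, interpolated linearly to 0 at
  \<open>u $ k = 1\<close>, is subtracted. The bracket then vanishes at both ends for every path,
  and its product with the bounded \<open>g\<close> is continuous. When the path vanishes at the
  marginal points 0 this is \<open>Cop\<close>.\<close>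

definition CopC :: "(real^'p \<Rightarrow> real) \<Rightarrow> real^'p \<Rightarrow> real" where
  "CopC b u = b u / p - (\<Sum>k\<in>UNIV. g k u / p\<^sup>2 * (bridge b k u - (1 - u $ k) * b (vupd (vec 1) k 0))) - D u / p\<^sup>2 * b (vec 1)"

text \<open>The coefficient left over when \<open>Cinf\<close> is expressed through
  \<open>CopC\<close>; it holds the possibly unspecified boundary values of
  \<open>pdD\<close>.\<close>

definition qk :: "'p \<Rightarrow> real^'p \<Rightarrow> real" where
  "qk k u = pdD M X Z A k u * (1 - u $ k) / p\<^sup>2"

lemma CopC_Cop: "(\<And>k. b (vupd (vec 1) k 0) = 0) \<Longrightarrow> CopC b u = Cop b u"
  by (simp add: CopC_def Cop_def)

text \<open>At an end of coordinate \<open>k\<close> the factor \<open>g\<close> may jump, but it is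
  bounded by \<open>p\<close> while \<beta> tends to 0.\<close>

lemma g_mult_cont:
  assumes \<beta>: "continuous_on unitcube \<beta>" and z: "\<And>u. u \<in> unitcube \<Longrightarrow> u $ k = 0 \<or> u $ k = 1 \<Longrightarrow> \<beta> u = 0"
  shows "continuous_on unitcube (\<lambda>u. g k u * \<beta> u)"
  unfolding continuous_on_eq_continuous_within
proof
  fix u :: "real^'p" assume u: "u \<in> unitcube"
  have uk: "0 \<le> u $ k" "u $ k \<le> 1" using u by (auto simp: unitcube_iff)
  have bw: "continuous (at u within unitcube) \<beta>" using \<beta> u by (simp add: continuous_on_eq_continuous_within)
  show "continuous (at u within unitcube) (\<lambda>u. g k u * \<beta> u)"
  proof (cases "0 < u $ k \<and> u $ k < 1")
    case True
    define Op where "Op = {v :: real^'p. 0 < v $ k} \<inter> {v. v $ k < 1}"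
    have Op: "open Op" unfolding Op_def by (intro open_Int open_Collect_less continuous_intros)
    have "at u within {v \<in> unitcube. 0 < v $ k \<and> v $ k < 1} = at u within unitcube"
      by (rule at_within_nhd[OF _ Op]) (use True in \<open>auto simp: Op_def\<close>)
    moreover have "continuous (at u within {v \<in> unitcube. 0 < v $ k \<and> v $ k < 1}) (g k)"
      using g_cont[of k] u True by (auto simp: continuous_on_eq_continuous_within)
    ultimately show ?thesis using bw by (simp add: continuous_mult)
  next
    case False
    then have k01: "u $ k = 0 \<or> u $ k = 1" using uk by auto
    have b0: "\<beta> u = 0" using z[OF u k01] .
    have "((\<lambda>v. p * \<bar>\<beta> v\<bar>) \<longlongrightarrow> 0) (at u within unitcube)"
      using bw b0 unfolding continuous_within by (auto intro!: tendsto_eq_intros)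
    moreover have "eventually (\<lambda>v. norm (g k v * \<beta> v) \<le> p * \<bar>\<beta> v\<bar>) (at u within unitcube)"
      unfolding eventually_at_filter using g_bound[of _ k]
      by (auto simp: abs_mult intro!: always_eventually mult_right_mono)
    ultimately have "((\<lambda>v. g k v * \<beta> v) \<longlongrightarrow> 0) (at u within unitcube)" by (rule Lim_null_comparison[rotated])
    then show ?thesis unfolding continuous_within using b0 by simp
  qed
qed

lemma CopC_cont:
  assumes b: "continuous_on unitcube b"
  shows "continuous_on unitcube (CopC b)"
proof -
  have mc: "continuous_on unitcube (\<lambda>u. vupd (vec 1) k (u $ k))" for k :: 'p
    unfolding vupd_def
  proof (rule continuous_on_vec_lambda)
    show "continuous_on unitcube (\<lambda>u. if j = k then u $ k else vec 1 $ j)" for j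
      by (cases "j = k") (auto intro!: continuous_intros)
  qed
  have bc: "continuous_on unitcube (\<lambda>u. b (vupd (vec 1) k (u $ k)))" for k
    by (rule continuous_on_compose2[OF b mc]) (auto intro: marg_cube')
  have "continuous_on unitcube (\<lambda>u. g k u * ((bridge b k u - (1 - u $ k) * b (vupd (vec 1) k 0)) / p\<^sup>2))" for k
    using p_pos unfolding bridge_def by (intro g_mult_cont continuous_intros bc) auto
  then have "continuous_on unitcube (\<lambda>u. g k u / p\<^sup>2 * (bridge b k u - (1 - u $ k) * b (vupd (vec 1) k 0)))" for k by simp
  moreover have "continuous_on unitcube (\<lambda>u. b u / p)" "continuous_on unitcube (\<lambda>u. D u / p\<^sup>2 * b (vec 1))"
    using b D_cont p_pos by (intro continuous_intros; simp)+
  ultimately show ?thesis unfolding CopC_def by (intro continuous_on_diff continuous_on_sum) auto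
qed

lemma mult_sub: "x * (y - z) = g' \<Longrightarrow> x * y = g' + x * (z::real)"
  by (simp add: right_diff_distrib)

text \<open>Against the bracket of \<open>CopC\<close>, \<open>pdD\<close> may be exchanged for
  \<open>g\<close>: the bracket vanishes wherever the two differ. The identity holds for every
  path.\<close>

lemma Cinf_eq:
  assumes u: "u \<in> unitcube"
  shows "Cinf M X Z A B u \<eta> = CopC (\<lambda>u. B u \<eta>) u - (\<Sum>k\<in>UNIV. B (vupd (vec 1) k 0) \<eta> * qk k u)"
proof -
  define b where "b u = B u \<eta>" for u
  have each: "pdD M X Z A k u / p\<^sup>2 * bridge b k u
     = g k u / p\<^sup>2 * (bridge b k u - (1 - u $ k) * b (vupd (vec 1) k 0)) + b (vupd (vec 1) k 0) * qk k u" for k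
  proof -
    have "pdD M X Z A k u * (bridge b k u - (1 - u $ k) * b (vupd (vec 1) k 0))
       = g k u * (bridge b k u - (1 - u $ k) * b (vupd (vec 1) k 0))"
    proof (cases "0 < u $ k \<and> u $ k < 1")
      case False
      have "u $ k = 0 \<or> u $ k = 1" using False u unitcube_iff by (metis less_eq_real_def)
      then have "bridge b k u - (1 - u $ k) * b (vupd (vec 1) k 0) = 0" by (auto simp: bridge_def)
      then show ?thesis by simp
    qed (simp add: g_def)
    from mult_sub[OF this] have "pdD M X Z A k u * bridge b k u
       = g k u * (bridge b k u - (1 - u $ k) * b (vupd (vec 1) k 0)) + b (vupd (vec 1) k 0) * (pdD M X Z A k u * (1 - u $ k))"
      by (simp only: mult.assoc mult.left_commute mult.commute)
    then have "pdD M X Z A k u * bridge b k u / p\<^sup>2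
       = g k u * (bridge b k u - (1 - u $ k) * b (vupd (vec 1) k 0)) / p\<^sup>2 + b (vupd (vec 1) k 0) * (pdD M X Z A k u * (1 - u $ k)) / p\<^sup>2"
      by (simp only: add_divide_distrib)
    then show ?thesis by (simp only: qk_def times_divide_eq_left times_divide_eq_right)
  qed
  have "Cinf M X Z A B u \<eta> = b u / p - (\<Sum>k\<in>UNIV. pdD M X Z A k u / p\<^sup>2 * bridge b k u) - D u / p\<^sup>2 * b (vec 1)"
    by (simp add: Cinf_def b_def bridge_def)
  also have "\<dots> = CopC b u - (\<Sum>k\<in>UNIV. b (vupd (vec 1) k 0) * qk k u)"
    unfolding each CopC_def by (simp add: sum.distrib)
  finally show ?thesis unfolding b_def[abs_def] .
qed

text \<open>The value returned by \<open>deriv\<close> at a point without derivative.\<close>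

definition J0 :: real where "J0 = (SOME D. False)"

text \<open>The difference quotients at 0 along \<open>1 / l\<close> tend to 0, spelt out with
  quantifiers over naturals so that it defines a measurable condition on \<open>u\<close>.\<close>

definition flat :: "'p \<Rightarrow> real^'p \<Rightarrow> bool" where
  "flat k u \<longleftrightarrow> (\<forall>j::nat. \<exists>i::nat. \<forall>l::nat. i \<le> l \<longrightarrow> real l * D (vupd u k (1 / real l)) \<le> 1 / real (Suc j))"

lemma D_mono: "(\<And>k. u $ k \<le> v $ k) \<Longrightarrow> D u \<le> D v"
  unfolding DA_def by (intro finite_measure_mono) (auto intro: order_trans)

lemma D_zero: "u $ k \<le> 0 \<Longrightarrow> D u = 0"
proof -
  assume "u $ k \<le> 0"
  then have "D u \<le> measure M {\<xi> \<in> space M. U \<xi> $ k \<le> 0 \<and> Z \<xi> \<in> A}"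
    unfolding DA_def by (intro finite_measure_mono) (auto intro: order_trans)
  then show ?thesis using prob_transform[of k 0] D_nonneg[of u] by simp
qed

text \<open>At \<open>u\<^sub>k = 0\<close> the two-sided partial derivative is either zero or the unspecified value of an
  undefined derivative; both alternatives depend measurably on \<open>u\<close>.\<close>
lemma pdD_zero:
  assumes uk: "u $ k = 0"
  shows "pdD M X Z A k u = (if flat k u then 0 else J0)"
proof -
  define f where "f t = D (vupd u k t)" for t
  have f0: "f t = 0" if "t \<le> 0" for t unfolding f_def by (rule D_zero[of _ k]) (use that in simp)
  have fn: "0 \<le> f t" for t unfolding f_def by (rule D_nonneg)
  have fm: "f s \<le> f t" if "s \<le> t" for s t unfolding f_def by (rule D_mono) (use that in simp)
  have inv0: "(\<lambda>l. inverse (real (Suc l))) \<longlonglongrightarrow> 0" by (rule LIMSEQ_inverse_real_of_nat)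
  have flat_imp: "(f has_real_derivative 0) (at 0)" if fl: "flat k u"
    unfolding has_field_derivative_iff
  proof (rule LIM_I)
    fix r :: real assume r: "0 < r"
    obtain j :: nat where j: "2 / r < real (Suc j)"
      using reals_Archimedean2[of "2 / r"] by (meson less_le_trans lessI less_imp_le of_nat_le_iff)
    obtain i where i: "\<And>l. i \<le> l \<Longrightarrow> real l * f (1 / real l) \<le> 1 / real (Suc j)"
      using fl unfolding flat_def f_def by blast
    define i' where "i' = Suc i"
    show "\<exists>s>0. \<forall>x. x \<noteq> 0 \<and> norm (x - 0) < s \<longrightarrow> norm ((f x - f 0) / (x - 0) - 0) < r"
    proof (intro exI[of _ "1 / real i'"] conjI allI impI)
      show "0 < 1 / real i'" by (simp add: i'_def)
      fix x :: real assume x: "x \<noteq> 0 \<and> norm (x - 0) < 1 / real i'"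
      show "norm ((f x - f 0) / (x - 0) - 0) < r"
      proof (cases "x < 0")
        case True then show ?thesis using f0[of x] f0[of 0] r by simp
      next
        case False
        then have x0: "0 < x" "x < 1 / real i'" using x by auto
        \<comment> \<open>By monotonicity \<open>x\<close> is compared with \<open>1 / l\<close>,
          the next such point above it. As \<open>1 / x < l + 1 \<le> 2 * l\<close>, this loses a
          factor 2, whence the choice of \<open>j\<close>.\<close>
        define l where "l = nat \<lfloor>1 / x\<rfloor>"
        have "real i' < 1 / x" using x0 by (simp add: i'_def field_simps)
        then have fl: "int i' \<le> \<lfloor>1 / x\<rfloor>" by linarith
        then have l: "i' \<le> l" "real l \<le> 1 / x" "1 / x < real l + 1"
          unfolding l_def using x0(1) by linarith+
        have l0: "0 < l" using l(1) by (simp add: i'_def)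
        have "x \<le> 1 / real l" using l(2) x0(1) l0 by (simp add: field_simps)
        then have "f x \<le> f (1 / real l)" by (rule fm)
        also have "\<dots> \<le> 1 / real (Suc j) / real l"
        proof -
          have "f (1 / real l) * real l \<le> 1 / real (Suc j)" using i[of l] l(1) unfolding i'_def by (simp only: mult.commute Suc_leD)
          then show ?thesis using l0 by (simp only: pos_le_divide_eq of_nat_0_less_iff)
        qed
        finally have "f x / x \<le> 1 / real (Suc j) / real l * (1 / x)" using x0(1) divide_right_mono[of "f x" "1 / real (Suc j) / real l" x] by simp
        also have "\<dots> \<le> 1 / real (Suc j) / real l * (real l + 1)"
          using l(3) l0 by (intro mult_left_mono) auto
        also have "\<dots> \<le> 1 / real (Suc j) / real l * (2 * real l)"
          using l0 by (intro mult_left_mono) auto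
        also have "\<dots> = 2 / real (Suc j)" using l0 by simp
        also have "\<dots> < r" using j r by (simp add: field_simps)
        finally show ?thesis using x0(1) fn[of x] f0[of 0] by (simp add: abs_divide)
      qed
    qed
  qed
  have diff_imp: "d = 0 \<and> flat k u" if d: "(f has_real_derivative d) (at 0)" for d
  proof -
    have lim: "((\<lambda>h. f h / h) \<longlongrightarrow> d) (at 0)" using d f0[of 0] by (simp add: has_field_derivative_iff)
    \<comment> \<open>\<open>f\<close> vanishes on the negative side, so a two-sided derivative can
      only be 0.\<close>
    have neg: "(\<lambda>l. f (- inverse (real (Suc l))) / (- inverse (real (Suc l)))) \<longlonglongrightarrow> d"
      by (rule filterlim_compose[where g = "\<lambda>h. f h / h", OF lim])
        (use tendsto_minus[OF inv0] in \<open>auto simp: filterlim_at simp del: of_nat_Suc\<close>)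
    have "(\<lambda>l. f (- inverse (real (Suc l))) / (- inverse (real (Suc l)))) = (\<lambda>l. 0)"
      using f0 by (intro ext) simp
    then have d0: "d = 0" using neg LIMSEQ_unique tendsto_const by metis
    have pos: "(\<lambda>l. f (inverse (real (Suc l))) / inverse (real (Suc l))) \<longlonglongrightarrow> 0"
      using lim unfolding d0
      by (rule filterlim_compose[where g = "\<lambda>h. f h / h"]) (use inv0 in \<open>auto simp: filterlim_at simp del: of_nat_Suc\<close>)
    have "flat k u"
      unfolding flat_def
    proof
      fix j :: nat
      obtain i where i: "\<And>l. i \<le> l \<Longrightarrow> norm (f (inverse (real (Suc l))) / inverse (real (Suc l)) - 0) < 1 / real (Suc j)"
        using LIMSEQ_D[OF pos, of "1 / real (Suc j)"] by auto
      show "\<exists>i. \<forall>l\<ge>i. real l * D (vupd u k (1 / real l)) \<le> 1 / real (Suc j)"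
      proof (intro exI[of _ "Suc i"] allI impI)
        fix l assume "Suc i \<le> l"
        then obtain l' where l': "l = Suc l'" "i \<le> l'" by (cases l) auto
        then show "real l * D (vupd u k (1 / real l)) \<le> 1 / real (Suc j)"
          using i[OF l'(2)] fn by (simp add: f_def inverse_eq_divide mult.commute abs_mult)
      qed
    qed
    then show ?thesis using d0 by simp
  qed
  have pd: "pdD M X Z A k u = (SOME d. (f has_real_derivative d) (at 0))"
    unfolding pdD_def deriv_def uk f_def ..
  show ?thesis
  proof (cases "flat k u")
    case True
    have "(f has_real_derivative (SOME d. (f has_real_derivative d) (at 0))) (at 0)" by (rule someI[where x = 0]) (rule flat_imp[OF True])
    then show ?thesis using True diff_imp pd by simp
  next
    case False
    then have "(\<lambda>d. (f has_real_derivative d) (at 0)) = (\<lambda>d. False)" using diff_imp by blast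
    then show ?thesis using False unfolding pd J0_def by simp
  qed
qed

lemma qk_eq:
  assumes "u \<in> unitcube"
  shows "qk k u = (g k u + (if u $ k = 0 then (if flat k u then 0 else J0) else 0)) * (1 - u $ k) / p\<^sup>2"
proof -
  consider "u $ k = 0" | "u $ k = 1" | "0 < u $ k" "u $ k < 1"
    using assms by (metis unitcube_iff less_eq_real_def)
  then show ?thesis by cases (auto simp: qk_def pdD_zero g_def)
qed

lemma qk_meas:
  assumes [measurable]: "v \<in> borel_measurable Q" and vc: "\<And>x. x \<in> space Q \<Longrightarrow> v x \<in> unitcube"
  shows "(\<lambda>x. qk k (v x)) \<in> borel_measurable Q"
proof -
  have [measurable]: "(\<lambda>x. g k (v x)) \<in> borel_measurable Q"
  proof -
    have "(\<lambda>x. indicator unitcube (v x) * g k (v x)) \<in> borel_measurable Q"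
      using measurable_compose[OF assms(1) g_meas] .
    then show ?thesis by (subst measurable_cong[of Q _ "\<lambda>x. indicator unitcube (v x) * g k (v x)"]) (use vc in auto)
  qed
  have "(\<lambda>x. (g k (v x) + (if v x $ k = 0 then (if flat k (v x) then 0 else J0) else 0)) * (1 - v x $ k) / p\<^sup>2) \<in> borel_measurable Q"
    unfolding flat_def by measurable
  then show ?thesis using qk_eq vc by (subst measurable_cong) auto
qed

lemma qk_bound:
  assumes "u \<in> unitcube" shows "\<bar>qk k u\<bar> \<le> (p + \<bar>J0\<bar>) / p\<^sup>2"
proof -
  have uk: "0 \<le> u $ k" "u $ k \<le> 1" using assms by (auto simp: unitcube_iff)
  have "\<bar>g k u + (if u $ k = 0 then (if flat k u then 0 else J0) else 0)\<bar> \<le> p + \<bar>J0\<bar>"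
    using g_bound[OF assms, of k] by (auto intro: order_trans[OF abs_triangle_ineq])
  then have "\<bar>(g k u + (if u $ k = 0 then (if flat k u then 0 else J0) else 0)) * (1 - u $ k)\<bar> \<le> (p + \<bar>J0\<bar>) * 1"
    unfolding abs_mult using uk p_pos by (intro mult_mono) auto
  then show ?thesis unfolding qk_eq[OF assms] abs_divide by (simp add: divide_right_mono)
qed

text \<open>A single observation already has the covariance of the Gaussian process, so every finite
  linear functional has the same variance under \<open>alpha n\<close> and under
  \<open>B\<close>.\<close>

lemma hc_cov: "(\<integral>e. hc e u * hc e v \<partial>Pd) = covB M X Z A u v"
proof -
  have HH: "H e u * H e v = H e (vmeet u v)" for e
    by (auto simp: H_def vmeet_def)
  have "(\<integral>e. hc e u * hc e v \<partial>Pd) = (\<integral>e. H e (vmeet u v) - D v * H e u - D u * H e v + D u * D v \<partial>Pd)"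
    by (intro Bochner_Integration.integral_cong refl) (simp add: hc_def HH[symmetric] algebra_simps)
  also have "\<dots> = D (vmeet u v) - D u * D v" using H_integrable by (simp add: integral_H Pd.prob_space)
  also have "\<dots> = covB M X Z A u v" using p_pos by (simp add: covB_def condCop_def power2_eq_square)
  finally show ?thesis .
qed

lemma finlin_hc:
  assumes "finlin T"
  shows "integrable Pd (\<lambda>e. T (hc e))" "(\<integral>e. T (hc e) \<partial>Pd) = 0" "\<exists>b. \<forall>e. \<bar>T (hc e)\<bar> \<le> b"
    "h \<in> borel_measurable Q \<Longrightarrow> (\<lambda>x. T (hc (h x))) \<in> borel_measurable Q"
    "T (alpha n \<xi>) = (\<Sum>j<n. T (hc (E j \<xi>))) / sqrt (real n)"
proof -
  obtain S c where S: "finite S" "S \<subseteq> unitcube" "\<And>b. T b = (\<Sum>u\<in>S. c u * b u)" using assms unfolding finlin_def by blast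
  show "integrable Pd (\<lambda>e. T (hc e))" unfolding S(3) using hc_integrable by auto
  show "(\<integral>e. T (hc e) \<partial>Pd) = 0" unfolding S(3) using hc_integrable by (simp add: hc_mean)
  have "\<bar>T (hc e)\<bar> \<le> (\<Sum>u\<in>S. \<bar>c u\<bar>)" for e
    unfolding S(3) by (rule order_trans[OF sum_abs], rule sum_mono) (use hc_bound in \<open>simp add: abs_mult mult_left_le\<close>)
  then show "\<exists>b. \<forall>e. \<bar>T (hc e)\<bar> \<le> b" by blast
  show "h \<in> borel_measurable Q \<Longrightarrow> (\<lambda>x. T (hc (h x))) \<in> borel_measurable Q" unfolding S(3) by measurable
  show "T (alpha n \<xi>) = (\<Sum>j<n. T (hc (E j \<xi>))) / sqrt (real n)"
    unfolding S(3) alpha_def by (subst sum.swap) (simp add: sum_divide_distrib[symmetric] sum_distrib_left[symmetric])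
qed

end

lemma continuous_onK: "continuous_on S (\<lambda>u. onK J u)"
  unfolding vmix_def
proof (rule continuous_on_vec_lambda)
  show "continuous_on S (\<lambda>u. if j \<in> J then u $ j else vec 1 $ j)" for j
    by (cases "j \<in> J") (auto intro!: continuous_intros)
qed

lemma onK_in_cube: "u \<in> unitcube \<Longrightarrow> onK J u \<in> unitcube"
  by (auto simp: unitcube_iff)

section \<open>The central limit theorem for finite linear functionals\<close>

context cop_data
begin

abbreviation vT :: "((real^'p \<Rightarrow> real) \<Rightarrow> real) \<Rightarrow> real" where
  "vT T \<equiv> (\<integral>e. (T (hc e))\<^sup>2 \<partial>Pd)"

lemma finlin_alpha_meas: "finlin T \<Longrightarrow> (\<lambda>\<xi>. T (alpha n \<xi>)) \<in> borel_measurable M"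
  unfolding finlin_hc(5) using finlin_hc(4)[OF _ E_measurable] by simp

lemma finlin_second_moment:
  assumes T: "finlin T" and n: "0 < n"
  shows "integrable M (\<lambda>\<xi>. (T (alpha n \<xi>))\<^sup>2)" "(\<integral>\<xi>. (T (alpha n \<xi>))\<^sup>2 \<partial>M) = vT T"
proof -
  define f where "f e = T (hc e)" for e
  obtain b where b: "\<And>e. \<bar>f e\<bar> \<le> b" using finlin_hc(3)[OF T] unfolding f_def by blast
  have b0: "0 \<le> b" using b[of undefined] by linarith
  have fm[measurable]: "f \<in> borel_measurable borel" unfolding f_def by (rule finlin_hc(4)[OF T]) simp
  have ffb: "\<bar>f x * f y\<bar> \<le> b * b" for x y unfolding abs_mult by (intro mult_mono b b0) simp
  have i: "integrable M (\<lambda>\<xi>. f (E i \<xi>) * f (E j \<xi>))" for i j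
    by (rule integrable_const_bound[where B = "b * b"]) (auto simp: ffb)
  have e: "(\<integral>\<xi>. f (E i \<xi>) * f (E j \<xi>) \<partial>M) = (if i = j then vT T else 0)" for i j
  proof (cases "i = j")
    case True
    have "(\<integral>\<xi>. f (E j \<xi>) * f (E j \<xi>) \<partial>M) = (\<integral>e. f e * f e \<partial>Pd)" by (rule integral_one) simp
    then show ?thesis using True by (simp add: f_def power2_eq_square)
  next
    case False
    have "(\<integral>\<xi>. f (fst (E i \<xi>, E j \<xi>)) * f (snd (E i \<xi>, E j \<xi>)) \<partial>M)
        = (\<integral>\<xi>. (\<integral>x. f (fst (x, E j \<xi>)) * f (snd (x, E j \<xi>)) \<partial>Pd) \<partial>M)"
      by (rule integral_pair[where G = "\<lambda>z. f (fst z) * f (snd z)" and b = "b * b"]) (use False ffb in auto)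
    then show ?thesis using False finlin_hc(2)[OF T] by (simp add: f_def)
  qed
  have sq: "(T (alpha n \<xi>))\<^sup>2 = (\<Sum>i<n. \<Sum>j<n. f (E i \<xi>) * f (E j \<xi>)) / real n" for \<xi>
    unfolding finlin_hc(5)[OF T] by (simp add: power_divide power2_eq_square sum_product f_def)
  show "integrable M (\<lambda>\<xi>. (T (alpha n \<xi>))\<^sup>2)" unfolding sq using i by auto
  have "(\<integral>\<xi>. (T (alpha n \<xi>))\<^sup>2 \<partial>M) = (\<Sum>i<n. \<Sum>j<n. (\<integral>\<xi>. f (E i \<xi>) * f (E j \<xi>) \<partial>M)) / real n"
    unfolding sq using i by simp
  then show "(\<integral>\<xi>. (T (alpha n \<xi>))\<^sup>2 \<partial>M) = vT T" unfolding e using n by simp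
qed

lemma finlin_clt:
  assumes T: "finlin T"
  shows "(\<lambda>n. char (distr M borel (\<lambda>\<xi>. T (alpha n \<xi>))) t) \<longlonglongrightarrow> complex_of_real (exp (- (vT T * t\<^sup>2) / 2))"
\<comment> \<open>The central limit theorem divides by the standard deviation; with variance 0 the
  functional vanishes almost surely for every positive \<open>n\<close>.\<close>
proof (cases "vT T = 0")
  case True
  have "char (distr M borel (\<lambda>\<xi>. T (alpha n \<xi>))) t = 1" if n: "0 < n" for n
  proof -
    have "AE \<xi> in M. (T (alpha n \<xi>))\<^sup>2 = 0"
      using finlin_second_moment[OF T n] True by (subst integral_nonneg_eq_0_iff_AE[symmetric]) auto
    then have "(\<integral>\<xi>. iexp (t * T (alpha n \<xi>)) \<partial>M) = (\<integral>\<xi>. 1 \<partial>M)"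
      using finlin_alpha_meas[OF T, of n] by (intro integral_cong_AE) auto
    then show ?thesis unfolding char_def using finlin_alpha_meas[OF T, of n] by (subst integral_distr) (auto simp: prob_space)
  qed
  then have "\<forall>\<^sub>F n in sequentially. char (distr M borel (\<lambda>\<xi>. T (alpha n \<xi>))) t = 1"
    unfolding eventually_sequentially by (intro exI[of _ 1]) auto
  then show ?thesis using True by (intro tendsto_eventually) simp
next
  case False
  define \<sigma> where "\<sigma> = sqrt (vT T)"
  have v0: "0 \<le> vT T" by simp
  then have s: "0 < \<sigma>" "\<sigma>\<^sup>2 = vT T" unfolding \<sigma>_def using False by (auto simp: less_le)
  define f where "f e = T (hc e)" for e
  obtain b where b: "\<And>e. \<bar>f e\<bar> \<le> b" using finlin_hc(3)[OF T] unfolding f_def by blast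
  have fm[measurable]: "f \<in> borel_measurable borel" unfolding f_def by (rule finlin_hc(4)[OF T]) simp
  have mean: "(\<integral>\<xi>. f (E i \<xi>) \<partial>M) = 0" for i using finlin_hc(2)[OF T] integral_one[OF fm, of i] by (simp add: f_def)
  have clt: "weak_conv_m (\<lambda>n. distr M borel (\<lambda>\<xi>. (\<Sum>i<n. f (E i \<xi>)) / sqrt (real n * \<sigma>\<^sup>2))) std_normal_distribution"
  proof (rule central_limit_theorem_zero_mean[where \<mu> = "distr Pd borel f"])
    show "indep_vars (\<lambda>i. borel) (\<lambda>i \<xi>. f (E i \<xi>)) UNIV" using indep_vars_compose2[OF indep, of "\<lambda>_. f" "\<lambda>_. borel"] by simp
    show "integrable M (\<lambda>x. (f (E n x))\<^sup>2)" for n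
      by (rule integrable_const_bound[where B = "b\<^sup>2"]) (auto simp: abs_le_square_iff[symmetric] intro!: AE_I2 order_trans[OF b])
    show "variance (\<lambda>\<xi>. f (E n \<xi>)) = \<sigma>\<^sup>2" for n
    proof -
      have "(\<integral>\<xi>. (f (E n \<xi>))\<^sup>2 \<partial>M) = (\<integral>e. (f e)\<^sup>2 \<partial>Pd)" by (rule integral_one) simp
      then show ?thesis unfolding mean by (simp add: s f_def)
    qed
    show "distr M borel (\<lambda>\<xi>. f (E n \<xi>)) = distr Pd borel f" for n
      unfolding law[of n, symmetric] by (subst distr_distr) (auto simp: comp_def)
  qed (use mean s in auto)
  have eq: "char (distr M borel (\<lambda>\<xi>. T (alpha n \<xi>))) t
     = char (distr M borel (\<lambda>\<xi>. (\<Sum>i<n. f (E i \<xi>)) / sqrt (real n * \<sigma>\<^sup>2))) (t * \<sigma>)" for n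
  proof -
    have "t * \<sigma> * ((\<Sum>i<n. f (E i \<xi>)) / sqrt (real n * \<sigma>\<^sup>2)) = t * T (alpha n \<xi>)" for \<xi>
      unfolding finlin_hc(5)[OF T] f_def[symmetric] using s(1) by (simp add: real_sqrt_mult)
    then show ?thesis unfolding char_def using finlin_alpha_meas[OF T, of n]
      by (subst (1 2) integral_distr) (simp_all only:, measurable)
  qed
  have "(\<lambda>n. char (distr M borel (\<lambda>\<xi>. (\<Sum>i<n. f (E i \<xi>)) / sqrt (real n * \<sigma>\<^sup>2))) (t * \<sigma>)) \<longlonglongrightarrow> char std_normal_distribution (t * \<sigma>)"
    by (rule levy_continuity1[OF _ real_dist_normal_dist clt]) (auto intro!: real_distribution_distr)
  moreover have "char std_normal_distribution (t * \<sigma>) = complex_of_real (exp (- (vT T * t\<^sup>2) / 2))"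
    unfolding char_std_normal_distribution power_mult_distrib s(2) by (simp add: mult.commute)
  ultimately show ?thesis unfolding eq by simp
qed

end

context cop_stat
begin

text \<open>The inner integral belonging to one observation. Its mean \<open>Pint Q\<close> is the
  integral of \<open>Q\<close> against the conditional copula in the coordinates of
  \<open>K'\<close> and Lebesgue measure in the others.\<close>

definition Iq :: "(real^'p \<Rightarrow> real) \<Rightarrow> (real^'p) \<times> (real^'q) \<Rightarrow> real" where
  "Iq Q e = indicator A (snd e) * (\<integral>w. Q (vK e w) \<partial>Lc) / p"

definition Pint :: "(real^'p \<Rightarrow> real) \<Rightarrow> real" where
  "Pint Q = (\<integral>e. Iq Q e \<partial>Pd)"

text \<open>A class closed under linear combinations that contains the continuous integrands and the
  possibly discontinuous ones built from \<open>qk\<close>.\<close>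

definition okQ :: "(real^'p \<Rightarrow> real) \<Rightarrow> bool" where
  "okQ Q \<longleftrightarrow> (\<lambda>z. Q (vK (fst z) (snd z))) \<in> borel_measurable (borel \<Otimes>\<^sub>M Lc) \<and> (\<exists>C. \<forall>u\<in>unitcube. \<bar>Q u\<bar> \<le> C)"

lemma okQ_I:
  assumes "\<And>v :: ((real^'p) \<times> (real^'q)) \<times> (real^'p) \<Rightarrow> real^'p. v \<in> borel_measurable (borel \<Otimes>\<^sub>M Lc) \<Longrightarrow>
     (\<And>z. z \<in> space (borel \<Otimes>\<^sub>M Lc) \<Longrightarrow> v z \<in> unitcube) \<Longrightarrow> (\<lambda>z. Q (v z)) \<in> borel_measurable (borel \<Otimes>\<^sub>M Lc)" "\<And>u. u \<in> unitcube \<Longrightarrow> \<bar>Q u\<bar> \<le> C"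
  shows "okQ Q"
  unfolding okQ_def
proof (intro conjI exI[of _ C] ballI assms(2) assms(1)[of "\<lambda>z. vK (fst z) (snd z)"])
  show "(\<lambda>z. vK (fst z) (snd z)) \<in> borel_measurable (borel \<Otimes>\<^sub>M Lc)" by measurable
  show "vK (fst z) (snd z) \<in> unitcube" if "z \<in> space (borel \<Otimes>\<^sub>M Lc)" for z
    using that by (intro vK_cube) (auto simp: space_pair_measure space_Lc)
qed

lemma okQ_cont:
  assumes "continuous_on unitcube Q" shows "okQ Q"
proof -
  have "compact (Q ` unitcube)" by (rule compact_continuous_image[OF assms]) simp
  then obtain C where "\<And>x. x \<in> Q ` unitcube \<Longrightarrow> norm x \<le> C" using compact_imp_bounded bounded_iff by metis
  then show ?thesis by (intro okQ_I[of Q C] cont_comp_meas[OF assms]) (assumption | simp)+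
qed

lemma okQ_lin: "okQ Q \<Longrightarrow> okQ Q' \<Longrightarrow> okQ (\<lambda>v. Q v + c * Q' v)"
proof -
  assume a: "okQ Q" "okQ Q'"
  obtain C C' where C: "\<And>u. u \<in> unitcube \<Longrightarrow> \<bar>Q u\<bar> \<le> C" "\<And>u. u \<in> unitcube \<Longrightarrow> \<bar>Q' u\<bar> \<le> C'" using a unfolding okQ_def by blast
  have "\<bar>Q u + c * Q' u\<bar> \<le> C + \<bar>c\<bar> * C'" if "u \<in> unitcube" for u
    using C[OF that] mult_left_mono[OF C(2)[OF that], of "\<bar>c\<bar>"] abs_triangle_ineq[of "Q u" "c * Q' u"] by (simp add: abs_mult)
  then show ?thesis using a unfolding okQ_def by (intro conjI exI[of _ "C + \<bar>c\<bar> * C'"]) auto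
qed

lemma okQ_integrable:
  assumes "okQ Q"
  shows "integrable Lc (\<lambda>w. Q (vK e w))" "Iq Q \<in> borel_measurable borel" "integrable Pd (Iq Q)"
    "(\<And>u. u \<in> unitcube \<Longrightarrow> \<bar>Q u\<bar> \<le> C) \<Longrightarrow> \<bar>Iq Q e\<bar> \<le> C / p"
proof -
  have m[measurable]: "(\<lambda>z. Q (vK (fst z) (snd z))) \<in> borel_measurable (borel \<Otimes>\<^sub>M Lc)" using assms by (simp add: okQ_def)
  obtain C0 where C0: "\<And>u. u \<in> unitcube \<Longrightarrow> \<bar>Q u\<bar> \<le> C0" using assms unfolding okQ_def by blast
  have i: "integrable Lc (\<lambda>w. Q (vK e w))" for e
  proof (rule Lc.integrable_const_bound[where B = C0])
    show "AE w in Lc. norm (Q (vK e w)) \<le> C0" using C0 vK_cube by (intro AE_I2) (auto simp: space_Lc)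
    show "(\<lambda>w. Q (vK e w)) \<in> borel_measurable Lc" using measurable_compose[OF measurable_Pair1'[of e borel Lc] m] by simp
  qed
  then show "integrable Lc (\<lambda>w. Q (vK e w))" .
  have "(\<lambda>e. \<integral>w. Q (vK e w) \<partial>Lc) \<in> borel_measurable borel"
    using Lc.borel_measurable_lebesgue_integral[of "\<lambda>e w. Q (vK e w)" borel] m by (simp add: split_beta')
  then show m': "Iq Q \<in> borel_measurable borel" unfolding Iq_def by measurable
  have bd: "\<bar>Iq Q e\<bar> \<le> C / p" if C: "\<And>u. u \<in> unitcube \<Longrightarrow> \<bar>Q u\<bar> \<le> C" for C e
  proof -
    have C': "0 \<le> C" using C[OF one_cube] by linarith
    have "\<bar>\<integral>w. Q (vK e w) \<partial>Lc\<bar> \<le> (\<integral>w. C \<partial>(Lc :: (real^'p) measure))"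
      by (rule order_trans[OF integral_abs_bound], rule integral_mono)
        (auto intro!: integrable_abs i C vK_cube simp: space_Lc)
    then have "\<bar>\<integral>w. Q (vK e w) \<partial>Lc\<bar> \<le> C" by (simp add: Lc.prob_space)
    then show ?thesis using p_pos C' unfolding Iq_def by (cases "snd e \<in> A") (auto simp: abs_divide divide_right_mono)
  qed
  then show "(\<And>u. u \<in> unitcube \<Longrightarrow> \<bar>Q u\<bar> \<le> C) \<Longrightarrow> \<bar>Iq Q e\<bar> \<le> C / p" .
  show "integrable Pd (Iq Q)"
    by (rule Pd.integrable_const_bound[where B = "C0 / p"]) (use bd[OF C0] m' in auto)
qed

lemma Pint_lin:
  assumes "okQ Q" "okQ Q'"
  shows "Pint (\<lambda>v. Q v + c * Q' v) = Pint Q + c * Pint Q'"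
proof -
  have "Iq (\<lambda>v. Q v + c * Q' v) e = Iq Q e + c * Iq Q' e" for e
    unfolding Iq_def using okQ_integrable(1)[OF assms(1)] okQ_integrable(1)[OF assms(2)] by (simp add: distrib_left add_divide_distrib)
  then have "Iq (\<lambda>v. Q v + c * Q' v) = (\<lambda>e. Iq Q e + c * Iq Q' e)" by (intro ext)
  then show ?thesis unfolding Pint_def using okQ_integrable(3)[OF assms(1)] okQ_integrable(3)[OF assms(2)] by simp
qed

lemma Pint_sum:
  assumes "okQ Q" "finite I" "\<And>i. i \<in> I \<Longrightarrow> okQ (R i)"
  shows "okQ (\<lambda>v. Q v - (\<Sum>i\<in>I. c i * R i v)) \<and> Pint (\<lambda>v. Q v - (\<Sum>i\<in>I. c i * R i v)) = Pint Q - (\<Sum>i\<in>I. c i * Pint (R i))"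
  using assms(2,3)
proof (induction I rule: finite_induct)
  case (insert i I)
  then have IH: "okQ (\<lambda>v. Q v - (\<Sum>i\<in>I. c i * R i v))" "Pint (\<lambda>v. Q v - (\<Sum>i\<in>I. c i * R i v)) = Pint Q - (\<Sum>i\<in>I. c i * Pint (R i))" by auto
  have "(\<lambda>v. Q v - (\<Sum>i\<in>insert i I. c i * R i v)) = (\<lambda>v. (Q v - (\<Sum>i\<in>I. c i * R i v)) + (- c i) * R i v)"
    using insert.hyps by (intro ext) simp
  then show ?case using okQ_lin[OF IH(1), of "R i" "- c i"] Pint_lin[OF IH(1), of "R i" "- c i"] insert IH(2) by simp
qed (use assms(1) in simp)

lemma round_limit:
  assumes Q: "continuous_on unitcube Q"
  shows "(\<lambda>m. \<Sum>v\<in>Gm (Suc m). mu (Suc m) v * Q v) \<longlonglongrightarrow> Pint Q"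
proof (rule LIMSEQ_I)
  fix r :: real assume r: "0 < r"
  obtain n0 where n0: "\<And>m u. n0 \<le> m \<Longrightarrow> u \<in> unitcube \<Longrightarrow> \<bar>Q (rd (Suc m) u) - Q u\<bar> \<le> r * p / 2"
    using rd_close[OF Q, of "r * p / 2"] r p_pos by auto
  show "\<exists>n0. \<forall>m\<ge>n0. norm ((\<Sum>v\<in>Gm (Suc m). mu (Suc m) v * Q v) - Pint Q) < r"
  proof (intro exI[of _ n0] allI impI)
    fix m assume m: "n0 \<le> m"
    define R where "R u = Q (rd (Suc m) u)" for u
    have c: "rd (Suc m) u \<in> unitcube" if "u \<in> unitcube" for u by (rule rd_props(3)[OF _ that]) simp
    obtain C where C: "\<And>u. u \<in> unitcube \<Longrightarrow> \<bar>Q u\<bar> \<le> C" using okQ_cont[OF Q] unfolding okQ_def by blast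
    have okR: "okQ R"
      unfolding R_def by (intro okQ_I[where C = C] cont_comp_meas[OF Q] rd_meas c C)
    have RQ: "\<bar>R u + (-1) * Q u\<bar> \<le> r * p / 2" if u: "u \<in> unitcube" for u
      using n0[OF m u] unfolding R_def by simp
    have "(\<Sum>v\<in>Gm (Suc m). mu (Suc m) v * Q v) = (\<integral>e. (\<Sum>v\<in>Gm (Suc m). zeta (Suc m) v e * Q v) \<partial>Pd)"
      unfolding mu_def using zeta_integrable by simp
    also have "\<dots> = Pint R" unfolding Pint_def Iq_def R_def by (subst round_sum[symmetric]) auto
    finally have eq: "(\<Sum>v\<in>Gm (Suc m). mu (Suc m) v * Q v) - Pint Q = Pint (\<lambda>u. R u + (-1) * Q u)"
      using Pint_lin[OF okR okQ_cont[OF Q], of "-1"] by simp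
    have ok: "okQ (\<lambda>u. R u + (-1) * Q u)" by (rule okQ_lin[OF okR okQ_cont[OF Q]])
    have "\<bar>Pint (\<lambda>u. R u + (-1) * Q u)\<bar> \<le> (\<integral>e. r * p / 2 / p \<partial>Pd)"
      unfolding Pint_def
    proof (rule order_trans[OF integral_abs_bound], rule integral_mono)
      show "\<bar>Iq (\<lambda>u. R u + (-1) * Q u) e\<bar> \<le> r * p / 2 / p" for e by (rule okQ_integrable(4)[OF ok RQ])
    qed (intro integrable_abs okQ_integrable(3)[OF ok], simp)
    then have "\<bar>Pint (\<lambda>u. R u + (-1) * Q u)\<bar> \<le> r / 2" using p_pos by (simp add: Pd.prob_space)
    then show "norm ((\<Sum>v\<in>Gm (Suc m). mu (Suc m) v * Q v) - Pint Q) < r" unfolding eq using r by simp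
  qed
qed

lemma T2_RS:
  assumes "0 < m"
  shows "T2 m b = (\<Sum>J\<in>Pow K'. (-1) ^ card J * RSsum J (ugrid m) fst (\<lambda>x. Cop b (onK J x)) (\<lambda>x. \<phi> (onK J x)))"
  unfolding T2_def RSsum_def
proof (intro sum.cong refl arg_cong2[where f = "(*)"])
  fix J and c :: "(real^'p) \<times> (real^'p)" assume "c \<in> grid_cells J (ugrid m)"
  then have "onK J (fst c) = fst c" by (auto simp: vec_eq_iff grid_cells_def)
  then show "Cop b (fst c) = Cop b (onK J (fst c))" by simp
qed

lemma finlin_T1: "0 < m \<Longrightarrow> finlin (T1 m)"
  unfolding T1_def[abs_def] by (intro finlin_sum finite_Gm finlin_scale finlin_Cop onK_cube Gm_cube)

lemma finlin_T2:
  assumes "0 < m" shows "finlin (T2 m)"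
  unfolding T2_def[abs_def]
proof (intro finlin_sum finlin_scale finlin_mult finlin_Cop finite_cells is_grid_ugrid assms)
  fix J and c :: "(real^'p) \<times> (real^'p)" assume c: "c \<in> grid_cells J (ugrid m)"
  have g: "is_grid J (ugrid m)" by (rule is_grid_ugrid[OF assms])
  show "fst c \<in> unitcube" using tagged_fst[OF g] c by (intro grid_cell_cube[OF g c]) (auto simp: tagged_def)
qed simp

end

section \<open>The limit variable as a function of the Gaussian path\<close>

locale cop_gauss = cop_stat M X Z Xs Zs A \<psi> K K'
  for M :: "'a measure" and X :: "'a \<Rightarrow> real^'p::finite" and Z :: "'a \<Rightarrow> real^'q::finite"
    and Xs :: "nat \<Rightarrow> 'a \<Rightarrow> real^'p" and Zs :: "nat \<Rightarrow> 'a \<Rightarrow> real^'q" and A :: "(real^'q) set"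
    and \<psi> :: "real^'p \<Rightarrow> real" and K K' :: "'p set" +
  fixes N :: "'b measure" and B :: "real^'p \<Rightarrow> 'b \<Rightarrow> real"
  assumes gp: "gaussian_process N B (covB M X Z A)"
begin

lemma prob_N: "prob_space N" and B_meas [measurable]: "B u \<in> borel_measurable N"
  and B_cont: "\<eta> \<in> space N \<Longrightarrow> continuous_on unitcube (\<lambda>u. B u \<eta>)"
  using gp unfolding gaussian_process_def by auto

abbreviation "Bp \<eta> \<equiv> \<lambda>u. B u \<eta>"

lemma gauss_finlin:
  assumes "finlin T"
  shows "(\<lambda>\<eta>. T (Bp \<eta>)) \<in> borel_measurable N" "distr N borel (\<lambda>\<eta>. T (Bp \<eta>)) = normal_meas (vT T)"
proof -
  obtain S c where S: "finite S" "S \<subseteq> unitcube" "\<And>b. T b = (\<Sum>u\<in>S. c u * b u)" using assms unfolding finlin_def by blast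
  show "(\<lambda>\<eta>. T (Bp \<eta>)) \<in> borel_measurable N" unfolding S(3) by measurable
  define n where "n = card S"
  obtain h where h: "bij_betw h {..<n} S" using ex_bij_betw_nat_finite[OF S(1)] unfolding n_def lessThan_atLeast0 by blast
  have T: "T b = (\<Sum>i<n. c (h i) * b (h i))" for b unfolding S(3) by (rule sum.reindex_bij_betw[OF h, symmetric])
  have hc': "h i \<in> unitcube" if "i < n" for i using h S(2) that unfolding bij_betw_def by blast
  have ii: "integrable Pd (\<lambda>e. hc e u * hc e v)" for u v
    by (rule Pd.integrable_const_bound[where B = 1]) (auto simp: abs_mult intro!: AE_I2 mult_le_one hc_bound)
  have "vT T = (\<integral>e. (\<Sum>i<n. \<Sum>j<n. c (h i) * c (h j) * (hc e (h i) * hc e (h j))) \<partial>Pd)"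
    unfolding T power2_eq_square sum_product by (simp add: mult_ac)
  also have "\<dots> = (\<Sum>i<n. \<Sum>j<n. c (h i) * c (h j) * covB M X Z A (h i) (h j))"
    using ii by (simp add: hc_cov)
  finally have v: "vT T = \<dots>" .
  have "distr N borel (\<lambda>\<xi>. \<Sum>i<n. c (h i) * B (h i) \<xi>) = normal_meas (\<Sum>i<n. \<Sum>j<n. c (h i) * c (h j) * covB M X Z A (h i) (h j))"
    by (rule gp[unfolded gaussian_process_def, THEN conjunct2, THEN conjunct2, THEN conjunct2, THEN spec, THEN spec, THEN spec, THEN mp])
      (use hc' in blast)
  then show "distr N borel (\<lambda>\<eta>. T (Bp \<eta>)) = normal_meas (vT T)" unfolding v unfolding T .
qed

definition Reg :: "'b \<Rightarrow> bool" where
  "Reg \<eta> \<longleftrightarrow> (\<forall>k. B (vupd (vec 1) k 0) \<eta> = 0)"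

text \<open>\<open>D\<close> is 0 where a coordinate is 0, so \<open>B\<close> has variance 0 at
  these marginal points.\<close>

lemma AE_Reg: "AE \<eta> in N. Reg \<eta>"
proof -
  have "AE \<eta> in N. B (vupd (vec 1) k 0) \<eta> = 0" for k
  proof -
    define u where "u = (vupd (vec 1) k 0 :: real^'p)"
    have f: "finlin (\<lambda>b. b u)" unfolding u_def by (intro finlin_eval marg_cube) auto
    have "D u = 0" by (rule D_zero[of _ k]) (simp add: u_def)
    moreover have "vmeet u u = u" by (simp add: vmeet_def vec_eq_iff)
    ultimately have "vT (\<lambda>b. b u) = 0" using hc_cov[of u u] by (simp add: power2_eq_square covB_def condCop_def)
    then have "integrable N (\<lambda>\<eta>. (B u \<eta>)\<^sup>2)" "(\<integral>\<eta>. (B u \<eta>)\<^sup>2 \<partial>N) = 0"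
      using gaussian_moments(3,4)[OF gauss_finlin[OF f]] by auto
    then have "AE \<eta> in N. (B u \<eta>)\<^sup>2 = 0" by (subst integral_nonneg_eq_0_iff_AE[symmetric]) auto
    then show ?thesis unfolding u_def by eventually_elim simp
  qed
  then show ?thesis unfolding Reg_def by (subst AE_all_countable) auto
qed

definition CQ :: "'b \<Rightarrow> real^'p \<Rightarrow> real" where
  "CQ \<eta> v = \<psi> v * CopC (Bp \<eta>) (onK K v)"

lemma CopC_onK_cont: "\<eta> \<in> space N \<Longrightarrow> continuous_on unitcube (\<lambda>v. CopC (Bp \<eta>) (onK J v))"
  by (rule continuous_on_compose2[OF CopC_cont[OF B_cont] continuous_onK]) (auto intro: onK_in_cube)

lemma CQ_cont: "\<eta> \<in> space N \<Longrightarrow> continuous_on unitcube (CQ \<eta>)"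
  unfolding CQ_def by (intro continuous_on_mult psi_cont CopC_onK_cont)

lemma CopC_meas [measurable]: "(\<lambda>\<eta>. CopC (Bp \<eta>) v) \<in> borel_measurable N"
  unfolding CopC_def bridge_def by measurable

text \<open>The sum accounts for paths outside \<open>Reg\<close>, so that \<open>limitRV_eq\<close>
  holds on the whole space and exhibits \<open>limitRV\<close> as a measurable function.\<close>

definition Y1 :: "'b \<Rightarrow> real" where
  "Y1 \<eta> = Pint (CQ \<eta>) - (\<Sum>k\<in>UNIV. B (vupd (vec 1) k 0) \<eta> * Pint (\<lambda>v. \<psi> v * qk k (onK K v)))"

definition Y2 :: "'b \<Rightarrow> real" where
  "Y2 \<eta> = ibp_int K' \<phi> (\<lambda>u. Cinf M X Z A B (onK K' u) \<eta>)"

lemma okQ_qk: "okQ (\<lambda>v. \<psi> v * qk k (onK K v))"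
proof -
  obtain C where C: "0 < C" "\<And>u. u \<in> unitcube \<Longrightarrow> \<bar>\<psi> u\<bar> \<le> C" using psi_bound by metis
  show ?thesis
  proof (rule okQ_I[where C = "C * ((p + \<bar>J0\<bar>) / p\<^sup>2)"])
    fix v :: "((real^'p) \<times> (real^'q)) \<times> (real^'p) \<Rightarrow> real^'p"
    assume v: "v \<in> borel_measurable (borel \<Otimes>\<^sub>M Lc)" "\<And>z. z \<in> space (borel \<Otimes>\<^sub>M Lc) \<Longrightarrow> v z \<in> unitcube"
    have "(\<lambda>z. onK K (v z)) \<in> borel_measurable (borel \<Otimes>\<^sub>M Lc)" using v(1) by measurable
    then show "(\<lambda>z. \<psi> (v z) * qk k (onK K (v z))) \<in> borel_measurable (borel \<Otimes>\<^sub>M Lc)"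
      using v by (intro borel_measurable_times cont_comp_meas[OF psi_cont] qk_meas onK_in_cube) auto
  next
    fix u :: "real^'p" assume "u \<in> unitcube"
    then show "\<bar>\<psi> u * qk k (onK K u)\<bar> \<le> C * ((p + \<bar>J0\<bar>) / p\<^sup>2)"
      unfolding abs_mult using C by (intro mult_mono qk_bound onK_in_cube) auto
  qed
qed

lemma limitRV_eq:
  assumes \<eta>: "\<eta> \<in> space N"
  shows "limitRV M X Z A \<psi> K K' B \<eta> = Y1 \<eta> + Y2 \<eta>"
proof -
  define Q where "Q v = CQ \<eta> v - (\<Sum>k\<in>UNIV. B (vupd (vec 1) k 0) \<eta> * (\<psi> v * qk k (onK K v)))" for v
  have ok: "okQ Q" and PQ: "Pint Q = Y1 \<eta>"
    unfolding Q_def Y1_def using Pint_sum[OF okQ_cont[OF CQ_cont[OF \<eta>]], of UNIV "\<lambda>k v. \<psi> v * qk k (onK K v)"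
      "\<lambda>k. B (vupd (vec 1) k 0) \<eta>"] okQ_qk by auto
  have Qv: "\<psi> v * Cinf M X Z A B (onK K v) \<eta> = Q v" if "v \<in> unitcube" for v
    unfolding Q_def CQ_def Cinf_eq[OF onK_in_cube[OF that]] by (simp add: right_diff_distrib sum_distrib_left mult_ac)
  have inner: "(LINT w : unitcube | lborel. \<psi> (vmix K' (U \<xi>) w) * Cinf M X Z A B (onK K (vmix K' (U \<xi>) w)) \<eta>)
      = (\<integral>w. Q (vK (U \<xi>, Z \<xi>) w) \<partial>Lc)" for \<xi>
    unfolding LINT_Lc
  proof (rule Bochner_Integration.integral_cong[OF refl])
    fix w :: "real^'p" assume w: "w \<in> space Lc"
    have "vK (U \<xi>, Z \<xi>) w = vmix K' (U \<xi>) w" using U_cube by (simp add: vK_def)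
    then show "\<psi> (vmix K' (U \<xi>) w) * Cinf M X Z A B (onK K (vmix K' (U \<xi>) w)) \<eta> = Q (vK (U \<xi>, Z \<xi>) w)"
      using w by (simp add: Qv vmix_cube U_cube space_Lc)
  qed
  have "(\<integral>\<xi>. indicator {\<xi>. Z \<xi> \<in> A} \<xi> * (LINT w : unitcube | lborel. \<psi> (vmix K' (U \<xi>) w) * Cinf M X Z A B (onK K (vmix K' (U \<xi>) w)) \<eta>) \<partial>M) / p
      = (\<integral>\<xi>. Iq Q (U \<xi>, Z \<xi>) \<partial>M)"
    unfolding inner Iq_def integral_divide_zero[symmetric] by (simp add: indicator_def)
  also have "\<dots> = Pint Q" unfolding Pint_def Pd_def
    by (subst integral_distr) (use okQ_integrable(2)[OF ok] in auto)
  finally show ?thesis unfolding limitRV_def Y2_def PQ by simp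
qed

lemma Y1_meas [measurable]: "Y1 \<in> borel_measurable N"
proof -
  have "(\<lambda>\<eta>. Pint (CQ \<eta>)) \<in> borel_measurable N"
  proof (rule borel_measurable_LIMSEQ_real)
    show "(\<lambda>m. \<Sum>v\<in>Gm (Suc m). mu (Suc m) v * CQ \<eta> v) \<longlonglongrightarrow> Pint (CQ \<eta>)" if "\<eta> \<in> space N" for \<eta>
      by (rule round_limit[OF CQ_cont[OF that]])
    show "(\<lambda>\<eta>. \<Sum>v\<in>Gm (Suc m). mu (Suc m) v * CQ \<eta> v) \<in> borel_measurable N" for m unfolding CQ_def by measurable
  qed
  then show ?thesis unfolding Y1_def by measurable
qed

lemma Y2_eq: "Y2 \<eta> = (\<Sum>J\<in>Pow K'. (-1) ^ card J * RS_int J (\<lambda>x. CopC (Bp \<eta>) (onK J x)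
    - (\<Sum>k\<in>UNIV. B (vupd (vec 1) k 0) \<eta> * qk k (onK J x))) (\<lambda>x. \<phi> (onK J x)))"
  unfolding Y2_def ibp_int_def
proof (intro sum.cong refl arg_cong2[where f = "(*)"] RS_int_cong)
  fix J and x :: "real^'p" assume J: "J \<in> Pow K'" and x: "x \<in> unitcube"
  \<comment> \<open>A face \<open>J\<close> inside \<open>K'\<close> is left fixed by the outer
    evaluation.\<close>
  have "onK K' (onK J x) = onK J x" using J by (auto simp: vec_eq_iff)
  then show "Cinf M X Z A B (onK K' (onK J x)) \<eta> = CopC (Bp \<eta>) (onK J x) - (\<Sum>k\<in>UNIV. B (vupd (vec 1) k 0) \<eta> * qk k (onK J x))"
    by (simp add: Cinf_eq[OF onK_in_cube[OF x]])
qed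

lemma Y2_meas [measurable]: "Y2 \<in> borel_measurable N"
  unfolding Y2_eq[abs_def]
  by (intro borel_measurable_sum borel_measurable_times borel_measurable_const RS_int_measurable CopC_onK_cont phi_vitali)
    auto

lemma T1_limit:
  assumes "\<eta> \<in> space N" "Reg \<eta>"
  shows "(\<lambda>m. T1 (Suc m) (Bp \<eta>)) \<longlonglongrightarrow> Y1 \<eta>"
proof -
  have z: "B (vupd (vec 1) k 0) \<eta> = 0" for k using assms(2) by (simp add: Reg_def)
  have "T1 (Suc m) (Bp \<eta>) = (\<Sum>v\<in>Gm (Suc m). mu (Suc m) v * CQ \<eta> v)" for m
    unfolding T1_def CQ_def by (simp add: CopC_Cop z)
  then show ?thesis using round_limit[OF CQ_cont[OF assms(1)]] by (simp add: Y1_def z)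
qed

lemma T2_limit:
  assumes \<eta>: "\<eta> \<in> space N" "Reg \<eta>"
  shows "(\<lambda>m. T2 (Suc m) (Bp \<eta>)) \<longlonglongrightarrow> Y2 \<eta>"
proof -
  have z: "B (vupd (vec 1) k 0) \<eta> = 0" for k using assms(2) by (simp add: Reg_def)
  have eq: "Cop (Bp \<eta>) v = CopC (Bp \<eta>) v" for v by (simp add: CopC_Cop z)
  have lim: "(\<lambda>m. RSsum J (ugrid (Suc m)) fst (\<lambda>x. CopC (Bp \<eta>) (onK J x)) (\<lambda>x. \<phi> (onK J x)))
     \<longlonglongrightarrow> RS_int J (\<lambda>x. CopC (Bp \<eta>) (onK J x)) (\<lambda>x. \<phi> (onK J x))" if J: "J \<in> Pow K'" for J
  proof -
    obtain I where I: "has_RS J (\<lambda>x. CopC (Bp \<eta>) (onK J x)) (\<lambda>x. \<phi> (onK J x)) I"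
      using RS_exists[OF CopC_onK_cont[OF \<eta>(1)] phi_vitali] J by blast
    show ?thesis unfolding RS_int_eq[OF I] using has_RS_limit[OF I] by (rule LIMSEQ_Suc)
  qed
  have "(\<lambda>m. \<Sum>J\<in>Pow K'. (-1) ^ card J * RSsum J (ugrid (Suc m)) fst (\<lambda>x. CopC (Bp \<eta>) (onK J x)) (\<lambda>x. \<phi> (onK J x)))
     \<longlonglongrightarrow> (\<Sum>J\<in>Pow K'. (-1) ^ card J * RS_int J (\<lambda>x. CopC (Bp \<eta>) (onK J x)) (\<lambda>x. \<phi> (onK J x)))"
    by (intro tendsto_sum tendsto_mult tendsto_const lim)
  then show ?thesis unfolding Y2_eq T2_RS[OF zero_less_Suc] eq by (simp add: z)
qed

end

context cop_stat
begin

lemma empF_bounds: "0 \<le> empF Xs Zs A n \<xi> k t" "empF Xs Zs A n \<xi> k t \<le> 1"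
proof -
  have d: "real n * phatA Zs A n \<xi> = (\<Sum>i<n. indicator A (Zs i \<xi>))" by (cases "n = 0") (auto simp: phatA_def)
  have "(\<Sum>i<n. if Xs i \<xi> $ k \<le> t \<and> Zs i \<xi> \<in> A then 1 else 0) \<le> (\<Sum>i<n. indicator A (Zs i \<xi>) :: real)"
    by (intro sum_mono) (auto simp: indicator_def)
  moreover have "0 \<le> (\<Sum>i<n. if Xs i \<xi> $ k \<le> t \<and> Zs i \<xi> \<in> A then 1 else 0 :: real)" by (intro sum_nonneg) auto
  ultimately show "0 \<le> empF Xs Zs A n \<xi> k t" "empF Xs Zs A n \<xi> k t \<le> 1"
    unfolding empF_def d by (auto intro!: divide_le_eq_1[THEN iffD2] divide_nonneg_nonneg simp: less_le)
qed

lemma stat_meas [measurable]: "stat n \<in> borel_measurable M"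
proof -
  have em: "(\<lambda>\<xi>. empF Xs Zs A n \<xi> j (Xs i \<xi> $ j)) \<in> borel_measurable M" for i j
    unfolding empF_def phatA_def by measurable
  have pm[measurable]: "(\<lambda>\<xi>. pseudoU Xs Zs A n \<xi> i) \<in> borel_measurable M" for i
    unfolding pseudoU_def using em by measurable
  have pc: "pseudoU Xs Zs A n \<xi> i \<in> unitcube" for \<xi> i
    using empF_bounds by (simp add: unitcube_iff pseudoU_def)
  have fm[measurable]: "fst \<in> measurable (M \<Otimes>\<^sub>M (Lc :: (real^'p) measure)) M" by simp
  have m: "(\<lambda>z. vmix K' (pseudoU Xs Zs A n (fst z) i) (snd z)) \<in> borel_measurable (M \<Otimes>\<^sub>M Lc)" for i
    unfolding vmix_def by measurable
  have psi: "(\<lambda>z. \<psi> (vmix K' (pseudoU Xs Zs A n (fst z) i) (snd z))) \<in> borel_measurable (M \<Otimes>\<^sub>M Lc)" for i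
    by (rule cont_comp_meas[OF psi_cont m]) (auto intro!: vmix_cube pc simp: space_pair_measure space_Lc)
  have cop: "(\<lambda>z. empCop Xs Zs A n (fst z) K (vmix K' (pseudoU Xs Zs A n (fst z) i) (snd z))) \<in> borel_measurable (M \<Otimes>\<^sub>M Lc)" for i
    unfolding empCop_def phatA_def using m[of i] by measurable
  have "(\<lambda>\<xi>. \<integral>w. \<psi> (vmix K' (pseudoU Xs Zs A n \<xi> i) w) * empCop Xs Zs A n \<xi> K (vmix K' (pseudoU Xs Zs A n \<xi> i) w) \<partial>Lc) \<in> borel_measurable M" for i
    by (rule Lc.borel_measurable_lebesgue_integral) (use borel_measurable_times[OF psi cop] in \<open>simp add: split_beta'\<close>)
  then show ?thesis unfolding stat_def[abs_def] rhohat_def LINT_Lc phatA_def by measurable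
qed

end

section \<open>Transfer from the Gaussian process and convergence in law\<close>

context cop_gauss
begin

lemma gauss_sequence:
  assumes T: "\<And>n. finlin (T n)" and Y[measurable]: "Y \<in> borel_measurable N"
    and lim: "AE \<eta> in N. (\<lambda>n. T n (Bp \<eta>)) \<longlonglongrightarrow> Y \<eta>"
  shows "(\<lambda>n. vT (T n)) \<longlonglongrightarrow> (\<integral>\<eta>. (Y \<eta>)\<^sup>2 \<partial>N)" "0 \<le> (\<integral>\<eta>. (Y \<eta>)\<^sup>2 \<partial>N)"
    "distr N borel Y = normal_meas (\<integral>\<eta>. (Y \<eta>)\<^sup>2 \<partial>N)"
  using gaussian_limit[OF prob_N gauss_finlin(1)[OF T] Y lim gauss_finlin(2)[OF T]] by auto

text \<open>\<open>gaussian_limit\<close> is used twice. For fixed \<open>m\<close> the variances of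
  \<open>T n - T m\<close> tend to the second moment of \<open>Y - T m\<close>; these remainders are
  Gaussian and tend to 0 almost surely as \<open>m\<close> grows, hence also in second
  moment.\<close>

lemma gauss_cauchy:
  assumes T: "\<And>n. finlin (T n)" and Y[measurable]: "Y \<in> borel_measurable N"
    and lim: "AE \<eta> in N. (\<lambda>n. T n (Bp \<eta>)) \<longlonglongrightarrow> Y \<eta>" and e: "0 < e"
  shows "\<exists>m0. \<forall>m\<ge>m0. \<exists>n0. \<forall>n\<ge>n0. vT (\<lambda>b. T n b - T m b) \<le> e"
proof -
  define y where "y m = (\<integral>\<eta>. (Y \<eta> - T m (Bp \<eta>))\<^sup>2 \<partial>N)" for m
  have Tm[measurable]: "(\<lambda>\<eta>. T m (Bp \<eta>)) \<in> borel_measurable N" for m by (rule gauss_finlin(1)[OF T])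
  have Ym: "(\<lambda>\<eta>. Y \<eta> - T m (Bp \<eta>)) \<in> borel_measurable N" for m by measurable
  have l: "AE \<eta> in N. (\<lambda>n. T n (Bp \<eta>) - T m (Bp \<eta>)) \<longlonglongrightarrow> Y \<eta> - T m (Bp \<eta>)" for m
    using lim by eventually_elim (intro tendsto_intros)
  note gs = gauss_sequence[where T = "\<lambda>n b. T n b - T m b" and Y = "\<lambda>\<eta>. Y \<eta> - T m (Bp \<eta>)" for m, OF finlin_diff[OF T T] Ym l, folded y_def]
  have "AE \<eta> in N. (\<lambda>m. Y \<eta> - T m (Bp \<eta>)) \<longlonglongrightarrow> 0"
    using lim
  proof eventually_elim
    fix \<eta> assume "(\<lambda>n. T n (Bp \<eta>)) \<longlonglongrightarrow> Y \<eta>"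
    from tendsto_diff[OF tendsto_const[of "Y \<eta>"] this] show "(\<lambda>m. Y \<eta> - T m (Bp \<eta>)) \<longlonglongrightarrow> 0" by simp
  qed
  from gaussian_limit(1)[OF prob_N Ym _ this gs(3) gs(2)] have "y \<longlonglongrightarrow> 0" by simp
  then have "\<forall>\<^sub>F m in sequentially. y m < e" using e by (rule order_tendstoD)
  then obtain m0 where m0: "\<And>m. m0 \<le> m \<Longrightarrow> y m < e" unfolding eventually_sequentially by blast
  show ?thesis
  proof (rule exI[of _ m0], intro allI impI)
    fix m assume "m0 \<le> m"
    then have "\<forall>\<^sub>F n in sequentially. vT (\<lambda>b. T n b - T m b) < e" using gs(1)[of m] m0 by (intro order_tendstoD(2)) auto
    then show "\<exists>n0. \<forall>n\<ge>n0. vT (\<lambda>b. T n b - T m b) \<le> e" unfolding eventually_sequentially using less_imp_le by blast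
  qed
qed

text \<open>Uniformity in \<open>u\<close> without a rate. A violating sequence of meshes and points
  would give Gaussian variables that tend to 0 on every regular path, by its uniform continuity,
  while their variances stay above \<open>e\<close>.\<close>

lemma fD_small:
  assumes e: "0 < e"
  shows "\<exists>m0. \<forall>m\<ge>m0. \<forall>u\<in>unitcube. (\<integral>x. (fD (Suc m) x u)\<^sup>2 \<partial>Pd) \<le> e"
proof (rule ccontr)
  assume "\<not> ?thesis"
  then have "\<forall>i. \<exists>m u. i \<le> m \<and> u \<in> unitcube \<and> e < (\<integral>x. (fD (Suc m) x u)\<^sup>2 \<partial>Pd)" by (meson not_le)
  then obtain mm uu where mu: "\<And>i. i \<le> mm i" "\<And>i. uu i \<in> unitcube" "\<And>i. e < (\<integral>x. (fD (Suc (mm i)) x (uu i))\<^sup>2 \<partial>Pd)" by metis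
  define T where "T i b = \<psi> (uu i) * Cop b (onK K (uu i)) - \<psi> (rd (Suc (mm i)) (uu i)) * Cop b (onK K (rd (Suc (mm i)) (uu i)))" for i b
  have rc: "rd (Suc (mm i)) (uu i) \<in> unitcube" for i by (rule rd_props(3)[OF _ mu(2)]) simp
  have Tf: "finlin (T i)" for i
    unfolding T_def by (intro finlin_diff finlin_scale finlin_Cop onK_cube mu(2) rc)
  have "AE \<eta> in N. (\<lambda>i. T i (Bp \<eta>)) \<longlonglongrightarrow> 0"
    using AE_Reg AE_space
  proof eventually_elim
    fix \<eta> assume r: "Reg \<eta>" and \<eta>: "\<eta> \<in> space N"
    have z: "B (vupd (vec 1) k 0) \<eta> = 0" for k using r by (simp add: Reg_def)
    have TQ: "T i (Bp \<eta>) = CQ \<eta> (uu i) - CQ \<eta> (rd (Suc (mm i)) (uu i))" for i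
      by (simp add: T_def CQ_def CopC_Cop z)
    show "(\<lambda>i. T i (Bp \<eta>)) \<longlonglongrightarrow> 0"
    proof (rule LIMSEQ_I)
      fix s :: real assume s: "0 < s"
      obtain n0 where n0: "\<And>m u. n0 \<le> m \<Longrightarrow> u \<in> unitcube \<Longrightarrow> \<bar>CQ \<eta> (rd (Suc m) u) - CQ \<eta> u\<bar> \<le> s / 2"
        using rd_close[OF CQ_cont[OF \<eta>], of "s / 2"] s by auto
      show "\<exists>n0. \<forall>i\<ge>n0. norm (T i (Bp \<eta>) - 0) < s"
      proof (intro exI[of _ n0] allI impI)
        fix i assume "n0 \<le> i"
        then have "\<bar>CQ \<eta> (rd (Suc (mm i)) (uu i)) - CQ \<eta> (uu i)\<bar> \<le> s / 2" using n0 mu(1)[of i] mu(2) by auto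
        then show "norm (T i (Bp \<eta>) - 0) < s" unfolding TQ using s by (simp add: abs_minus_commute)
      qed
    qed
  qed
  from gauss_sequence(1)[OF Tf _ this] have "(\<lambda>i. vT (T i)) \<longlonglongrightarrow> 0" by simp
  then have "\<forall>\<^sub>F i in sequentially. vT (T i) < e" using e by (rule order_tendstoD)
  then obtain i where "vT (T i) < e" unfolding eventually_sequentially by blast
  then show False using mu(3)[of i] by (simp add: T_def fD_def)
qed

definition Tt :: "nat \<Rightarrow> (real^'p \<Rightarrow> real) \<Rightarrow> real" where
  "Tt m b = T1 (Suc m) b + T2 (Suc m) b"

lemma finlin_Tt: "finlin (Tt m)"
  unfolding Tt_def[abs_def] by (intro finlin_add finlin_T1 finlin_T2) auto

lemma AE_T2_limit: "AE \<eta> in N. (\<lambda>m. T2 (Suc m) (Bp \<eta>)) \<longlonglongrightarrow> Y2 \<eta>"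
  using AE_Reg AE_space by eventually_elim (rule T2_limit)

lemma AE_Tt_limit: "AE \<eta> in N. (\<lambda>m. Tt m (Bp \<eta>)) \<longlonglongrightarrow> Y1 \<eta> + Y2 \<eta>"
  using AE_Reg AE_space unfolding Tt_def by eventually_elim (intro tendsto_add T1_limit T2_limit)

lemma finlin_approx:
  assumes T: "finlin T" and v: "vT T \<le> e\<^sup>2" and e: "0 < e" and n: "0 < n"
  shows "approx n (\<lambda>\<xi>. T (alpha n \<xi>)) (2 * e)"
proof (rule approxI[where Y = "\<lambda>\<xi>. e + (T (alpha n \<xi>))\<^sup>2 / e"])
  note sm = finlin_second_moment[OF T n]
  show "integrable M (\<lambda>\<xi>. e + (T (alpha n \<xi>))\<^sup>2 / e)" using sm(1) by simp
  have "(\<integral>\<xi>. e + (T (alpha n \<xi>))\<^sup>2 / e \<partial>M) = e + vT T / e" using sm by (simp add: prob_space)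
  also have "\<dots> \<le> e + e\<^sup>2 / e" using v e by (intro add_left_mono divide_right_mono) auto
  finally show "(\<integral>\<xi>. e + (T (alpha n \<xi>))\<^sup>2 / e \<partial>M) \<le> 2 * e" using e by (simp add: power2_eq_square)
  show "AE \<xi> in M. dense n \<xi> \<longrightarrow> \<bar>T (alpha n \<xi>)\<bar> \<le> e + (T (alpha n \<xi>))\<^sup>2 / e"
    by (intro AE_I2 impI abs_le_square_div e)
qed (use e in auto)

text \<open>For given \<open>n\<close> the summation by parts is available at fine meshes only.
  Passing from such a mesh \<open>l\<close> to the fixed \<open>m\<close> costs a variance in which
  \<open>n\<close> does not occur, and \<open>gauss_cauchy\<close> makes it small.\<close>

lemma stat_approx:
  assumes eps: "0 < \<epsilon>"
  shows "\<exists>m0. \<forall>m\<ge>m0. \<exists>n0. \<forall>n\<ge>n0. approx n (\<lambda>\<xi>. stat n \<xi> - Tt m (alpha n \<xi>)) \<epsilon>"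
proof -
  \<comment> \<open>Six shares: one for the linearised integrand, two for \<open>R1\<close>, one for
    \<open>S2\<close> at mesh \<open>l\<close> and two for passing from \<open>l\<close> to
    \<open>m\<close>.\<close>
  define e where "e = \<epsilon> / 6"
  have e: "0 < e" using eps by (simp add: e_def)
  obtain n1 where n1: "\<And>n. n1 \<le> n \<Longrightarrow> approx n (\<lambda>\<xi>. stat n \<xi> - S2 n \<xi> - R1 n \<xi>) e" using S1_approx[OF e] by blast
  obtain n2 where n2: "\<And>n. n2 \<le> n \<Longrightarrow> \<exists>m0. \<forall>m\<ge>m0. approx n (\<lambda>\<xi>. S2 n \<xi> - T2 m (alpha n \<xi>)) e" using S2_approx[OF e] by blast
  \<comment> \<open>With \<open>s\<close> below this makes both terms of
    \<open>(\<kappa> + 2 * s / \<kappa>) / p\<close> equal to \<open>e / 2\<close>.\<close>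
  define \<kappa> where "\<kappa> = e * p / 2"
  define s where "s = \<kappa>\<^sup>2 / 2"
  have k: "0 < \<kappa>" "0 < s" using e p_pos by (auto simp: \<kappa>_def s_def)
  have ks: "(\<kappa> + 2 * s / \<kappa>) / p = e" using k p_pos by (simp add: s_def power2_eq_square) (simp add: \<kappa>_def)
  obtain m1 where m1: "\<And>m u. m1 \<le> m \<Longrightarrow> u \<in> unitcube \<Longrightarrow> (\<integral>x. (fD (Suc m) x u)\<^sup>2 \<partial>Pd) \<le> s" using fD_small[OF k(2)] by blast
  have e2: "0 < e\<^sup>2" using e by simp
  have f2: "finlin (T2 (Suc m))" for m by (rule finlin_T2) simp
  obtain m2 where m2: "\<And>m. m2 \<le> m \<Longrightarrow> \<exists>n0. \<forall>n\<ge>n0. vT (\<lambda>b. T2 (Suc n) b - T2 (Suc m) b) \<le> e\<^sup>2"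
    using gauss_cauchy[where T = "\<lambda>m. T2 (Suc m)", OF f2 Y2_meas AE_T2_limit e2] by blast
  show ?thesis
  proof (rule exI[of _ "max m1 m2"], intro allI impI)
    fix m assume m: "max m1 m2 \<le> m"
    obtain c where c: "\<And>n. 0 < n \<Longrightarrow> approx n (\<lambda>\<xi>. R1 n \<xi> - T1 (Suc m) (alpha n \<xi>)) ((\<kappa> + 2 * s / \<kappa>) / p + c / sqrt (real n))"
      using R1_approx[OF zero_less_Suc k(1) m1, of m] m by auto
    obtain l0 where l0: "\<And>n. l0 \<le> n \<Longrightarrow> vT (\<lambda>b. T2 (Suc n) b - T2 (Suc m) b) \<le> e\<^sup>2" using m2[of m] m by auto
    have "(\<lambda>n. c / sqrt (real n)) \<longlonglongrightarrow> 0" by real_asymp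
    then have "\<forall>\<^sub>F n in sequentially. c / sqrt (real n) < e" using e by (rule order_tendstoD)
    then obtain n3 where n3: "\<And>n. n3 \<le> n \<Longrightarrow> c / sqrt (real n) < e" unfolding eventually_sequentially by blast
    show "\<exists>n0. \<forall>n\<ge>n0. approx n (\<lambda>\<xi>. stat n \<xi> - Tt m (alpha n \<xi>)) \<epsilon>"
    proof (intro exI[of _ "Suc (n1 + n2 + n3)"] allI impI)
      fix n assume "Suc (n1 + n2 + n3) \<le> n"
      then have n: "n1 \<le> n" "n2 \<le> n" "n3 \<le> n" "0 < n" by auto
      obtain k0 where k0: "\<And>m. k0 \<le> m \<Longrightarrow> approx n (\<lambda>\<xi>. S2 n \<xi> - T2 m (alpha n \<xi>)) e" using n2[OF n(2)] by blast
      define l where "l = l0 + k0"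
      have a1: "approx n (\<lambda>\<xi>. R1 n \<xi> - T1 (Suc m) (alpha n \<xi>)) (2 * e)"
        by (rule approx_mono[OF c[OF n(4)]]) (use ks n3[OF n(3)] in linarith)
      have a2: "approx n (\<lambda>\<xi>. S2 n \<xi> - T2 (Suc l) (alpha n \<xi>)) e" by (rule k0) (simp add: l_def)
      have a3: "approx n (\<lambda>\<xi>. T2 (Suc l) (alpha n \<xi>) - T2 (Suc m) (alpha n \<xi>)) (2 * e)"
        by (rule finlin_approx[OF finlin_diff[OF f2 f2] l0 e n(4)]) (simp add: l_def)
      have eq: "(\<lambda>\<xi>. stat n \<xi> - Tt m (alpha n \<xi>)) = (\<lambda>\<xi>. (stat n \<xi> - S2 n \<xi> - R1 n \<xi>) + (R1 n \<xi> - T1 (Suc m) (alpha n \<xi>))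
          + ((S2 n \<xi> - T2 (Suc l) (alpha n \<xi>)) + (T2 (Suc l) (alpha n \<xi>) - T2 (Suc m) (alpha n \<xi>))))"
        by (rule ext) (simp add: Tt_def)
      show "approx n (\<lambda>\<xi>. stat n \<xi> - Tt m (alpha n \<xi>)) \<epsilon>"
        unfolding eq by (rule approx_mono[OF approx_add[OF approx_add[OF n1[OF n(1)] a1] approx_add[OF a2 a3]]]) (simp add: e_def)
    qed
  qed
qed

lemma cmod_iexp_diff: "cmod (iexp x - iexp y) \<le> \<bar>x - y\<bar>"
proof -
  have "iexp x - iexp y = iexp y * (iexp (x - y) - 1)" by (simp add: exp_diff exp_minus right_diff_distrib)
  then have "cmod (iexp x - iexp y) = cmod (iexp (x - y) - 1)" by (simp add: norm_mult)
  then show ?thesis using iexp_approx1[of "x - y" 0] by simp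
qed

text \<open>Off the bad event the exponentials differ by at most \<open>\<bar>t\<bar>\<close> times
  the error. On it they differ by at most 2, and twice the bound of \<open>not_good_prob\<close>
  gives the constant 32.\<close>

lemma char_approx:
  assumes a: "approx n (\<lambda>\<xi>. S \<xi> - S' \<xi>) e" and [measurable]: "S \<in> borel_measurable M" "S' \<in> borel_measurable M" and n: "0 < n"
  shows "cmod (char (distr M borel S) t - char (distr M borel S') t) \<le> \<bar>t\<bar> * e + 32 / (p\<^sup>2 * real n)"
proof -
  obtain Y where Y0: "\<And>\<xi>. 0 \<le> Y \<xi>" and Y: "integrable M Y" "(\<integral>\<xi>. Y \<xi> \<partial>M) \<le> e"
    "AE \<xi> in M. dense n \<xi> \<longrightarrow> \<bar>S \<xi> - S' \<xi>\<bar> \<le> Y \<xi>" using a unfolding approx_def by blast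
  define bad where "bad = {\<xi> \<in> space M. \<not> dense n \<xi>}"
  have bm[measurable]: "bad \<in> sets M" unfolding bad_def card_aset by measurable
  have i: "integrable M (\<lambda>\<xi>. iexp (t * S \<xi>))" "integrable M (\<lambda>\<xi>. iexp (t * S' \<xi>))"
    by (rule integrable_const_bound[where B = 1]; simp)+
  have "char (distr M borel S) t - char (distr M borel S') t = (\<integral>\<xi>. iexp (t * S \<xi>) - iexp (t * S' \<xi>) \<partial>M)"
    unfolding char_def using i by (subst (1 2) integral_distr) auto
  then have "cmod (char (distr M borel S) t - char (distr M borel S') t) \<le> (\<integral>\<xi>. cmod (iexp (t * S \<xi>) - iexp (t * S' \<xi>)) \<partial>M)"
    by (simp only: integral_norm_bound)
  also have "\<dots> \<le> (\<integral>\<xi>. \<bar>t\<bar> * Y \<xi> + 2 * indicator bad \<xi> \<partial>M)"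
  proof (rule integral_mono_AE)
    show "integrable M (\<lambda>\<xi>. cmod (iexp (t * S \<xi>) - iexp (t * S' \<xi>)))" using i by (intro integrable_norm Bochner_Integration.integrable_diff)
    show "integrable M (\<lambda>\<xi>. \<bar>t\<bar> * Y \<xi> + 2 * indicator bad \<xi>)" using Y(1) by (auto simp: emeasure_eq_measure)
    show "AE \<xi> in M. cmod (iexp (t * S \<xi>) - iexp (t * S' \<xi>)) \<le> \<bar>t\<bar> * Y \<xi> + 2 * indicator bad \<xi>"
      using Y(3) AE_space
    proof eventually_elim
      fix \<xi> assume h: "dense n \<xi> \<longrightarrow> \<bar>S \<xi> - S' \<xi>\<bar> \<le> Y \<xi>" "\<xi> \<in> space M"
      show "cmod (iexp (t * S \<xi>) - iexp (t * S' \<xi>)) \<le> \<bar>t\<bar> * Y \<xi> + 2 * indicator bad \<xi>"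
      proof (cases "\<xi> \<in> bad")
        case True
        have "cmod (iexp (t * S \<xi>) - iexp (t * S' \<xi>)) \<le> cmod (iexp (t * S \<xi>)) + cmod (iexp (t * S' \<xi>))" by (rule norm_triangle_ineq4)
        also have "\<dots> = 2" by simp
        finally have "cmod (iexp (t * S \<xi>) - iexp (t * S' \<xi>)) \<le> 2" .
        moreover have "0 \<le> \<bar>t\<bar> * Y \<xi>" using Y0 by simp
        ultimately show ?thesis using True by (simp only: indicator_simps)
      next
        case False
        have "cmod (iexp (t * S \<xi>) - iexp (t * S' \<xi>)) \<le> \<bar>t * S \<xi> - t * S' \<xi>\<bar>" by (rule cmod_iexp_diff)
        also have "\<dots> = \<bar>t\<bar> * \<bar>S \<xi> - S' \<xi>\<bar>" by (simp only: right_diff_distrib[symmetric] abs_mult)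
        also have "\<dots> \<le> \<bar>t\<bar> * Y \<xi>" using False h by (intro mult_left_mono) (auto simp: bad_def)
        finally show ?thesis using False by simp
      qed
    qed
  qed
  also have "\<dots> = \<bar>t\<bar> * (\<integral>\<xi>. Y \<xi> \<partial>M) + 2 * prob bad" using Y(1) by (simp add: emeasure_eq_measure)
  also have "\<dots> \<le> \<bar>t\<bar> * e + 2 * (16 / (p\<^sup>2 * real n))"
    using Y(2) not_good_prob[OF n] unfolding bad_def by (intro add_mono mult_left_mono) auto
  finally show ?thesis by simp
qed

theorem stat_weak_limit: "weak_conv_m (\<lambda>n. distr M borel (stat n)) (normal_meas (sigma2 M X Z A \<psi> K K' N B))"
proof -
  interpret N: prob_space N by (rule prob_N)
  define \<sigma>2 where "\<sigma>2 = (\<integral>\<eta>. (Y1 \<eta> + Y2 \<eta>)\<^sup>2 \<partial>N)"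
  have Ym: "(\<lambda>\<eta>. Y1 \<eta> + Y2 \<eta>) \<in> borel_measurable N" by measurable
  note gs = gauss_sequence[OF finlin_Tt Ym AE_Tt_limit, folded \<sigma>2_def]
  \<comment> \<open>As a limit of centred Gaussians the limit variable has mean 0, so its variance
    is its second moment.\<close>
  have sig: "sigma2 M X Z A \<psi> K K' N B = \<sigma>2"
  proof -
    have "(\<integral>\<eta>. limitRV M X Z A \<psi> K K' B \<eta> \<partial>N) = (\<integral>\<eta>. Y1 \<eta> + Y2 \<eta> \<partial>N)"
      by (rule Bochner_Integration.integral_cong[OF refl limitRV_eq])
    then have "(\<integral>\<eta>. limitRV M X Z A \<psi> K K' B \<eta> \<partial>N) = 0" using gaussian_moments(2)[OF Ym gs(3) gs(2)] by simp
    then show ?thesis unfolding sigma2_def \<sigma>2_def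
      by (simp only: diff_zero) (rule Bochner_Integration.integral_cong[OF refl], simp only: limitRV_eq)
  qed
  show ?thesis unfolding sig
  proof (rule levy_continuity)
    show "real_distribution (distr M borel (stat n))" for n by (rule real_distribution_distr) simp
    show "real_distribution (normal_meas \<sigma>2)" by (rule real_distribution_normal_meas)
    fix t
    define L where "L v = complex_of_real (exp (- (v * t\<^sup>2) / 2))" for v
    have "(\<lambda>n. char (distr M borel (stat n)) t) \<longlonglongrightarrow> L \<sigma>2"
    proof (rule LIMSEQ_I)
      fix r :: real assume r: "0 < r"
      \<comment> \<open>A quarter of \<open>r\<close> each for the mean error, the bad event, the
        central limit theorem at mesh \<open>m\<close> and the convergence of variances; the added 1
        covers \<open>t = 0\<close>.\<close>
      define \<epsilon> where "\<epsilon> = r / (4 * (\<bar>t\<bar> + 1))"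
      have eps: "0 < \<epsilon>" using r by (simp add: \<epsilon>_def)
      have te: "\<bar>t\<bar> * \<epsilon> \<le> r / 4"
      proof -
        have "\<bar>t\<bar> * \<epsilon> \<le> (\<bar>t\<bar> + 1) * \<epsilon>" using eps by (intro mult_right_mono) auto
        also have "\<dots> = r / 4" unfolding \<epsilon>_def by (simp add: divide_simps)
        finally show ?thesis .
      qed
      obtain m0 where m0: "\<And>m. m0 \<le> m \<Longrightarrow> \<exists>n0. \<forall>n\<ge>n0. approx n (\<lambda>\<xi>. stat n \<xi> - Tt m (alpha n \<xi>)) \<epsilon>"
        using stat_approx[OF eps] by blast
      have "(\<lambda>m. L (vT (Tt m))) \<longlonglongrightarrow> L \<sigma>2" unfolding L_def by (intro tendsto_intros gs(1)) auto
      from LIMSEQ_D[OF this, of "r / 4"] r obtain m1 where m1: "\<And>m. m1 \<le> m \<Longrightarrow> cmod (L (vT (Tt m)) - L \<sigma>2) < r / 4" by auto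
      define m where "m = max m0 m1"
      obtain n0 where n0: "\<And>n. n0 \<le> n \<Longrightarrow> approx n (\<lambda>\<xi>. stat n \<xi> - Tt m (alpha n \<xi>)) \<epsilon>" using m0[of m] by (auto simp: m_def)
      from LIMSEQ_D[OF finlin_clt[OF finlin_Tt, of m t], of "r / 4"] r
      obtain n1 where n1: "\<And>n. n1 \<le> n \<Longrightarrow> cmod (char (distr M borel (\<lambda>\<xi>. Tt m (alpha n \<xi>))) t - L (vT (Tt m))) < r / 4"
        unfolding L_def by auto
      have "(\<lambda>n. 32 / (p\<^sup>2 * real n)) \<longlonglongrightarrow> 0" using tendsto_mult_right_zero[OF lim_1_over_n, of "32 / p\<^sup>2"] by simp
      then have "\<forall>\<^sub>F n in sequentially. 32 / (p\<^sup>2 * real n) < r / 4" using r by (intro order_tendstoD(2)) auto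
      then obtain n2 where n2: "\<And>n. n2 \<le> n \<Longrightarrow> 32 / (p\<^sup>2 * real n) < r / 4" unfolding eventually_sequentially by blast
      show "\<exists>n0. \<forall>n\<ge>n0. norm (char (distr M borel (stat n)) t - L \<sigma>2) < r"
      proof (intro exI[of _ "Suc (n0 + n1 + n2)"] allI impI)
        fix n assume "Suc (n0 + n1 + n2) \<le> n"
        then have n: "n0 \<le> n" "n1 \<le> n" "n2 \<le> n" "0 < n" by auto
        let ?a = "char (distr M borel (stat n)) t" and ?b = "char (distr M borel (\<lambda>\<xi>. Tt m (alpha n \<xi>))) t"
        have "cmod (?a - ?b) < r / 2"
          using char_approx[OF n0[OF n(1)] stat_meas finlin_alpha_meas[OF finlin_Tt] n(4), of t] te n2[OF n(3)] by linarith
        moreover have "cmod (?b - L (vT (Tt m))) < r / 4" by (rule n1[OF n(2)])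
        moreover have "cmod (L (vT (Tt m)) - L \<sigma>2) < r / 4" by (rule m1) (simp add: m_def)
        moreover have "cmod (?a - L \<sigma>2) \<le> cmod (?a - ?b) + (cmod (?b - L (vT (Tt m))) + cmod (L (vT (Tt m)) - L \<sigma>2))"
          using norm_triangle_ineq[of "?a - ?b" "?b - L \<sigma>2"] norm_triangle_ineq[of "?b - L (vT (Tt m))" "L (vT (Tt m)) - L \<sigma>2"] by simp
        ultimately show "norm (?a - L \<sigma>2) < r" by linarith
      qed
    qed
    then show "(\<lambda>n. char (distr M borel (stat n)) t) \<longlonglongrightarrow> char (normal_meas \<sigma>2) t"
      unfolding char_normal_meas[OF gs(2)] L_def .
  qed
qed

end

theorem theorem9:
  fixes M :: "'a measure"
    and X :: "'a \<Rightarrow> real^'p::finite" and Z :: "'a \<Rightarrow> real^'q::finite"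
    and Xs :: "nat \<Rightarrow> 'a \<Rightarrow> real^'p" and Zs :: "nat \<Rightarrow> 'a \<Rightarrow> real^'q"
    and A :: "(real^'q) set" and \<psi> :: "real^'p \<Rightarrow> real" and K K' :: "'p set"
    and N :: "'b measure" and B :: "real^'p \<Rightarrow> 'b \<Rightarrow> real"
  assumes "prob_space M"
    and "X \<in> borel_measurable M" and "Z \<in> borel_measurable M"
    and "\<And>i. Xs i \<in> borel_measurable M" and "\<And>i. Zs i \<in> borel_measurable M"
    and "prob_space.indep_vars M (\<lambda>_. borel) (\<lambda>i \<omega>. (Xs i \<omega>, Zs i \<omega>)) UNIV"
    and "\<And>i. distr M borel (\<lambda>\<omega>. (Xs i \<omega>, Zs i \<omega>)) = distr M borel (\<lambda>\<omega>. (X \<omega>, Z \<omega>))"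
    and "A \<in> sets borel"
    and "pA M Z A > 0"
    and "\<And>k. continuous_on UNIV (condF M X Z A k)"
    and "condition_C M X Z A"
    and "continuous_on unitcube \<psi>"
    and "hk_bv K' (phiKK M X Z A \<psi> K K')"
    and "gaussian_process N B (covB M X Z A)"
  shows "weak_conv_m
           (\<lambda>n. distr M borel (\<lambda>\<omega>. sqrt (real n) * (rhohat Xs Zs A \<psi> K K' n \<omega> - rhoKK M X Z A \<psi> K K')))
           (normal_meas (sigma2 M X Z A \<psi> K K' N B))"
proof -
  interpret cop_gauss M X Z Xs Zs A \<psi> K K' N B
    using assms by (intro cop_gauss.intro cop_stat.intro cop_data.intro cop_data_axioms.intro
        cop_stat_axioms.intro cop_gauss_axioms.intro)
  show ?thesis using stat_weak_limit unfolding stat_def[abs_def] .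
qed

end
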